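(* Let $d\ge4$, let $\mathbb P$ satisfy Assumptions (A1)–(A4) listed in the context, and let $\alpha_0$ be as in (A4). Set $r:=\lfloor \tfrac d2-1\rfloor$ and $\lambda_n(\omega):=n^{d/2}\,\mathsf P^{2n}_\omega(0,0)$. Then for all $\alpha\in(0,\alpha_0)$ there is a $\mathbb P_\alpha$-a.s. finite random variable $C=C(\omega)$ such that for all $n\ge1$ and all $\theta$ with $1\le\theta\le n/2$ there is $n^\star\in\{n-\theta,\dots,n\}$ (i.e., an integer $n^\star$ with $n-\theta\le n^\star\le n$) for which $$P^0_\omega\bigl(\mathcal E^{(r)}_{\omega,\alpha}(\theta,n^\star)\,\big|\,X_{2n^\star}=0\bigr)\ \ge\ 1-\frac{C(\omega)}{\lambda_n(\omega)}\begin{cases}\frac n\theta\log(n/\theta),& d=4,\\ \bigl(\frac n\theta\bigr)^{d/2-1},& d\ge5.\end{cases}$$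
   Context: Basic setting. Let $\mathbb B(\mathbb Z^d)$ be the set of unordered nearest-neighbor edges of $\mathbb Z^d$ and $\Omega:=(0,1]^{\mathbb B(\mathbb Z^d)}$ with the product $\sigma$-algebra. For $\omega\in\Omega$ write $\omega_{xy}=\omega_{yx}=\omega_b$ for the value at $b=\langle x,y\rangle$. Put $\pi_\omega(x):=\sum_{z:|z-x|=1}\omega_{xz}$ and $\mathsf P_\omega(x,y):=\omega_{xy}/\pi_\omega(x)$ for nearest neighbors $x,y$ (and $0$ otherwise). $(X_n)_{n\ge0}$ is the Markov chain on $\mathbb Z^d$ with transition kernel $\mathsf P_\omega$; $P^x_\omega$ is its law when started at $x$ and $\mathsf P^n_\omega(x,y)=P^x_\omega(X_n=y)$. Shifts: $(\tau_x\omega)_{y,z}:=\omega_{y+x,z+x}$. Strong component. For $\alpha>0$, $\mathscr C_{\infty,\alpha}=\mathscr C_{\infty,\alpha}(\omega)$ is the set of vertices of $\mathbb Z^d$ lying on an infinite self-avoiding path of edges $b$ with $\omega_b\ge\alpha$. For $y\notin\mathscr C_{\infty,\alpha}$ let $\mathcal F_y$ be the connected component (in the graph $\mathbb Z^d$) of $\mathbb Z^d\setminus\mathscr C_{\infty,\alpha}$ containing $y$; for $y\in\mathscr C_{\infty,\alpha}$ let $\mathcal F_y:=\{y\}$. Let $\mathcal G_x:=\bigcup_{y:\langle x,y\rangle\in\mathbb B(\mathbb Z^d)}\mathcal F_y$, with cardinality $|\mathcal G_x|$. Coarse-grained walk. When all components of $\mathbb Z^d\setminus\mathscr C_{\infty,\alpha}$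 are finite, set $T_0:=0$, $T_{k+1}:=\inf\{n>T_0+\dots+T_k: X_n\in\mathscr C_{\infty,\alpha}\}-(T_0+\dots+T_k)$ and $\hat X_\ell:=X_{T_0+\dots+T_\ell}$. Started in $\mathscr C_{\infty,\alpha}$, $\hat X$ is a Markov chain on $\mathscr C_{\infty,\alpha}$ with kernel $\hat{\mathsf P}_\omega(x,y):=P^x_\omega(X_{T_1}=y)$, whose $n$-th power is $\hat{\mathsf P}^n_\omega$. Let $\mathrm d_\omega(x,y):=\inf\{n\ge0:\hat{\mathsf P}^n_\omega(x,y)>0\}$. Assumptions on the law $\mathbb P$ of $\omega$. (A1) $\mathbb P$ is a probability measure on $\Omega$, (jointly) ergodic with respect to the shifts $(\tau_x)_{x\in\mathbb Z^d}$. (A2) For $\mathbb P$-a.e. $\omega$, $\bigcup_{\alpha>0}\mathscr C_{\infty,\alpha}(\omega)=\mathbb Z^d$. Consequently $\alpha_1:=\inf\{\alpha>0:\mathbb P(0\in\mathscr C_{\infty,\alpha})=0\}>0$, and for $\alpha\in(0,\alpha_1)$ one sets $\mathbb P_\alpha(\cdot):=\mathbb P(\cdot\mid 0\in\mathscr C_{\infty,\alpha})$. (A3) There is $\alpha\in(0,\alpha_1)$ such that $|\mathcal G_0|\in L^p(\mathbb P_\alpha)$ for all $1\le p<\infty$. Let $\alpha_2$ be the supremum of such $\alpha\in(0,\alpha_1)$. (A4) There is $\alpha_0\in(0,\alpha_2]$ such that for each $\alpha\in(0,\alpha_0)$ and each $\rho>0$ there is a $\mathbb P_\alpha$-a.s.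 finite random variable $C=C(\omega)$ such that for $\mathbb P_\alpha$-a.e. $\omega$ and all $n\ge1$, $$\max_{x\in\mathscr C_{\infty,\alpha},\ \mathrm d_\omega(0,x)\le\rho n}\ \sup_{y\in\mathscr C_{\infty,\alpha}}\hat{\mathsf P}^n_\omega(x,y)\le \frac{C(\omega)}{n^{d/2}} .$$ Trapping event. For $n\ge1$ let $\ell_n:=\inf\{m\ge1:\sum_{k=1}^mT_k\ge2n\}$. For $1\le r\le\ell$ and $\theta\ge1$ let $$G_{\ell,r}(\theta):=\Bigl\{(t_1,\dots,t_\ell)\in\mathbb N^\ell:\ \min_{1\le i_1<\dots<i_r\le\ell}\ \sum_{k\in\{1,\dots,\ell\}\setminus\{i_1,\dots,i_r\}}t_k\le\theta\Bigr\},$$ and define the event $\mathcal E^{(r)}_{\omega,\alpha}(\theta,n):=\{r\le\ell_n\le\theta,\ (T_1,\dots,T_{\ell_n})\in G_{\ell_n,r}(\theta)\}$ (all quantities $T_k,\ell_n$ depend on $\omega$ and $\alpha$). *)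

theory Defs
  imports "HOL-Probability.Probability"
begin

section \<open>Environments\<close>

type_synonym 'd site = "int ^ 'd"
type_synonym 'd environment = "'d site set \<Rightarrow> real"

definition neighbor :: "'d::finite site \<Rightarrow> 'd site \<Rightarrow> bool" where
  "neighbor x y \<longleftrightarrow> (\<Sum>i\<in>UNIV. \<bar>x $ i - y $ i\<bar>) = 1"

text \<open>An unordered edge is the two-element set of its endpoints.\<close>

definition edges :: "'d::finite site set set" where
  "edges = {{x, y} |x y. neighbor x y}"

definition env_space :: "'d::finite environment measure" where
  "env_space = (\<Pi>\<^sub>M b\<in>edges. restrict_space borel {0<..1})"

text \<open>The shift \<open>(\<tau>\<^sub>x \<omega>)\<^bsub>y,z\<^esub> = \<omega>\<^bsub>y+x,z+x\<^esub>\<close>; the restriction keeps it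
  inside the extensional functions that make up a product space.\<close>

definition shift :: "'d::finite site \<Rightarrow> 'd environment \<Rightarrow> 'd environment" where
  "shift x \<omega> = (\<lambda>b\<in>edges. \<omega> ((\<lambda>v. v + x) ` b))"

definition jointly_ergodic :: "'d::finite environment measure \<Rightarrow> bool" where
  "jointly_ergodic P \<longleftrightarrow>
     (\<forall>x. shift x \<in> measurable P P \<and> distr P P (shift x) = P) \<and>
     (\<forall>A\<in>sets P. (\<forall>x. shift x -` A \<inter> space P = A) \<longrightarrow> measure P A = 0 \<or> measure P A = 1)"

section \<open>The random walk\<close>

definition total_conductance :: "'d::finite environment \<Rightarrow> 'd site \<Rightarrow> real" where
  "total_conductance \<omega> x = (\<Sum>z | neighbor x z. \<omega> {x, z})"

definition walk_kernel :: "'d::finite environment \<Rightarrow> 'd site \<Rightarrow> 'd site \<Rightarrow> real" where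
  "walk_kernel \<omega> x y = (if neighbor x y then \<omega> {x, y} / total_conductance \<omega> x else 0)"

text \<open>Transition probabilities in the form required by the Ionescu-Tulcea construction: the
  law of \<open>X\<^sub>n\<close> given the history \<open>(X\<^sub>0, \<dots>, X\<^bsub>n-1\<^esub>)\<close>.\<close>

definition walk_step ::
    "'d::finite environment \<Rightarrow> 'd site \<Rightarrow> nat \<Rightarrow> (nat \<Rightarrow> 'd site) \<Rightarrow> 'd site measure" where
  "walk_step \<omega> x n h = (case n of
       0 \<Rightarrow> return (count_space UNIV) x
     | Suc m \<Rightarrow> point_measure UNIV (\<lambda>y. ennreal (walk_kernel \<omega> (h m) y)))"

text \<open>The quenched law of the trajectory started at \<open>x\<close>, a measure on
  \<open>\<Pi>\<^sub>M n\<in>UNIV. count_space UNIV\<close>.  It is the projective limit provided by the locale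
  \<open>Ionescu_Tulcea\<close>, whose assumptions hold for every \<open>\<omega>\<close> in the environment space (lemma
  \<open>Ionescu_Tulcea_walk_step\<close> below).\<close>

definition walk_law :: "'d::finite environment \<Rightarrow> 'd site \<Rightarrow> (nat \<Rightarrow> 'd site) measure" where
  "walk_law \<omega> x =
     projective_family.lim UNIV (Ionescu_Tulcea.CI (walk_step \<omega> x) (\<lambda>_. count_space UNIV))
       (\<lambda>_. count_space UNIV)"

definition heat_kernel :: "'d::finite environment \<Rightarrow> nat \<Rightarrow> 'd site \<Rightarrow> 'd site \<Rightarrow> real" where
  "heat_kernel \<omega> n x y = \<P>(X in walk_law \<omega> x. X n = y)"

section \<open>The strong component\<close>

definition strong_component :: "real \<Rightarrow> 'd::finite environment \<Rightarrow> 'd site set" where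
  "strong_component \<alpha> \<omega> =
     {x. \<exists>\<gamma>::nat \<Rightarrow> 'd site. inj \<gamma> \<and> x \<in> range \<gamma> \<and>
           (\<forall>k. neighbor (\<gamma> k) (\<gamma> (Suc k)) \<and> \<omega> {\<gamma> k, \<gamma> (Suc k)} \<ge> \<alpha>)}"

definition hole :: "real \<Rightarrow> 'd::finite environment \<Rightarrow> 'd site \<Rightarrow> 'd site set" where
  "hole \<alpha> \<omega> y =
     (if y \<in> strong_component \<alpha> \<omega> then {y}
      else {z. (y, z) \<in> {(u, v). neighbor u v \<and> u \<notin> strong_component \<alpha> \<omega> \<and>
                                 v \<notin> strong_component \<alpha> \<omega>}\<^sup>*})"

definition adjacent_holes :: "real \<Rightarrow> 'd::finite environment \<Rightarrow> 'd site \<Rightarrow> 'd site set" where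
  "adjacent_holes \<alpha> \<omega> x = (\<Union>y\<in>{y. neighbor x y}. hole \<alpha> \<omega> y)"

definition component_event ::
    "'d::finite environment measure \<Rightarrow> real \<Rightarrow> 'd environment set" where
  "component_event P \<alpha> = {\<omega>\<in>space P. 0 \<in> strong_component \<alpha> \<omega>}"

text \<open>\<open>P\<^sub>\<alpha>\<close>, the law \<open>P\<close> conditioned on \<open>0\<close> being in the strong component\<close>

definition cond_law :: "'d::finite environment measure \<Rightarrow> real \<Rightarrow> 'd environment measure" where
  "cond_law P \<alpha> = uniform_measure P (component_event P \<alpha>)"

definition alpha1 :: "'d::finite environment measure \<Rightarrow> real" where
  "alpha1 P = Inf {\<alpha>. 0 < \<alpha> \<and> measure P (component_event P \<alpha>) = 0}"

text \<open>As \<open>card\<close> is \<open>0\<close> on infinite sets, the almost sure finiteness of \<open>\<G>\<^sub>0\<close> that is part of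
  \<open>|\<G>\<^sub>0| \<in> L\<^sup>p\<close> has to be stated separately.\<close>

definition holes_in_Lp :: "'d::finite environment measure \<Rightarrow> real \<Rightarrow> real \<Rightarrow> bool" where
  "holes_in_Lp P \<alpha> p \<longleftrightarrow>
     (AE \<omega> in cond_law P \<alpha>. finite (adjacent_holes \<alpha> \<omega> 0)) \<and>
     integrable (cond_law P \<alpha>) (\<lambda>\<omega>. real (card (adjacent_holes \<alpha> \<omega> 0)) powr p)"

definition good_alphas :: "'d::finite environment measure \<Rightarrow> real set" where
  "good_alphas P = {\<alpha>. 0 < \<alpha> \<and> \<alpha> < alpha1 P \<and> (\<forall>p\<ge>1. holes_in_Lp P \<alpha> p)}"

definition alpha2 :: "'d::finite environment measure \<Rightarrow> real" where
  "alpha2 P = Sup (good_alphas P)"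

section \<open>The coarse-grained walk\<close>

text \<open>\<open>return_time A X k\<close> is \<open>T\<^sub>k\<close> for the trajectory \<open>X\<close> and the set \<open>A\<close>.  It is \<open>\<infinity>\<close> once \<open>X\<close> no
  longer visits \<open>A\<close>, since \<open>\<infinity> - \<infinity> = \<infinity>\<close> in \<^typ>\<open>enat\<close>.\<close>

fun return_time :: "'s set \<Rightarrow> (nat \<Rightarrow> 's) \<Rightarrow> nat \<Rightarrow> enat" where
  "return_time A X 0 = 0"
| "return_time A X (Suc k) =
     Inf {enat n |n. (\<Sum>j\<le>k. return_time A X j) < enat n \<and> X n \<in> A}
       - (\<Sum>j\<le>k. return_time A X j)"

definition coarse_kernel ::
    "real \<Rightarrow> 'd::finite environment \<Rightarrow> 'd site \<Rightarrow> 'd site \<Rightarrow> real" where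
  "coarse_kernel \<alpha> \<omega> x y =
     \<P>(X in walk_law \<omega> x. \<exists>n. return_time (strong_component \<alpha> \<omega>) X 1 = enat n \<and> X n = y)"

primrec coarse_heat_kernel ::
    "real \<Rightarrow> 'd::finite environment \<Rightarrow> nat \<Rightarrow> 'd site \<Rightarrow> 'd site \<Rightarrow> real" where
  "coarse_heat_kernel \<alpha> \<omega> 0 x y = (if x = y then 1 else 0)"
| "coarse_heat_kernel \<alpha> \<omega> (Suc n) x y =
     (\<Sum>\<^sub>\<infinity>z\<in>strong_component \<alpha> \<omega>. coarse_kernel \<alpha> \<omega> x z * coarse_heat_kernel \<alpha> \<omega> n z y)"

definition coarse_dist :: "real \<Rightarrow> 'd::finite environment \<Rightarrow> 'd site \<Rightarrow> 'd site \<Rightarrow> enat" where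
  "coarse_dist \<alpha> \<omega> x y = Inf {enat n |n. coarse_heat_kernel \<alpha> \<omega> n x y > 0}"

text \<open>The bound of the maximum over \<open>x\<close> and the supremum over \<open>y\<close> is stated pointwise.\<close>

definition heat_kernel_bound :: "'d::finite environment measure \<Rightarrow> real \<Rightarrow> bool" where
  "heat_kernel_bound P \<alpha>0 \<longleftrightarrow>
     (\<forall>\<alpha>. 0 < \<alpha> \<and> \<alpha> < \<alpha>0 \<longrightarrow> (\<forall>\<rho>>0. \<exists>C :: 'd environment \<Rightarrow> real.
        C \<in> borel_measurable P \<and>
        (AE \<omega> in cond_law P \<alpha>. \<forall>n\<ge>1.
           \<forall>x\<in>strong_component \<alpha> \<omega>.
             ereal_of_enat (coarse_dist \<alpha> \<omega> 0 x) \<le> ereal (\<rho> * real n) \<longrightarrow>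
             (\<forall>y\<in>strong_component \<alpha> \<omega>.
                coarse_heat_kernel \<alpha> \<omega> n x y \<le> C \<omega> / real n powr (real CARD('d) / 2)))))"

section \<open>The trapping event\<close>

text \<open>\<open>steps_until A X n\<close> is \<open>\<ell>\<^sub>n\<close>; the minimum exists because \<open>T\<^sub>k \<ge> 1\<close> for \<open>k \<ge> 1\<close>.\<close>

definition steps_until :: "'s set \<Rightarrow> (nat \<Rightarrow> 's) \<Rightarrow> nat \<Rightarrow> nat" where
  "steps_until A X n = (LEAST m. 1 \<le> m \<and> enat (2 * n) \<le> (\<Sum>k=1..m. return_time A X k))"

text \<open>A tuple \<open>(t\<^sub>1, \<dots>, t\<^sub>l)\<close> is a function on \<open>nat\<close> of which only the values on \<open>{1..l}\<close> matter.\<close>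

definition short_sums :: "nat \<Rightarrow> nat \<Rightarrow> real \<Rightarrow> (nat \<Rightarrow> nat) set" where
  "short_sums l r \<theta> =
     {t. real (Min ((\<lambda>I. \<Sum>k\<in>{1..l} - I. t k) ` {I. I \<subseteq> {1..l} \<and> card I = r})) \<le> \<theta>}"

text \<open>Membership of \<open>(T\<^sub>1, \<dots>, T\<^sub>l)\<close> in a set of tuples of natural numbers includes finiteness of
  these times.\<close>

definition trapping_event :: "'s set \<Rightarrow> nat \<Rightarrow> real \<Rightarrow> nat \<Rightarrow> (nat \<Rightarrow> 's) \<Rightarrow> bool" where
  "trapping_event A r \<theta> n X \<longleftrightarrow>
     (let l = steps_until A X n in
        r \<le> l \<and> real l \<le> \<theta> \<and>
        (\<exists>t\<in>short_sums l r \<theta>. \<forall>k\<in>{1..l}. return_time A X k = enat (t k)))"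

section \<open>Well-definedness of the walk\<close>

lemma finite_neighbors: "finite {y. neighbor (x::'d::finite site) y}"
proof -
  have "vec_nth ` {y. neighbor x y} \<subseteq> (\<Pi>\<^sub>E i\<in>UNIV. {x $ i - 1 .. x $ i + 1})"
  proof safe
    fix y i assume "neighbor x y"
    then have "\<bar>x $ i - y $ i\<bar> \<le> 1"
      using member_le_sum[of i UNIV "\<lambda>i. \<bar>x $ i - y $ i\<bar>"] by (simp add: neighbor_def)
    then show "y $ i \<in> {x $ i - 1 .. x $ i + 1}" by auto
  qed auto
  then have "finite (vec_nth ` {y. neighbor x y})"
    by (rule finite_subset) (auto intro!: finite_PiE)
  then show ?thesis
    by (rule finite_imageD) (auto simp: inj_on_def vec_eq_iff)
qed

lemma env_pos:
  assumes "\<omega> \<in> space (env_space :: 'd::finite environment measure)" "neighbor x y"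
  shows "0 < \<omega> {x, y}" "\<omega> {x, y} \<le> 1"
proof -
  have "{x, y} \<in> edges" using assms(2) by (auto simp: edges_def)
  with assms(1) have "\<omega> {x, y} \<in> {0<..1}"
    by (auto simp: env_space_def space_PiM space_restrict_space PiE_iff)
  then show "0 < \<omega> {x, y}" "\<omega> {x, y} \<le> 1" by auto
qed

lemma ex_neighbor: "\<exists>y. neighbor (x::'d::finite site) y"
proof
  let ?j = "undefined :: 'd"
  have "(\<Sum>i\<in>UNIV. \<bar>x $ i - (x + axis ?j 1) $ i\<bar>) = (\<Sum>i\<in>UNIV. if i = ?j then 1 else 0)"
    by (intro sum.cong) (auto simp: axis_def)
  then show "neighbor x (x + axis ?j 1)"
    by (simp add: neighbor_def)
qed

lemma total_conductance_pos:
  assumes "\<omega> \<in> space (env_space :: 'd::finite environment measure)"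
  shows "0 < total_conductance \<omega> x"
  unfolding total_conductance_def
  using env_pos[OF assms] ex_neighbor[of x] finite_neighbors[of x] by (intro sum_pos) auto

lemma prob_space_walk_kernel:
  assumes \<omega>: "\<omega> \<in> space (env_space :: 'd::finite environment measure)"
  shows "prob_space (point_measure UNIV (\<lambda>y. ennreal (walk_kernel \<omega> x y)))"
proof
  let ?N = "{y. neighbor x y}"
  have nn: "0 \<le> walk_kernel \<omega> x y" for y
    using env_pos(1)[OF \<omega>, of x y] total_conductance_pos[OF \<omega>, of x]
    by (auto simp: walk_kernel_def intro!: divide_nonneg_pos)
  have "emeasure (point_measure UNIV (\<lambda>y. ennreal (walk_kernel \<omega> x y))) UNIV
      = (\<integral>\<^sup>+y. ennreal (walk_kernel \<omega> x y) \<partial>count_space UNIV)"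
    unfolding point_measure_def by (subst emeasure_density) auto
  also have "\<dots> = (\<Sum>y\<in>?N. ennreal (walk_kernel \<omega> x y))"
    using finite_neighbors[of x] by (intro nn_integral_count_space') (auto simp: walk_kernel_def)
  also have "\<dots> = ennreal (\<Sum>y\<in>?N. walk_kernel \<omega> x y)"
    using nn by (intro sum_ennreal) auto
  also have "(\<Sum>y\<in>?N. walk_kernel \<omega> x y) = total_conductance \<omega> x / total_conductance \<omega> x"
    by (simp add: walk_kernel_def sum_divide_distrib[symmetric] total_conductance_def)
  also have "\<dots> = 1" using total_conductance_pos[OF \<omega>, of x] by simp
  finally show "emeasure (point_measure UNIV (\<lambda>y. ennreal (walk_kernel \<omega> x y)))
      (space (point_measure UNIV (\<lambda>y. ennreal (walk_kernel \<omega> x y)))) = 1"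
    by (simp add: space_point_measure)
qed

lemma Ionescu_Tulcea_walk_step:
  assumes \<omega>: "\<omega> \<in> space (env_space :: 'd::finite environment measure)"
  shows "Ionescu_Tulcea (walk_step \<omega> x) (\<lambda>_. count_space UNIV)"
proof (rule Ionescu_Tulcea.intro)
  fix n h
  show "prob_space (walk_step \<omega> x n h)"
    by (cases n) (auto simp: walk_step_def prob_space_return prob_space_walk_kernel[OF \<omega>])
next
  fix n
  show "walk_step \<omega> x n \<in> measurable (\<Pi>\<^sub>M i\<in>{0..<n}. count_space UNIV)
      (subprob_algebra (count_space UNIV))"
  proof (cases n)
    case 0
    then show ?thesis
      by (auto simp: walk_step_def[abs_def] space_subprob_algebra
          intro!: measurable_const prob_space_imp_subprob_space prob_space_return)
  next
    case (Suc m)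
    have "(\<lambda>z. point_measure UNIV (\<lambda>y. ennreal (walk_kernel \<omega> z y)))
        \<in> measurable (count_space UNIV) (subprob_algebra (count_space UNIV))"
      using prob_space_walk_kernel[OF \<omega>]
      by (auto simp: space_subprob_algebra sets_point_measure intro!: prob_space_imp_subprob_space)
    moreover have "(\<lambda>h. h m) \<in> measurable (\<Pi>\<^sub>M i\<in>{0..<n}. count_space UNIV) (count_space UNIV)"
      using Suc by (intro measurable_component_singleton) auto
    ultimately have "(\<lambda>h. point_measure UNIV (\<lambda>y. ennreal (walk_kernel \<omega> (h m) y)))
        \<in> measurable (\<Pi>\<^sub>M i\<in>{0..<n}. count_space UNIV) (subprob_algebra (count_space UNIV))"
      by (rule measurable_compose[rotated])
    then show ?thesis
      using Suc by (simp add: walk_step_def[abs_def])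
  qed
qed

lemma prob_space_walk_law:
  assumes "\<omega> \<in> space (env_space :: 'd::finite environment measure)"
  shows "prob_space (walk_law \<omega> x)"
proof -
  interpret Ionescu_Tulcea "walk_step \<omega> x" "\<lambda>_. count_space UNIV"
    by (rule Ionescu_Tulcea_walk_step[OF assms])
  have "emeasure PF.lim (PF.emb UNIV {} {\<lambda>_. undefined}) = emeasure (CI {}) {\<lambda>_. undefined}"
    by (rule lim) (auto simp: PiM_empty)
  moreover have "PF.emb UNIV {} {\<lambda>_. undefined} = space PF.lim"
    by (auto simp: prod_emb_def space_PiM)
  moreover have "emeasure (CI {}) {\<lambda>_. undefined} = 1"
    using prob_space.emeasure_space_1[OF PF.prob_space_P[of "{}"]] by (simp add: PF.space_P space_PiM)
  ultimately show ?thesis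
    unfolding walk_law_def by (intro prob_spaceI) simp
qed

text \<open>The finite-dimensional distributions characterize the law of the Markov chain.\<close>

lemma walk_law_cylinder:
  assumes \<omega>: "\<omega> \<in> space (env_space :: 'd::finite environment measure)"
  shows "emeasure (walk_law \<omega> x) {X \<in> space (walk_law \<omega> x). \<forall>i\<le>n. X i = p i}
      = (if p 0 = x then \<Prod>i<n. ennreal (walk_kernel \<omega> (p i) (p (Suc i))) else 0)"
proof -
  interpret Ionescu_Tulcea "walk_step \<omega> x" "\<lambda>_. count_space UNIV"
    by (rule Ionescu_Tulcea_walk_step[OF \<omega>])
  let ?M = "\<lambda>n. \<Pi>\<^sub>M i\<in>{0..<n::nat}. count_space (UNIV :: 'd site set)"
  let ?u = "\<lambda>_::nat. undefined :: 'd site"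
  let ?q = "\<lambda>n. restrict p {0..<n}"
  have u: "?u \<in> space (?M 0)" by (simp add: space_PiM)
  have q: "?q n \<in> space (?M n)" for n by (simp add: space_PiM)
  have q_sets[measurable]: "{?q n} \<in> sets (?M n)" for n
  proof -
    have "{?q n} = (\<Pi>\<^sub>E i\<in>{0..<n}. {p i})" by (subst PiE_singleton[symmetric, of "?q n" "{0..<n}"]) (auto intro!: PiE_cong)
    also have "\<dots> \<in> sets (?M n)" by (intro sets_PiM_I_finite) auto
    finally show ?thesis .
  qed
  have step: "emeasure (C 0 (Suc n) ?u) {?q (Suc n)}
      = emeasure (C 0 n ?u) {?q n} * emeasure (walk_step \<omega> x n (?q n)) {p n}" for n
  proof -
    have sp: "space (C 0 n ?u) = space (?M n)"
      using space_C[OF u, of n] by simp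
    have eq: "emeasure (eP n h) {?q (Suc n)}
        = emeasure (walk_step \<omega> x n (?q n)) {p n} * indicator {?q n} h"
      if h: "h \<in> space (?M n)" for h
    proof -
      have "(fun_upd h n -` {?q (Suc n)}) \<inter> UNIV = (if h = ?q n then {p n} else {})"
        using h by (auto simp: fun_eq_iff space_PiM PiE_iff extensional_def
            split: if_splits) (metis less_SucI less_irrefl)
      then show ?thesis
        using emeasure_eP[OF h q_sets] by (auto simp: indicator_def)
    qed
    have "emeasure (C 0 (Suc n) ?u) {?q (Suc n)}
        = (\<integral>\<^sup>+h. emeasure (eP n h) {?q (Suc n)} \<partial>C 0 n ?u)"
      using measurable_eP[of n] sets_C[OF u, of n] sp q[of n]
      by (simp, subst emeasure_bind[where N="?M (Suc n)"])
         (auto simp: measurable_cong_sets[OF sets_C[OF u, of n] refl])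
    also have "\<dots> = (\<integral>\<^sup>+h. emeasure (walk_step \<omega> x n (?q n)) {p n} * indicator {?q n} h \<partial>C 0 n ?u)"
      by (intro nn_integral_cong eq) (simp add: sp)
    also have "\<dots> = emeasure (walk_step \<omega> x n (?q n)) {p n} * emeasure (C 0 n ?u) {?q n}"
      using q_sets[of n] sets_C[OF u, of n] by (intro nn_integral_cmult_indicator) simp
    finally show ?thesis by (simp add: mult.commute)
  qed
  have "emeasure (C 0 (Suc n) ?u) {?q (Suc n)}
      = (if p 0 = x then \<Prod>i<n. ennreal (walk_kernel \<omega> (p i) (p (Suc i))) else 0)"
  proof (induction n)
    case 0
    have "emeasure (C 0 0 ?u) {?q 0} = 1"
      by (simp add: PiM_empty restrict_def)
    then show ?case
      unfolding step by (auto simp: walk_step_def indicator_def)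
  next
    case (Suc n)
    have "emeasure (walk_step \<omega> x (Suc n) (?q (Suc n))) {p (Suc n)}
        = ennreal (walk_kernel \<omega> (p n) (p (Suc n)))"
      by (simp add: walk_step_def emeasure_point_measure_finite2)
    then show ?case
      unfolding step[of "Suc n"] Suc.IH by simp
  qed
  moreover have "emeasure PF.lim (PF.emb UNIV {0..<Suc n} {?q (Suc n)})
      = emeasure (CI {0..<Suc n}) {?q (Suc n)}"
    by (rule lim) simp_all
  moreover have "emeasure (CI {0..<Suc n}) {?q (Suc n)} = emeasure (C 0 (Suc n) ?u) {?q (Suc n)}"
    using emeasure_CI[OF subset_refl q_sets[of "Suc n"]] by (simp add: prod_emb_id q)
  moreover have "PF.emb UNIV {0..<Suc n} {?q (Suc n)} = {X \<in> space PF.lim. \<forall>i\<le>n. X i = p i}"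
    by (auto simp: prod_emb_def space_PiM fun_eq_iff restrict_def less_Suc_eq_le)
       (metis (full_types))
  ultimately show ?thesis
    unfolding walk_law_def by simp
qed

end

theory Submission
  imports Defs
begin

text \<open>
  Let \<open>P\<close> be the kernel of the coarse-grained walk and \<open>Q(x,y) = E\<^sup>x[T\<^sub>1; X\<^sub>T\<^sub>1 = y]\<close>.  Summing the
  probability that \<open>X\<^bsub>2m\<^esub> = 0\<close> and the trapping event fails over the window
  \<open>n - \<theta> \<le> m \<le> n\<close> and bounding the indicator of failure by elementary symmetric sums of
  \<open>T\<^sub>1, \<dots>, T\<^sub>l\<close> leads to words of length \<open>l\<close> in \<open>P\<close> and \<open>Q\<close> with one or \<open>r + 1\<close> letters \<open>Q\<close>: for
  \<open>l > \<theta>\<close> one uses \<open>T\<^sub>1 + \<dots> + T\<^sub>l \<ge> n\<close>, and for \<open>r \<le> l \<le> \<theta>\<close> that removing any \<open>r\<close> of the times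
  leaves a sum above \<open>\<theta>\<close>.  For \<open>l < r\<close> a single excursion has length of order \<open>n\<close>, which has rapidly
  decaying probability.

  In a word with \<open>q\<close> letters \<open>Q\<close> one of \<open>q + 1\<close> blocks of equal length is free of \<open>Q\<close>; the
  heat-kernel bound applied there gives \<open>l\<^bsup>-d/2\<^esup>\<close>, and the remaining factors are controlled, after
  reversing the last part of the word, by the iterated ergodic maximal functions
  \<open>(M Q)\<^sup>q 1\<close> with \<open>M f = sup\<^sub>n (1/n) \<Sum>\<^bsub>i<n\<^esub> P\<^sup>i f\<close>.  These are finite almost surely: by
  reversibility \<open>E\<^sup>x[T\<^sub>1]\<close> is at most of the order of the size of the holes next to \<open>x\<close>, so \<open>Q\<close> preserves
  the class of stationary fields with all moments, and so does \<open>M\<close> by the maximal ergodic theorem for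
  the environment seen from the coarse-grained walk.
\<close>

text \<open>The heat-kernel bound controls the coarse walk at a fixed number l of steps, whereas
  X_2m = 0 fixes the time. Summing over m releases the time: what survives is that the gaps add up
  to at least n, and only l is summed. Since the window holds at least \<theta> integers and
  P^2m(0,0) decreases in m by reversibility, some m inherits the averaged bound relative to
  P^2n(0,0).

  Conductances inside holes can be arbitrarily small, so of an excursion time only the mean is
  bounded uniformly in them. Elementary symmetric sums contain each time to the first power only,
  hence the first-moment kernel Q suffices. A higher moment enters for l < r alone, where finiteness
  for fixed \<omega> is enough.

  The choice of r: r + 1 - d/2 is 0 or -1/2, so l^(r+1-d/2) / (n \<theta>^r) summed over l <=
  \<theta> is of order \<theta>^(2-d/2) / n. The sum of l^(1-d/2) / n over l > \<theta> has the same
  order, with a logarithm at d = 4. Dividing by \<theta> P^2n(0,0) gives the stated error.\<close>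

type_synonym 's kernel = "'s \<Rightarrow> 's \<Rightarrow> ennreal"

section \<open>Calculus of nonnegative kernels\<close>

definition kapp :: "'s kernel \<Rightarrow> ('s \<Rightarrow> ennreal) \<Rightarrow> 's \<Rightarrow> ennreal" where
  "kapp A f x = (\<integral>\<^sup>+y. A x y * f y \<partial>count_space UNIV)"

definition kcomp :: "'s kernel \<Rightarrow> 's kernel \<Rightarrow> 's kernel" (infixl "\<odot>" 70) where
  "(A \<odot> B) x y = kapp A (\<lambda>z. B z y) x"

definition kone :: "'s kernel" where
  "kone x y = (if x = y then 1 else 0)"

text \<open>Tonelli for counting measures on arbitrary types; together with values in
  \<open>ennreal\<close> it removes all summability conditions from the kernel calculus.\<close>

lemma nn_integral_count_space_swap:
  "(\<integral>\<^sup>+x. (\<integral>\<^sup>+y. f x y \<partial>count_space UNIV) \<partial>count_space UNIV)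
    = (\<integral>\<^sup>+y. (\<integral>\<^sup>+x. f x y \<partial>count_space UNIV) \<partial>count_space UNIV)"
  using nn_integral_fst_count_space[of "\<lambda>(x, y). f x y"] nn_integral_snd_count_space[of "\<lambda>(x, y). f x y"]
  by simp

lemma kapp_mono: "(\<And>y. A x y \<le> B x y) \<Longrightarrow> (\<And>y. f y \<le> g y) \<Longrightarrow> kapp A f x \<le> kapp B g x"
  unfolding kapp_def by (intro nn_integral_mono mult_mono) auto

lemma kapp_mono_right: "(\<And>y. A x y \<noteq> 0 \<Longrightarrow> f y \<le> g y) \<Longrightarrow> kapp A f x \<le> kapp A g x"
  unfolding kapp_def by (intro nn_integral_mono) (metis mult_left_mono mult_zero_left order_refl zero_le)

lemma kapp_add: "kapp A (\<lambda>y. f y + g y) x = kapp A f x + kapp A g x"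
  unfolding kapp_def by (simp add: distrib_left nn_integral_add)

lemma kapp_add_left: "kapp (\<lambda>x y. A x y + B x y) f x = kapp A f x + kapp B f x"
  unfolding kapp_def by (simp add: distrib_right nn_integral_add)

lemma kapp_cmult: "kapp A (\<lambda>y. c * f y) x = c * kapp A f x"
  unfolding kapp_def by (simp add: mult.left_commute[of _ c] nn_integral_cmult)

lemma kapp_multc: "kapp A (\<lambda>y. f y * c) x = kapp A f x * c"
  using kapp_cmult[of A c f x] by (simp add: mult.commute)

lemma kapp_zero [simp]: "kapp A (\<lambda>y. 0) x = 0"
  unfolding kapp_def by simp

lemma kapp_sum: "kapp A (\<lambda>y. \<Sum>i\<in>I. f i y) x = (\<Sum>i\<in>I. kapp A (f i) x)"
  by (induction I rule: infinite_finite_induct) (auto simp: kapp_add)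

lemma kapp_sum_left: "kapp (\<lambda>x y. \<Sum>i\<in>I. A i x y) f x = (\<Sum>i\<in>I. kapp (A i) f x)"
  unfolding kapp_def sum_distrib_right by (rule nn_integral_sum) auto

lemma kapp_suminf_left: "kapp (\<lambda>x y. \<Sum>i. A i x y) f x = (\<Sum>i. kapp (A i) f x)"
  unfolding kapp_def ennreal_suminf_multc[symmetric] by (rule nn_integral_suminf) auto

lemma kapp_kcomp: "kapp (A \<odot> B) f x = kapp A (kapp B f) x"
proof -
  have "kapp (A \<odot> B) f x = (\<integral>\<^sup>+y. (\<integral>\<^sup>+z. A x z * (B z y * f y) \<partial>count_space UNIV) \<partial>count_space UNIV)"
    by (simp add: kapp_def kcomp_def nn_integral_multc[symmetric] mult.assoc)
  also have "\<dots> = (\<integral>\<^sup>+z. (\<integral>\<^sup>+y. A x z * (B z y * f y) \<partial>count_space UNIV) \<partial>count_space UNIV)"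
    by (rule nn_integral_count_space_swap)
  finally show ?thesis by (simp add: kapp_def nn_integral_cmult)
qed

lemma kcomp_assoc: "(A \<odot> B) \<odot> C = A \<odot> (B \<odot> C)"
  by (intro ext) (simp add: kcomp_def[of _ C] kapp_kcomp, simp add: kcomp_def)

lemma nn_integral_count_space_point:
  "(\<integral>\<^sup>+y. (if y = x then f y else 0) \<partial>count_space UNIV) = (f x :: ennreal)"
proof -
  have "(\<integral>\<^sup>+y. (if y = x then f y else 0) \<partial>count_space UNIV) = (\<integral>\<^sup>+y. f x * indicator {x} y \<partial>count_space UNIV)"
    by (intro nn_integral_cong) (auto simp: indicator_def)
  then show ?thesis by (simp add: nn_integral_cmult)
qed

lemma kapp_kone [simp]: "kapp kone f x = f x"
proof -
  have "kapp kone f x = (\<integral>\<^sup>+y. (if y = x then f y else 0) \<partial>count_space UNIV)"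
    unfolding kapp_def kone_def by (intro nn_integral_cong) auto
  then show ?thesis by (simp add: nn_integral_count_space_point)
qed

lemma kcomp_kone_left [simp]: "kone \<odot> A = A"
  by (intro ext) (simp add: kcomp_def)

lemma kcomp_kone_right [simp]: "A \<odot> kone = A"
proof (intro ext)
  fix x y
  have "(A \<odot> kone) x y = (\<integral>\<^sup>+z. (if z = y then A x z else 0) \<partial>count_space UNIV)"
    unfolding kcomp_def kapp_def kone_def by (intro nn_integral_cong) auto
  then show "(A \<odot> kone) x y = A x y" by (simp add: nn_integral_count_space_point)
qed

lemma kcomp_mono: "(\<And>z. A x z \<le> A' x z) \<Longrightarrow> (\<And>z. B z y \<le> B' z y) \<Longrightarrow> (A \<odot> B) x y \<le> (A' \<odot> B') x y"
  unfolding kcomp_def by (rule kapp_mono)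

lemma kcomp_term_le: "A x z * B z y \<le> (A \<odot> B) x y"
proof -
  have "A x z * B z y = (\<integral>\<^sup>+w. (if w = z then A x w * B w y else 0) \<partial>count_space UNIV)"
    by (simp add: nn_integral_count_space_point)
  also have "\<dots> \<le> (A \<odot> B) x y"
    unfolding kcomp_def kapp_def by (intro nn_integral_mono) auto
  finally show ?thesis .
qed

lemma kcomp_eq_0: "(\<And>z. A x z = 0 \<or> B z y = 0) \<Longrightarrow> (A \<odot> B) x y = 0"
  unfolding kcomp_def kapp_def
  by (subst nn_integral_cong[of _ _ "\<lambda>_. 0"]) (auto simp: disj_commute)

lemma kcomp_nonzeroE:
  assumes "(A \<odot> B) x y \<noteq> 0" obtains z where "A x z \<noteq> 0" "B z y \<noteq> 0"
  using assms kcomp_eq_0[of A x B y] by blast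

text \<open>Detailed balance with respect to \<open>w\<close>. The weight may vanish: later it is
  also the conductance cut off outside the strong component.\<close>

definition ksym :: "('s \<Rightarrow> ennreal) \<Rightarrow> 's kernel \<Rightarrow> bool" where
  "ksym w A \<longleftrightarrow> (\<forall>x y. w x * A x y = w y * A y x)"

lemma ksymD: "ksym w A \<Longrightarrow> w x * A x y = w y * A y x"
  by (simp add: ksym_def)

text \<open>Reversal exchanges the factors, so a product of two different reversible kernels is in
  general not reversible. This is why symmetry is later claimed for sums over all words.\<close>

lemma kcomp_reverse:
  assumes "ksym w A" "ksym w B"
  shows "w x * (A \<odot> B) x y = w y * (B \<odot> A) y x"
proof -
  have "w x * (A x z * B z y) = w y * (B y z * A z x)" for z
    using ksymD[OF assms(1), of x z] ksymD[OF assms(2), of z y]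
    by (metis (no_types, lifting) mult.assoc mult.commute)
  then show ?thesis
    unfolding kcomp_def kapp_def by (simp add: nn_integral_cmult[symmetric])
qed

section \<open>Words in two kernels\<close>

text \<open>\<open>kword P Q l q\<close> is the coefficient of \<open>s\<^sup>q\<close> in \<open>(P + s Q)\<^sup>l\<close>.\<close>

fun kword :: "'s kernel \<Rightarrow> 's kernel \<Rightarrow> nat \<Rightarrow> nat \<Rightarrow> 's kernel" where
  "kword P Q 0 0 = kone"
| "kword P Q 0 (Suc q) = (\<lambda>x y. 0)"
| "kword P Q (Suc l) 0 = P \<odot> kword P Q l 0"
| "kword P Q (Suc l) (Suc q) = (\<lambda>x y. (P \<odot> kword P Q l (Suc q)) x y + (Q \<odot> kword P Q l q) x y)"

lemma kcomp_zero_left: "((\<lambda>x y. 0) \<odot> A) x y = 0"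
  by (simp add: kcomp_def kapp_def)

lemma kcomp_zero_right: "(A \<odot> (\<lambda>x y. 0)) x y = 0"
  by (simp add: kcomp_def kapp_def)

lemma kcomp_sum_right: "(A \<odot> (\<lambda>x y. \<Sum>i\<in>I. B i x y)) x y = (\<Sum>i\<in>I. (A \<odot> B i) x y)"
  by (simp add: kcomp_def kapp_sum)

lemma kcomp_sum_left: "((\<lambda>x y. \<Sum>i\<in>I. A i x y) \<odot> B) x y = (\<Sum>i\<in>I. (A i \<odot> B) x y)"
  by (simp add: kcomp_def kapp_sum_left)

lemma kcomp_add_left: "((\<lambda>x y. A x y + B x y) \<odot> C) x y = (A \<odot> C) x y + (B \<odot> C) x y"
  by (simp add: kcomp_def kapp_add_left)

text \<open>Cauchy product of the coefficients of \<open>(P + s Q)^l\<close> and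
  \<open>(P + s Q)^m\<close>: the \<open>q\<close> letters \<open>Q\<close> are distributed over the
  two parts.\<close>

lemma kword_add:
  "kword P Q (l + m) q x y = (\<Sum>a\<le>q. (kword P Q l a \<odot> kword P Q m (q - a)) x y)"
proof (induction l arbitrary: q x y)
  case 0
  have "(\<Sum>a\<le>q. (kword P Q 0 a \<odot> kword P Q m (q - a)) x y)
      = (\<Sum>a\<in>{0}. (kword P Q 0 a \<odot> kword P Q m (q - a)) x y)"
  proof (rule sum.mono_neutral_right)
    show "\<forall>a\<in>{..q} - {0}. (kword P Q 0 a \<odot> kword P Q m (q - a)) x y = 0"
    proof
      fix a assume "a \<in> {..q} - {0}"
      then obtain b where "a = Suc b" using not0_implies_Suc by auto
      then show "(kword P Q 0 a \<odot> kword P Q m (q - a)) x y = 0" by (simp add: kcomp_zero_left)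
    qed
  qed auto
  then show ?case by simp
next
  case (Suc l)
  have IH: "kword P Q (l + m) q = (\<lambda>x y. \<Sum>a\<le>q. (kword P Q l a \<odot> kword P Q m (q - a)) x y)" for q
    by (intro ext Suc.IH)
  show ?case
  proof (cases q)
    case 0
    then show ?thesis by (simp add: IH kcomp_assoc)
  next
    case (Suc p)
    have "kword P Q (Suc l + m) (Suc p) x y =
        (\<Sum>a\<le>Suc p. (P \<odot> (kword P Q l a \<odot> kword P Q m (Suc p - a))) x y)
        + (\<Sum>a\<le>p. (Q \<odot> (kword P Q l a \<odot> kword P Q m (p - a))) x y)"
      by (simp only: add_Suc kword.simps IH kcomp_sum_right)
    also have "\<dots> = (\<Sum>a\<le>Suc p. (kword P Q (Suc l) a \<odot> kword P Q m (Suc p - a)) x y)"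
      by (simp only: sum.atMost_Suc_shift kword.simps kcomp_add_left kcomp_assoc sum.distrib
          diff_Suc_Suc diff_zero add.assoc)
    finally show ?thesis using Suc by simp
  qed
qed

lemma kword_one [simp]:
  "kword P Q (Suc 0) 0 = P" "kword P Q (Suc 0) (Suc 0) = Q"
  "kword P Q (Suc 0) (Suc (Suc q)) x y = 0"
  by (auto intro!: ext simp: kcomp_zero_right)

text \<open>The recursion of \<open>kword\<close> peels letters off on the left; reversal, and lists
  of times extended at their end, need the right-hand version.\<close>

lemma kword_Suc_right:
  "kword P Q (Suc l) (Suc q) x y = (kword P Q l (Suc q) \<odot> P) x y + (kword P Q l q \<odot> Q) x y"
proof -
  have "kword P Q (l + Suc 0) (Suc q) x y
      = (\<Sum>a\<in>{q, Suc q}. (kword P Q l a \<odot> kword P Q (Suc 0) (Suc q - a)) x y)"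
    unfolding kword_add
  proof (rule sum.mono_neutral_right)
    show "\<forall>a\<in>{..Suc q} - {q, Suc q}. (kword P Q l a \<odot> kword P Q (Suc 0) (Suc q - a)) x y = 0"
    proof
      fix a assume a: "a \<in> {..Suc q} - {q, Suc q}"
      have "Suc q - a = Suc (Suc (q - a - 1))" using a by auto
      then have "kword P Q (Suc 0) (Suc q - a) = (\<lambda>x y. 0)" by (metis kword_one(3) ext)
      then show "(kword P Q l a \<odot> kword P Q (Suc 0) (Suc q - a)) x y = 0" by (simp only: kcomp_zero_right)
    qed
  qed auto
  moreover have "Suc q - q = Suc 0" by simp
  ultimately show ?thesis by (simp del: kword.simps add: add.commute)
qed

lemma kword_Suc_right_0: "kword P Q (Suc l) 0 x y = (kword P Q l 0 \<odot> P) x y"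
  using kword_add[of P Q l "Suc 0" 0 x y] by simp

text \<open>Reversal turns a single word into its mirror image, and the collection of all words with
  \<open>q\<close> letters \<open>Q\<close> is invariant under mirroring.\<close>

lemma kword_sym:
  assumes "ksym w P" "ksym w Q"
  shows "ksym w (kword P Q l q)"
proof (induction l arbitrary: q)
  case 0
  show ?case by (cases q) (auto simp: ksym_def kone_def)
next
  case (Suc l)
  show ?case
  proof (cases q)
    case 0
    then show ?thesis
      using kcomp_reverse[OF assms(1) Suc.IH] unfolding ksym_def
      by (metis kword.simps(3) kword_Suc_right_0)
  next
    case q: (Suc p)
    have "w x * kword P Q (Suc l) q x y = w y * kword P Q (Suc l) q y x" for x y
    proof -
      have "w x * kword P Q (Suc l) q x y
          = w x * (P \<odot> kword P Q l q) x y + w x * (Q \<odot> kword P Q l p) x y"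
        by (simp add: q distrib_left)
      also have "\<dots> = w y * (kword P Q l q \<odot> P) y x + w y * (kword P Q l p \<odot> Q) y x"
        using kcomp_reverse[OF assms(1) Suc.IH] kcomp_reverse[OF assms(2) Suc.IH] by simp
      also have "\<dots> = w y * kword P Q (Suc l) q y x"
        unfolding q kword_Suc_right distrib_left ..
      finally show ?thesis .
    qed
    then show ?thesis by (auto simp: ksym_def)
  qed
qed

lemma sum_triangle_reorder:
  fixes f :: "nat \<Rightarrow> nat \<Rightarrow> ennreal"
  shows "(\<Sum>a<m. \<Sum>b\<le>a. f b (a - b)) = (\<Sum>b<m. \<Sum>c<m - b. f b c)"
proof -
  have "(\<Sum>a<m. \<Sum>b\<le>a. f b (a - b)) = (\<Sum>(a, b)\<in>(SIGMA a:{..<m}. {..a}). f b (a - b))"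
    by (rule sum.Sigma) auto
  also have "\<dots> = (\<Sum>(b, c)\<in>(SIGMA b:{..<m}. {..<m - b}). f b c)"
    by (rule sum.reindex_bij_witness[where i="\<lambda>(b, c). (b + c, b)" and j="\<lambda>(a, b). (b, a - b)"]) auto
  also have "\<dots> = (\<Sum>b<m. \<Sum>c<m - b. f b c)"
    by (rule sum.Sigma[symmetric]) auto
  finally show ?thesis .
qed

text \<open>Pigeonhole: among \<open>m\<close> consecutive blocks carrying fewer than \<open>m\<close> factors \<open>Q\<close>, one is free of
  \<open>Q\<close>.\<close>

lemma kword_blocks_aux:
  assumes "m * L \<le> l" "m \<le> Suc q"
  shows "(\<Sum>a<m. (kword P Q (m * L) a \<odot> kword P Q (l - m * L) (q - a)) x y)
    \<le> (\<Sum>j<m. \<Sum>a\<le>q. (kword P Q (j * L) a \<odot> kword P Q L 0 \<odot> kword P Q (l - Suc j * L) (q - a)) x y)"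
  using assms
proof (induction m)
  case 0
  then show ?case by simp
next
  case (Suc m)
  let ?D = "kword P Q"
  let ?R = "l - Suc m * L"
  have R: "l - m * L = L + ?R" using Suc.prems by simp
  define f where "f b c = (?D (m * L) b \<odot> ?D L c \<odot> ?D ?R (q - b - c)) x y" for b c
  have "(\<Sum>a<Suc m. (?D (Suc m * L) a \<odot> ?D ?R (q - a)) x y) = (\<Sum>a<Suc m. \<Sum>b\<le>a. f b (a - b))"
  proof (intro sum.cong refl)
    fix a assume "a \<in> {..<Suc m}"
    have "?D (Suc m * L) a = (\<lambda>x y. \<Sum>b\<le>a. (?D (m * L) b \<odot> ?D L (a - b)) x y)"
      by (intro ext) (metis add.commute kword_add mult_Suc)
    then show "(?D (Suc m * L) a \<odot> ?D ?R (q - a)) x y = (\<Sum>b\<le>a. f b (a - b))"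
      by (simp add: kcomp_sum_left f_def)
  qed
  also have "\<dots> = (\<Sum>b<Suc m. \<Sum>c<Suc m - b. f b c)"
    by (rule sum_triangle_reorder)
  \<comment> \<open>Here b counts the letters \<open>Q\<close> in the first m blocks and c those in
    the next one. If b < m, the induction hypothesis finds a free block among the first m; if b = m,
    then c = 0 and the next block is itself free.\<close>
  also have "\<dots> = (\<Sum>b<m. \<Sum>c<Suc m - b. f b c) + f m 0"
    by simp
  also have "(\<Sum>b<m. \<Sum>c<Suc m - b. f b c) \<le> (\<Sum>b<m. (?D (m * L) b \<odot> ?D (l - m * L) (q - b)) x y)"
  proof (intro sum_mono)
    fix b assume b: "b \<in> {..<m}"
    have "?D (l - m * L) (q - b) = (\<lambda>x y. \<Sum>c\<le>q - b. (?D L c \<odot> ?D ?R (q - b - c)) x y)"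
      unfolding R by (intro ext) (rule kword_add)
    then have "(?D (m * L) b \<odot> ?D (l - m * L) (q - b)) x y = (\<Sum>c\<le>q - b. f b c)"
      by (simp add: kcomp_sum_right f_def kcomp_assoc)
    moreover have "{..<Suc m - b} \<subseteq> {..q - b}" using b Suc.prems by auto
    ultimately show "(\<Sum>c<Suc m - b. f b c) \<le> (?D (m * L) b \<odot> ?D (l - m * L) (q - b)) x y"
      by (simp add: sum_mono2)
  qed
  also have "\<dots> \<le> (\<Sum>j<m. \<Sum>a\<le>q. (?D (j * L) a \<odot> ?D L 0 \<odot> ?D (l - Suc j * L) (q - a)) x y)"
    using Suc by simp
  also have "f m 0 \<le> (\<Sum>a\<le>q. (?D (m * L) a \<odot> ?D L 0 \<odot> ?D ?R (q - a)) x y)"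
    using Suc.prems member_le_sum[of m "{..q}" "\<lambda>a. (?D (m * L) a \<odot> ?D L 0 \<odot> ?D ?R (q - a)) x y"]
    by (simp add: f_def)
  finally show ?case by (simp add: add_mono)
qed

lemma kword_blocks:
  assumes "Suc q * L \<le> l"
  shows "kword P Q l q x y
    \<le> (\<Sum>j\<le>q. \<Sum>a\<le>q. (kword P Q (j * L) a \<odot> kword P Q L 0 \<odot> kword P Q (l - Suc j * L) (q - a)) x y)"
proof -
  have "kword P Q l q x y = (\<Sum>a<Suc q. (kword P Q (Suc q * L) a \<odot> kword P Q (l - Suc q * L) (q - a)) x y)"
    using kword_add[of P Q "Suc q * L" "l - Suc q * L" q x y] assms by (simp add: lessThan_Suc_atMost)
  also note kword_blocks_aux[OF assms order_refl]
  finally show ?thesis by (simp add: lessThan_Suc_atMost)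
qed

section \<open>Ergodic averages\<close>

text \<open>\<open>ksums P f n\<close> is \<open>\<Sum>\<^bsub>i<n\<^esub> P\<^sup>i f\<close>.\<close>

primrec ksums :: "'s kernel \<Rightarrow> ('s \<Rightarrow> ennreal) \<Rightarrow> nat \<Rightarrow> 's \<Rightarrow> ennreal" where
  "ksums P f 0 = (\<lambda>x. 0)"
| "ksums P f (Suc n) = (\<lambda>x. f x + kapp P (ksums P f n) x)"

definition kmaxavg :: "'s kernel \<Rightarrow> ('s \<Rightarrow> ennreal) \<Rightarrow> 's \<Rightarrow> ennreal" where
  "kmaxavg P f x = (SUP n. ksums P f (Suc n) x / of_nat (Suc n))"

primrec kiter :: "'s kernel \<Rightarrow> 's kernel \<Rightarrow> nat \<Rightarrow> 's \<Rightarrow> ennreal" where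
  "kiter P Q 0 = (\<lambda>x. 1)"
| "kiter P Q (Suc q) = kmaxavg P (kapp Q (kiter P Q q))"

lemma ksums_le_kmaxavg: "ksums P f n x \<le> of_nat n * kmaxavg P f x"
proof (cases n)
  case 0
  then show ?thesis by simp
next
  case (Suc m)
  have "ksums P f (Suc m) x = of_nat (Suc m) * (ksums P f (Suc m) x / of_nat (Suc m))"
    by (metis ennreal_mult_divide_eq ennreal_times_divide mult.commute of_nat_neq_0 ennreal_of_nat_neq_top)
  also have "\<dots> \<le> of_nat (Suc m) * kmaxavg P f x"
    unfolding kmaxavg_def by (intro mult_left_mono SUP_upper) auto
  finally show ?thesis using Suc by simp
qed

lemma ksums_mult: "ksums P (\<lambda>x. c * f x) n x = c * ksums P f n x"
proof (induction n arbitrary: x)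
  case (Suc n)
  have "ksums P (\<lambda>x. c * f x) n = (\<lambda>x. c * ksums P f n x)" using Suc by (intro ext)
  then show ?case by (simp add: kapp_cmult distrib_left)
qed simp

text \<open>Decompose at the first letter \<open>Q\<close>: the powers of \<open>P\<close> before it
  produce an ergodic sum of \<open>Q\<close> applied to the shorter words, and an ergodic sum of
  length at most \<open>m\<close> is at most \<open>m\<close> times the maximal average. The common
  bound \<open>m\<close> lets inner words of all lengths share one estimate.\<close>

lemma kword_total_le:
  assumes P1: "\<And>x. kapp P (\<lambda>_. 1) x \<le> 1" and "l \<le> m"
  shows "kapp (kword P Q l q) (\<lambda>_. 1) x \<le> of_nat m ^ q * kiter P Q q x"
  using assms(2)
proof (induction q arbitrary: l x)
  case 0
  have "kapp (kword P Q l 0) (\<lambda>_. 1) x \<le> 1" for l x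
  proof (induction l arbitrary: x)
    case (Suc l)
    have "kapp P (kapp (kword P Q l 0) (\<lambda>_. 1)) x \<le> kapp P (\<lambda>_. 1) x"
      by (rule kapp_mono) (auto simp: Suc)
    then show ?case using P1[of x] by (simp add: kapp_kcomp)
  qed simp
  then show ?case by simp
next
  case (Suc q)
  have "kapp (kword P Q l (Suc q)) (\<lambda>_. 1) x \<le> ksums P (\<lambda>x. of_nat m ^ q * kapp Q (kiter P Q q) x) l x"
    using Suc.prems
  proof (induction l arbitrary: x)
    case 0
    then show ?case by (simp add: kapp_def)
  next
    case (Suc l)
    have "kapp (kword P Q (Suc l) (Suc q)) (\<lambda>_. 1) x
        = kapp P (kapp (kword P Q l (Suc q)) (\<lambda>_. 1)) x + kapp Q (kapp (kword P Q l q) (\<lambda>_. 1)) x"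
      by (simp add: kapp_add_left kapp_kcomp)
    also have "kapp Q (kapp (kword P Q l q) (\<lambda>_. 1)) x \<le> kapp Q (\<lambda>x. of_nat m ^ q * kiter P Q q x) x"
      using Suc.prems by (intro kapp_mono \<open>\<And>l x. l \<le> m \<Longrightarrow> kapp (kword P Q l q) (\<lambda>_. 1) x \<le> of_nat m ^ q * kiter P Q q x\<close>) auto
    also have "kapp P (kapp (kword P Q l (Suc q)) (\<lambda>_. 1)) x
        \<le> kapp P (ksums P (\<lambda>x. of_nat m ^ q * kapp Q (kiter P Q q) x) l) x"
      using Suc by (intro kapp_mono) auto
    finally show ?case by (simp add: kapp_cmult add.commute add_mono)
  qed
  also have "\<dots> = of_nat m ^ q * ksums P (kapp Q (kiter P Q q)) l x"
    by (rule ksums_mult)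
  also have "\<dots> \<le> of_nat m ^ q * (of_nat m * kiter P Q (Suc q) x)"
    using ksums_le_kmaxavg[of P "kapp Q (kiter P Q q)" l x] Suc.prems
    by (intro mult_left_mono) (auto intro!: order_trans[OF ksums_le_kmaxavg] mult_right_mono)
  finally show ?case by (simp add: ac_simps)
qed

section \<open>Elementary symmetric sums\<close>

definition esum :: "nat \<Rightarrow> nat set \<Rightarrow> (nat \<Rightarrow> nat) \<Rightarrow> nat" where
  "esum q A t = (\<Sum>I | I \<subseteq> A \<and> card I = q. \<Prod>i\<in>I. t i)"

lemma esum_0: "finite A \<Longrightarrow> esum 0 A t = 1"
proof -
  assume "finite A"
  then have "{I. I \<subseteq> A \<and> card I = 0} = {{}}"
    by (auto dest: finite_subset simp: card_eq_0_iff)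
  then show ?thesis by (simp add: esum_def)
qed

lemma esum_1: "esum (Suc 0) A t = sum t A"
proof -
  have "{I. I \<subseteq> A \<and> card I = Suc 0} = (\<lambda>i. {i}) ` A"
    by (auto simp: card_1_singleton_iff)
  then show ?thesis by (simp add: esum_def sum.reindex)
qed

lemma esum_cong: "(\<And>i. i \<in> A \<Longrightarrow> s i = t i) \<Longrightarrow> esum q A s = esum q A t"
  unfolding esum_def by (intro sum.cong prod.cong) auto

lemma esum_insert:
  assumes "finite A" "a \<notin> A"
  shows "esum (Suc q) (insert a A) t = esum (Suc q) A t + t a * esum q A t"
proof -
  let ?S = "\<lambda>q. {I. I \<subseteq> A \<and> card I = q}"
  have fin: "finite (?S q)" for q using assms by simp
  have "{I. I \<subseteq> insert a A \<and> card I = Suc q} = ?S (Suc q) \<union> insert a ` ?S q"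
  proof (intro set_eqI iffI)
    fix I assume I: "I \<in> {I. I \<subseteq> insert a A \<and> card I = Suc q}"
    show "I \<in> ?S (Suc q) \<union> insert a ` ?S q"
    proof (cases "a \<in> I")
      case True
      have "finite I" using I assms(1) by (metis (no_types, lifting) finite_insert finite_subset mem_Collect_eq)
      then have "I - {a} \<in> ?S q" using I True by auto
      moreover have "I = insert a (I - {a})" using True by auto
      ultimately show ?thesis by blast
    qed (use I in auto)
  next
    fix I assume "I \<in> ?S (Suc q) \<union> insert a ` ?S q"
    then show "I \<in> {I. I \<subseteq> insert a A \<and> card I = Suc q}"
      using assms finite_subset by (auto simp: card_insert_if)
  qed
  moreover have "?S (Suc q) \<inter> insert a ` ?S q = {}" using assms(2) by auto
  moreover have "inj_on (insert a) (?S q)"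
    using assms(2) by (auto simp: inj_on_def)
  moreover have "(\<Prod>i\<in>insert a I. t i) = t a * (\<Prod>i\<in>I. t i)" if "I \<in> ?S q" for I
    using that assms by (subst prod.insert) (auto dest: finite_subset)
  ultimately show ?thesis
    using fin unfolding esum_def
    by (simp add: sum.union_disjoint sum.reindex sum_distrib_left)
qed

text \<open>Double counting of sets of size \<open>Suc k\<close> with one marked element: the marked
  element is the one outside \<open>I\<close>.\<close>

lemma esum_Suc:
  assumes "finite A"
  shows "Suc k * esum (Suc k) A t = (\<Sum>I | I \<subseteq> A \<and> card I = k. (\<Prod>i\<in>I. t i) * sum t (A - I))"
proof -
  let ?S = "\<lambda>q. {I. I \<subseteq> A \<and> card I = q}"
  have finS: "finite (?S q)" for q using assms by simp
  have "(\<Sum>I\<in>?S k. (\<Prod>i\<in>I. t i) * sum t (A - I)) = (\<Sum>I\<in>?S k. \<Sum>i\<in>A - I. \<Prod>j\<in>insert i I. t j)"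
  proof (intro sum.cong refl)
    fix I assume "I \<in> ?S k"
    then have fin: "finite I" using assms by (auto dest: finite_subset)
    show "(\<Prod>i\<in>I. t i) * sum t (A - I) = (\<Sum>i\<in>A - I. \<Prod>j\<in>insert i I. t j)"
      unfolding sum_distrib_left using fin by (intro sum.cong) auto
  qed
  also have "\<dots> = (\<Sum>(I, i)\<in>Sigma (?S k) (\<lambda>I. A - I). \<Prod>j\<in>insert i I. t j)"
    using finS assms by (intro sum.Sigma) auto
  also have "\<dots> = (\<Sum>(J, i)\<in>Sigma (?S (Suc k)) (\<lambda>J. J). \<Prod>j\<in>J. t j)"
  proof (rule sum.reindex_bij_witness[where i="\<lambda>(J, i). (J - {i}, i)" and j="\<lambda>(I, i). (insert i I, i)"])
    fix a assume "a \<in> Sigma (?S k) (\<lambda>I. A - I)"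
    then obtain I i where a: "a = (I, i)" "I \<subseteq> A" "card I = k" "i \<in> A" "i \<notin> I" by auto
    have "finite I" using a(2) assms by (rule finite_subset)
    with a show "(case case a of (I, i) \<Rightarrow> (insert i I, i) of (J, i) \<Rightarrow> (J - {i}, i)) = a"
      "(case a of (I, i) \<Rightarrow> (insert i I, i)) \<in> Sigma (?S (Suc k)) (\<lambda>J. J)"
      by auto
  next
    fix b assume "b \<in> Sigma (?S (Suc k)) (\<lambda>J. J)"
    then obtain J i where b: "b = (J, i)" "J \<subseteq> A" "card J = Suc k" "i \<in> J" by auto
    have "finite J" using b(2) assms by (rule finite_subset)
    with b show "(case b of (J, i) \<Rightarrow> (J - {i}, i)) \<in> Sigma (?S k) (\<lambda>I. A - I)"
      by auto
    show "(case case b of (J, i) \<Rightarrow> (J - {i}, i) of (I, i) \<Rightarrow> (insert i I, i)) = b"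
      using b by (simp add: insert_absorb)
  qed auto
  also have "\<dots> = (\<Sum>J\<in>?S (Suc k). \<Sum>i\<in>J. \<Prod>j\<in>J. t j)"
    using finS by (intro sum.Sigma[symmetric] ballI) (auto intro: finite_subset[OF _ assms])
  also have "\<dots> = (\<Sum>J\<in>?S (Suc k). Suc k * (\<Prod>j\<in>J. t j))"
    by (intro sum.cong) auto
  finally show ?thesis by (simp only: esum_def sum_distrib_left)
qed

text \<open>By \<open>esum_Suc\<close>, passing from one symmetric sum to the next gains a factor
  \<theta>, because whatever remains after removing at most \<open>r\<close> entries still sums to
  at least \<theta>. The first factor is kept as the full sum, which in the application is at least
  n and so better than \<theta>.\<close>

lemma esum_ge:
  fixes \<theta> :: real
  assumes A: "finite A" "r \<le> card A" and \<theta>: "0 \<le> \<theta>"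
    and big: "\<And>I. I \<subseteq> A \<Longrightarrow> card I = r \<Longrightarrow> \<theta> \<le> real (sum t (A - I))"
    and "k \<le> r"
  shows "real (sum t A) * \<theta> ^ k \<le> fact (Suc k) * real (esum (Suc k) A t)"
  using \<open>k \<le> r\<close>
proof (induction k)
  case 0
  then show ?case by (simp add: esum_1)
next
  case (Suc k)
  have *: "\<theta> \<le> real (sum t (A - I))" if I: "I \<subseteq> A" "card I = Suc k" for I
  proof -
    obtain J where J: "I \<subseteq> J" "J \<subseteq> A" "card J = r"
      using exists_subset_between[of I r A] A I Suc.prems by auto
    then have "\<theta> \<le> real (sum t (A - J))" using big by simp
    also have "sum t (A - J) \<le> sum t (A - I)"
      using A J by (intro sum_mono2) auto
    finally show ?thesis by simp
  qed
  have "\<theta> * real (esum (Suc k) A t) = (\<Sum>I | I \<subseteq> A \<and> card I = Suc k. \<theta> * real (prod t I))"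
    by (simp only: esum_def of_nat_sum sum_distrib_left)
  also have "\<dots> \<le> (\<Sum>I | I \<subseteq> A \<and> card I = Suc k. real (prod t I * sum t (A - I)))"
  proof (intro sum_mono)
    fix I assume "I \<in> {I. I \<subseteq> A \<and> card I = Suc k}"
    then have "real (prod t I) * \<theta> \<le> real (prod t I) * real (sum t (A - I))"
      using * by (intro mult_left_mono of_nat_0_le_iff) auto
    then show "\<theta> * real (prod t I) \<le> real (prod t I * sum t (A - I))"
      by (simp only: mult.commute[of \<theta>] of_nat_mult)
  qed
  also have "\<dots> = real (Suc (Suc k) * esum (Suc (Suc k)) A t)"
    unfolding esum_Suc[OF A(1)] by simp
  finally have "\<theta> * real (esum (Suc k) A t) \<le> real (Suc (Suc k) * esum (Suc (Suc k)) A t)" .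
  then have "fact (Suc k) * (\<theta> * real (esum (Suc k) A t))
      \<le> fact (Suc k) * real (Suc (Suc k) * esum (Suc (Suc k)) A t)"
    by (intro mult_left_mono) auto
  moreover have "real (sum t A) * \<theta> ^ Suc k \<le> \<theta> * (fact (Suc k) * real (esum (Suc k) A t))"
    using mult_left_mono[OF Suc.IH \<theta>] Suc.prems by (simp add: ac_simps)
  ultimately have "real (sum t A) * \<theta> ^ Suc k \<le> fact (Suc k) * real (Suc (Suc k) * esum (Suc (Suc k)) A t)"
    by (simp only: mult.left_commute[of "fact (Suc k)" \<theta>])
  also have "\<dots> = fact (Suc (Suc k)) * real (esum (Suc (Suc k)) A t)"
    by (simp only: fact_Suc[of "Suc k"] of_nat_mult of_nat_fact mult.assoc mult.commute[of "fact (Suc k)"] mult.left_commute[of "fact (Suc k)"])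
  finally show ?case .
qed

section \<open>Products of kernels along lists of times\<close>

primrec kpath :: "(nat \<Rightarrow> 's kernel) \<Rightarrow> nat list \<Rightarrow> 's kernel" where
  "kpath K [] = kone"
| "kpath K (t # ts) = K t \<odot> kpath K ts"

lemma kpath_append: "kpath K (ts @ us) = kpath K ts \<odot> kpath K us"
  by (induction ts) (auto simp: kcomp_assoc)

text \<open>Cutting the gaps off at \<open>N\<close> makes the set finite; for paths observed up to
  time \<open>2 * n\<close> the choice \<open>N = 2 * n\<close> loses nothing.\<close>

definition time_lists :: "nat \<Rightarrow> nat \<Rightarrow> nat list set" where
  "time_lists N l = {ts. set ts \<subseteq> {1..N} \<and> length ts = l}"

lemma finite_time_lists [simp]: "finite (time_lists N l)"
  unfolding time_lists_def by (rule finite_lists_length_eq) simp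

lemma sum_time_lists_Suc:
  fixes f :: "nat list \<Rightarrow> ennreal"
  shows "(\<Sum>ts\<in>time_lists N (Suc l). f ts) = (\<Sum>ts\<in>time_lists N l. \<Sum>t=1..N. f (ts @ [t]))"
proof -
  have "(\<Sum>ts\<in>time_lists N (Suc l). f ts) = (\<Sum>(ts, t)\<in>time_lists N l \<times> {1..N}. f (ts @ [t]))"
  proof (rule sum.reindex_bij_witness[where j="\<lambda>ts. (butlast ts, last ts)" and i="\<lambda>(ts, t). ts @ [t]"])
    fix ts assume ts: "ts \<in> time_lists N (Suc l)"
    then have ne: "ts \<noteq> []" by (auto simp: time_lists_def)
    then show "(case (butlast ts, last ts) of (ts, t) \<Rightarrow> ts @ [t]) = ts" by simp
    have "set (butlast ts) \<subseteq> set ts" "last ts \<in> set ts" using ne by (auto dest: in_set_butlastD)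
    then show "(butlast ts, last ts) \<in> time_lists N l \<times> {1..N}"
      using ts by (auto simp: time_lists_def)
    show "(case (butlast ts, last ts) of (ts, t) \<Rightarrow> f (ts @ [t])) = f ts" using ne by simp
  next
    fix b assume "b \<in> time_lists N l \<times> {1..N}"
    then show "(case b of (ts, t) \<Rightarrow> ts @ [t]) \<in> time_lists N (Suc l)"
      "(butlast (case b of (ts, t) \<Rightarrow> ts @ [t]), last (case b of (ts, t) \<Rightarrow> ts @ [t])) = b"
      by (auto simp: time_lists_def)
  qed
  then show ?thesis by (simp add: sum.cartesian_product)
qed

definition time_esum :: "nat \<Rightarrow> nat list \<Rightarrow> nat" where
  "time_esum q ts = esum q {..<length ts} ((!) ts)"

lemma time_esum_0 [simp]: "time_esum 0 ts = 1"
  by (simp add: time_esum_def esum_0)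

lemma time_esum_snoc: "time_esum (Suc q) (ts @ [t]) = time_esum (Suc q) ts + t * time_esum q ts"
proof -
  have "esum q {..<length ts} ((!) (ts @ [t])) = esum q {..<length ts} ((!) ts)" for q
    by (rule esum_cong) (simp add: nth_append)
  then show ?thesis
    by (simp add: time_esum_def lessThan_Suc esum_insert)
qed

lemma time_esum_1: "time_esum (Suc 0) ts = sum_list ts"
  by (simp add: time_esum_def esum_1 sum_list_sum_nth atLeast0LessThan)

definition ktotal :: "(nat \<Rightarrow> 's kernel) \<Rightarrow> 's kernel" where
  "ktotal K x y = (\<Sum>t. K t x y)"

text \<open>For excursion kernels \<open>p = 1\<close> gives the kernel Q of the overview, while
  \<open>p = Suc r\<close> serves the words of length below \<open>r\<close>.\<close>

definition kmoment :: "nat \<Rightarrow> (nat \<Rightarrow> 's kernel) \<Rightarrow> 's kernel" where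
  "kmoment p K x y = (\<Sum>t. of_nat t ^ p * K t x y)"

lemma sum_le_suminf_ennreal: "finite I \<Longrightarrow> (\<Sum>i\<in>I. f i) \<le> (\<Sum>i. f i :: ennreal)"
  by (rule sum_le_suminf) auto

text \<open>Expands the product, over the letters, of the sum over t of (1 + s t^p) K t and compares
  the coefficients of s^q. It is an inequality because the times on the left are cut off at
  \<open>N\<close>.\<close>

lemma sum_kpath_le_kword:
  "(\<Sum>ts\<in>time_lists N l. of_nat (time_esum q (map (\<lambda>t. t ^ p) ts)) * kpath K ts x y)
    \<le> kword (ktotal K) (kmoment p K) l q x y"
proof (induction l arbitrary: q x y)
  case 0
  have [simp]: "time_lists N 0 = {[]}" by (auto simp: time_lists_def)
  have "time_esum (Suc j) [] = 0" for j
  proof -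
    have "{I. I \<subseteq> {} \<and> card I = Suc j} = {}" by auto
    then show ?thesis by (simp add: time_esum_def esum_def)
  qed
  then show ?case by (cases q) auto
next
  case (Suc l)
  let ?D = "kword (ktotal K) (kmoment p K)"
  let ?T = "time_lists N l"
  let ?m = "map (\<lambda>t. t ^ p)"
  have P: "(\<Sum>ts\<in>?T. \<Sum>t=1..N. of_nat (time_esum q (?m ts)) * (kpath K ts \<odot> K t) x y) \<le> (?D l q \<odot> ktotal K) x y" for q
  proof -
    have "(\<Sum>ts\<in>?T. \<Sum>t=1..N. of_nat (time_esum q (?m ts)) * (kpath K ts \<odot> K t) x y)
        = ((\<lambda>x y. \<Sum>ts\<in>?T. of_nat (time_esum q (?m ts)) * kpath K ts x y) \<odot> (\<lambda>x y. \<Sum>t=1..N. K t x y)) x y"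
      unfolding kcomp_sum_left kcomp_sum_right
      by (simp add: kcomp_def kapp_def nn_integral_cmult[symmetric] mult.assoc)
    also have "\<dots> \<le> (?D l q \<odot> ktotal K) x y"
      by (intro kcomp_mono Suc.IH) (auto simp: ktotal_def sum_le_suminf_ennreal)
    finally show ?thesis .
  qed
  have Q: "(\<Sum>ts\<in>?T. \<Sum>t=1..N. of_nat (t ^ p * time_esum q (?m ts)) * (kpath K ts \<odot> K t) x y) \<le> (?D l q \<odot> kmoment p K) x y" for q
  proof -
    have "(\<Sum>ts\<in>?T. \<Sum>t=1..N. of_nat (t ^ p * time_esum q (?m ts)) * (kpath K ts \<odot> K t) x y)
        = ((\<lambda>x y. \<Sum>ts\<in>?T. of_nat (time_esum q (?m ts)) * kpath K ts x y) \<odot> (\<lambda>x y. \<Sum>t=1..N. of_nat t ^ p * K t x y)) x y"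
      unfolding kcomp_sum_left kcomp_sum_right
      by (simp add: kcomp_def kapp_def nn_integral_cmult[symmetric] ac_simps)
    also have "\<dots> \<le> (?D l q \<odot> kmoment p K) x y"
      by (intro kcomp_mono Suc.IH, unfold kmoment_def) (rule sum_le_suminf_ennreal, simp)
    finally show ?thesis .
  qed
  show ?case
  proof (cases q)
    case 0
    then show ?thesis
      using P[of 0] unfolding 0 kword_Suc_right_0 sum_time_lists_Suc by (simp add: kpath_append)
  next
    case (Suc j)
    then show ?thesis
      using add_mono[OF P[of "Suc j"] Q[of j]]
      unfolding Suc kword_Suc_right sum_time_lists_Suc
      by (simp add: kpath_append time_esum_snoc distrib_right sum.distrib)
  qed
qed

section \<open>Visit patterns\<close>

text \<open>\<open>visits A X N ts\<close>: the visits of \<open>X\<close> to \<open>A\<close> during \<open>(N, N + sum_list ts]\<close> have the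
  successive gaps \<open>ts\<close>.\<close>

primrec visits :: "'s set \<Rightarrow> (nat \<Rightarrow> 's) \<Rightarrow> nat \<Rightarrow> nat list \<Rightarrow> bool" where
  "visits A X N [] = True"
| "visits A X N (t # ts) = (0 < t \<and> (\<forall>i\<in>{N<..<N + t}. X i \<notin> A) \<and> X (N + t) \<in> A \<and> visits A X (N + t) ts)"

lemma visits_exists:
  assumes "X N \<in> A" "M \<le> N"
  shows "\<exists>ts. visits A X M ts \<and> M + sum_list ts = N"
  using assms(2)
proof (induction "N - M" arbitrary: M rule: less_induct)
  case less
  show ?case
  proof (cases "M = N")
    case True
    then show ?thesis by (intro exI[of _ "[]"]) auto
  next
    case False
    define n where "n = (LEAST n. M < n \<and> X n \<in> A)"
    have ex: "M < N \<and> X N \<in> A" using False less.prems assms(1) by auto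
    have n: "M < n" "X n \<in> A" "n \<le> N"
      using LeastI[of "\<lambda>n. M < n \<and> X n \<in> A", OF ex] Least_le[of "\<lambda>n. M < n \<and> X n \<in> A", OF ex]
      by (auto simp: n_def)
    have before: "X i \<notin> A" if "M < i" "i < n" for i
      using not_less_Least[of i "\<lambda>n. M < n \<and> X n \<in> A"] that by (auto simp: n_def)
    obtain ts where ts: "visits A X n ts" "n + sum_list ts = N"
      using less.hyps[of n] n by fastforce
    then have "visits A X M ((n - M) # ts) \<and> M + sum_list ((n - M) # ts) = N"
      using n before by auto
    then show ?thesis by blast
  qed
qed

lemma visits_pos: "visits A X N ts \<Longrightarrow> t \<in> set ts \<Longrightarrow> 0 < t"
  by (induction ts arbitrary: N) auto

lemma visits_step:
  "visits A X N ts \<Longrightarrow> k < length ts \<Longrightarrow>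
    0 < ts ! k \<and> X (N + sum_list (take (Suc k) ts)) \<in> A \<and>
    (\<forall>i\<in>{N + sum_list (take k ts)<..<N + sum_list (take (Suc k) ts)}. X i \<notin> A)"
proof (induction ts arbitrary: N k)
  case (Cons t ts)
  show ?case
  proof (cases k)
    case 0
    then show ?thesis using Cons.prems by auto
  next
    case (Suc j)
    then show ?thesis using Cons.IH[of "N + t" j] Cons.prems by (auto simp: add.assoc)
  qed
qed simp

text \<open>Partial sums and gaps are carried together because each \<open>return_time\<close> is
  defined through the sum of all earlier ones.\<close>

lemma return_time_visits:
  assumes "visits A X 0 ts" "k \<le> length ts"
  shows "(\<Sum>j\<le>k. return_time A X j) = enat (sum_list (take k ts)) \<and>
    (0 < k \<longrightarrow> return_time A X k = enat (ts ! (k - 1)))"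
  using assms(2)
proof (induction k)
  case 0
  then show ?case by (simp add: zero_enat_def)
next
  case (Suc k)
  let ?s = "sum_list (take k ts)" and ?s' = "sum_list (take (Suc k) ts)"
  have S: "(\<Sum>j\<le>k. return_time A X j) = enat ?s" using Suc by simp
  have s': "?s' = ?s + ts ! k" using Suc.prems by (simp add: take_Suc_conv_app_nth)
  have st: "0 < ts ! k" "X ?s' \<in> A" "\<And>i. ?s < i \<Longrightarrow> i < ?s' \<Longrightarrow> X i \<notin> A"
    using visits_step[OF assms(1), of k] Suc.prems by auto
  have "Inf {enat n |n. enat ?s < enat n \<and> X n \<in> A} = enat ?s'"
  proof (rule antisym)
    show "Inf {enat n |n. enat ?s < enat n \<and> X n \<in> A} \<le> enat ?s'"
      using st s' by (intro Inf_lower) auto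
    show "enat ?s' \<le> Inf {enat n |n. enat ?s < enat n \<and> X n \<in> A}"
      using st(3) by (intro Inf_greatest) (auto simp: not_less[symmetric])
  qed
  then have "return_time A X (Suc k) = enat (ts ! k)"
    by (simp add: S s')
  then show ?case using S s' by (simp del: return_time.simps)
qed

text \<open>Since time \<open>2 * m\<close> is itself a visit, the partial sums reach it exactly at
  the last gap; positivity of the gaps keeps every shorter prefix strictly below.\<close>

lemma steps_until_visits:
  assumes "visits A X 0 ts" "sum_list ts = 2 * m" "0 < m"
  shows "steps_until A X m = length ts"
  unfolding steps_until_def
proof (rule Least_equality)
  have sums: "(\<Sum>k=1..l. return_time A X k) = enat (sum_list (take l ts))" if "l \<le> length ts" for l
  proof -
    have "(\<Sum>j\<le>l. return_time A X j) = return_time A X 0 + (\<Sum>k=1..l. return_time A X k)"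
      by (simp add: atMost_atLeast0 sum.atLeast_Suc_atMost)
    then show ?thesis using return_time_visits[OF assms(1) that] by simp
  qed
  have "ts \<noteq> []" using assms by auto
  then show "1 \<le> length ts \<and> enat (2 * m) \<le> (\<Sum>k=1..length ts. return_time A X k)"
    using sums[of "length ts"] assms(2) by (auto simp: Suc_le_eq)
  fix l assume l: "1 \<le> l \<and> enat (2 * m) \<le> (\<Sum>k=1..l. return_time A X k)"
  show "length ts \<le> l"
  proof (rule ccontr)
    assume "\<not> length ts \<le> l"
    then have lt: "l < length ts" by simp
    then have "2 * m \<le> sum_list (take l ts)" using l sums[of l] by simp
    moreover have "sum_list (take (Suc l) ts) \<le> sum_list ts"
      by (metis append_take_drop_id le_add1 sum_list_append)
    moreover have "0 < ts ! l" using visits_step[OF assms(1) lt] by simp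
    ultimately show False using assms(2) lt by (simp add: take_Suc_conv_app_nth)
  qed
qed

text \<open>\<open>short_list\<close> is the trapping event read off the list of gaps.\<close>

definition short_list :: "nat \<Rightarrow> real \<Rightarrow> nat list \<Rightarrow> bool" where
  "short_list r \<theta> ts \<longleftrightarrow> r \<le> length ts \<and> real (length ts) \<le> \<theta> \<and>
     (\<exists>I\<subseteq>{..<length ts}. card I = r \<and> real (\<Sum>k\<in>{..<length ts} - I. ts ! k) \<le> \<theta>)"

text \<open>Translates tuples indexed from 1 into lists indexed from 0, and the minimum over sets of
  size \<open>r\<close> into the existence of one such set.\<close>

lemma trapping_event_visits:
  assumes "visits A X 0 ts" "sum_list ts = 2 * m" "0 < m"
  shows "trapping_event A r \<theta> m X \<longleftrightarrow> short_list r \<theta> ts"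
proof -
  let ?l = "length ts"
  have T: "return_time A X k = enat (ts ! (k - 1))" if "k \<in> {1..?l}" for k
    using return_time_visits[OF assms(1), of k] that by auto
  have "(\<exists>t\<in>short_sums ?l r \<theta>. \<forall>k\<in>{1..?l}. return_time A X k = enat (t k)) \<longleftrightarrow>
      (\<lambda>k. ts ! (k - 1)) \<in> short_sums ?l r \<theta>"
  proof
    assume "\<exists>t\<in>short_sums ?l r \<theta>. \<forall>k\<in>{1..?l}. return_time A X k = enat (t k)"
    then obtain t where t: "t \<in> short_sums ?l r \<theta>" "\<And>k. k \<in> {1..?l} \<Longrightarrow> t k = ts ! (k - 1)"
      using T by fastforce
    have eq: "(\<lambda>I. \<Sum>k\<in>{1..?l} - I. t k) = (\<lambda>I. \<Sum>k\<in>{1..?l} - I. ts ! (k - 1))"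
      by (intro ext sum.cong) (auto simp: t)
    show "(\<lambda>k. ts ! (k - 1)) \<in> short_sums ?l r \<theta>"
      using t(1) unfolding short_sums_def mem_Collect_eq eq .
  qed (use T in auto)
  moreover have "(\<lambda>k. ts ! (k - 1)) \<in> short_sums ?l r \<theta> \<longleftrightarrow>
      (\<exists>I\<subseteq>{..<?l}. card I = r \<and> real (\<Sum>k\<in>{..<?l} - I. ts ! k) \<le> \<theta>)" if r: "r \<le> ?l"
  proof -
    let ?\<S> = "{I. I \<subseteq> {1..?l} \<and> card I = r}"
    \<comment> \<open>This is where \<open>r \<le> length ts\<close> matters: without it
      \<open>Min\<close> would be taken over the empty set.\<close>
    have ne: "?\<S> \<noteq> {}" using obtain_subset_with_card_n[of r "{1..?l}"] r by auto
    have fin: "finite ?\<S>" by simp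
    have "(\<lambda>k. ts ! (k - 1)) \<in> short_sums ?l r \<theta> \<longleftrightarrow>
        (\<exists>I\<in>?\<S>. real (\<Sum>k\<in>{1..?l} - I. ts ! (k - 1)) \<le> \<theta>)"
    proof -
      let ?F = "(\<lambda>I. \<Sum>k\<in>{1..?l} - I. ts ! (k - 1)) ` ?\<S>"
      have F: "finite ?F" "?F \<noteq> {}" using fin ne by blast+
      show ?thesis
      proof
        assume "(\<lambda>k. ts ! (k - 1)) \<in> short_sums ?l r \<theta>"
        then have "real (Min ?F) \<le> \<theta>" by (simp add: short_sums_def)
        moreover obtain I where "I \<in> ?\<S>" "Min ?F = (\<Sum>k\<in>{1..?l} - I. ts ! (k - 1))"
          using Min_in[OF F] by (rule imageE)
        ultimately show "\<exists>I\<in>?\<S>. real (\<Sum>k\<in>{1..?l} - I. ts ! (k - 1)) \<le> \<theta>"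
          by (intro bexI[of _ I]) simp_all
      next
        assume "\<exists>I\<in>?\<S>. real (\<Sum>k\<in>{1..?l} - I. ts ! (k - 1)) \<le> \<theta>"
        then obtain v where v: "v \<in> ?F" "real v \<le> \<theta>" by blast
        then have "real (Min ?F) \<le> \<theta>" using Min_le[OF F(1) v(1)] by linarith
        then show "(\<lambda>k. ts ! (k - 1)) \<in> short_sums ?l r \<theta>" by (simp add: short_sums_def)
      qed
    qed
    also have "\<dots> \<longleftrightarrow> (\<exists>I\<subseteq>{..<?l}. card I = r \<and> real (\<Sum>k\<in>{..<?l} - I. ts ! k) \<le> \<theta>)"
    proof -
      have img: "{1..?l} = Suc ` {..<?l}" by (simp add: lessThan_atLeast0 image_Suc_atLeastLessThan atLeastLessThanSuc_atLeastAtMost)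
      have A: "(\<Sum>k\<in>{1..?l} - Suc ` I. ts ! (k - 1)) = (\<Sum>k\<in>{..<?l} - I. ts ! k)" for I
        unfolding img by (subst image_set_diff[symmetric]) (auto simp: sum.reindex)
      have B: "?\<S> = (`) Suc ` {I. I \<subseteq> {..<?l} \<and> card I = r}"
      proof (intro set_eqI iffI)
        fix J assume J: "J \<in> ?\<S>"
        then obtain I where "I \<subseteq> {..<?l}" "J = Suc ` I" unfolding img by (auto simp: subset_image_iff)
        then show "J \<in> (`) Suc ` {I. I \<subseteq> {..<?l} \<and> card I = r}" using J by (auto simp: card_image)
      qed (auto simp: card_image)
      show ?thesis
      proof
        assume "\<exists>J\<in>?\<S>. real (\<Sum>k\<in>{1..?l} - J. ts ! (k - 1)) \<le> \<theta>"
        then obtain J where J: "J \<in> ?\<S>" "real (\<Sum>k\<in>{1..?l} - J. ts ! (k - 1)) \<le> \<theta>" ..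
        from J(1) obtain I where I: "J = Suc ` I" "I \<subseteq> {..<?l}" "card I = r" unfolding B by auto
        have "real (\<Sum>k\<in>{..<?l} - I. ts ! k) \<le> \<theta>" using J(2) unfolding I(1) A .
        with I show "\<exists>I\<subseteq>{..<?l}. card I = r \<and> real (\<Sum>k\<in>{..<?l} - I. ts ! k) \<le> \<theta>" by blast
      next
        assume "\<exists>I\<subseteq>{..<?l}. card I = r \<and> real (\<Sum>k\<in>{..<?l} - I. ts ! k) \<le> \<theta>"
        then obtain I where I: "I \<subseteq> {..<?l}" "card I = r" "real (\<Sum>k\<in>{..<?l} - I. ts ! k) \<le> \<theta>" by blast
        have "Suc ` I \<in> ?\<S>" unfolding B using I by blast
        moreover have "real (\<Sum>k\<in>{1..?l} - Suc ` I. ts ! (k - 1)) \<le> \<theta>" using I(3) unfolding A .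
        ultimately show "\<exists>J\<in>?\<S>. real (\<Sum>k\<in>{1..?l} - J. ts ! (k - 1)) \<le> \<theta>" ..
      qed
    qed
    finally show ?thesis .
  qed
  ultimately show ?thesis
    unfolding trapping_event_def steps_until_visits[OF assms] Let_def short_list_def by blast
qed

lemma not_short_list_bound:
  assumes "\<not> short_list r \<theta> ts" "r \<le> length ts" "real (length ts) \<le> \<theta>" "0 \<le> \<theta>"
  shows "real (sum_list ts) * \<theta> ^ r \<le> fact (Suc r) * real (time_esum (Suc r) ts)"
proof -
  have "real (sum ((!) ts) {..<length ts}) * \<theta> ^ r \<le> fact (Suc r) * real (esum (Suc r) {..<length ts} ((!) ts))"
    using assms by (intro esum_ge[where r=r]) (auto simp: short_list_def not_le intro: less_imp_le)
  then show ?thesis by (simp add: time_esum_def sum_list_sum_nth atLeast0LessThan)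
qed

text \<open>The free middle block is replaced by its bound \<open>e\<close>. What remains is a row
  sum of the first part, bounded by \<open>kword_total_le\<close>, and a column sum of the last
  part, which reversal turns into a row sum at \<open>o'\<close> at the price of the factor
  \<open>c\<close>. The bound \<open>e\<close> is asked only for \<open>x\<close> reached from
  \<open>o'\<close> by the preceding blocks, matching the distance restriction in the heat-kernel
  estimate.\<close>

lemma kword_diag_le:
  assumes P1: "\<And>x. kapp P (\<lambda>_. 1) x \<le> 1"
    and sym: "ksym w P" "ksym w Q"
    and w: "\<And>l b y. kword P Q l b y o' \<noteq> 0 \<Longrightarrow> w o' \<le> c * w y \<and> w y \<noteq> 0 \<and> w y \<noteq> \<top>"
    and L: "Suc q * L \<le> l"
    and e: "\<And>j a b k x y. j \<le> q \<Longrightarrow> kword P Q (j * L) a o' x \<noteq> 0 \<Longrightarrow> kword P Q k b y o' \<noteq> 0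
        \<Longrightarrow> kword P Q L 0 x y \<le> e"
  shows "kword P Q l q o' o' \<le> of_nat (Suc q) * of_nat l ^ q * e * c * (\<Sum>a\<le>q. kiter P Q a o' * kiter P Q (q - a) o')"
proof -
  let ?D = "kword P Q"
  have col: "(\<integral>\<^sup>+y. ?D k b y o' \<partial>count_space UNIV) \<le> c * kapp (?D k b) (\<lambda>_. 1) o'" for k b
  proof -
    have "?D k b y o' \<le> c * ?D k b o' y" for y
    proof (cases "?D k b y o' = 0")
      case False
      have "w y * ?D k b y o' = w o' * ?D k b o' y" by (rule ksymD[OF kword_sym[OF sym]])
      also have "\<dots> \<le> (c * w y) * ?D k b o' y" using w[OF False] by (intro mult_right_mono) auto
      finally have "w y * ?D k b y o' \<le> w y * (c * ?D k b o' y)" by (simp add: ac_simps)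
      then show ?thesis using w[OF False] by (simp add: ennreal_mult_le_mult_iff)
    qed simp
    then show ?thesis
      unfolding kapp_def by (subst nn_integral_cmult[symmetric]) (auto intro!: nn_integral_mono)
  qed
  have term_le: "(?D (j * L) a \<odot> ?D L 0 \<odot> ?D (l - Suc j * L) (q - a)) o' o'
      \<le> of_nat l ^ q * e * c * (kiter P Q a o' * kiter P Q (q - a) o')" if "j \<le> q" "a \<le> q" for j a
  proof -
    let ?k = "l - Suc j * L"
    have jL: "j * L \<le> l"
      using L that(1) by (metis add_leD1 add.commute le_trans mult_Suc mult_le_mono1)
    have "(?D (j * L) a \<odot> ?D L 0 \<odot> ?D ?k (q - a)) o' o'
        = kapp (?D (j * L) a) (kapp (?D L 0) (\<lambda>y. ?D ?k (q - a) y o')) o'"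
      by (simp add: kcomp_assoc kcomp_def kapp_kcomp)
    also have "\<dots> \<le> kapp (?D (j * L) a) (\<lambda>x. e * (c * (of_nat l ^ (q - a) * kiter P Q (q - a) o'))) o'"
    proof (rule kapp_mono_right)
      fix x assume x: "?D (j * L) a o' x \<noteq> 0"
      have "kapp (?D L 0) (\<lambda>y. ?D ?k (q - a) y o') x \<le> (\<integral>\<^sup>+y. e * ?D ?k (q - a) y o' \<partial>count_space UNIV)"
        unfolding kapp_def
      proof (intro nn_integral_mono)
        fix y show "?D L 0 x y * ?D ?k (q - a) y o' \<le> e * ?D ?k (q - a) y o'"
          using e[OF that(1) x, of ?k "q - a" y] by (cases "?D ?k (q - a) y o' = 0") (auto intro: mult_right_mono)
      qed
      also have "\<dots> = e * (\<integral>\<^sup>+y. ?D ?k (q - a) y o' \<partial>count_space UNIV)"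
        by (rule nn_integral_cmult) simp
      also have "\<dots> \<le> e * (c * (of_nat l ^ (q - a) * kiter P Q (q - a) o'))"
        by (intro mult_left_mono order_trans[OF col] kword_total_le P1) auto
      finally show "kapp (?D L 0) (\<lambda>y. ?D ?k (q - a) y o') x \<le> e * (c * (of_nat l ^ (q - a) * kiter P Q (q - a) o'))" .
    qed
    also have "\<dots> = kapp (?D (j * L) a) (\<lambda>_. 1) o' * (e * (c * (of_nat l ^ (q - a) * kiter P Q (q - a) o')))"
      by (subst kapp_multc[symmetric]) simp
    also have "\<dots> \<le> (of_nat l ^ a * kiter P Q a o') * (e * (c * (of_nat l ^ (q - a) * kiter P Q (q - a) o')))"
      by (intro mult_right_mono kword_total_le P1 jL) auto
    also have "\<dots> = (of_nat l ^ a * of_nat l ^ (q - a)) * e * c * (kiter P Q a o' * kiter P Q (q - a) o')"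
      by (simp add: ac_simps)
    also have "of_nat l ^ a * of_nat l ^ (q - a) = (of_nat l ^ q :: ennreal)"
      using that by (simp flip: power_add)
    finally show ?thesis .
  qed
  have "?D l q o' o' \<le> (\<Sum>j\<le>q. \<Sum>a\<le>q. (?D (j * L) a \<odot> ?D L 0 \<odot> ?D (l - Suc j * L) (q - a)) o' o')"
    by (rule kword_blocks[OF L])
  also have "\<dots> \<le> (\<Sum>j\<le>q. \<Sum>a\<le>q. of_nat l ^ q * e * c * (kiter P Q a o' * kiter P Q (q - a) o'))"
    by (intro sum_mono term_le) auto
  also have "\<dots> = of_nat (Suc q) * of_nat l ^ q * e * c * (\<Sum>a\<le>q. kiter P Q a o' * kiter P Q (q - a) o')"
    by (simp add: sum_distrib_left[symmetric] mult.assoc del: of_nat_Suc)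
  finally show ?thesis .
qed

section \<open>Excursions of a reversible chain away from a set\<close>

definition kresl :: "'s set \<Rightarrow> 's kernel \<Rightarrow> 's kernel" where
  "kresl B K x y = indicator B x * K x y"

definition kresr :: "'s set \<Rightarrow> 's kernel \<Rightarrow> 's kernel" where
  "kresr B K x y = K x y * indicator B y"

lemma kcomp_kresl: "A \<odot> kresl B C = kresr B A \<odot> C"
  by (intro ext) (simp add: kcomp_def kapp_def kresl_def kresr_def mult.assoc)

lemma kresl_kcomp: "kresl B A \<odot> C = kresl B (A \<odot> C)"
  by (intro ext) (simp add: kcomp_def kapp_def kresl_def mult.assoc nn_integral_cmult)

lemma kapp_kresr: "kapp (kresr B K) f x = kapp K (\<lambda>y. indicator B y * f y) x"
  by (simp add: kapp_def kresr_def mult.assoc)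

text \<open>\<open>taboo p A t x y\<close> is the probability to be in \<open>y\<close> after \<open>t + 1\<close> steps from \<open>x\<close> without
  visiting \<open>A\<close> strictly in between.\<close>

primrec taboo :: "'s kernel \<Rightarrow> 's set \<Rightarrow> nat \<Rightarrow> 's kernel" where
  "taboo p A 0 = p"
| "taboo p A (Suc t) = p \<odot> kresl (- A) (taboo p A t)"

text \<open>The definition splits off the first step; splitting off the last one is what the Markov
  property and time reversal use.\<close>

lemma taboo_Suc_right: "taboo p A (Suc t) = kresr (- A) (taboo p A t) \<odot> p"
proof (induction t)
  case (Suc t)
  have "taboo p A (Suc (Suc t)) = p \<odot> kresl (- A) (taboo p A t \<odot> kresl (- A) p)"
    using Suc by (simp add: kcomp_kresl)
  also have "\<dots> = kresr (- A) (taboo p A (Suc t)) \<odot> p"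
    by (simp add: kresl_kcomp[symmetric] kcomp_assoc[symmetric] kcomp_kresl[symmetric])
  finally show ?case .
qed (simp add: kcomp_kresl)

text \<open>\<open>excursion p A t x y\<close> is the probability that the chain started in \<open>x \<in> A\<close> first returns to
  \<open>A\<close> at time \<open>t\<close>, in \<open>y\<close>.\<close>

fun excursion :: "'s kernel \<Rightarrow> 's set \<Rightarrow> nat \<Rightarrow> 's kernel" where
  "excursion p A 0 = (\<lambda>x y. 0)"
| "excursion p A (Suc t) = (\<lambda>x y. indicator A x * taboo p A t x y * indicator A y)"

text \<open>Index \<open>t\<close> stands for \<open>t + 1\<close> steps: the chain avoids
  \<open>A\<close> at times 1 to \<open>t + 1\<close>. Correspondingly, \<open>hitting\<close> with
  index \<open>t\<close> means that the first visit to \<open>A\<close> at a positive time occurs at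
  time \<open>t + 1\<close>.\<close>

definition survival :: "'s kernel \<Rightarrow> 's set \<Rightarrow> nat \<Rightarrow> 's \<Rightarrow> ennreal" where
  "survival p A t x = kapp (taboo p A t) (indicator (- A)) x"

definition hitting :: "'s kernel \<Rightarrow> 's set \<Rightarrow> nat \<Rightarrow> 's \<Rightarrow> ennreal" where
  "hitting p A t x = kapp (taboo p A t) (indicator A) x"

lemma survival_Suc: "survival p A (Suc t) x = kapp p (\<lambda>z. indicator (- A) z * survival p A t z) x"
  unfolding survival_def taboo.simps kcomp_kresl kapp_kcomp kapp_kresr ..

lemma hitting_le_survival: "indicator A y * taboo p A t x y \<le> hitting p A t x"
  using kcomp_term_le[of "taboo p A t" x y "\<lambda>z _. indicator A z" y]
  by (simp add: kcomp_def hitting_def mult.commute)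

locale reversible_chain =
  fixes p :: "'s kernel" and w :: "'s \<Rightarrow> ennreal" and A :: "'s set"
  assumes p_one: "\<And>x. kapp p (\<lambda>_. 1) x = 1"
    and p_sym: "ksym w p"
begin

abbreviation "J \<equiv> taboo p A"
abbreviation "K \<equiv> excursion p A"

lemma taboo_sym: "ksym w (J t)"
proof (induction t)
  case (Suc t)
  have "w x * J (Suc t) x y = w y * J (Suc t) y x" for x y
  proof -
    have "w x * J (Suc t) x y = (\<integral>\<^sup>+z. w x * (p x z * (indicator (- A) z * J t z y)) \<partial>count_space UNIV)"
      by (simp add: kcomp_def kapp_def kresl_def nn_integral_cmult)
    also have "\<dots> = (\<integral>\<^sup>+z. w y * (J t y z * indicator (- A) z * p z x) \<partial>count_space UNIV)"
    proof (intro nn_integral_cong)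
      fix z
      have "w x * (p x z * (indicator (- A) z * J t z y)) = indicator (- A) z * (w x * p x z) * J t z y"
        by (simp add: ac_simps)
      also have "\<dots> = indicator (- A) z * (w z * p z x) * J t z y"
        using ksymD[OF p_sym] by metis
      also have "\<dots> = indicator (- A) z * p z x * (w z * J t z y)"
        by (simp add: ac_simps)
      also have "\<dots> = indicator (- A) z * p z x * (w y * J t y z)"
        using ksymD[OF Suc] by metis
      finally show "w x * (p x z * (indicator (- A) z * J t z y)) = w y * (J t y z * indicator (- A) z * p z x)"
        by (simp add: ac_simps)
    qed
    also have "\<dots> = w y * J (Suc t) y x"
      unfolding taboo_Suc_right by (simp add: kcomp_def kapp_def kresr_def nn_integral_cmult)
    finally show ?thesis .
  qed
  then show ?case by (auto simp: ksym_def)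
qed (simp add: p_sym)

text \<open>A reversed excursion is again an excursion between two points of \<open>A\<close>; for
  this \<open>excursion\<close> carries the indicator of \<open>A\<close> at both ends.\<close>

lemma excursion_sym: "ksym w (K t)"
proof (cases t)
  case (Suc s)
  then show ?thesis
    using taboo_sym[of s] unfolding ksym_def by (auto simp: indicator_def)
qed (simp add: ksym_def)

lemma hitting_plus_survival_0: "hitting p A 0 x + survival p A 0 x = 1"
proof -
  have "hitting p A 0 x + survival p A 0 x = kapp p (\<lambda>y. indicator A y + indicator (- A) y) x"
    by (simp add: hitting_def survival_def kapp_add)
  also have "(\<lambda>y. indicator A y + indicator (- A) y :: ennreal) = (\<lambda>_. 1)"
    by (auto simp: indicator_def)
  finally show ?thesis by (simp add: p_one)
qed

lemma hitting_plus_survival: "hitting p A (Suc t) x + survival p A (Suc t) x = survival p A t x"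
proof -
  have "hitting p A (Suc t) x + survival p A (Suc t) x
      = kapp (J (Suc t)) (\<lambda>y. indicator A y + indicator (- A) y) x"
    by (simp add: hitting_def survival_def kapp_add)
  also have "(\<lambda>y. indicator A y + indicator (- A) y :: ennreal) = (\<lambda>_. 1)"
    by (auto simp: indicator_def)
  also have "kapp (J (Suc t)) (\<lambda>_. 1) x = survival p A t x"
    unfolding taboo_Suc_right kapp_kcomp kapp_kresr survival_def by (simp add: p_one)
  finally show ?thesis .
qed

lemma sum_hitting: "(\<Sum>t<n. hitting p A (j + Suc t) x) + survival p A (j + n) x = survival p A j x"
proof (induction n)
  case (Suc n)
  have "(\<Sum>t<Suc n. hitting p A (j + Suc t) x) + survival p A (j + Suc n) x
      = (\<Sum>t<n. hitting p A (j + Suc t) x) + (hitting p A (Suc (j + n)) x + survival p A (Suc (j + n)) x)"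
    by (simp add: add.assoc)
  also have "\<dots> = survival p A j x" unfolding hitting_plus_survival by (rule Suc)
  finally show ?case .
qed simp

lemma sum_hitting_le: "(\<Sum>t<n. hitting p A (j + Suc t) x) \<le> survival p A j x"
  using sum_hitting[of j x n] by (metis le_iff_add)

lemma suminf_hitting_le_1: "(\<Sum>t. hitting p A t x) \<le> 1"
proof (rule suminf_le_const)
  fix n
  show "(\<Sum>t<n. hitting p A t x) \<le> 1"
  proof (cases n)
    case (Suc m)
    have "(\<Sum>t<n. hitting p A t x) \<le> hitting p A 0 x + survival p A 0 x"
      using sum_hitting_le[where j=0 and n=m and x=x] unfolding Suc sum.lessThan_Suc_shift
      by (simp add: add_left_mono)
    then show ?thesis by (simp add: hitting_plus_survival_0)
  qed simp
qed simp

lemma kapp_excursion: "kapp (K (Suc t)) (\<lambda>_. 1) x = indicator A x * hitting p A t x"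
  by (simp add: kapp_def hitting_def mult.assoc nn_integral_cmult)

lemma excursion_total_le_1: "kapp (\<lambda>x y. \<Sum>t. K t x y) (\<lambda>_. 1) x \<le> 1"
proof -
  have "kapp (\<lambda>x y. \<Sum>t. K t x y) (\<lambda>_. 1) x = (\<Sum>t. kapp (K t) (\<lambda>_. 1) x)"
    by (rule kapp_suminf_left)
  also have "\<dots> = (\<Sum>t. kapp (K (Suc t)) (\<lambda>_. 1) x) + kapp (K 0) (\<lambda>_. 1) x"
    by (subst suminf_offset[where i=1]) (auto simp: add.commute)
  also have "\<dots> = (\<Sum>t. indicator A x * hitting p A t x)"
    by (simp only: kapp_excursion) (simp add: kapp_def)
  also have "\<dots> \<le> (\<Sum>t. hitting p A t x)"
    by (intro suminf_le) (auto simp: indicator_def)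
  finally show ?thesis using suminf_hitting_le_1[of x] by simp
qed

text \<open>Summation by parts for E[T] as the sum of P(T > t), stated for finite \<open>m\<close>
  so that nothing is subtracted in \<open>ennreal\<close>. The \<open>survival\<close> term on the
  left accounts for paths that have not returned yet.\<close>

lemma sum_of_nat_hitting:
  "(\<Sum>t<Suc m. of_nat (Suc t) * hitting p A t x) + of_nat (Suc m) * survival p A m x
      = 1 + (\<Sum>t<m. survival p A t x)"
proof (induction m)
  case 0
  then show ?case by (simp add: hitting_plus_survival_0)
next
  case (Suc m)
  have "(\<Sum>t<Suc (Suc m). of_nat (Suc t) * hitting p A t x) + of_nat (Suc (Suc m)) * survival p A (Suc m) x
      = (\<Sum>t<Suc m. of_nat (Suc t) * hitting p A t x)
        + of_nat (Suc (Suc m)) * (hitting p A (Suc m) x + survival p A (Suc m) x)"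
    by (simp only: sum.lessThan_Suc[of _ "Suc m"] distrib_left add.assoc)
  also have "\<dots> = ((\<Sum>t<Suc m. of_nat (Suc t) * hitting p A t x) + of_nat (Suc m) * survival p A m x)
      + survival p A m x"
    unfolding hitting_plus_survival of_nat_Suc[of "Suc m"] by (simp only: distrib_right mult_1_left ac_simps)
  also have "\<dots> = 1 + (\<Sum>t<Suc m. survival p A t x)"
    unfolding Suc.IH by (simp add: add.assoc)
  finally show ?case .
qed

lemma suminf_of_nat_hitting_le:
  "(\<Sum>t. of_nat (Suc t) * hitting p A t x) \<le> 1 + (\<Sum>t. survival p A t x)"
proof (rule suminf_le_const)
  fix n
  have "(\<Sum>t<n. of_nat (Suc t) * hitting p A t x) \<le> (\<Sum>t<Suc n. of_nat (Suc t) * hitting p A t x)"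
    by (intro sum_mono2) auto
  also have "\<dots> \<le> 1 + (\<Sum>t<n. survival p A t x)"
    using sum_of_nat_hitting[where m=n and x=x] by (metis le_iff_add)
  also have "\<dots> \<le> 1 + (\<Sum>t. survival p A t x)"
    by (intro add_left_mono sum_le_suminf) auto
  finally show "(\<Sum>t<n. of_nat (Suc t) * hitting p A t x) \<le> 1 + (\<Sum>t. survival p A t x)" .
qed simp

text \<open>Reversibility turns the expected time spent in \<open>z\<close> during one excursion from \<open>x\<close> into the
  probability that the chain started in \<open>z\<close> enters \<open>A\<close> at \<open>x\<close>.\<close>

lemma weighted_survival_le:
  assumes "x \<in> A"
  shows "w x * (\<Sum>t. survival p A t x) \<le> (\<integral>\<^sup>+z. w z * indicator {z. z \<notin> A \<and> (\<exists>t. J t x z \<noteq> 0)} z \<partial>count_space UNIV)"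
proof -
  let ?G = "{z. z \<notin> A \<and> (\<exists>t. J t x z \<noteq> 0)}"
  have "w x * (\<Sum>t. survival p A t x) = (\<Sum>t. \<integral>\<^sup>+z. w x * (J t x z * indicator (- A) z) \<partial>count_space UNIV)"
    by (subst ennreal_suminf_cmult[symmetric]) (simp add: survival_def kapp_def nn_integral_cmult)
  also have "\<dots> = (\<integral>\<^sup>+z. (\<Sum>t. w x * (J t x z * indicator (- A) z)) \<partial>count_space UNIV)"
    by (rule nn_integral_suminf[symmetric]) simp
  also have "\<dots> \<le> (\<integral>\<^sup>+z. w z * indicator ?G z \<partial>count_space UNIV)"
  proof (intro nn_integral_mono)
    fix z
    show "(\<Sum>t. w x * (J t x z * indicator (- A) z)) \<le> w z * indicator ?G z"
    proof (cases "z \<in> ?G")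
      case True
      have "(\<Sum>t. w x * (J t x z * indicator (- A) z)) = (\<Sum>t. w z * J t z x)"
        using True ksymD[OF taboo_sym, of x _ z] by simp
      also have "\<dots> \<le> (\<Sum>t. w z * hitting p A t z)"
        using assms hitting_le_survival[of A x p _ z] by (intro suminf_le mult_left_mono) auto
      also have "\<dots> \<le> w z * 1"
        unfolding ennreal_suminf_cmult by (intro mult_left_mono suminf_hitting_le_1) auto
      finally show ?thesis using True by simp
    next
      case False
      then have "w x * (J t x z * indicator (- A) z) = 0" for t by (auto simp: indicator_def)
      then show ?thesis by (simp only: suminf_zero zero_le)
    qed
  qed
  finally show ?thesis .
qed

lemma survival_antimono: "survival p A (Suc t) x \<le> survival p A t x"
  using hitting_plus_survival[of t x] by (metis le_add_same_cancel2 add.commute le_iff_add zero_le)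

lemma survival_antimono': "s \<le> t \<Longrightarrow> survival p A t x \<le> survival p A s x"
  by (rule lift_Suc_antimono_le[of "\<lambda>t. survival p A t x"]) (auto intro: survival_antimono)

lemma survival_le_1: "survival p A t x \<le> 1"
  using survival_antimono'[of 0 t x] hitting_plus_survival_0[of x] by (metis le_add_same_cancel2 order_trans add.commute le_iff_add zero_le le0)

text \<open>On a finite set \<open>H\<close> that can be left only into \<open>A\<close>, one time
  \<open>N\<close> serves all starting points, and the Markov property multiplies the survival
  probabilities over successive stretches of \<open>N\<close> steps.\<close>

lemma survival_geometric:
  assumes H: "finite H" "H \<inter> A = {}" "\<And>z z'. z \<in> H \<Longrightarrow> p z z' \<noteq> 0 \<Longrightarrow> z' \<notin> A \<Longrightarrow> z' \<in> H"
    and exits: "\<And>z. z \<in> H \<Longrightarrow> \<exists>t. survival p A t z < 1"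
  obtains N c where "0 < N" "c < 1" "\<And>k z. z \<in> H \<Longrightarrow> survival p A (k * N) z \<le> ennreal c ^ k" "0 \<le> c"
proof -
  obtain T where T: "\<And>z. z \<in> H \<Longrightarrow> survival p A (T z) z < 1" using exits by metis
  define N where "N = Suc (Max (insert 0 (T ` H)))"
  have TN: "T z \<le> N - 1" if "z \<in> H" for z using that H(1) by (auto simp: N_def intro: Max_ge)
  define e where "e = Max (insert 0 ((\<lambda>z. survival p A (N - 1) z) ` H))"
  have e: "survival p A (N - 1) z \<le> e" if "z \<in> H" for z using that H(1) by (auto simp: e_def intro: Max_ge)
  have "e < 1" unfolding e_def using H(1) T TN
    by (subst Max_less_iff) (auto intro: le_less_trans[OF survival_antimono'])
  \<comment> \<open>Survival with index \<open>n\<close> takes \<open>n + 1\<close> steps; another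
    \<open>s + 1\<close> steps lead to index \<open>n + s + 1\<close>.\<close>
  have step: "survival p A (n + s + 1) z \<le> survival p A n z * ennreal d"
    if "\<And>z'. z' \<in> H \<Longrightarrow> survival p A s z' \<le> ennreal d" "z \<in> H" for n s d z
    using that(2)
  proof (induction n arbitrary: z)
    case 0
    have "survival p A (Suc s) z = kapp p (\<lambda>z. indicator (- A) z * survival p A s z) z"
      by (rule survival_Suc)
    also have "\<dots> \<le> kapp p (\<lambda>z. indicator (- A) z * ennreal d) z"
      using that(1) H(3) 0 by (intro kapp_mono_right) (auto simp: indicator_def)
    finally show ?case by (simp add: kapp_multc survival_def)
  next
    case (Suc n)
    have "survival p A (Suc (n + s + 1)) z = kapp p (\<lambda>z. indicator (- A) z * survival p A (n + s + 1) z) z"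
      by (rule survival_Suc)
    also have "\<dots> \<le> kapp p (\<lambda>z. indicator (- A) z * survival p A n z * ennreal d) z"
      using Suc H(3) by (intro kapp_mono_right) (auto simp: indicator_def)
    also have "\<dots> = survival p A (Suc n) z * ennreal d"
      by (simp add: kapp_multc survival_Suc)
    finally show ?case by simp
  qed
  have e': "e = ennreal (enn2real e)" using order_less_trans[OF \<open>e < 1\<close> ennreal_one_less_top] by (simp add: ennreal_enn2real)
  have "survival p A (k * N) z \<le> ennreal (enn2real e) ^ k" if "z \<in> H" for k z
    using that
  proof (induction k)
    case 0
    then show ?case by (simp add: survival_le_1)
  next
    case (Suc k)
    have "survival p A (k * N + (N - 1) + 1) z \<le> survival p A (k * N) z * ennreal (enn2real e)"
      using step[of "N - 1" "enn2real e" z "k * N"] e Suc.prems e' by auto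
    also have "\<dots> \<le> ennreal (enn2real e) ^ k * ennreal (enn2real e)"
      using Suc by (intro mult_right_mono) auto
    finally show ?case by (simp add: N_def ac_simps)
  qed
  moreover have "enn2real e < 1" using \<open>e < 1\<close> e'
    by (metis ennreal_1 ennreal_less_iff enn2real_nonneg)
  ultimately show ?thesis using that[of N "enn2real e"] by (simp add: N_def)
qed

text \<open>A geometric tail beats every power. The bound depends on the chain, which suffices
  because only finiteness for a fixed environment is drawn from it.\<close>

lemma survival_moment_finite:
  assumes H: "finite H" "H \<inter> A = {}" "\<And>z z'. z \<in> H \<Longrightarrow> p z z' \<noteq> 0 \<Longrightarrow> z' \<notin> A \<Longrightarrow> z' \<in> H"
    and exits: "\<And>z. z \<in> H \<Longrightarrow> \<exists>t. survival p A t z < 1"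
    and x: "\<And>z. p x z \<noteq> 0 \<Longrightarrow> z \<notin> A \<Longrightarrow> z \<in> H"
  shows "(\<Sum>t. of_nat (Suc t) ^ m * hitting p A t x) < \<top>"
proof -
  obtain N c where Nc: "0 < N" "c < 1" "0 \<le> c" "\<And>k z. z \<in> H \<Longrightarrow> survival p A (k * N) z \<le> ennreal c ^ k"
    by (rule survival_geometric[of H]) (use H exits in blast)+
  \<comment> \<open>The maximum with 1/2 keeps \<open>b\<close> positive and gives
    \<open>1 \<le> 2 * b ^ N\<close>, which pays for rounding \<open>t\<close> down to a multiple of
    \<open>N\<close>.\<close>
  define b where "b = root N (max c (1/2))"
  have b: "0 < b" "b < 1" "b ^ N = max c (1/2)"
    using Nc by (auto simp: b_def real_root_lt_1_iff)
  have surv: "survival p A t z \<le> ennreal (2 * b ^ t)" if "z \<in> H" for t z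
  proof -
    let ?k = "t div N"
    have "survival p A t z \<le> survival p A (?k * N) z" by (rule survival_antimono') simp
    also have "\<dots> \<le> ennreal (c ^ ?k)" using Nc(4)[OF that, of ?k] Nc(3) by (simp add: ennreal_power)
    also have "\<dots> \<le> ennreal (2 * b ^ t)"
    proof (rule ennreal_leI)
      have "c ^ ?k \<le> max c (1/2) ^ ?k" using Nc by (intro power_mono) auto
      also have "\<dots> = b ^ (N * ?k)" by (simp add: b(3)[symmetric] power_mult)
      also have "\<dots> \<le> 2 * b ^ N * b ^ (N * ?k)"
        using b by (simp add: b(3) max_def)
      also have "\<dots> = 2 * b ^ (N + N * ?k)" by (simp add: power_add)
      also have "\<dots> \<le> 2 * b ^ t"
      proof -
        have "t \<le> N + N * ?k"
          using Nc(1) by (metis add.commute div_mult_mod_eq le_add2 less_imp_le mod_less_divisor mult.commute nat_add_left_cancel_le)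
        then show ?thesis using b by (intro mult_left_mono power_decreasing) auto
      qed
      finally show "c ^ ?k \<le> 2 * b ^ t" .
    qed
    finally show ?thesis .
  qed
  \<comment> \<open>To hit at index t + 2 the chain has to survive index t + 1, and the first of
    these steps leads into \<open>H\<close>, where the geometric bound applies with index t.\<close>
  have hit: "hitting p A (Suc (Suc t)) x \<le> ennreal (2 * b ^ t)" for t
  proof -
    have "hitting p A (Suc (Suc t)) x \<le> survival p A (Suc t) x"
      using hitting_plus_survival[of "Suc t" x] by (metis le_iff_add)
    also have "\<dots> \<le> kapp p (\<lambda>z. 1 * ennreal (2 * b ^ t)) x"
      unfolding survival_Suc using surv x by (intro kapp_mono_right) (auto simp: indicator_def)
    also have "\<dots> = ennreal (2 * b ^ t)" unfolding kapp_multc by (simp add: p_one)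
    finally show ?thesis .
  qed
  have h1: "hitting p A t x \<le> 1" for t
  proof -
    have "hitting p A t x \<le> (\<Sum>t. hitting p A t x)" using sum_le_suminf[of "\<lambda>t. hitting p A t x" "{t}"] by simp
    then show ?thesis using suminf_hitting_le_1[of x] by simp
  qed
  \<comment> \<open>Ratio test: the polynomial factor eventually grows by less than 1 / sqrt b per
    step, so the ratio is at most sqrt b < 1.\<close>
  have sm: "summable (\<lambda>t. real (t + 3) ^ m * (2 * b ^ t))"
  proof -
    have "(\<lambda>t. (1 + inverse (real (Suc (t + 2)))) ^ m) \<longlonglongrightarrow> (1 + 0) ^ m"
      by (intro tendsto_intros LIMSEQ_ignore_initial_segment[OF LIMSEQ_inverse_real_of_nat])
    moreover have "(1 + 0) ^ m < 1 / sqrt b" using b by simp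
    ultimately have "eventually (\<lambda>t. (1 + inverse (real (Suc (t + 2)))) ^ m < 1 / sqrt b) sequentially"
      by (rule order_tendstoD)
    then obtain M where M: "\<And>t. M \<le> t \<Longrightarrow> (1 + inverse (real (Suc (t + 2)))) ^ m < 1 / sqrt b"
      by (auto simp: eventually_sequentially)
    show ?thesis
    proof (rule summable_ratio_test[of "sqrt b" M])
      show "sqrt b < 1" using b by simp
      fix t assume "M \<le> t"
      have "real (Suc t + 3) = (1 + inverse (real (Suc (t + 2)))) * real (t + 3)"
        by (simp add: field_simps)
      then have "real (Suc t + 3) ^ m * (2 * b ^ Suc t)
          = ((1 + inverse (real (Suc (t + 2)))) ^ m * b) * (real (t + 3) ^ m * (2 * b ^ t))"
        by (simp only: power_mult_distrib power_Suc ac_simps)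
      also have "\<dots> \<le> (1 / sqrt b * b) * (real (t + 3) ^ m * (2 * b ^ t))"
        using M[OF \<open>M \<le> t\<close>] b by (intro mult_right_mono) auto
      also have "1 / sqrt b * b = sqrt b" using b by (simp add: real_div_sqrt)
      finally show "norm (real (Suc t + 3) ^ m * (2 * b ^ Suc t)) \<le> sqrt b * norm (real (t + 3) ^ m * (2 * b ^ t))"
        using b by simp
    qed
  qed
  have "(\<Sum>t. of_nat (Suc t) ^ m * hitting p A t x)
      = (\<Sum>t. of_nat (Suc (t + 2)) ^ m * hitting p A (t + 2) x) + (\<Sum>t<2. of_nat (Suc t) ^ m * hitting p A t x)"
    by (subst suminf_offset[where i=2]) (auto simp: add.commute)
  also have "\<dots> \<le> (\<Sum>t. ennreal (real (t + 3) ^ m * (2 * b ^ t))) + (\<Sum>t<2. of_nat (Suc t) ^ m * 1)"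
  proof (intro add_mono suminf_le sum_mono mult_left_mono h1)
    fix t
    have "of_nat (Suc (t + 2)) ^ m * hitting p A (t + 2) x \<le> of_nat (Suc (t + 2)) ^ m * ennreal (2 * b ^ t)"
      using hit[of t] by (intro mult_left_mono) auto
    also have "\<dots> = ennreal (real (t + 3) ^ m * (2 * b ^ t))"
    proof -
      have "Suc (t + 2) = t + 3" by simp
      then have "of_nat (Suc (t + 2)) ^ m = ennreal (real (t + 3) ^ m)"
        by (simp only: ennreal_of_nat_eq_real_of_nat ennreal_power of_nat_0_le_iff)
      then show ?thesis using b by (simp only: ennreal_mult[symmetric] zero_le_power of_nat_0_le_iff) (simp add: ennreal_mult)
    qed
    finally show "of_nat (Suc (t + 2)) ^ m * hitting p A (t + 2) x \<le> ennreal (real (t + 3) ^ m * (2 * b ^ t))" .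
  qed auto
  also have "\<dots> < \<top>"
  proof -
    have "(\<Sum>t. ennreal (real (t + 3) ^ m * (2 * b ^ t))) < \<top>"
      using b by (subst suminf_ennreal_eq[OF _ summable_sums[OF sm]]) simp_all
    moreover have "(\<Sum>t<2. of_nat (Suc t) ^ m * 1 :: ennreal) = of_nat (\<Sum>t<2. Suc t ^ m)"
      by (simp only: of_nat_sum of_nat_power mult_1_right)
    ultimately show ?thesis by (simp only: ennreal_add_less_top of_nat_less_top)
  qed
  finally show ?thesis .
qed

end

section \<open>The quenched walk\<close>

definition walk :: "'d::finite environment \<Rightarrow> 'd site kernel" where
  "walk \<omega> x y = ennreal (walk_kernel \<omega> x y)"

definition conductance :: "'d::finite environment \<Rightarrow> 'd site \<Rightarrow> ennreal" where
  "conductance \<omega> x = ennreal (total_conductance \<omega> x)"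

lemma neighbor_sym: "neighbor x y \<longleftrightarrow> neighbor y x"
  by (simp add: neighbor_def abs_minus_commute)

lemma walk_sym:
  assumes "\<omega> \<in> space env_space"
  shows "ksym (conductance \<omega>) (walk \<omega>)"
  unfolding ksym_def
proof (intro allI)
  fix x y
  have *: "conductance \<omega> x * walk \<omega> x y = (if neighbor x y then ennreal (\<omega> {x, y}) else 0)" for x y
    using total_conductance_pos[OF assms, of x] env_pos(1)[OF assms, of x y]
    by (auto simp: conductance_def walk_def walk_kernel_def ennreal_mult[symmetric])
  show "conductance \<omega> x * walk \<omega> x y = conductance \<omega> y * walk \<omega> y x"
    unfolding * by (simp add: neighbor_sym[of x y] insert_commute)
qed

lemma walk_one:
  assumes "\<omega> \<in> space env_space"
  shows "kapp (walk \<omega>) (\<lambda>_. 1) x = 1"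
proof -
  interpret prob_space "point_measure UNIV (\<lambda>y. ennreal (walk_kernel \<omega> x y))"
    by (rule prob_space_walk_kernel[OF assms])
  have "emeasure (point_measure UNIV (\<lambda>y. ennreal (walk_kernel \<omega> x y))) UNIV = 1"
    using emeasure_space_1 by (simp add: space_point_measure)
  then show ?thesis
    unfolding point_measure_def by (subst (asm) emeasure_density) (auto simp: kapp_def walk_def)
qed

lemma walk_nonzero: "walk \<omega> x y \<noteq> 0 \<Longrightarrow> neighbor x y"
  by (auto simp: walk_def walk_kernel_def split: if_splits)

lemma walk_pos:
  assumes "\<omega> \<in> space env_space" "neighbor x y"
  shows "walk \<omega> x y \<noteq> 0"
  using total_conductance_pos[OF assms(1), of x] env_pos(1)[OF assms] assms(2)
  by (auto simp: walk_def walk_kernel_def ennreal_eq_0_iff not_le)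

lemma reversible_chain_walk:
  "\<omega> \<in> space env_space \<Longrightarrow> reversible_chain (walk \<omega>) (conductance \<omega>)"
  by unfold_locales (auto simp: walk_one walk_sym)

text \<open>Stands in for measurability with respect to the first \<open>N + 1\<close> coordinates;
  on the countable lattice every predicate of finitely many coordinates is measurable.\<close>

definition upto_time :: "nat \<Rightarrow> ((nat \<Rightarrow> 's) \<Rightarrow> bool) \<Rightarrow> bool" where
  "upto_time N H \<longleftrightarrow> (\<forall>X Y. (\<forall>i\<le>N. X i = Y i) \<longrightarrow> H X = H Y)"

lemma upto_timeI: "(\<And>X Y. (\<And>i. i \<le> N \<Longrightarrow> X i = Y i) \<Longrightarrow> H X \<Longrightarrow> H Y) \<Longrightarrow> upto_time N H"
  unfolding upto_time_def by metis

lemma upto_timeD: "upto_time N H \<Longrightarrow> (\<And>i. i \<le> N \<Longrightarrow> X i = Y i) \<Longrightarrow> H X = H Y"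
  unfolding upto_time_def by metis

lemma upto_time_conj: "upto_time N H \<Longrightarrow> upto_time N G \<Longrightarrow> upto_time N (\<lambda>X. H X \<and> G X)"
  unfolding upto_time_def by metis

lemma upto_time_mono: "upto_time N H \<Longrightarrow> N \<le> M \<Longrightarrow> upto_time M H"
  unfolding upto_time_def by (meson le_trans)

lemma upto_time_at: "i \<le> N \<Longrightarrow> upto_time N (\<lambda>X. X i = u)"
  unfolding upto_time_def by simp

lemma upto_time_ball: "(\<And>i. i \<in> B \<Longrightarrow> i \<le> N) \<Longrightarrow> upto_time N (\<lambda>X. \<forall>i\<in>B. X i \<notin> A)"
  unfolding upto_time_def by simp

lemmas upto_time_intros = upto_time_conj upto_time_at upto_time_ball

section \<open>Markov property and the law of visit patterns\<close>

context
  fixes \<omega> :: "'d::finite environment" and x :: "'d site"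
  assumes \<omega>: "\<omega> \<in> space env_space"
begin

definition pr :: "((nat \<Rightarrow> 'd site) \<Rightarrow> bool) \<Rightarrow> ennreal" where
  "pr H = emeasure (walk_law \<omega> x) {X \<in> space (walk_law \<omega> x). H X}"

lemma sets_walk_law: "sets (walk_law \<omega> x) = sets (\<Pi>\<^sub>M i\<in>UNIV. count_space UNIV)"
proof -
  interpret Ionescu_Tulcea "walk_step \<omega> x" "\<lambda>_. count_space UNIV"
    by (rule Ionescu_Tulcea_walk_step[OF \<omega>])
  show ?thesis unfolding walk_law_def by simp
qed

lemma space_walk_law: "space (walk_law \<omega> x) = UNIV"
  using sets_eq_imp_space_eq[OF sets_walk_law] by (simp add: space_PiM)

lemma coordinate_measurable [measurable]: "(\<lambda>X. X i) \<in> measurable (walk_law \<omega> x) (count_space UNIV)"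
  using measurable_component_singleton[of i UNIV "\<lambda>_. count_space (UNIV :: 'd site set)"]
  by (simp add: measurable_cong_sets[OF sets_walk_law refl])

lemma cylinder_sets: "{X. \<forall>i\<le>N. X i = p i} \<in> sets (walk_law \<omega> x)"
proof -
  have "{X \<in> space (walk_law \<omega> x). \<forall>i\<in>{..N}. X i = p i} \<in> sets (walk_law \<omega> x)"
    by measurable
  moreover have "{X \<in> space (walk_law \<omega> x). \<forall>i\<in>{..N}. X i = p i} = {X. \<forall>i\<le>N. X i = p i}"
    by (auto simp: space_walk_law)
  ultimately show ?thesis by simp
qed

definition histories :: "nat \<Rightarrow> ((nat \<Rightarrow> 'd site) \<Rightarrow> bool) \<Rightarrow> 'd site list set" where
  "histories N H = {ps. length ps = Suc N \<and> H ((!) ps)}"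

text \<open>With the disjointness below, this writes an event up to time \<open>N\<close> as a
  countable disjoint union of cylinders, whose probabilities \<open>walk_law_cylinder\<close> gives
  explicitly.\<close>

lemma history_Union:
  assumes "upto_time N H"
  shows "{X. H X} = (\<Union>ps\<in>histories N H. {X. \<forall>i\<le>N. X i = ps ! i})"
proof (intro set_eqI iffI)
  fix X assume X: "X \<in> {X. H X}"
  have "H ((!) (map X [0..<Suc N])) = H X"
    by (rule upto_timeD[OF assms]) (auto simp del: upt_Suc)
  then have "map X [0..<Suc N] \<in> histories N H" using X by (simp add: histories_def)
  moreover have "\<forall>i\<le>N. X i = map X [0..<Suc N] ! i" by (auto simp del: upt_Suc)
  ultimately show "X \<in> (\<Union>ps\<in>histories N H. {X. \<forall>i\<le>N. X i = ps ! i})" by blast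
next
  fix X assume "X \<in> (\<Union>ps\<in>histories N H. {X. \<forall>i\<le>N. X i = ps ! i})"
  then obtain ps where ps: "H ((!) ps)" "\<And>i. i \<le> N \<Longrightarrow> X i = ps ! i" by (auto simp: histories_def)
  then show "X \<in> {X. H X}" using upto_timeD[OF assms, of X "(!) ps"] by auto
qed

lemma history_disjoint: "disjoint_family_on (\<lambda>ps. {X. \<forall>i\<le>N. X i = ps ! i}) (histories N H)"
  unfolding disjoint_family_on_def
proof (intro ballI impI equals0I)
  fix ps qs X assume a: "ps \<in> histories N H" "qs \<in> histories N H" "ps \<noteq> qs"
    "X \<in> {X. \<forall>i\<le>N. X i = ps ! i} \<inter> {X. \<forall>i\<le>N. X i = qs ! i}"
  then have "ps = qs" by (intro nth_equalityI) (auto simp: histories_def)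
  then show False using a by simp
qed

lemma history_sets: "upto_time N H \<Longrightarrow> {X. H X} \<in> sets (walk_law \<omega> x)"
  by (subst history_Union, assumption) (intro sets.countable_UN'', auto simp: cylinder_sets)

lemma pr_history:
  assumes "upto_time N H"
  shows "pr H = (\<integral>\<^sup>+ps. emeasure (walk_law \<omega> x) {X. \<forall>i\<le>N. X i = ps ! i} \<partial>count_space (histories N H))"
  unfolding pr_def space_walk_law using history_Union[OF assms]
  by (simp add: emeasure_UN_countable cylinder_sets history_disjoint)

lemma pr_split:
  assumes "\<And>u. upto_time N (\<lambda>X. H X \<and> X M = u)"
  shows "pr H = (\<integral>\<^sup>+u. pr (\<lambda>X. H X \<and> X M = u) \<partial>count_space UNIV)"
proof -
  have "{X. H X} = (\<Union>u. {X. H X \<and> X M = u})" by auto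
  moreover have "emeasure (walk_law \<omega> x) (\<Union>u. {X. H X \<and> X M = u})
      = (\<integral>\<^sup>+u. emeasure (walk_law \<omega> x) {X. H X \<and> X M = u} \<partial>count_space UNIV)"
    by (rule emeasure_UN_countable) (auto simp: disjoint_family_on_def intro: history_sets[OF assms])
  ultimately show ?thesis by (simp add: pr_def space_walk_law)
qed

lemma emeasure_cylinder:
  "emeasure (walk_law \<omega> x) {X. \<forall>i\<le>N. X i = p i}
    = (if p 0 = x then \<Prod>i<N. walk \<omega> (p i) (p (Suc i)) else 0)"
  using walk_law_cylinder[OF \<omega>, of x N p] by (simp add: space_walk_law walk_def)

lemma pr_markov:
  assumes H: "upto_time N H"
  shows "pr (\<lambda>X. (H X \<and> X N = y) \<and> X (Suc N) = z) = pr (\<lambda>X. H X \<and> X N = y) * walk \<omega> y z"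
proof -
  have H': "upto_time N (\<lambda>X. H X \<and> X N = y)"
    by (intro upto_time_intros H) auto
  let ?I = "histories N (\<lambda>X. H X \<and> X N = y)"
  let ?C = "\<lambda>ps. {X. (\<forall>i\<le>N. X i = ps ! i) \<and> X (Suc N) = z}"
  have C: "?C ps = {X. \<forall>i\<le>Suc N. X i = (ps @ [z]) ! i}" if "ps \<in> ?I" for ps
    using that by (auto simp: histories_def nth_append le_Suc_eq)
  have em: "emeasure (walk_law \<omega> x) (?C ps)
      = emeasure (walk_law \<omega> x) {X. \<forall>i\<le>N. X i = ps ! i} * walk \<omega> y z" if ps: "ps \<in> ?I" for ps
  proof -
    have "(\<Prod>i<N. walk \<omega> ((ps @ [z]) ! i) ((ps @ [z]) ! Suc i)) = (\<Prod>i<N. walk \<omega> (ps ! i) (ps ! Suc i))"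
      using ps by (intro prod.cong) (auto simp: histories_def nth_append)
    moreover have "(ps @ [z]) ! N = y" "(ps @ [z]) ! Suc N = z" "(ps @ [z]) ! 0 = ps ! 0"
      using ps by (auto simp: histories_def nth_append)
    ultimately show ?thesis unfolding C[OF ps] emeasure_cylinder by simp
  qed
  have "{X. (H X \<and> X N = y) \<and> X (Suc N) = z} = (\<Union>ps\<in>?I. ?C ps)"
    using history_Union[OF H'] by auto
  moreover have "emeasure (walk_law \<omega> x) (\<Union>ps\<in>?I. ?C ps)
      = (\<integral>\<^sup>+ps. emeasure (walk_law \<omega> x) (?C ps) \<partial>count_space ?I)"
  proof (rule emeasure_UN_countable)
    show "disjoint_family_on ?C ?I"
      using history_disjoint[of N "\<lambda>X. H X \<and> X N = y"] by (fastforce simp: disjoint_family_on_def)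
  qed (auto simp: C cylinder_sets)
  ultimately have "pr (\<lambda>X. (H X \<and> X N = y) \<and> X (Suc N) = z)
      = (\<integral>\<^sup>+ps. emeasure (walk_law \<omega> x) (?C ps) \<partial>count_space ?I)"
    by (simp add: pr_def space_walk_law)
  also have "\<dots> = (\<integral>\<^sup>+ps. emeasure (walk_law \<omega> x) {X. \<forall>i\<le>N. X i = ps ! i} * walk \<omega> y z \<partial>count_space ?I)"
    by (intro nn_integral_cong em) simp
  also have "\<dots> = pr (\<lambda>X. H X \<and> X N = y) * walk \<omega> y z"
    unfolding pr_history[OF H'] by (rule nn_integral_multc) simp
  finally show ?thesis .
qed

lemma pr_taboo:
  assumes H: "upto_time N H"
  shows "pr (\<lambda>X. H X \<and> X N = y \<and> (\<forall>i\<in>{N<..<N + Suc t}. X i \<notin> A) \<and> X (N + Suc t) = z)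
    = pr (\<lambda>X. H X \<and> X N = y) * taboo (walk \<omega>) A t y z"
proof (induction t arbitrary: z)
  case 0
  have "{N<..<N + Suc 0} = {}" by auto
  then show ?case using pr_markov[OF H, of y z] by simp
next
  case (Suc t)
  let ?E = "\<lambda>X. H X \<and> X N = y \<and> (\<forall>i\<in>{N<..<N + Suc t}. X i \<notin> A)"
  have dep: "upto_time (N + Suc t) ?E"
    by (intro upto_time_intros upto_time_mono[OF H]) auto
  have split: "(\<forall>i\<in>{N<..<N + Suc (Suc t)}. X i \<notin> A) \<longleftrightarrow> (\<forall>i\<in>{N<..<N + Suc t}. X i \<notin> A) \<and> X (N + Suc t) \<notin> A" for X
  proof -
    have "{N<..<N + Suc (Suc t)} = insert (N + Suc t) {N<..<N + Suc t}" by auto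
    then show ?thesis by auto
  qed
  let ?F = "\<lambda>X. H X \<and> X N = y \<and> (\<forall>i\<in>{N<..<N + Suc (Suc t)}. X i \<notin> A) \<and> X (N + Suc (Suc t)) = z"
  have "pr ?F = (\<integral>\<^sup>+u. pr (\<lambda>X. ?F X \<and> X (N + Suc t) = u) \<partial>count_space UNIV)"
  proof (rule pr_split[where N="N + Suc (Suc t)"])
    show "upto_time (N + Suc (Suc t)) (\<lambda>X. ?F X \<and> X (N + Suc t) = u)" for u
      by (intro upto_time_intros upto_time_mono[OF H]) auto
  qed
  also have "\<dots> = (\<integral>\<^sup>+u. pr (\<lambda>X. H X \<and> X N = y) * (taboo (walk \<omega>) A t y u * indicator (- A) u * walk \<omega> u z) \<partial>count_space UNIV)"
  proof (intro nn_integral_cong)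
    fix u
    show "pr (\<lambda>X. ?F X \<and> X (N + Suc t) = u)
      = pr (\<lambda>X. H X \<and> X N = y) * (taboo (walk \<omega>) A t y u * indicator (- A) u * walk \<omega> u z)"
    proof (cases "u \<in> A")
      case True
      then have "(\<lambda>X. ?F X \<and> X (N + Suc t) = u) = (\<lambda>X. False)" unfolding split by auto
      then show ?thesis using True by (simp add: pr_def)
    next
      case False
      have "(\<lambda>X. ?F X \<and> X (N + Suc t) = u) = (\<lambda>X. (?E X \<and> X (N + Suc t) = u) \<and> X (Suc (N + Suc t)) = z)"
        using False unfolding split by (intro ext) auto
      then have "pr (\<lambda>X. ?F X \<and> X (N + Suc t) = u) = pr (\<lambda>X. ?E X \<and> X (N + Suc t) = u) * walk \<omega> u z"
        using pr_markov[OF dep] by simp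
      also have "(\<lambda>X. ?E X \<and> X (N + Suc t) = u) = (\<lambda>X. H X \<and> X N = y \<and> (\<forall>i\<in>{N<..<N + Suc t}. X i \<notin> A) \<and> X (N + Suc t) = u)"
        by auto
      finally show ?thesis using False Suc by (simp add: mult.assoc)
    qed
  qed
  also have "\<dots> = pr (\<lambda>X. H X \<and> X N = y) * taboo (walk \<omega>) A (Suc t) y z"
    unfolding taboo_Suc_right by (simp add: nn_integral_cmult kcomp_def kapp_def kresr_def)
  finally show ?case .
qed

lemma visits_cong: "(\<And>i. i \<le> N + sum_list ts \<Longrightarrow> X i = Y i) \<Longrightarrow> visits A X N ts = visits A Y N ts"
  by (induction ts arbitrary: N) (auto simp: add.assoc)

text \<open>Prescribing the gaps places every visit at a deterministic time, so the simple Markov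
  property suffices and no stopping times occur. The generality in \<open>N\<close> and
  \<open>H\<close> is for the induction, in which the past absorbs the first gap.\<close>

lemma pr_visits:
  assumes "upto_time N H" "y \<in> A"
  shows "pr (\<lambda>X. H X \<and> X N = y \<and> visits A X N ts \<and> X (N + sum_list ts) = z)
    = pr (\<lambda>X. H X \<and> X N = y) * kpath (excursion (walk \<omega>) A) ts y z"
  using assms
proof (induction ts arbitrary: N H y)
  case Nil
  show ?case
  proof (cases "y = z")
    case True
    then have "(\<lambda>X. H X \<and> X N = y \<and> visits A X N [] \<and> X (N + sum_list []) = z) = (\<lambda>X. H X \<and> X N = y)" by auto
    then show ?thesis using True by (simp add: kone_def)
  next
    case False
    then have "(\<lambda>X. H X \<and> X N = y \<and> visits A X N [] \<and> X (N + sum_list []) = z) = (\<lambda>X. False)" by auto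
    then show ?thesis using False by (simp only: pr_def) (simp add: kone_def)
  qed
next
  case (Cons t ts)
  note H = Cons.prems(1)
  show ?case
  proof (cases t)
    case 0
    then show ?thesis by (simp add: pr_def kcomp_zero_left)
  next
    case (Suc s)
    let ?F = "\<lambda>X. H X \<and> X N = y \<and> visits A X N (t # ts) \<and> X (N + sum_list (t # ts)) = z"
    let ?E = "\<lambda>X. H X \<and> X N = y \<and> (\<forall>i\<in>{N<..<N + Suc s}. X i \<notin> A)"
    let ?K = "excursion (walk \<omega>) A"
    have dep: "upto_time (N + t) ?E"
      by (intro upto_time_intros upto_time_mono[OF H]) (auto simp: Suc)
    have "pr ?F = (\<integral>\<^sup>+u. pr (\<lambda>X. ?F X \<and> X (N + t) = u) \<partial>count_space UNIV)"
    proof (rule pr_split[where N="N + sum_list (t # ts)"])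
      fix u
      show "upto_time (N + sum_list (t # ts)) (\<lambda>X. ?F X \<and> X (N + t) = u)"
      proof (rule upto_timeI)
        fix X Y assume eq: "\<And>i. i \<le> N + sum_list (t # ts) \<Longrightarrow> X i = Y i" and F: "?F X \<and> X (N + t) = u"
        have "H X = H Y" by (rule upto_timeD[OF H]) (simp add: eq)
        moreover have "visits A X N (t # ts) = visits A Y N (t # ts)" by (rule visits_cong[OF eq])
        ultimately show "?F Y \<and> Y (N + t) = u" using F eq[of N] eq[of "N + t"] eq[of "N + sum_list (t # ts)"] by (simp del: visits.simps)
      qed
    qed
    also have "\<dots> = (\<integral>\<^sup>+u. pr (\<lambda>X. H X \<and> X N = y) * (?K t y u * kpath ?K ts u z) \<partial>count_space UNIV)"
    proof (intro nn_integral_cong)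
      fix u
      show "pr (\<lambda>X. ?F X \<and> X (N + t) = u) = pr (\<lambda>X. H X \<and> X N = y) * (?K t y u * kpath ?K ts u z)"
      proof (cases "u \<in> A")
        case False
        then have "(\<lambda>X. ?F X \<and> X (N + t) = u) = (\<lambda>X. False)" by auto
        then show ?thesis using False by (simp only: pr_def) (simp add: Suc)
      next
        case True
        have "(\<lambda>X. ?F X \<and> X (N + t) = u) = (\<lambda>X. ?E X \<and> X (N + t) = u \<and> visits A X (N + t) ts \<and> X ((N + t) + sum_list ts) = z)"
          using True Suc by (intro ext) (auto simp: add.assoc)
        then have "pr (\<lambda>X. ?F X \<and> X (N + t) = u) = pr (\<lambda>X. ?E X \<and> X (N + t) = u) * kpath ?K ts u z"
          using Cons.IH[OF dep True] by simp
        also have "pr (\<lambda>X. ?E X \<and> X (N + t) = u) = pr (\<lambda>X. H X \<and> X N = y) * taboo (walk \<omega>) A s y u"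
          unfolding pr_taboo[OF H, symmetric] using Suc by (simp add: conj_assoc)
        finally show ?thesis using True Cons.prems(2) Suc by (simp add: mult.assoc)
      qed
    qed
    also have "\<dots> = pr (\<lambda>X. H X \<and> X N = y) * kpath ?K (t # ts) y z"
      by (simp add: nn_integral_cmult kcomp_def kapp_def)
    finally show ?thesis .
  qed
qed

lemma pr_start: "pr (\<lambda>X. X 0 = x) = 1"
  using emeasure_cylinder[of 0 "\<lambda>_. x"] by (simp add: pr_def space_walk_law)

lemma pr_AE_start:
  assumes "{X. H X} \<in> sets (walk_law \<omega> x)"
  shows "pr (\<lambda>X. X 0 = x \<and> H X) = pr H"
proof -
  interpret prob_space "walk_law \<omega> x" by (rule prob_space_walk_law[OF \<omega>])
  have s: "{X. X 0 = x} \<in> sets (walk_law \<omega> x)"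
    using cylinder_sets[of 0 "\<lambda>_. x"] by simp
  have "prob {X. X 0 = x} = 1" using pr_start by (simp add: pr_def space_walk_law measure_def)
  then have "AE X in walk_law \<omega> x. X \<in> {X. X 0 = x}" by (simp add: prob_eq_1[OF s])
  moreover have "{X. X 0 = x \<and> H X} \<in> sets (walk_law \<omega> x)"
    using sets.Int[OF s assms] by (simp add: Collect_conj_eq[symmetric])
  ultimately show ?thesis
    unfolding pr_def space_walk_law using assms by (intro emeasure_eq_AE) auto
qed

lemma visits_sets: "{X. visits A X 0 ts \<and> X (sum_list ts) = z} \<in> sets (walk_law \<omega> x)"
proof (rule history_sets)
  show "upto_time (sum_list ts) (\<lambda>X. visits A X 0 ts \<and> X (sum_list ts) = z)"
  proof (rule upto_timeI)
    fix X Y assume eq: "\<And>i. i \<le> sum_list ts \<Longrightarrow> X i = Y i" and *: "visits A X 0 ts \<and> X (sum_list ts) = z"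
    then show "visits A Y 0 ts \<and> Y (sum_list ts) = z"
      using visits_cong[of 0 ts X Y A] eq[of "sum_list ts"] by auto
  qed
qed

lemma pr_visits_start:
  assumes "x \<in> A"
  shows "pr (\<lambda>X. visits A X 0 ts \<and> X (sum_list ts) = z) = kpath (excursion (walk \<omega>) A) ts x z"
proof -
  have "pr (\<lambda>X. visits A X 0 ts \<and> X (sum_list ts) = z)
      = pr (\<lambda>X. X 0 = x \<and> (visits A X 0 ts \<and> X (sum_list ts) = z))"
    by (rule pr_AE_start[symmetric]) (rule visits_sets)
  also have "\<dots> = pr (\<lambda>X. True \<and> X 0 = x \<and> visits A X 0 ts \<and> X (0 + sum_list ts) = z)"
    by simp
  also have "\<dots> = kpath (excursion (walk \<omega>) A) ts x z"
    by (subst pr_visits[OF _ assms]) (simp_all add: upto_time_def pr_start)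
  finally show ?thesis .
qed

section \<open>Heat kernels as powers of kernels\<close>

lemma taboo_empty: "taboo p {} t = kword p q (Suc t) 0"
proof (induction t)
  case (Suc t)
  have "kresl (- {}) (taboo p {} t) = taboo p {} t" by (intro ext) (simp add: kresl_def)
  then show ?case using Suc by (simp add: kword.simps(3)[symmetric] del: kword.simps(3))
qed simp

lemma heat_kernel_kword: "ennreal (heat_kernel \<omega> n x z) = kword (walk \<omega>) (walk \<omega>) n 0 x z"
proof -
  interpret prob_space "walk_law \<omega> x" by (rule prob_space_walk_law[OF \<omega>])
  have hk: "ennreal (heat_kernel \<omega> n x z) = pr (\<lambda>X. X n = z)"
    by (simp add: heat_kernel_def pr_def emeasure_eq_measure)
  have "{X. X n = z} \<in> sets (walk_law \<omega> x)"
    by (rule history_sets[of n]) (auto simp: upto_time_def)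
  then have "pr (\<lambda>X. X n = z) = pr (\<lambda>X. X 0 = x \<and> X n = z)"
    by (rule pr_AE_start[symmetric])
  also have "\<dots> = kword (walk \<omega>) (walk \<omega>) n 0 x z"
  proof (cases n)
    case 0
    show ?thesis
    proof (cases "x = z")
      case True
      then show ?thesis using pr_start 0 by (simp add: kone_def)
    next
      case False
      then have "(\<lambda>X. X 0 = x \<and> X n = z) = (\<lambda>X. False)" using 0 by auto
      then show ?thesis using 0 False by (simp only: pr_def) (simp add: kone_def)
    qed
  next
    case (Suc t)
    then show ?thesis
      using pr_taboo[of 0 "\<lambda>_. True" x t "{}" z]
      by (simp add: upto_time_def pr_start taboo_empty[where q="walk \<omega>"] del: kword.simps)
  qed
  finally show ?thesis using hk by simp
qed

lemma return_time_1_visits: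
  assumes "z \<in> A"
  shows "(\<exists>n. return_time A X 1 = enat n \<and> X n = z) \<longleftrightarrow> (\<exists>n. visits A X 0 [n] \<and> X n = z)"
proof
  assume "\<exists>n. visits A X 0 [n] \<and> X n = z"
  then obtain n where n: "visits A X 0 [n]" "X n = z" by blast
  then show "\<exists>n. return_time A X 1 = enat n \<and> X n = z"
    using return_time_visits[OF n(1), of 1] by auto
next
  assume "\<exists>n. return_time A X 1 = enat n \<and> X n = z"
  then obtain n where n: "return_time A X 1 = enat n" "X n = z" by blast
  let ?S = "{enat n |n. 0 < enat n \<and> X n \<in> A}"
  have inf: "Inf ?S = enat n" using n(1) by (simp add: zero_enat_def[symmetric])
  \<comment> \<open>In \<open>enat\<close> the infimum of the empty set is infinite, so a finite
    return time comes from a nonempty set and is attained.\<close>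
  have "?S \<noteq> {}"
  proof
    assume "?S = {}"
    then have "Inf ?S = \<infinity>" by (simp only: Inf_enat_def if_True simp_thms)
    then show False using inf by simp
  qed
  then have "Inf ?S \<in> ?S" unfolding Inf_enat_def by (auto intro: LeastI)
  then have "0 < n" "X n \<in> A" unfolding inf by (auto simp: zero_enat_def)
  moreover have "X i \<notin> A" if "0 < i" "i < n" for i
  proof
    assume "X i \<in> A"
    then have "Inf ?S \<le> enat i" using that by (intro Inf_lower) (auto simp: zero_enat_def)
    then show False using that inf by simp
  qed
  ultimately show "\<exists>n. visits A X 0 [n] \<and> X n = z" using n(2) by auto
qed

lemma coarse_kernel_ktotal:
  assumes A: "A = strong_component \<alpha> \<omega>" and "x \<in> A" "z \<in> A"
  shows "ennreal (coarse_kernel \<alpha> \<omega> x z) = ktotal (excursion (walk \<omega>) A) x z"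
proof -
  interpret prob_space "walk_law \<omega> x" by (rule prob_space_walk_law[OF \<omega>])
  have "ennreal (coarse_kernel \<alpha> \<omega> x z) = emeasure (walk_law \<omega> x) {X. \<exists>n. visits A X 0 [n] \<and> X n = z}"
    unfolding coarse_kernel_def A[symmetric] return_time_1_visits[OF \<open>z \<in> A\<close>]
    by (simp add: emeasure_eq_measure space_walk_law)
  also have "{X. \<exists>n. visits A X 0 [n] \<and> X n = z} = (\<Union>n. {X. visits A X 0 [n] \<and> X n = z})" by auto
  also have "emeasure (walk_law \<omega> x) \<dots> = (\<Sum>n. emeasure (walk_law \<omega> x) {X. visits A X 0 [n] \<and> X n = z})"
  proof (rule suminf_emeasure[symmetric])
    show "disjoint_family (\<lambda>n. {X. visits A X 0 [n] \<and> X n = z})"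
      unfolding disjoint_family_on_def
    proof (intro ballI impI equals0I)
      fix m n X assume "m \<noteq> n" "X \<in> {X. visits A X 0 [m] \<and> X m = z} \<inter> {X. visits A X 0 [n] \<and> X n = z}"
      then show False by (cases "m < n") (auto simp: not_less)
    qed
  next
    show "range (\<lambda>n. {X. visits A X 0 [n] \<and> X n = z}) \<subseteq> sets (walk_law \<omega> x)"
    proof (intro image_subsetI)
      fix n show "{X. visits A X 0 [n] \<and> X n = z} \<in> sets (walk_law \<omega> x)"
        using visits_sets[of A "[n]" z] by simp
    qed
  qed
  also have "\<dots> = (\<Sum>n. excursion (walk \<omega>) A n x z)"
  proof (intro suminf_cong)
    fix n
    show "emeasure (walk_law \<omega> x) {X. visits A X 0 [n] \<and> X n = z} = excursion (walk \<omega>) A n x z"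
      using pr_visits_start[OF \<open>x \<in> A\<close>, of "[n]" z] by (simp add: pr_def space_walk_law)
  qed
  finally show ?thesis by (simp add: ktotal_def)
qed

end

section \<open>Three sums\<close>

text \<open>Each term is compared with the increment of x^(1-s) by the mean value theorem; the
  factor 2^s arises because the intermediate point is at most n + 1 <= 2 n.\<close>

lemma sum_powr_tail_le:
  fixes s :: real
  assumes "1 < s" "1 \<le> a" "a \<le> b"
  shows "(\<Sum>l=a..<b. real l powr (-s)) \<le> 2 powr s / (s - 1) * (real a powr (1 - s) - real b powr (1 - s))"
  using assms(3)
proof (induction b rule: dec_induct)
  case (step n)
  have n: "1 \<le> n" using step(1) assms(2) by simp
  obtain z where z: "real n < z" "z < real (Suc n)"
    "real (Suc n) powr (1 - s) - real n powr (1 - s) = (real (Suc n) - real n) * ((1 - s) * z powr (1 - s - 1))"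
  proof (rule MVT2[of "real n" "real (Suc n)" "\<lambda>x. x powr (1 - s)" "\<lambda>x. (1 - s) * x powr (1 - s - 1)", THEN exE])
    fix x assume "real n \<le> x" "x \<le> real (Suc n)"
    then have "0 < x" using n by simp
    then show "((\<lambda>x. x powr (1 - s)) has_real_derivative (1 - s) * x powr (1 - s - 1)) (at x)"
      by (rule has_real_derivative_powr)
  qed auto
  have "real n powr (-s) = 2 powr s * (2 * real n) powr (-s)"
    using n by (simp add: powr_mult powr_minus field_simps)
  also have "\<dots> \<le> 2 powr s * z powr (-s)"
    using z n assms(1) by (intro mult_left_mono powr_mono2') auto
  also have "z powr (-s) = (real n powr (1 - s) - real (Suc n) powr (1 - s)) / (s - 1)"
  proof -
    have "(s - 1) * z powr (-s) = real n powr (1 - s) - real (Suc n) powr (1 - s)"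
      using z(3) by (simp add: algebra_simps)
    then show ?thesis using assms(1) by (metis diff_gt_0_iff_gt less_irrefl nonzero_mult_div_cancel_left)
  qed
  finally have "real n powr (-s) \<le> 2 powr s / (s - 1) * (real n powr (1 - s) - real (Suc n) powr (1 - s))"
    by simp
  then have "(\<Sum>l=a..<n. real l powr (-s)) + real n powr (-s)
      \<le> 2 powr s / (s - 1) * (real a powr (1 - s) - real n powr (1 - s))
        + 2 powr s / (s - 1) * (real n powr (1 - s) - real (Suc n) powr (1 - s))"
    using step.IH by (rule add_mono[rotated])
  also have "\<dots> = 2 powr s / (s - 1) * (real a powr (1 - s) - real (Suc n) powr (1 - s))"
    unfolding distrib_left[symmetric] by simp
  finally show ?case using step.hyps by (simp add: sum.atLeastLessThan_Suc del: of_nat_Suc)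
qed simp

text \<open>From \<open>ln x \<le> x - 1\<close> at x = n / (n + 1); replacing 1 / (n + 1) by 1 / (2
  n) costs the factor 2.\<close>

lemma sum_inverse_le_ln:
  assumes "1 \<le> a" "a \<le> b"
  shows "(\<Sum>l=a..<b. 1 / real l) \<le> 2 * (ln (real b) - ln (real a))"
  using assms(2)
proof (induction b rule: dec_induct)
  case (step n)
  have n: "1 \<le> n" using step(1) assms(1) by simp
  have "ln (real n / real (Suc n)) \<le> real n / real (Suc n) - 1"
    using n by (intro ln_le_minus_one) auto
  moreover have "real n / real (Suc n) - 1 \<le> - (1 / (2 * real n))" using n by (simp add: field_simps)
  ultimately have "ln (real n) - ln (real (Suc n)) \<le> - (1 / (2 * real n))"
    using n by (simp add: ln_div del: of_nat_Suc)
  moreover have "x - y \<le> - z \<Longrightarrow> 2 * z \<le> 2 * (y - x)" for x y z :: real by simp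
  ultimately have "2 * (1 / (2 * real n)) \<le> 2 * (ln (real (Suc n)) - ln (real n))" by blast
  then have "1 / real n \<le> 2 * (ln (real (Suc n)) - ln (real n))" by simp
  then show ?case using step by (simp add: sum.atLeastLessThan_Suc algebra_simps del: of_nat_Suc)
qed simp

text \<open>The exponents in use are 0 in even and -1/2 in odd dimension. The induction step reduces
  to the worst exponent -1/2 and then to sqrt (1 - 2 y) <= 1 - y.\<close>

lemma sum_powr_le:
  fixes u :: real
  assumes "- 1 / 2 \<le> u" "u \<le> 0"
  shows "(\<Sum>l=1..m. real l powr u) \<le> 2 * real m powr (u + 1)"
proof (induction m)
  case (Suc m)
  let ?x = "real m / real (Suc m)"
  have "?x powr (u + 1) \<le> ?x powr (1 / 2)"
    using assms by (intro powr_mono') auto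
  also have "\<dots> = sqrt ?x" by (simp add: powr_half_sqrt)
  also have "\<dots> \<le> 1 - 1 / (2 * real (Suc m))"
  proof (rule real_le_lsqrt)
    have "?x = 1 - 2 * (1 / (2 * real (Suc m)))" by (simp add: field_simps)
    also have "\<dots> \<le> (1 - 1 / (2 * real (Suc m)))\<^sup>2"
      unfolding power2_diff using zero_le_power2[of "1 / (2 * real (Suc m))"] by simp
    finally show "?x \<le> (1 - 1 / (2 * real (Suc m)))\<^sup>2" .
  qed auto
  finally have "real (Suc m) powr (u + 1) * ?x powr (u + 1) \<le> real (Suc m) powr (u + 1) * (1 - 1 / (2 * real (Suc m)))"
    by (intro mult_left_mono) auto
  moreover have "real (Suc m) powr (u + 1) * ?x powr (u + 1) = real m powr (u + 1)"
    by (simp add: powr_mult[symmetric] del: of_nat_Suc)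
  moreover have "real (Suc m) powr (u + 1) = real (Suc m) powr u * real (Suc m)"
    by (simp add: powr_add del: of_nat_Suc)
  ultimately have "real m powr (u + 1) \<le> real (Suc m) powr (u + 1) - real (Suc m) powr u / 2"
    by (simp add: right_diff_distrib del: of_nat_Suc)
  then have "2 * real m powr (u + 1) + real (Suc m) powr u \<le> 2 * real (Suc m) powr (u + 1)"
    by simp
  then show ?case using Suc by simp
qed simp

text \<open>The error term of the theorem, up to the factor \<open>\<lambda>\<^sub>n\<close>\<close>

definition trap_error :: "nat \<Rightarrow> real \<Rightarrow> real \<Rightarrow> real" where
  "trap_error d n \<theta> = (if d = 4 then n / \<theta> * ln (n / \<theta>) else (n / \<theta>) powr (real d / 2 - 1))"

text \<open>This product is the size allowed, up to constants, to the failure probabilities summed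
  over the window; in simplified form it can be compared directly with the sums over l.\<close>

lemma trap_error_eq:
  assumes "0 < \<theta>" "0 < n"
  shows "\<theta> * n powr (- (real d / 2)) * trap_error d n \<theta>
    = (if d = 4 then ln (n / \<theta>) / n else \<theta> powr (2 - real d / 2) / n)"
proof (cases "d = 4")
  case True
  have "n powr (- (real d / 2)) = 1 / n ^ 2"
    using assms True by (simp add: powr_minus powr_numeral field_simps)
  then show ?thesis using assms True by (simp add: trap_error_def power2_eq_square)
next
  case False
  have "\<theta> * n powr (- (real d / 2)) * (n / \<theta>) powr (real d / 2 - 1)
      = (\<theta> powr 1 * \<theta> powr - (real d / 2 - 1)) * (n powr (- (real d / 2)) * n powr (real d / 2 - 1))"
    using assms by (simp add: powr_divide powr_minus field_simps)
  also have "\<dots> = \<theta> powr (2 - real d / 2) * n powr (- 1)"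
    unfolding powr_add[symmetric] by simp
  finally show ?thesis using assms False by (simp add: trap_error_def powr_minus field_simps)
qed

text \<open>The three terms come from the lengths l > \<theta>, from r <= l <= \<theta> (with the
  sum extended down to 1) and from l < r.\<close>

lemma trap_sums_le:
  fixes d r :: nat
  assumes d: "4 \<le> d" and r: "r = nat \<lfloor>real d / 2 - 1\<rfloor>"
  obtains c where "0 \<le> c"
    "\<And>n \<theta>. 1 \<le> \<theta> \<Longrightarrow> \<theta> \<le> real n / 2 \<Longrightarrow>
      (\<Sum>l | \<theta> < real l \<and> l \<le> 2 * n. real l powr (1 - real d / 2)) / real n
      + fact (Suc r) / (real n * \<theta> ^ r) * (\<Sum>l | 1 \<le> l \<and> real l \<le> \<theta>. real l powr (real (Suc r) - real d / 2))
      + real r * (real r / real n) ^ Suc r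
      \<le> c * (\<theta> * real n powr (- (real d / 2)) * trap_error d n \<theta>)"
proof -
  have rd: "real r \<le> real d / 2 - 1" "real d / 2 - 3 / 2 \<le> real r"
  proof -
    have "real d / 2 - 1 = real (d - 2) / 2" using d by (simp add: of_nat_diff field_simps)
    then have "\<lfloor>real d / 2 - 1\<rfloor> = int ((d - 2) div 2)" by (metis floor_divide_of_nat_eq of_nat_numeral)
    then have "r = (d - 2) div 2" using r by simp
    then have "2 * r \<le> d - 2" "d - 2 \<le> 2 * r + 1" by auto
    then have "2 * real r \<le> real d - 2" "real d - 2 \<le> 2 * real r + 1" using d by linarith+
    then show "real r \<le> real d / 2 - 1" "real d / 2 - 3 / 2 \<le> real r" by auto
  qed
  define s where "s = real d / 2 - 1"
  \<comment> \<open>The 6 serves d = 4 and the quotient serves d >= 5; at d = 4 one has s = 1, and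
    the quotient is 0 by the convention for division by zero.\<close>
  define c1 where "c1 = 6 + 2 powr s / (s - 1)"
  \<comment> \<open>Because \<theta> <= n/2 gives ln (n / \<theta>) >= ln 2, the logarithmic error
    at d = 4 also dominates the terms without logarithm, at the cost of 1 / ln 2.\<close>
  define c where "c = c1 + (2 * fact (Suc r) + real r ^ (r + 2)) / ln 2"
  have s: "1 \<le> s" using d by (simp add: s_def)
  have c1: "0 \<le> c1" using s by (simp add: c1_def)
  have "0 \<le> c" using c1 by (simp add: c_def)
  moreover have "(\<Sum>l | \<theta> < real l \<and> l \<le> 2 * n. real l powr (1 - real d / 2)) / real n
      + fact (Suc r) / (real n * \<theta> ^ r) * (\<Sum>l | 1 \<le> l \<and> real l \<le> \<theta>. real l powr (real (Suc r) - real d / 2))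
      + real r * (real r / real n) ^ Suc r
      \<le> c * (\<theta> * real n powr (- (real d / 2)) * trap_error d n \<theta>)"
    if \<theta>: "1 \<le> \<theta>" "\<theta> \<le> real n / 2" for n \<theta>
  proof -
    define \<Psi> where "\<Psi> = \<theta> powr (2 - real d / 2) / real n"
    define \<Phi> where "\<Phi> = \<theta> * real n powr (- (real d / 2)) * trap_error d n \<theta>"
    have n: "2 \<le> real n" using \<theta> by linarith
    have \<Phi>: "\<Phi> = (if d = 4 then ln (real n / \<theta>) / real n else \<Psi>)"
      unfolding \<Phi>_def \<Psi>_def using \<theta> n by (intro trap_error_eq) auto
    have ln2: "ln 2 \<le> ln (real n / \<theta>)" using \<theta> n by (subst ln_le_cancel_iff) (auto simp: field_simps)
    have \<Psi>0: "0 \<le> \<Psi>" using n by (simp add: \<Psi>_def)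
    have \<Psi>\<Phi>: "ln 2 * \<Psi> \<le> \<Phi>"
    proof (cases "d = 4")
      case True
      then show ?thesis using ln2 n \<theta> by (simp add: \<Phi> \<Psi>_def divide_right_mono)
    next
      case False
      have "ln 2 * \<Psi> \<le> 1 * \<Psi>" using \<Psi>0 ln_2_less_1 by (intro mult_right_mono) auto
      then show ?thesis using False by (simp add: \<Phi>)
    qed
    let ?a = "Suc (nat \<lfloor>\<theta>\<rfloor>)"
    have a: "\<theta> \<le> real ?a" "\<theta> < real l \<longleftrightarrow> ?a \<le> l" for l using \<theta> by (simp_all, linarith+)
    have ab: "?a \<le> Suc (2 * n)" using \<theta> n by (simp add: nat_le_iff floor_le_iff)
    have set1: "{l. \<theta> < real l \<and> l \<le> 2 * n} = {?a..<Suc (2 * n)}" by (auto simp: a)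
    have sum1: "(\<Sum>l | \<theta> < real l \<and> l \<le> 2 * n. real l powr (1 - real d / 2)) / real n \<le> c1 * \<Phi>"
    proof (cases "d = 4")
      case True
      have "(\<Sum>l | \<theta> < real l \<and> l \<le> 2 * n. real l powr (1 - real d / 2)) = (\<Sum>l=?a..<Suc (2 * n). 1 / real l)"
        unfolding set1 by (intro sum.cong) (auto simp: True powr_minus field_simps)
      also have "\<dots> \<le> 2 * (ln (real (Suc (2 * n))) - ln (real ?a))"
        using ab by (intro sum_inverse_le_ln) auto
      also have "\<dots> \<le> 2 * (ln (4 * real n) - ln \<theta>)"
      proof -
        have "ln (real (Suc (2 * n))) \<le> ln (4 * real n)" using n by (subst ln_le_cancel_iff) auto
        moreover have "ln \<theta> \<le> ln (real ?a)" using a(1) \<theta> by (subst ln_le_cancel_iff) auto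
        ultimately show ?thesis by (intro mult_left_mono diff_mono) auto
      qed
      also have "\<dots> = 2 * (2 * ln 2 + ln (real n / \<theta>))"
      proof -
        have "ln (4::real) = ln (2 ^ 2)" by simp
        also have "\<dots> = 2 * ln 2" by (subst ln_realpow) auto
        finally show ?thesis using n \<theta> by (simp add: ln_mult ln_div)
      qed
      also have "\<dots> \<le> 2 * (2 * ln (real n / \<theta>) + ln (real n / \<theta>))"
        using ln2 by (intro mult_left_mono add_right_mono) auto
      also have "\<dots> = 6 * ln (real n / \<theta>)" by simp
      finally have "(\<Sum>l | \<theta> < real l \<and> l \<le> 2 * n. real l powr (1 - real d / 2)) / real n \<le> 6 * \<Phi>"
        using n True by (simp add: \<Phi> divide_right_mono)
      also have "\<dots> \<le> c1 * \<Phi>"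
      proof (intro mult_right_mono)
        show "6 \<le> c1" using s by (simp add: c1_def)
        show "0 \<le> \<Phi>" using \<Psi>\<Phi> \<Psi>0 by (meson ln_ge_zero mult_nonneg_nonneg one_le_numeral order_trans)
      qed
      finally show ?thesis .
    next
      case False
      then have s1: "1 < s" using d by (simp add: s_def)
      have "(\<Sum>l | \<theta> < real l \<and> l \<le> 2 * n. real l powr (1 - real d / 2)) = (\<Sum>l=?a..<Suc (2 * n). real l powr (-s))"
        unfolding set1 s_def by simp
      also have "\<dots> \<le> 2 powr s / (s - 1) * (real ?a powr (1 - s) - real (Suc (2 * n)) powr (1 - s))"
        using ab s1 by (intro sum_powr_tail_le) auto
      also have "\<dots> \<le> 2 powr s / (s - 1) * \<theta> powr (1 - s)"
      proof (intro mult_left_mono)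
        have "real ?a powr (1 - s) \<le> \<theta> powr (1 - s)" using a(1) \<theta> s1 by (intro powr_mono2') auto
        then show "real ?a powr (1 - s) - real (Suc (2 * n)) powr (1 - s) \<le> \<theta> powr (1 - s)"
          using powr_ge_zero[of "real (Suc (2 * n))" "1 - s"] by linarith
      qed (use s1 in auto)
      also have "\<dots> \<le> c1 * \<theta> powr (1 - s)" by (intro mult_right_mono) (auto simp: c1_def)
      also have "1 - s = 2 - real d / 2" by (simp add: s_def)
      finally show ?thesis using n False by (simp add: \<Phi> \<Psi>_def divide_right_mono)
    qed
    have sum2: "fact (Suc r) / (real n * \<theta> ^ r) * (\<Sum>l | 1 \<le> l \<and> real l \<le> \<theta>. real l powr (real (Suc r) - real d / 2))
        \<le> 2 * fact (Suc r) * \<Psi>"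
    proof -
      let ?u = "real (Suc r) - real d / 2"
      have set2: "{l. 1 \<le> l \<and> real l \<le> \<theta>} = {1..nat \<lfloor>\<theta>\<rfloor>}" using \<theta> by (auto simp: le_nat_floor le_nat_iff le_floor_iff)
      have "(\<Sum>l | 1 \<le> l \<and> real l \<le> \<theta>. real l powr ?u) \<le> 2 * real (nat \<lfloor>\<theta>\<rfloor>) powr (?u + 1)"
        unfolding set2 using rd by (intro sum_powr_le) auto
      also have "\<dots> \<le> 2 * \<theta> powr (?u + 1)"
        using \<theta> rd by (intro mult_left_mono powr_mono2) auto
      finally have "fact (Suc r) / (real n * \<theta> ^ r) * (\<Sum>l | 1 \<le> l \<and> real l \<le> \<theta>. real l powr ?u)
          \<le> fact (Suc r) / (real n * \<theta> ^ r) * (2 * \<theta> powr (?u + 1))"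
        using \<theta> by (intro mult_left_mono) auto
      also have "\<dots> = 2 * fact (Suc r) * (\<theta> powr (?u + 1) / \<theta> powr real r / real n)"
        using \<theta> by (simp add: powr_realpow ac_simps)
      also have "\<theta> powr (?u + 1) / \<theta> powr real r = \<theta> powr (2 - real d / 2)"
        by (simp add: powr_diff[symmetric])
      finally show ?thesis by (simp add: \<Psi>_def)
    qed
    have sum3: "real r * (real r / real n) ^ Suc r \<le> real r ^ (r + 2) * \<Psi>"
    proof -
      have "1 / real n ^ r \<le> 1 / \<theta> ^ r" using \<theta> n by (intro divide_left_mono power_mono) auto
      also have "\<dots> = \<theta> powr (- real r)" using \<theta> by (simp add: powr_minus powr_realpow field_simps)
      also have "\<dots> \<le> \<theta> powr (2 - real d / 2)" using \<theta> rd by (intro powr_mono) auto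
      finally have "1 / real n ^ r / real n \<le> \<Psi>" unfolding \<Psi>_def using n by (intro divide_right_mono) auto
      then have "real r ^ (r + 2) * (1 / real n ^ r / real n) \<le> real r ^ (r + 2) * \<Psi>" by (intro mult_left_mono) auto
      then show ?thesis by (simp add: power_divide field_simps)
    qed
    have "(2 * fact (Suc r) + real r ^ (r + 2)) * \<Psi> = (2 * fact (Suc r) + real r ^ (r + 2)) / ln 2 * (ln 2 * \<Psi>)"
      by simp
    also have "\<dots> \<le> (2 * fact (Suc r) + real r ^ (r + 2)) / ln 2 * \<Phi>"
      using \<Psi>\<Phi> by (intro mult_left_mono) auto
    finally show ?thesis
      using sum1 sum2 sum3 unfolding \<Phi>_def[symmetric] c_def by (simp add: distrib_right)
  qed
  ultimately show ?thesis using that by blast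
qed

section \<open>The coarse-grained heat kernel as a power of the excursion kernel\<close>

lemma coarse_heat_kernel_nonneg: "0 \<le> coarse_heat_kernel \<alpha> \<omega> n x y"
proof (induction n arbitrary: x)
  case (Suc n)
  have "0 \<le> coarse_kernel \<alpha> \<omega> x z" for z by (simp add: coarse_kernel_def)
  then show ?case using Suc by (auto intro!: infsum_nonneg mult_nonneg_nonneg)
qed simp

lemma infsum_nn_integral:
  fixes f :: "'a \<Rightarrow> real"
  assumes "\<And>x. x \<in> A \<Longrightarrow> 0 \<le> f x" "(\<integral>\<^sup>+x. ennreal (f x) \<partial>count_space A) < \<top>"
  shows "(\<integral>\<^sup>+x. ennreal (f x) \<partial>count_space A) = ennreal (\<Sum>\<^sub>\<infinity>x\<in>A. f x)"
proof -
  have "integrable (count_space A) f"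
    using assms by (intro integrableI_nonneg) (auto simp: AE_count_space)
  then have s: "Infinite_Set_Sum.abs_summable_on f A"
    by (simp add: Infinite_Set_Sum.abs_summable_on_def)
  show ?thesis
    using nn_integral_conv_infsetsum[OF s assms(1)] infsetsum_infsum[OF s] by simp
qed

lemma ktotal_excursion_le_1:
  assumes "\<omega> \<in> space env_space"
  shows "kapp (ktotal (excursion (walk \<omega>) A)) (\<lambda>_. 1) x \<le> 1"
proof -
  interpret reversible_chain "walk \<omega>" "conductance \<omega>" A by (rule reversible_chain_walk[OF assms])
  show ?thesis using excursion_total_le_1[of x] by (simp add: ktotal_def[abs_def])
qed

lemma kernel_le_total: "(K x y :: ennreal) \<le> kapp K (\<lambda>_. 1) x"
  using kcomp_term_le[of K x y "\<lambda>_ _. 1" y] by (simp add: kcomp_def)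

lemma excursion_outside: "x \<notin> A \<or> y \<notin> A \<Longrightarrow> excursion p A t x y = 0"
  by (cases t) auto

text \<open>The infinite sum in \<open>coarse_heat_kernel\<close> is real-valued and would be 0 if
  it diverged; row sums of at most 1 ensure that it is the true sum.\<close>

lemma coarse_heat_kernel_kword:
  fixes \<omega> :: "'d::finite environment"
  assumes \<omega>: "\<omega> \<in> space env_space" and A: "A = strong_component \<alpha> \<omega>" and "x \<in> A" "z \<in> A"
  shows "ennreal (coarse_heat_kernel \<alpha> \<omega> n x z) = kword (ktotal (excursion (walk \<omega>) A)) Q n 0 x z"
  using \<open>x \<in> A\<close>
proof (induction n arbitrary: x)
  case 0
  then show ?case by (simp add: kone_def)
next
  case (Suc n)
  let ?P = "ktotal (excursion (walk \<omega>) A)"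
  let ?f = "\<lambda>u. coarse_kernel \<alpha> \<omega> x u * coarse_heat_kernel \<alpha> \<omega> n u z"
  have f0: "0 \<le> ?f u" for u
    by (intro mult_nonneg_nonneg coarse_heat_kernel_nonneg) (simp add: coarse_kernel_def)
  have "kword ?P Q (Suc n) 0 x z = (\<integral>\<^sup>+u. ?P x u * kword ?P Q n 0 u z \<partial>count_space UNIV)"
    by (simp add: kcomp_def kapp_def)
  also have "\<dots> = (\<integral>\<^sup>+u. ennreal (?f u) * indicator A u \<partial>count_space UNIV)"
  proof (intro nn_integral_cong)
    fix u
    show "?P x u * kword ?P Q n 0 u z = ennreal (?f u) * indicator A u"
    proof (cases "u \<in> A")
      case True
      then show ?thesis
        using coarse_kernel_ktotal[OF \<omega> A Suc.prems True] Suc.IH[OF True] coarse_heat_kernel_nonneg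
        by (simp add: ennreal_mult' coarse_kernel_def)
    qed (simp add: ktotal_def excursion_outside)
  qed
  also have "\<dots> = (\<integral>\<^sup>+u. ennreal (?f u) \<partial>count_space A)"
    by (simp add: nn_integral_count_space_indicator)
  finally have *: "kword ?P Q (Suc n) 0 x z = (\<integral>\<^sup>+u. ennreal (?f u) \<partial>count_space A)" .
  have "kword ?P Q (Suc n) 0 x z \<le> kapp (kword ?P Q (Suc n) 0) (\<lambda>_. 1) x"
    by (rule kernel_le_total)
  also have "\<dots> \<le> 1"
    using kword_total_le[where P="?P" and Q=Q and l="Suc n" and m="Suc n" and q=0 and x=x]
      ktotal_excursion_le_1[OF \<omega>, of A] by (simp del: kword.simps)
  finally have "(\<integral>\<^sup>+u. ennreal (?f u) \<partial>count_space A) < \<top>"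
    unfolding * using ennreal_one_less_top by (rule le_less_trans)
  then have "(\<integral>\<^sup>+u. ennreal (?f u) \<partial>count_space A) = ennreal (\<Sum>\<^sub>\<infinity>u\<in>A. ?f u)"
    using f0 by (intro infsum_nn_integral) auto
  then show ?case using * A by simp
qed

section \<open>Return probabilities\<close>

lemma kapp_square_le:
  assumes "kapp p (\<lambda>_. 1) x = 1"
  shows "(kapp p f x)\<^sup>2 \<le> kapp p (\<lambda>y. (f y)\<^sup>2) x"
proof -
  let ?M = "density (count_space UNIV) (p x)"
  have M: "(\<integral>\<^sup>+y. g y \<partial>?M) = kapp p g x" for g
    by (simp add: nn_integral_density kapp_def)
  have "(\<integral>\<^sup>+y. f y * 1 \<partial>?M)\<^sup>2 \<le> (\<integral>\<^sup>+y. (f y)\<^sup>2 \<partial>?M) * (\<integral>\<^sup>+y. 1\<^sup>2 \<partial>?M)"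
    by (rule Cauchy_Schwarz_nn_integral) auto
  then show ?thesis unfolding M using assms by simp
qed

text \<open>w(x) p^2n(x,x) is the squared norm of p^n(.,x) in L^2(w), and p is a contraction there,
  by Cauchy-Schwarz in each row and invariance of w.\<close>

lemma return_decreasing:
  assumes "\<And>x. kapp p (\<lambda>_. 1) x = 1" "ksym w p" "w x \<noteq> 0" "w x \<noteq> \<top>" "m \<le> n"
  shows "kword p p (2 * n) 0 x x \<le> kword p p (2 * m) 0 x x"
  using \<open>m \<le> n\<close>
proof (induction n rule: dec_induct)
  case (step n)
  let ?k = "\<lambda>n. kword p p n 0"
  define N where "N n = (\<integral>\<^sup>+y. w y * (?k n y x)\<^sup>2 \<partial>count_space UNIV)" for n
  have N: "w x * ?k (2 * n) x x = N n" for n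
  proof -
    have "?k (2 * n) x x = (\<integral>\<^sup>+y. ?k n x y * ?k n y x \<partial>count_space UNIV)"
      using kword_add[of p p n n 0 x x] by (simp add: mult_2 kcomp_def kapp_def)
    then have "w x * ?k (2 * n) x x = (\<integral>\<^sup>+y. (w x * ?k n x y) * ?k n y x \<partial>count_space UNIV)"
      by (simp add: nn_integral_cmult mult.assoc)
    also have "\<dots> = N n"
      unfolding N_def ksymD[OF kword_sym[OF assms(2,2)], of x] by (simp add: power2_eq_square mult.assoc)
    finally show ?thesis .
  qed
  have "N (Suc n) = (\<integral>\<^sup>+y. w y * (kapp p (\<lambda>z. ?k n z x) y)\<^sup>2 \<partial>count_space UNIV)"
    by (simp add: N_def kcomp_def)
  also have "\<dots> \<le> (\<integral>\<^sup>+y. w y * kapp p (\<lambda>z. (?k n z x)\<^sup>2) y \<partial>count_space UNIV)"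
    by (intro nn_integral_mono mult_left_mono kapp_square_le assms) auto
  also have "\<dots> = (\<integral>\<^sup>+y. \<integral>\<^sup>+z. (w y * p y z) * (?k n z x)\<^sup>2 \<partial>count_space UNIV \<partial>count_space UNIV)"
    by (simp add: kapp_def nn_integral_cmult mult.assoc)
  also have "\<dots> = (\<integral>\<^sup>+y. \<integral>\<^sup>+z. (w z * p z y) * (?k n z x)\<^sup>2 \<partial>count_space UNIV \<partial>count_space UNIV)"
    by (intro nn_integral_cong) (simp only: ksymD[OF assms(2)])
  also have "\<dots> = (\<integral>\<^sup>+z. \<integral>\<^sup>+y. (w z * p z y) * (?k n z x)\<^sup>2 \<partial>count_space UNIV \<partial>count_space UNIV)"
    by (rule nn_integral_count_space_swap)
  also have "\<dots> = (\<integral>\<^sup>+z. w z * (?k n z x)\<^sup>2 * kapp p (\<lambda>_. 1) z \<partial>count_space UNIV)"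
    unfolding kapp_def
    by (intro nn_integral_cong) (simp add: nn_integral_multc nn_integral_cmult, simp add: ac_simps)
  also have "\<dots> = N n" by (simp add: assms(1) N_def)
  finally have "w x * ?k (2 * Suc n) x x \<le> w x * ?k (2 * n) x x" by (simp only: N)
  then have "?k (2 * Suc n) x x \<le> ?k (2 * n) x x"
    using assms(3,4) by (simp add: ennreal_mult_le_mult_iff)
  then show ?case using step by simp
qed simp

lemma heat_kernel_decreasing:
  assumes \<omega>: "\<omega> \<in> space env_space" and "m \<le> n"
  shows "heat_kernel \<omega> (2 * n) x x \<le> heat_kernel \<omega> (2 * m) x x"
proof -
  have "ennreal (heat_kernel \<omega> (2 * n) x x) \<le> ennreal (heat_kernel \<omega> (2 * m) x x)"
    unfolding heat_kernel_kword[OF \<omega>]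
    using total_conductance_pos[OF \<omega>, of x] \<open>m \<le> n\<close>
    by (intro return_decreasing[where w="conductance \<omega>"] walk_one walk_sym \<omega>) (auto simp: conductance_def)
  then show ?thesis by (simp add: ennreal_le_iff heat_kernel_def)
qed

text \<open>Step to a neighbor and back, n times. Positivity makes the conditioning on the return
  meaningful and permits division by lambda_n.\<close>

lemma heat_kernel_pos:
  fixes \<omega> :: "'d::finite environment"
  assumes \<omega>: "\<omega> \<in> space env_space"
  shows "0 < heat_kernel \<omega> (2 * n) x x"
proof -
  have "kword (walk \<omega>) (walk \<omega>) (2 * n) 0 x x \<noteq> 0"
  proof (induction n)
    case (Suc n)
    obtain y where "neighbor x y" using ex_neighbor by blast
    then have "walk \<omega> x y * (walk \<omega> y x * kword (walk \<omega>) (walk \<omega>) (2 * n) 0 x x) \<noteq> 0"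
      using Suc walk_pos[OF \<omega>] by (simp add: neighbor_sym)
    then have "0 < walk \<omega> x y * (walk \<omega> y x * kword (walk \<omega>) (walk \<omega>) (2 * n) 0 x x)"
      by (simp add: zero_less_iff_neq_zero)
    also have "\<dots> \<le> walk \<omega> x y * (walk \<omega> \<odot> kword (walk \<omega>) (walk \<omega>) (2 * n) 0) y x"
      by (intro mult_left_mono kcomp_term_le) simp
    also have "\<dots> \<le> (walk \<omega> \<odot> (walk \<omega> \<odot> kword (walk \<omega>) (walk \<omega>) (2 * n) 0)) x x"
      by (rule kcomp_term_le)
    finally show ?case by simp
  qed (simp add: kone_def)
  then show ?thesis
    unfolding heat_kernel_kword[OF \<omega>, symmetric] by (simp add: ennreal_eq_0_iff not_le)
qed

section \<open>The quenched estimate\<close>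

lemma length_le_sum_list: "(\<And>t. t \<in> set ts \<Longrightarrow> 0 < (t::nat)) \<Longrightarrow> length ts \<le> sum_list ts"
proof (induction ts)
  case (Cons t ts)
  have "0 < t" "length ts \<le> sum_list ts" using Cons by auto
  then show ?case by simp
qed simp

text \<open>The largest entry is at least the average of the entries.\<close>

lemma power_sum_list_le:
  fixes ts :: "nat list"
  assumes "0 < p"
  shows "sum_list ts ^ p \<le> length ts ^ p * sum_list (map (\<lambda>t. t ^ p) ts)"
proof (cases "ts = []")
  case True
  then show ?thesis using assms by simp
next
  case False
  define t where "t = Max (set ts)"
  have t: "t \<in> set ts" "\<And>s. s \<in> set ts \<Longrightarrow> s \<le> t" using False by (auto simp: t_def)
  have "sum_list ts \<le> length ts * t"
    using t(2) by (induction ts) (auto intro: add_mono)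
  then have "sum_list ts ^ p \<le> (length ts * t) ^ p" by (rule power_mono) simp
  also have "\<dots> = length ts ^ p * t ^ p" by (rule power_mult_distrib)
  also have "t ^ p \<le> sum_list (map (\<lambda>t. t ^ p) ts)"
    using t(1) by (intro member_le_sum_list) auto
  finally show ?thesis by simp
qed

context
  fixes \<omega> :: "'d::finite environment" and A :: "'d site set" and \<theta> :: real and n r :: nat
  assumes \<omega>: "\<omega> \<in> space env_space" and A: "0 \<in> A" and \<theta>: "1 \<le> \<theta>" "\<theta> \<le> real n / 2"
begin

abbreviation "exc_A \<equiv> excursion (walk \<omega>) A"

definition patterns :: "nat \<Rightarrow> nat list set" where
  "patterns m = {ts \<in> (\<Union>l\<in>{1..2 * n}. time_lists (2 * n) l). sum_list ts = 2 * m}"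

lemma finite_patterns: "finite (patterns m)"
  unfolding patterns_def by simp

lemma visits_patterns:
  assumes "X (2 * m) = 0" "0 < m" "m \<le> n"
  shows "\<exists>ts\<in>patterns m. visits A X 0 ts"
proof -
  obtain ts where ts: "visits A X 0 ts" "sum_list ts = 2 * m"
    using visits_exists[of X "2 * m" A 0] assms A by auto
  have pos: "0 < t" if "t \<in> set ts" for t using visits_pos[OF ts(1) that] .
  have "length ts \<le> 2 * m" using length_le_sum_list[of ts] pos ts(2) by simp
  moreover have "ts \<noteq> []" using ts(2) assms(2) by auto
  moreover have "t \<le> 2 * n" if "t \<in> set ts" for t
    using member_le_sum_list[OF that] ts(2) assms(3) by simp
  ultimately have "ts \<in> patterns m"
    using pos ts(2) assms(3) by (auto simp: patterns_def time_lists_def Suc_le_eq)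
  then show ?thesis using ts(1) by blast
qed

text \<open>The truth value \<open>b\<close> treats trapping and its failure at once. Both become
  finite unions over gap patterns, which also settles their measurability.\<close>

lemma trap_set:
  assumes "0 < m" "m \<le> n"
  shows "{X. X (2 * m) = 0 \<and> (trapping_event A r \<theta> m X \<longleftrightarrow> b)}
    = (\<Union>ts\<in>{ts \<in> patterns m. short_list r \<theta> ts \<longleftrightarrow> b}. {X. visits A X 0 ts \<and> X (sum_list ts) = 0})"
proof (intro set_eqI iffI)
  fix X assume X: "X \<in> {X. X (2 * m) = 0 \<and> (trapping_event A r \<theta> m X \<longleftrightarrow> b)}"
  then obtain ts where ts: "ts \<in> patterns m" "visits A X 0 ts"
    using visits_patterns[of X m] assms by auto
  then have s: "sum_list ts = 2 * m" by (simp add: patterns_def)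
  show "X \<in> (\<Union>ts\<in>{ts \<in> patterns m. short_list r \<theta> ts \<longleftrightarrow> b}. {X. visits A X 0 ts \<and> X (sum_list ts) = 0})"
    using X ts s trapping_event_visits[OF ts(2) s assms(1), of r \<theta>] by auto
next
  fix X assume "X \<in> (\<Union>ts\<in>{ts \<in> patterns m. short_list r \<theta> ts \<longleftrightarrow> b}. {X. visits A X 0 ts \<and> X (sum_list ts) = 0})"
  then obtain ts where ts: "ts \<in> patterns m" "short_list r \<theta> ts \<longleftrightarrow> b" "visits A X 0 ts" "X (sum_list ts) = 0"
    by auto
  then have s: "sum_list ts = 2 * m" by (simp add: patterns_def)
  show "X \<in> {X. X (2 * m) = 0 \<and> (trapping_event A r \<theta> m X \<longleftrightarrow> b)}"
    using ts s trapping_event_visits[OF ts(3) s assms(1), of r \<theta>] by auto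
qed

lemma trap_sets:
  assumes "0 < m" "m \<le> n"
  shows "{X. X (2 * m) = 0 \<and> (trapping_event A r \<theta> m X \<longleftrightarrow> b)} \<in> sets (walk_law \<omega> 0)"
  unfolding trap_set[OF assms] using finite_patterns by (intro sets.finite_UN visits_sets \<omega>) auto

lemma bad_le_patterns:
  assumes "0 < m" "m \<le> n"
  shows "emeasure (walk_law \<omega> 0) {X. X (2 * m) = 0 \<and> (trapping_event A r \<theta> m X \<longleftrightarrow> False)}
    \<le> (\<Sum>ts\<in>{ts \<in> patterns m. \<not> short_list r \<theta> ts}. kpath exc_A ts 0 0)"
proof -
  have "emeasure (walk_law \<omega> 0) {X. X (2 * m) = 0 \<and> (trapping_event A r \<theta> m X \<longleftrightarrow> False)}
      \<le> (\<Sum>ts\<in>{ts \<in> patterns m. short_list r \<theta> ts \<longleftrightarrow> False}. emeasure (walk_law \<omega> 0) {X. visits A X 0 ts \<and> X (sum_list ts) = 0})"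
    unfolding trap_set[OF assms]
    using finite_patterns by (intro emeasure_subadditive_finite image_subsetI visits_sets \<omega>) auto
  also have "\<dots> = (\<Sum>ts\<in>{ts \<in> patterns m. \<not> short_list r \<theta> ts}. kpath exc_A ts 0 0)"
    using pr_visits_start[OF \<omega> A] by (intro sum.cong) (auto simp: pr_def[OF \<omega>] space_walk_law[OF \<omega>])
  finally show ?thesis .
qed

text \<open>The time 2m is forgotten here. What is kept of it is that \<theta> <= n/2 forces 2m >= n
  throughout the window.\<close>

definition bad_lists :: "nat \<Rightarrow> nat list set" where
  "bad_lists l = {ts \<in> time_lists (2 * n) l. n \<le> sum_list ts \<and> \<not> short_list r \<theta> ts}"

lemma finite_bad_lists: "finite (bad_lists l)"
  unfolding bad_lists_def by simp

text \<open>A list determines m through its sum, so the patterns for different m are disjoint and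
  the sum over m and patterns is a single sum over lists. Regrouping by length brings in the coarse
  walk after l steps.\<close>

lemma sum_bad_le_lists:
  "(\<Sum>m | real n - \<theta> \<le> real m \<and> m \<le> n. emeasure (walk_law \<omega> 0) {X. X (2 * m) = 0 \<and> (trapping_event A r \<theta> m X \<longleftrightarrow> False)})
    \<le> (\<Sum>l=1..2 * n. \<Sum>ts\<in>bad_lists l. kpath exc_A ts 0 0)"
proof -
  let ?R = "{m. real n - \<theta> \<le> real m \<and> m \<le> n}"
  let ?T = "\<lambda>m. {ts \<in> patterns m. \<not> short_list r \<theta> ts}"
  have R: "0 < m" "m \<le> n" "n \<le> 2 * m" if "m \<in> ?R" for m
  proof -
    have "real n / 2 \<le> real m" "1 \<le> real n / 2" using that \<theta> by auto
    then show "0 < m" "m \<le> n" "n \<le> 2 * m" using that by auto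
  qed
  have finR: "finite ?R" by (rule finite_subset[of _ "{..n}"]) auto
  have "(\<Sum>m\<in>?R. emeasure (walk_law \<omega> 0) {X. X (2 * m) = 0 \<and> (trapping_event A r \<theta> m X \<longleftrightarrow> False)})
      \<le> (\<Sum>m\<in>?R. \<Sum>ts\<in>?T m. kpath exc_A ts 0 0)"
  proof (rule sum_mono)
    fix m assume "m \<in> ?R"
    from R(1,2)[OF this] show "emeasure (walk_law \<omega> 0) {X. X (2 * m) = 0 \<and> (trapping_event A r \<theta> m X \<longleftrightarrow> False)}
        \<le> (\<Sum>ts\<in>?T m. kpath exc_A ts 0 0)"
      by (rule bad_le_patterns)
  qed
  also have "\<dots> = (\<Sum>ts\<in>(\<Union>m\<in>?R. ?T m). kpath exc_A ts 0 0)"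
    using finR finite_patterns by (intro sum.UNION_disjoint[symmetric]) (auto simp: patterns_def)
  also have "\<dots> \<le> (\<Sum>ts\<in>(\<Union>l\<in>{1..2 * n}. bad_lists l). kpath exc_A ts 0 0)"
  proof (rule sum_mono2)
    show "finite (\<Union>l\<in>{1..2 * n}. bad_lists l)" by (auto simp: bad_lists_def)
    show "(\<Union>m\<in>?R. ?T m) \<subseteq> (\<Union>l\<in>{1..2 * n}. bad_lists l)"
    proof
      fix ts assume "ts \<in> (\<Union>m\<in>?R. ?T m)"
      then obtain m where m: "m \<in> ?R" "ts \<in> patterns m" "\<not> short_list r \<theta> ts" by blast
      then show "ts \<in> (\<Union>l\<in>{1..2 * n}. bad_lists l)" using R[OF m(1)] by (auto simp: patterns_def bad_lists_def)
    qed
  qed auto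
  also have "\<dots> = (\<Sum>l=1..2 * n. \<Sum>ts\<in>bad_lists l. kpath exc_A ts 0 0)"
  proof (rule sum.UNION_disjoint)
    show "\<forall>i\<in>{1..2 * n}. \<forall>j\<in>{1..2 * n}. i \<noteq> j \<longrightarrow> bad_lists i \<inter> bad_lists j = {}"
      by (auto simp: bad_lists_def time_lists_def)
  qed (auto simp: finite_bad_lists)
  finally show ?thesis .
qed

text \<open>Markov's inequality: on the bad lists 1 is dominated by \<open>c\<close> times a
  symmetric sum, whose total weight over all lists is a word.\<close>

lemma sum_weighted_le_kword:
  assumes "\<And>ts. ts \<in> bad_lists l \<Longrightarrow> 1 \<le> c * real (time_esum q (map (\<lambda>t. t ^ p) ts))" "0 \<le> c"
  shows "(\<Sum>ts\<in>bad_lists l. kpath exc_A ts 0 0) \<le> ennreal c * kword (ktotal exc_A) (kmoment p exc_A) l q 0 0"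
proof -
  have "(\<Sum>ts\<in>bad_lists l. kpath exc_A ts 0 0)
      \<le> (\<Sum>ts\<in>bad_lists l. ennreal c * (of_nat (time_esum q (map (\<lambda>t. t ^ p) ts)) * kpath exc_A ts 0 0))"
  proof (intro sum_mono)
    fix ts assume "ts \<in> bad_lists l"
    then have "ennreal 1 \<le> ennreal (c * real (time_esum q (map (\<lambda>t. t ^ p) ts)))"
      using assms by (intro ennreal_leI) auto
    also have "\<dots> = ennreal c * of_nat (time_esum q (map (\<lambda>t. t ^ p) ts))"
      using assms(2) by (simp add: ennreal_mult ennreal_of_nat_eq_real_of_nat)
    finally have "1 * kpath exc_A ts 0 0 \<le> ennreal c * of_nat (time_esum q (map (\<lambda>t. t ^ p) ts)) * kpath exc_A ts 0 0"
      by (intro mult_right_mono) auto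
    then show "kpath exc_A ts 0 0 \<le> ennreal c * (of_nat (time_esum q (map (\<lambda>t. t ^ p) ts)) * kpath exc_A ts 0 0)"
      by (simp add: mult.assoc)
  qed
  also have "\<dots> \<le> (\<Sum>ts\<in>time_lists (2 * n) l. ennreal c * (of_nat (time_esum q (map (\<lambda>t. t ^ p) ts)) * kpath exc_A ts 0 0))"
    by (intro sum_mono2) (auto simp: bad_lists_def)
  also have "\<dots> \<le> ennreal c * kword (ktotal exc_A) (kmoment p exc_A) l q 0 0"
    unfolding sum_distrib_left[symmetric] by (intro mult_left_mono sum_kpath_le_kword) auto
  finally show ?thesis .
qed

lemma sum_bad_le:
  fixes B d :: real
  assumes B: "0 \<le> B"
    and D1: "\<And>l. 1 \<le> l \<Longrightarrow> kword (ktotal exc_A) (kmoment 1 exc_A) l 1 0 0 \<le> ennreal (B * real l powr (1 - d))"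
    and D2: "\<And>l. 1 \<le> l \<Longrightarrow> kword (ktotal exc_A) (kmoment 1 exc_A) l (Suc r) 0 0 \<le> ennreal (B * real l powr (real (Suc r) - d))"
    and D3: "\<And>l. l < r \<Longrightarrow> kword (ktotal exc_A) (kmoment (Suc r) exc_A) l 1 0 0 \<le> ennreal B"
  shows "(\<Sum>m | real n - \<theta> \<le> real m \<and> m \<le> n. emeasure (walk_law \<omega> 0) {X. X (2 * m) = 0 \<and> (trapping_event A r \<theta> m X \<longleftrightarrow> False)})
    \<le> ennreal (B * ((\<Sum>l | \<theta> < real l \<and> l \<le> 2 * n. real l powr (1 - d)) / real n
      + fact (Suc r) / (real n * \<theta> ^ r) * (\<Sum>l | 1 \<le> l \<and> real l \<le> \<theta>. real l powr (real (Suc r) - d))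
      + real r * (real r / real n) ^ Suc r))"
proof -
  have n: "0 < real n" using \<theta> by linarith
  define b1 where "b1 l = B * (real l powr (1 - d) / real n)" for l
  define b2 where "b2 l = B * (fact (Suc r) / (real n * \<theta> ^ r) * real l powr (real (Suc r) - d))" for l
  define b3 where "b3 = B * (real r / real n) ^ Suc r"
  have b0: "0 \<le> b1 l" "0 \<le> b2 l" "0 \<le> b3" for l using B \<theta> n by (auto simp: b1_def b2_def b3_def)
  \<comment> \<open>All terms that may apply are added; the ranges overlap for l < r, which only
    enlarges the bound.\<close>
  define b where "b l = (if \<theta> < real l then b1 l else 0) + (if real l \<le> \<theta> then b2 l else 0) + (if l < r then b3 else 0)" for l
  have b: "(\<Sum>ts\<in>bad_lists l. kpath exc_A ts 0 0) \<le> ennreal (b l)" if l: "1 \<le> l" for l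
  proof -
    consider "\<theta> < real l" | "real l \<le> \<theta>" "r \<le> l" | "real l \<le> \<theta>" "l < r" by linarith
    then show ?thesis
    proof cases
      case 1
      have "(\<Sum>ts\<in>bad_lists l. kpath exc_A ts 0 0) \<le> ennreal (1 / real n) * kword (ktotal exc_A) (kmoment 1 exc_A) l 1 0 0"
      proof (rule sum_weighted_le_kword)
        fix ts assume "ts \<in> bad_lists l"
        then have "real n \<le> real (sum_list ts)" by (simp add: bad_lists_def)
        then show "1 \<le> 1 / real n * real (time_esum 1 (map (\<lambda>t. t ^ 1) ts))"
          using n by (simp add: time_esum_1)
      qed simp
      also have "\<dots> \<le> ennreal (1 / real n) * ennreal (B * real l powr (1 - d))"
        by (intro mult_left_mono D1 l) simp
      also have "\<dots> = ennreal (b1 l)" using B n by (simp add: ennreal_mult[symmetric] b1_def)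
      also have "\<dots> \<le> ennreal (b l)" using 1 b0 by (intro ennreal_leI) (auto simp: b_def)
      finally show ?thesis .
    next
      case 2
      let ?c = "fact (Suc r) / (real n * \<theta> ^ r)"
      have "(\<Sum>ts\<in>bad_lists l. kpath exc_A ts 0 0) \<le> ennreal ?c * kword (ktotal exc_A) (kmoment 1 exc_A) l (Suc r) 0 0"
      proof (rule sum_weighted_le_kword)
        fix ts assume ts: "ts \<in> bad_lists l"
        have "real n * \<theta> ^ r \<le> real (sum_list ts) * \<theta> ^ r"
          using ts \<theta> by (intro mult_right_mono) (auto simp: bad_lists_def)
        also have "\<dots> \<le> fact (Suc r) * real (time_esum (Suc r) ts)"
          using ts 2 \<theta> by (intro not_short_list_bound) (auto simp: bad_lists_def time_lists_def)
        finally show "1 \<le> ?c * real (time_esum (Suc r) (map (\<lambda>t. t ^ 1) ts))"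
          using n \<theta> by (simp add: le_divide_eq)
      qed (use \<theta> in auto)
      also have "\<dots> \<le> ennreal ?c * ennreal (B * real l powr (real (Suc r) - d))"
        by (intro mult_left_mono D2 l) simp
      also have "\<dots> = ennreal (b2 l)" using B n \<theta> by (simp add: ennreal_mult[symmetric] b2_def)
      also have "\<dots> \<le> ennreal (b l)" using 2 b0 by (intro ennreal_leI) (auto simp: b_def)
      finally show ?thesis .
    next
      \<comment> \<open>Fewer than r gaps with sum at least n include one of length at least n / r;
        the moment of order r + 1 makes this cost of order n^(-r-1).\<close>
      case 3
      let ?c = "(real r / real n) ^ Suc r"
      have "(\<Sum>ts\<in>bad_lists l. kpath exc_A ts 0 0) \<le> ennreal ?c * kword (ktotal exc_A) (kmoment (Suc r) exc_A) l 1 0 0"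
      proof (rule sum_weighted_le_kword)
        fix ts assume ts: "ts \<in> bad_lists l"
        let ?S = "sum_list (map (\<lambda>t. t ^ Suc r) ts)"
        have "n ^ Suc r \<le> sum_list ts ^ Suc r" using ts by (intro power_mono) (auto simp: bad_lists_def)
        also have "\<dots> \<le> length ts ^ Suc r * ?S" by (rule power_sum_list_le) simp
        also have "\<dots> \<le> r ^ Suc r * ?S"
          using ts 3 by (intro mult_right_mono power_mono) (auto simp: bad_lists_def time_lists_def)
        finally have "real n ^ Suc r \<le> real r ^ Suc r * real ?S" by (metis of_nat_le_iff of_nat_mult of_nat_power)
        then show "1 \<le> ?c * real (time_esum 1 (map (\<lambda>t. t ^ Suc r) ts))"
          using n unfolding One_nat_def time_esum_1 power_divide by (simp add: le_divide_eq del: power_Suc)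
      qed auto
      also have "\<dots> \<le> ennreal ?c * ennreal B"
        by (intro mult_left_mono D3 3) simp
      also have "\<dots> = ennreal b3" using B by (simp add: ennreal_mult[symmetric] b3_def mult.commute del: power_Suc)
      also have "\<dots> \<le> ennreal (b l)" using 3 b0 by (intro ennreal_leI) (auto simp: b_def)
      finally show ?thesis .
    qed
  qed
  have "(\<Sum>l=1..2 * n. \<Sum>ts\<in>bad_lists l. kpath exc_A ts 0 0) \<le> (\<Sum>l=1..2 * n. ennreal (b l))"
    by (intro sum_mono b) auto
  also have "\<dots> = ennreal (\<Sum>l=1..2 * n. b l)"
    using b0 by (intro sum_ennreal) (auto simp: b_def)
  also have "(\<Sum>l=1..2 * n. b l) \<le> (\<Sum>l | \<theta> < real l \<and> l \<le> 2 * n. b1 l) + (\<Sum>l | 1 \<le> l \<and> real l \<le> \<theta>. b2 l) + real r * b3"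
  proof -
    have fin2: "finite {l. 1 \<le> l \<and> real l \<le> \<theta>}"
      by (rule finite_subset[of _ "{..n}"]) (use \<theta> in auto)
    have "(\<Sum>l=1..2 * n. if \<theta> < real l then b1 l else 0) = (\<Sum>l | \<theta> < real l \<and> l \<le> 2 * n. b1 l)"
      using \<theta> by (subst sum.inter_filter[symmetric]) (auto intro!: sum.cong)
    moreover have "(\<Sum>l=1..2 * n. if real l \<le> \<theta> then b2 l else 0) \<le> (\<Sum>l | 1 \<le> l \<and> real l \<le> \<theta>. b2 l)"
      using fin2 b0 by (subst sum.inter_filter[symmetric]) (auto intro!: sum_mono2)
    moreover have "(\<Sum>l=1..2 * n. if l < r then b3 else 0) \<le> real r * b3"
    proof -
      have "(\<Sum>l=1..2 * n. if l < r then b3 else 0) = (\<Sum>l | l \<in> {1..2 * n} \<and> l < r. b3)"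
        by (subst sum.inter_filter[symmetric]) auto
      also have "\<dots> \<le> (\<Sum>l<r. b3)" using b0 by (intro sum_mono2) auto
      finally show ?thesis by simp
    qed
    ultimately show ?thesis unfolding b_def sum.distrib by linarith
  qed
  also have "(\<Sum>l | \<theta> < real l \<and> l \<le> 2 * n. b1 l) + (\<Sum>l | 1 \<le> l \<and> real l \<le> \<theta>. b2 l) + real r * b3
      = B * ((\<Sum>l | \<theta> < real l \<and> l \<le> 2 * n. real l powr (1 - d)) / real n
      + fact (Suc r) / (real n * \<theta> ^ r) * (\<Sum>l | 1 \<le> l \<and> real l \<le> \<theta>. real l powr (real (Suc r) - d))
      + real r * (real r / real n) ^ Suc r)"
    unfolding b1_def b2_def b3_def sum_distrib_left[symmetric] sum_divide_distrib[symmetric] distrib_left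
    by (simp only: mult.left_commute[of "real r" B])
  finally show ?thesis
    using sum_bad_le_lists by (meson ennreal_leI order_trans)
qed

end

text \<open>The walk is trapped at most times of a window of length \<open>\<theta>\<close>, hence at one of them.\<close>

lemma trapping_quenched:
  fixes \<omega> :: "'d::finite environment"
  assumes \<omega>: "\<omega> \<in> space env_space" and A: "0 \<in> A" and \<theta>: "1 \<le> \<theta>" "\<theta> \<le> real n / 2"
    and B: "0 \<le> B"
    and D1: "\<And>l. 1 \<le> l \<Longrightarrow> kword (ktotal (excursion (walk \<omega>) A)) (kmoment 1 (excursion (walk \<omega>) A)) l 1 0 0
      \<le> ennreal (B * real l powr (1 - real d / 2))"
    and D2: "\<And>l. 1 \<le> l \<Longrightarrow> kword (ktotal (excursion (walk \<omega>) A)) (kmoment 1 (excursion (walk \<omega>) A)) l (Suc r) 0 0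
      \<le> ennreal (B * real l powr (real (Suc r) - real d / 2))"
    and D3: "\<And>l. l < r \<Longrightarrow> kword (ktotal (excursion (walk \<omega>) A)) (kmoment (Suc r) (excursion (walk \<omega>) A)) l 1 0 0
      \<le> ennreal B"
    and c: "0 \<le> c" "(\<Sum>l | \<theta> < real l \<and> l \<le> 2 * n. real l powr (1 - real d / 2)) / real n
      + fact (Suc r) / (real n * \<theta> ^ r) * (\<Sum>l | 1 \<le> l \<and> real l \<le> \<theta>. real l powr (real (Suc r) - real d / 2))
      + real r * (real r / real n) ^ Suc r
      \<le> c * (\<theta> * real n powr (- (real d / 2)) * trap_error d (real n) \<theta>)"
  shows "\<exists>m. real n - \<theta> \<le> real m \<and> m \<le> n \<and>
    \<P>(X in walk_law \<omega> 0. trapping_event A r \<theta> m X \<bar> X (2 * m) = 0)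
      \<ge> 1 - c * B / (real n powr (real d / 2) * heat_kernel \<omega> (2 * n) 0 0) * trap_error d (real n) \<theta>"
proof (rule ccontr)
  assume neg: "\<not> ?thesis"
  interpret prob_space "walk_law \<omega> 0" by (rule prob_space_walk_law[OF \<omega>])
  let ?R = "{m. real n - \<theta> \<le> real m \<and> m \<le> n}"
  let ?G = "trap_error d (real n) \<theta>"
  let ?h = "\<lambda>m. heat_kernel \<omega> (2 * m) 0 0"
  let ?bad = "\<lambda>m. {X. X (2 * m) = 0 \<and> (trapping_event A r \<theta> m X \<longleftrightarrow> False)}"
  let ?good = "\<lambda>m. {X. X (2 * m) = 0 \<and> (trapping_event A r \<theta> m X \<longleftrightarrow> True)}"
  have n: "2 \<le> real n" using \<theta> by linarith
  \<comment> \<open>Chosen so that \<theta> e equals the bound on the failure probabilities summed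
    over the window. If no m satisfied the claim, each of them would exceed e and, there being at
    least \<theta> values of m, their sum would exceed \<theta> e.\<close>
  define e where "e = c * B * (real n powr (- (real d / 2)) * ?G)"
  have "0 \<le> ?G" using \<theta> n by (auto simp: trap_error_def field_simps)
  then have e0: "0 \<le> e" using c B by (simp add: e_def)
  have finR: "finite ?R" by (rule finite_subset[of _ "{..n}"]) auto
  have bad: "e < prob (?bad m)" if m: "m \<in> ?R" for m
  proof -
    have m': "0 < m" "m \<le> n" using m \<theta> by (auto intro!: gr0I)
    have sp: "space (walk_law \<omega> 0) = UNIV" by (rule space_walk_law[OF \<omega>])
    have h: "0 < ?h m" "0 < ?h n" "?h n \<le> ?h m"
      using heat_kernel_pos[OF \<omega>] heat_kernel_decreasing[OF \<omega> m'(2)] by auto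
    have gs: "?good m \<in> events" and bs: "?bad m \<in> events"
      using trap_sets[OF \<omega> A \<theta> m'] by blast+
    have "?good m \<union> ?bad m = {X \<in> space (walk_law \<omega> 0). X (2 * m) = 0}" by (auto simp: sp)
    then have "?h m = prob (?good m \<union> ?bad m)" by (simp add: heat_kernel_def)
    also have "\<dots> = prob (?good m) + prob (?bad m)"
      using gs bs by (intro finite_measure_Union) auto
    finally have hm: "prob (?good m) = ?h m - prob (?bad m)" by simp
    have "\<P>(X in walk_law \<omega> 0. trapping_event A r \<theta> m X \<bar> X (2 * m) = 0) = prob (?good m) / ?h m"
      by (simp add: cond_prob_def heat_kernel_def sp conj_commute)
    also have "\<dots> = 1 - prob (?bad m) / ?h m" unfolding hm diff_divide_distrib using h by simp
    finally have P: "\<P>(X in walk_law \<omega> 0. trapping_event A r \<theta> m X \<bar> X (2 * m) = 0) = 1 - prob (?bad m) / ?h m" .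
    have "real n - \<theta> \<le> real m" using m by simp
    then have ng: "\<not> 1 - c * B / (real n powr (real d / 2) * ?h n) * ?G
        \<le> \<P>(X in walk_law \<omega> 0. trapping_event A r \<theta> m X \<bar> X (2 * m) = 0)"
      using neg m'(2) by blast
    have "\<not> 1 - a \<le> 1 - b \<Longrightarrow> a < b" for a b :: real by simp
    from this[OF ng[unfolded P]]
    have "c * B / (real n powr (real d / 2) * ?h n) * ?G < prob (?bad m) / ?h m" .
    moreover have "c * B / (real n powr (real d / 2) * ?h n) * ?G = e / ?h n"
      by (simp only: e_def powr_minus divide_inverse inverse_mult_distrib mult_ac)
    \<comment> \<open>Monotonicity of the return probabilities replaces the denominator at time 2n
      by the one at time 2m.\<close>
    moreover have "e / ?h m \<le> e / ?h n" using h e0 by (intro divide_left_mono) auto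
    ultimately have "e / ?h m < prob (?bad m) / ?h m" by simp
    then show ?thesis using h by (simp add: divide_less_cancel)
  qed
  \<comment> \<open>As \<theta> need not be an integer, the window is counted by floor(\<theta>) + 1
    integers, which is more than \<theta>.\<close>
  have card: "\<theta> \<le> real (card ?R)"
  proof -
    have "{n - nat \<lfloor>\<theta>\<rfloor>..n} \<subseteq> ?R"
    proof
      fix m assume "m \<in> {n - nat \<lfloor>\<theta>\<rfloor>..n}"
      then have "n \<le> m + nat \<lfloor>\<theta>\<rfloor>" "m \<le> n" by auto
      moreover have "real (nat \<lfloor>\<theta>\<rfloor>) \<le> \<theta>" using \<theta> by simp
      ultimately show "m \<in> ?R" by (auto simp: of_nat_le_iff[symmetric, where 'a=real] simp del: of_nat_le_iff)
    qed
    then have "card {n - nat \<lfloor>\<theta>\<rfloor>..n} \<le> card ?R" using finR by (intro card_mono)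
    moreover have "nat \<lfloor>\<theta>\<rfloor> \<le> n" using \<theta> n by (simp add: nat_le_iff floor_le_iff)
    ultimately have "nat \<lfloor>\<theta>\<rfloor> + 1 \<le> card ?R" by simp
    then show ?thesis using \<theta> by linarith
  qed
  have "0 < card ?R" using card \<theta> by linarith
  have "\<theta> * e \<le> real (card ?R) * e" using card e0 by (rule mult_right_mono)
  also have "\<dots> = (\<Sum>m\<in>?R. e)" by simp
  also have "\<dots> < (\<Sum>m\<in>?R. prob (?bad m))"
    using finR \<open>0 < card ?R\<close> bad by (intro sum_strict_mono) (auto simp: card_gt_0_iff)
  also have "\<dots> \<le> B * (c * (\<theta> * real n powr (- (real d / 2)) * ?G))"
  proof -
    have "ennreal (\<Sum>m\<in>?R. prob (?bad m)) = (\<Sum>m\<in>?R. emeasure (walk_law \<omega> 0) (?bad m))"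
      by (simp add: emeasure_eq_measure sum_ennreal)
    also have "\<dots> \<le> ennreal (B * ((\<Sum>l | \<theta> < real l \<and> l \<le> 2 * n. real l powr (1 - real d / 2)) / real n
      + fact (Suc r) / (real n * \<theta> ^ r) * (\<Sum>l | 1 \<le> l \<and> real l \<le> \<theta>. real l powr (real (Suc r) - real d / 2))
      + real r * (real r / real n) ^ Suc r))"
      by (rule sum_bad_le[OF \<omega> A \<theta> B]) (fact D1 D2 D3)+
    also have "ennreal (B * ((\<Sum>l | \<theta> < real l \<and> l \<le> 2 * n. real l powr (1 - real d / 2)) / real n
      + fact (Suc r) / (real n * \<theta> ^ r) * (\<Sum>l | 1 \<le> l \<and> real l \<le> \<theta>. real l powr (real (Suc r) - real d / 2))
      + real r * (real r / real n) ^ Suc r)) \<le> ennreal (B * (c * (\<theta> * real n powr (- (real d / 2)) * ?G)))"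
      by (intro ennreal_leI mult_left_mono c B)
    finally have le: "ennreal (\<Sum>m\<in>?R. prob (?bad m))
      \<le> ennreal (B * (c * (\<theta> * real n powr (- (real d / 2)) * ?G)))" .
    have "0 \<le> B * (c * (\<theta> * real n powr (- (real d / 2)) * ?G))"
      using B c(1) \<open>0 \<le> ?G\<close> \<theta>(1) by (intro mult_nonneg_nonneg) auto
    from le[unfolded ennreal_le_iff[OF this]] show ?thesis .
  qed
  also have "\<dots> = \<theta> * e" by (simp add: e_def)
  finally show False by simp
qed

section \<open>Finite paths\<close>

text \<open>Infinite paths form an uncountable family, finite lists a countable one; through lists,
  membership in the strong component becomes a measurable event.\<close>

definition strong_path :: "real \<Rightarrow> 'd::finite environment \<Rightarrow> 'd site list \<Rightarrow> bool" where
  "strong_path \<alpha> \<omega> ps \<longleftrightarrow> distinct ps \<and>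
     (\<forall>k. Suc k < length ps \<longrightarrow> neighbor (ps ! k) (ps ! Suc k) \<and> \<alpha> \<le> \<omega> {ps ! k, ps ! Suc k})"

lemma strong_path_take: "strong_path \<alpha> \<omega> ps \<Longrightarrow> strong_path \<alpha> \<omega> (take n ps)"
  by (auto simp: strong_path_def)

definition extendable :: "real \<Rightarrow> 'd::finite environment \<Rightarrow> 'd site list \<Rightarrow> bool" where
  "extendable \<alpha> \<omega> ps \<longleftrightarrow>
     (\<forall>n. \<exists>qs. length qs = length ps + n \<and> strong_path \<alpha> \<omega> qs \<and> take (length ps) qs = ps)"

lemma extendable_path: "extendable \<alpha> \<omega> ps \<Longrightarrow> strong_path \<alpha> \<omega> ps"
  unfolding extendable_def by (metis add.right_neutral order_refl take_all)

text \<open>If each of the finitely many neighbors of the endpoint failed at some length, an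
  extension longer than all these lengths would contradict one of the failures.\<close>

lemma extendable_step:
  assumes "extendable \<alpha> \<omega> ps" "ps \<noteq> []"
  shows "\<exists>v. extendable \<alpha> \<omega> (ps @ [v])"
proof (rule ccontr)
  assume "\<nexists>v. extendable \<alpha> \<omega> (ps @ [v])"
  then have "\<forall>v. \<exists>n. \<not> (\<exists>qs. length qs = length (ps @ [v]) + n \<and> strong_path \<alpha> \<omega> qs
      \<and> take (length (ps @ [v])) qs = ps @ [v])"
    unfolding extendable_def by blast
  then obtain N where N: "\<And>v qs. length qs = length (ps @ [v]) + N v \<Longrightarrow> strong_path \<alpha> \<omega> qs
      \<Longrightarrow> take (length (ps @ [v])) qs \<noteq> ps @ [v]"
    by metis
  let ?F = "{v. neighbor (last ps) v}"
  let ?l = "length ps"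
  define M where "M = Max (insert 0 (N ` ?F))"
  obtain qs where qs: "length qs = ?l + Suc M" "strong_path \<alpha> \<omega> qs" "take ?l qs = ps"
    using assms(1) unfolding extendable_def by blast
  define v where "v = qs ! ?l"
  have l: "0 < ?l" using assms(2) by simp
  have "qs ! (?l - 1) = ps ! (?l - 1)" using qs(3) l by (metis diff_less nth_take zero_less_one)
  then have "neighbor (last ps) v"
    using qs(1,2) l unfolding strong_path_def v_def last_conv_nth[OF assms(2)]
    by (metis Suc_diff_1 add_Suc_right less_add_Suc1)
  then have "N v \<le> M" unfolding M_def using finite_neighbors by (intro Max_ge) auto
  let ?rs = "take (length (ps @ [v]) + N v) qs"
  have "length ?rs = length (ps @ [v]) + N v" using \<open>N v \<le> M\<close> qs(1) by simp
  moreover have "strong_path \<alpha> \<omega> ?rs" by (rule strong_path_take[OF qs(2)])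
  moreover have "take (length (ps @ [v])) ?rs = ps @ [v]"
  proof -
    have "take (Suc ?l) qs = take ?l qs @ [qs ! ?l]" using qs(1) by (intro take_Suc_conv_app_nth) simp
    then show ?thesis using qs(3) by (simp add: v_def min_def)
  qed
  ultimately show False using N by blast
qed

text \<open>Koenig's lemma, as the lattice is locally finite.\<close>

lemma strong_component_paths:
  "x \<in> strong_component \<alpha> \<omega> \<longleftrightarrow> (\<forall>n. \<exists>ps. length ps = Suc n \<and> ps ! 0 = x \<and> strong_path \<alpha> \<omega> ps)"
proof
  assume "x \<in> strong_component \<alpha> \<omega>"
  then obtain \<gamma> k where \<gamma>: "inj \<gamma>" "x = \<gamma> k"
    "\<And>k. neighbor (\<gamma> k) (\<gamma> (Suc k)) \<and> \<omega> {\<gamma> k, \<gamma> (Suc k)} \<ge> \<alpha>"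
    by (auto simp: strong_component_def)
  show "\<forall>n. \<exists>ps. length ps = Suc n \<and> ps ! 0 = x \<and> strong_path \<alpha> \<omega> ps"
  proof
    fix n
    have "strong_path \<alpha> \<omega> (map (\<lambda>i. \<gamma> (k + i)) [0..<Suc n])"
      unfolding strong_path_def
    proof
      show "distinct (map (\<lambda>i. \<gamma> (k + i)) [0..<Suc n])"
        unfolding distinct_map
      proof (intro conjI distinct_upt inj_onI)
        fix i j assume "\<gamma> (k + i) = \<gamma> (k + j)"
        from injD[OF \<gamma>(1) this] show "i = j" by simp
      qed
    qed (use \<gamma>(3) in \<open>simp del: upt_Suc\<close>)
    then show "\<exists>ps. length ps = Suc n \<and> ps ! 0 = x \<and> strong_path \<alpha> \<omega> ps"
      by (intro exI[of _ "map (\<lambda>i. \<gamma> (k + i)) [0..<Suc n]"]) (simp add: \<gamma>(2) del: upt_Suc)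
  qed
next
  assume paths: "\<forall>n. \<exists>ps. length ps = Suc n \<and> ps ! 0 = x \<and> strong_path \<alpha> \<omega> ps"
  have ext0: "extendable \<alpha> \<omega> [x]"
    unfolding extendable_def
  proof
    fix n
    obtain ps where ps: "length ps = Suc n" "ps ! 0 = x" "strong_path \<alpha> \<omega> ps" using paths by blast
    then have "take (length [x]) ps = [x]" by (cases ps) auto
    then show "\<exists>qs. length qs = length [x] + n \<and> strong_path \<alpha> \<omega> qs \<and> take (length [x]) qs = [x]"
      using ps by (intro exI[of _ ps]) auto
  qed
  define f where "f = rec_nat [x] (\<lambda>_ ps. ps @ [SOME v. extendable \<alpha> \<omega> (ps @ [v])])"
  have f0: "f 0 = [x]" and fS: "f (Suc n) = f n @ [SOME v. extendable \<alpha> \<omega> (f n @ [v])]" for n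
    by (simp_all add: f_def)
  have len: "length (f n) = Suc n" for n by (induction n) (auto simp: f0 fS)
  have ext: "extendable \<alpha> \<omega> (f n)" for n
  proof (induction n)
    case (Suc n)
    have "f n \<noteq> []" using len[of n] by auto
    from someI_ex[OF extendable_step[OF Suc this]] show ?case unfolding fS .
  qed (simp add: f0 ext0)
  define \<gamma> where "\<gamma> n = f n ! n" for n
  have nth: "f n ! i = \<gamma> i" if "i \<le> n" for i n
    using that
  proof (induction n rule: dec_induct)
    case (step n)
    then show ?case using len[of n] by (simp add: fS nth_append)
  qed (simp add: \<gamma>_def)
  have "inj \<gamma>"
  proof (rule linorder_injI)
    fix i j :: nat assume "i < j"
    have "distinct (f j)" using extendable_path[OF ext] by (simp add: strong_path_def)
    then have "f j ! i \<noteq> f j ! j" using \<open>i < j\<close> len[of j] by (simp add: nth_eq_iff_index_eq)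
    then show "\<gamma> i \<noteq> \<gamma> j" using nth[of i j] nth[of j j] \<open>i < j\<close> by simp
  qed
  moreover have "neighbor (\<gamma> k) (\<gamma> (Suc k)) \<and> \<alpha> \<le> \<omega> {\<gamma> k, \<gamma> (Suc k)}" for k
    using extendable_path[OF ext[of "Suc k"]] len[of "Suc k"] nth[of k "Suc k"] nth[of "Suc k" "Suc k"]
    unfolding strong_path_def by force
  moreover have "x = \<gamma> 0" by (simp add: \<gamma>_def f0)
  ultimately show "x \<in> strong_component \<alpha> \<omega>"
    unfolding strong_component_def by blast
qed

lemma strong_component_mono: "\<alpha> \<le> \<beta> \<Longrightarrow> strong_component \<beta> \<omega> \<subseteq> strong_component \<alpha> \<omega>"
  unfolding strong_component_def by (blast intro: order_trans)

section \<open>Stationary kernels and fields\<close>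

lemma neighbor_shift [simp]: "neighbor (x + z) (y + z) \<longleftrightarrow> neighbor x y"
  by (simp add: neighbor_def)

lemma shift_edge: "neighbor x y \<Longrightarrow> shift z \<omega> {x, y} = \<omega> {x + z, y + z}"
  by (auto simp: shift_def edges_def)

lemma nn_integral_count_space_translate:
  fixes f :: "'d::finite site \<Rightarrow> ennreal"
  shows "(\<integral>\<^sup>+y. f (y + z) \<partial>count_space UNIV) = (\<integral>\<^sup>+y. f y \<partial>count_space UNIV)"
proof -
  have "bij_betw (\<lambda>y. y + z) UNIV (UNIV :: 'd site set)"
    by (rule bij_betw_byWitness[where f'="\<lambda>y. y - z"]) auto
  from nn_integral_bij_count_space[OF this] show ?thesis .
qed

lemma nn_integral_count_space_uminus:
  fixes f :: "'d::finite site \<Rightarrow> ennreal"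
  shows "(\<integral>\<^sup>+y. f (- y) \<partial>count_space UNIV) = (\<integral>\<^sup>+y. f y \<partial>count_space UNIV)"
proof -
  have "bij_betw uminus UNIV (UNIV :: 'd site set)"
    by (rule bij_betw_byWitness[where f'=uminus]) auto
  from nn_integral_bij_count_space[OF this] show ?thesis .
qed

lemma borel_measurable_count_space_integral:
  fixes f :: "'a \<Rightarrow> 's::countable \<Rightarrow> ennreal"
  assumes "\<And>z. (\<lambda>\<omega>. f \<omega> z) \<in> borel_measurable M"
  shows "(\<lambda>\<omega>. \<integral>\<^sup>+z. f \<omega> z \<partial>count_space UNIV) \<in> borel_measurable M"
proof -
  interpret sigma_finite_measure "count_space (UNIV :: 's set)"
    by (rule sigma_finite_measure_count_space)
  have "(\<lambda>(\<omega>, z). f \<omega> z) \<in> borel_measurable (M \<Otimes>\<^sub>M count_space UNIV)"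
  proof -
    have "(\<lambda>x. (\<lambda>z x. f (fst x) z) (snd x) x) \<in> borel_measurable (M \<Otimes>\<^sub>M count_space UNIV)"
      by (rule measurable_compose_countable[OF measurable_compose[OF measurable_fst assms]]) simp
    then show ?thesis by (simp add: case_prod_beta')
  qed
  then show ?thesis by (rule borel_measurable_nn_integral)
qed

locale stationary_env =
  fixes P :: "'d::finite environment measure"
  assumes prob_P: "prob_space P" and sets_P: "sets P = sets env_space" and ergodic_P: "jointly_ergodic P"
begin

sublocale prob_space P by (rule prob_P)

lemma space_P: "space P = space env_space"
  using sets_P by (rule sets_eq_imp_space_eq)

lemma shift_measurable [measurable]: "shift z \<in> measurable P P"
  using ergodic_P by (simp add: jointly_ergodic_def)

lemma shift_space: "\<omega> \<in> space P \<Longrightarrow> shift z \<omega> \<in> space P"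
  using measurable_space[OF shift_measurable] .

lemma nn_integral_shift:
  assumes [measurable]: "f \<in> borel_measurable P"
  shows "(\<integral>\<^sup>+\<omega>. f (shift z \<omega>) \<partial>P) = (\<integral>\<^sup>+\<omega>. f \<omega> \<partial>P)"
proof -
  have "distr P P (shift z) = P" using ergodic_P by (simp add: jointly_ergodic_def)
  then show ?thesis using nn_integral_distr[of "shift z" P P f] by simp
qed

lemma edge_measurable [measurable]:
  assumes "neighbor x y"
  shows "(\<lambda>\<omega>. \<omega> {x, y}) \<in> borel_measurable P"
proof -
  have "{x, y} \<in> edges" using assms by (auto simp: edges_def)
  then have "(\<lambda>\<omega>. \<omega> {x, y}) \<in> measurable env_space (restrict_space borel {0<..1})"
    unfolding env_space_def by (rule measurable_component_singleton)
  then have "(\<lambda>\<omega>. \<omega> {x, y}) \<in> measurable env_space borel"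
    by (simp add: measurable_restrict_space2_iff)
  then show ?thesis by (simp add: measurable_cong_sets[OF sets_P refl])
qed

lemma total_conductance_measurable [measurable]: "(\<lambda>\<omega>. total_conductance \<omega> x) \<in> borel_measurable P"
  unfolding total_conductance_def by (intro borel_measurable_sum edge_measurable) simp

lemma total_conductance_shift: "total_conductance (shift z \<omega>) x = total_conductance \<omega> (x + z)"
proof -
  have "total_conductance (shift z \<omega>) x = (\<Sum>u | neighbor x u. \<omega> {x + z, u + z})"
    unfolding total_conductance_def by (intro sum.cong) (auto simp: shift_edge)
  also have "\<dots> = (\<Sum>v | neighbor (x + z) v. \<omega> {x + z, v})"
  proof (rule sum.reindex_bij_witness[where i="\<lambda>v. v - z" and j="\<lambda>u. u + z"])
    fix v assume "v \<in> {v. neighbor (x + z) v}"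
    then show "v - z \<in> {u. neighbor x u}" using neighbor_shift[of x z "v - z"] by simp
  qed auto
  finally show ?thesis by (simp add: total_conductance_def)
qed

text \<open>Measurability plus shift covariance: moving the environment amounts to translating the
  sites. These two properties survive all operations on kernels and fields used below, and they are
  what mass transport and stationarity require.\<close>

definition skernel :: "('d environment \<Rightarrow> 'd site kernel) \<Rightarrow> bool" where
  "skernel A \<longleftrightarrow> (\<forall>x y. (\<lambda>\<omega>. A \<omega> x y) \<in> borel_measurable P) \<and>
     (\<forall>\<omega>\<in>space P. \<forall>z x y. A (shift z \<omega>) x y = A \<omega> (x + z) (y + z))"

definition sfield :: "('d environment \<Rightarrow> 'd site \<Rightarrow> ennreal) \<Rightarrow> bool" where
  "sfield f \<longleftrightarrow> (\<forall>x. (\<lambda>\<omega>. f \<omega> x) \<in> borel_measurable P) \<and>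
     (\<forall>\<omega>\<in>space P. \<forall>z x. f (shift z \<omega>) x = f \<omega> (x + z))"

definition sset :: "('d environment \<Rightarrow> 'd site set) \<Rightarrow> bool" where
  "sset B \<longleftrightarrow> (\<forall>x. Measurable.pred P (\<lambda>\<omega>. x \<in> B \<omega>)) \<and>
     (\<forall>\<omega>\<in>space P. \<forall>z x. x \<in> B (shift z \<omega>) \<longleftrightarrow> x + z \<in> B \<omega>)"

lemma sfield_meas: "sfield f \<Longrightarrow> (\<lambda>\<omega>. f \<omega> x) \<in> borel_measurable P"
  and skernel_meas: "skernel A \<Longrightarrow> (\<lambda>\<omega>. A \<omega> x y) \<in> borel_measurable P"
  and sset_meas: "sset B \<Longrightarrow> Measurable.pred P (\<lambda>\<omega>. x \<in> B \<omega>)"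
  by (auto simp: sfield_def skernel_def sset_def)

lemma sfield_shift: "sfield f \<Longrightarrow> \<omega> \<in> space P \<Longrightarrow> f (shift z \<omega>) x = f \<omega> (x + z)"
  and skernel_shift: "skernel A \<Longrightarrow> \<omega> \<in> space P \<Longrightarrow> A (shift z \<omega>) x y = A \<omega> (x + z) (y + z)"
  and sset_shift: "sset B \<Longrightarrow> \<omega> \<in> space P \<Longrightarrow> x \<in> B (shift z \<omega>) \<longleftrightarrow> x + z \<in> B \<omega>"
  by (auto simp: sfield_def skernel_def sset_def)

lemma skernelI:
  assumes "\<And>x y. (\<lambda>\<omega>. A \<omega> x y) \<in> borel_measurable P"
    "\<And>\<omega> z x y. \<omega> \<in> space P \<Longrightarrow> A (shift z \<omega>) x y = A \<omega> (x + z) (y + z)"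
  shows "skernel A"
  using assms by (simp add: skernel_def)

lemma sfieldI:
  assumes "\<And>x. (\<lambda>\<omega>. f \<omega> x) \<in> borel_measurable P"
    "\<And>\<omega> z x. \<omega> \<in> space P \<Longrightarrow> f (shift z \<omega>) x = f \<omega> (x + z)"
  shows "sfield f"
  using assms by (simp add: sfield_def)

lemma sfield_const: "sfield (\<lambda>\<omega> x. c)"
  by (simp add: sfield_def)

lemma skernel_zero: "skernel (\<lambda>\<omega> x y. 0)"
  by (simp add: skernel_def)

lemma skernel_kone: "skernel (\<lambda>\<omega>. kone)"
  by (simp add: skernel_def kone_def)

lemma skernel_kapp:
  assumes "skernel A" "sfield f"
  shows "sfield (\<lambda>\<omega>. kapp (A \<omega>) (f \<omega>))"
  unfolding sfield_def
proof (intro conjI allI ballI)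
  fix x
  show "(\<lambda>\<omega>. kapp (A \<omega>) (f \<omega>) x) \<in> borel_measurable P"
    unfolding kapp_def
    by (intro borel_measurable_count_space_integral borel_measurable_times_ennreal skernel_meas sfield_meas assms)
next
  fix \<omega> z x assume \<omega>: "\<omega> \<in> space P"
  show "kapp (A (shift z \<omega>)) (f (shift z \<omega>)) x = kapp (A \<omega>) (f \<omega>) (x + z)"
    unfolding kapp_def skernel_shift[OF assms(1) \<omega>] sfield_shift[OF assms(2) \<omega>]
    by (rule nn_integral_count_space_translate[where f="\<lambda>y. A \<omega> (x + z) y * f \<omega> y"])
qed

lemma skernel_kcomp:
  assumes "skernel A" "skernel B"
  shows "skernel (\<lambda>\<omega>. A \<omega> \<odot> B \<omega>)"
  unfolding skernel_def
proof (intro conjI allI ballI)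
  fix x y
  show "(\<lambda>\<omega>. (A \<omega> \<odot> B \<omega>) x y) \<in> borel_measurable P"
    unfolding kapp_def kcomp_def
    by (intro borel_measurable_count_space_integral borel_measurable_times_ennreal skernel_meas assms)
next
  fix \<omega> z x y assume \<omega>: "\<omega> \<in> space P"
  show "(A (shift z \<omega>) \<odot> B (shift z \<omega>)) x y = (A \<omega> \<odot> B \<omega>) (x + z) (y + z)"
    unfolding kapp_def kcomp_def skernel_shift[OF assms(1) \<omega>] skernel_shift[OF assms(2) \<omega>]
    by (rule nn_integral_count_space_translate[where f="\<lambda>u. A \<omega> (x + z) u * B \<omega> u (y + z)"])
qed

lemma skernel_add:
  assumes "skernel A" "skernel B"
  shows "skernel (\<lambda>\<omega> x y. A \<omega> x y + B \<omega> x y)"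
proof (rule skernelI)
  note [measurable] = skernel_meas[OF assms(1)] skernel_meas[OF assms(2)]
  show "(\<lambda>\<omega>. (\<lambda>\<omega> x y. A \<omega> x y + B \<omega> x y) \<omega> x y) \<in> borel_measurable P" for x y
    by measurable
qed (simp add: skernel_shift[OF assms(1)] skernel_shift[OF assms(2)])

lemma sfield_add:
  assumes "sfield f" "sfield g"
  shows "sfield (\<lambda>\<omega> x. f \<omega> x + g \<omega> x)"
proof (rule sfieldI)
  note [measurable] = sfield_meas[OF assms(1)] sfield_meas[OF assms(2)]
  show "(\<lambda>\<omega>. (\<lambda>\<omega> x. f \<omega> x + g \<omega> x) \<omega> x) \<in> borel_measurable P" for x
    by measurable
qed (simp add: sfield_shift[OF assms(1)] sfield_shift[OF assms(2)])

lemma sfield_mult: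
  assumes "sfield f" "sfield g"
  shows "sfield (\<lambda>\<omega> x. f \<omega> x * g \<omega> x)"
proof (rule sfieldI)
  note [measurable] = sfield_meas[OF assms(1)] sfield_meas[OF assms(2)]
  show "(\<lambda>\<omega>. (\<lambda>\<omega> x. f \<omega> x * g \<omega> x) \<omega> x) \<in> borel_measurable P" for x
    by measurable
qed (simp add: sfield_shift[OF assms(1)] sfield_shift[OF assms(2)])

lemma sfield_power:
  assumes "sfield f"
  shows "sfield (\<lambda>\<omega> x. f \<omega> x ^ n)"
proof (rule sfieldI)
  note [measurable] = sfield_meas[OF assms(1)]
  show "(\<lambda>\<omega>. (\<lambda>\<omega> x. f \<omega> x ^ n) \<omega> x) \<in> borel_measurable P" for x
    by measurable
qed (simp add: sfield_shift[OF assms(1)])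

lemma sfield_diff:
  assumes "sfield f" "sfield g"
  shows "sfield (\<lambda>\<omega> x. f \<omega> x - g \<omega> x)"
proof (rule sfieldI)
  note [measurable] = sfield_meas[OF assms(1)] sfield_meas[OF assms(2)]
  show "(\<lambda>\<omega>. (\<lambda>\<omega> x. f \<omega> x - g \<omega> x) \<omega> x) \<in> borel_measurable P" for x
    by measurable
qed (simp add: sfield_shift[OF assms(1)] sfield_shift[OF assms(2)])

lemma sfield_indicator: "sset B \<Longrightarrow> sfield (\<lambda>\<omega>. indicator (B \<omega>))"
  unfolding sfield_def
proof (intro conjI allI ballI)
  fix x assume "sset B"
  then have [measurable]: "Measurable.pred P (\<lambda>\<omega>. x \<in> B \<omega>)" by (rule sset_meas)
  have "(\<lambda>\<omega>. if x \<in> B \<omega> then 1 else 0 :: ennreal) \<in> borel_measurable P" by measurable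
  then show "(\<lambda>\<omega>. indicator (B \<omega>) x :: ennreal) \<in> borel_measurable P" by (simp add: indicator_def[abs_def] of_bool_def)
qed (auto simp: indicator_def sset_shift)

lemma skernel_left: "sfield f \<Longrightarrow> skernel (\<lambda>\<omega> x y. f \<omega> x)"
  unfolding skernel_def sfield_def by auto

lemma skernel_right: "sfield f \<Longrightarrow> skernel (\<lambda>\<omega> x y. f \<omega> y)"
  unfolding skernel_def sfield_def by auto

lemma skernel_mult:
  assumes "skernel A" "skernel B"
  shows "skernel (\<lambda>\<omega> x y. A \<omega> x y * B \<omega> x y)"
proof (rule skernelI)
  note [measurable] = skernel_meas[OF assms(1)] skernel_meas[OF assms(2)]
  show "(\<lambda>\<omega>. (\<lambda>\<omega> x y. A \<omega> x y * B \<omega> x y) \<omega> x y) \<in> borel_measurable P" for x y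
    by measurable
qed (simp add: skernel_shift[OF assms(1)] skernel_shift[OF assms(2)])

lemma skernel_suminf:
  assumes "\<And>i. skernel (A i)"
  shows "skernel (\<lambda>\<omega> x y. \<Sum>i. A i \<omega> x y)"
proof (rule skernelI)
  note [measurable] = skernel_meas[OF assms(1)]
  show "(\<lambda>\<omega>. (\<lambda>\<omega> x y. \<Sum>i. A i \<omega> x y) \<omega> x y) \<in> borel_measurable P" for x y
    by measurable
qed (simp add: skernel_shift[OF assms(1)])

lemma skernel_const_mult:
  assumes "skernel A"
  shows "skernel (\<lambda>\<omega> x y. c * A \<omega> x y)"
proof (rule skernelI)
  note [measurable] = skernel_meas[OF assms(1)]
  show "(\<lambda>\<omega>. (\<lambda>\<omega> x y. c * A \<omega> x y) \<omega> x y) \<in> borel_measurable P" for x y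
    by measurable
qed (simp add: skernel_shift[OF assms(1)])

lemma skernel_kword:
  assumes "skernel A" "skernel B"
  shows "skernel (\<lambda>\<omega>. kword (A \<omega>) (B \<omega>) l q)"
proof (induction l arbitrary: q)
  case 0
  show ?case by (cases q) (auto simp: skernel_kone skernel_zero)
next
  case (Suc l)
  show ?case
    by (cases q) (auto intro!: skernel_add skernel_kcomp assms Suc)
qed

lemma sfield_ksums: "skernel A \<Longrightarrow> sfield f \<Longrightarrow> sfield (\<lambda>\<omega>. ksums (A \<omega>) (f \<omega>) n)"
proof (induction n)
  case 0
  then show ?case by (simp add: sfield_const)
next
  case (Suc n)
  then show ?case by (auto intro: sfield_add skernel_kapp)
qed

lemma sfield_kmaxavg:
  assumes "skernel A" "sfield f"
  shows "sfield (\<lambda>\<omega>. kmaxavg (A \<omega>) (f \<omega>))"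
proof -
  have s: "sfield (\<lambda>\<omega>. ksums (A \<omega>) (f \<omega>) n)" for n by (rule sfield_ksums[OF assms])
  have [measurable]: "(\<lambda>\<omega>. ksums (A \<omega>) (f \<omega>) n x) \<in> borel_measurable P" for n x
    by (rule sfield_meas[OF s])
  show ?thesis
    unfolding sfield_def kmaxavg_def
  proof (intro conjI allI ballI)
    fix x
    show "(\<lambda>\<omega>. SUP n. ksums (A \<omega>) (f \<omega>) (Suc n) x / of_nat (Suc n)) \<in> borel_measurable P"
      by measurable
  next
    fix \<omega> z x assume "\<omega> \<in> space P"
    then show "(SUP n. ksums (A (shift z \<omega>)) (f (shift z \<omega>)) (Suc n) x / of_nat (Suc n))
        = (SUP n. ksums (A \<omega>) (f \<omega>) (Suc n) (x + z) / of_nat (Suc n))"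
      by (simp only: sfield_shift[OF s])
  qed
qed

lemma sfield_kiter: "skernel A \<Longrightarrow> skernel B \<Longrightarrow> sfield (\<lambda>\<omega>. kiter (A \<omega>) (B \<omega>) q)"
  by (induction q) (auto intro: sfield_const sfield_kmaxavg skernel_kapp)

lemma sfield_conductance: "sfield conductance"
  unfolding sfield_def conductance_def by (auto simp: total_conductance_shift)

lemma skernel_walk: "skernel walk"
  unfolding skernel_def walk_def walk_kernel_def
proof (intro conjI allI ballI)
  fix x y
  show "(\<lambda>\<omega>. ennreal (if neighbor x y then \<omega> {x, y} / total_conductance \<omega> x else 0)) \<in> borel_measurable P"
  proof (cases "neighbor x y")
    case True
    note [measurable] = edge_measurable[OF True]
    show ?thesis by simp
  qed simp
qed (simp add: shift_edge total_conductance_shift)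

lemma sset_strong_component: "sset (strong_component \<alpha>)"
  unfolding sset_def
proof (intro conjI allI ballI)
  fix x
  have [measurable]: "Measurable.pred P (\<lambda>\<omega>. neighbor u v \<and> \<alpha> \<le> \<omega> {u, v})" for u v
  proof (cases "neighbor u v")
    case True
    note [measurable] = edge_measurable[OF True]
    show ?thesis by measurable
  qed simp
  show "Measurable.pred P (\<lambda>\<omega>. x \<in> strong_component \<alpha> \<omega>)"
    unfolding strong_component_paths strong_path_def by measurable
next
  fix \<omega> z x assume \<omega>: "\<omega> \<in> space P"
  have eq: "strong_path \<alpha> (shift z \<omega>) ps \<longleftrightarrow> strong_path \<alpha> \<omega> (map (\<lambda>v. v + z) ps)" for ps
    unfolding strong_path_def by (auto simp: distinct_map inj_on_def shift_edge)
  show "x \<in> strong_component \<alpha> (shift z \<omega>) \<longleftrightarrow> x + z \<in> strong_component \<alpha> \<omega>"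
  proof
    assume a: "x \<in> strong_component \<alpha> (shift z \<omega>)"
    show "x + z \<in> strong_component \<alpha> \<omega>"
      unfolding strong_component_paths
    proof
      fix n
      obtain ps where "length ps = Suc n" "ps ! 0 = x" "strong_path \<alpha> (shift z \<omega>) ps"
        using a unfolding strong_component_paths by blast
      then show "\<exists>ps. length ps = Suc n \<and> ps ! 0 = x + z \<and> strong_path \<alpha> \<omega> ps"
        unfolding eq by (intro exI[of _ "map (\<lambda>v. v + z) ps"]) auto
    qed
  next
    assume a: "x + z \<in> strong_component \<alpha> \<omega>"
    show "x \<in> strong_component \<alpha> (shift z \<omega>)"
      unfolding strong_component_paths
    proof
      fix n
      obtain ps where ps: "length ps = Suc n" "ps ! 0 = x + z" "strong_path \<alpha> \<omega> ps"
        using a unfolding strong_component_paths by blast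
      have "map (\<lambda>v. v + z) (map (\<lambda>v. v - z) ps) = ps" by (simp add: o_def)
      then have "strong_path \<alpha> (shift z \<omega>) (map (\<lambda>v. v - z) ps)" unfolding eq using ps(3) by simp
      then show "\<exists>ps. length ps = Suc n \<and> ps ! 0 = x \<and> strong_path \<alpha> (shift z \<omega>) ps"
        using ps by (intro exI[of _ "map (\<lambda>v. v - z) ps"]) auto
    qed
  qed
qed

definition sevent :: "('d environment \<Rightarrow> 'd site \<Rightarrow> 'd site \<Rightarrow> bool) \<Rightarrow> bool" where
  "sevent R \<longleftrightarrow> (\<forall>x y. Measurable.pred P (\<lambda>\<omega>. R \<omega> x y)) \<and>
     (\<forall>\<omega>\<in>space P. \<forall>z x y. R (shift z \<omega>) x y \<longleftrightarrow> R \<omega> (x + z) (y + z))"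

lemma ex_translate: "(\<exists>y. R (y + z)) \<longleftrightarrow> (\<exists>y::'d site. R y)"
  by (metis diff_add_cancel)

text \<open>Reachability is a countable union over the number of steps; for a fixed number,
  measurability and covariance follow by induction.\<close>

lemma sevent_hole: "sevent (\<lambda>\<omega> x y. y \<in> hole \<alpha> \<omega> x)"
proof -
  let ?C = "strong_component \<alpha>"
  let ?R = "\<lambda>\<omega>. {(u, v). neighbor u v \<and> u \<notin> ?C \<omega> \<and> v \<notin> ?C \<omega>}"
  note [measurable] = sset_meas[OF sset_strong_component]
  have R: "Measurable.pred P (\<lambda>\<omega>. (x, y) \<in> ?R \<omega> ^^ n)" for n x y
  proof (induction n arbitrary: y)
    case (Suc n)
    note [measurable] = Suc
    have "Measurable.pred P (\<lambda>\<omega>. \<exists>u. (x, u) \<in> ?R \<omega> ^^ n \<and> neighbor u y \<and> u \<notin> ?C \<omega> \<and> y \<notin> ?C \<omega>)"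
      by measurable
    also have "(\<lambda>\<omega>. \<exists>u. (x, u) \<in> ?R \<omega> ^^ n \<and> neighbor u y \<and> u \<notin> ?C \<omega> \<and> y \<notin> ?C \<omega>) = (\<lambda>\<omega>. (x, y) \<in> ?R \<omega> ^^ Suc n)"
      by (auto simp: fun_eq_iff)
    finally show ?case .
  qed simp
  have S: "(x, y) \<in> ?R (shift z \<omega>) ^^ n \<longleftrightarrow> (x + z, y + z) \<in> ?R \<omega> ^^ n" if \<omega>: "\<omega> \<in> space P" for n x y z \<omega>
  proof (induction n arbitrary: y)
    case (Suc n)
    have "(x, y) \<in> ?R (shift z \<omega>) ^^ Suc n \<longleftrightarrow> (\<exists>u. (x, u) \<in> ?R (shift z \<omega>) ^^ n \<and> (u, y) \<in> ?R (shift z \<omega>))"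
      by auto
    also have "\<dots> \<longleftrightarrow> (\<exists>u. (x + z, u + z) \<in> ?R \<omega> ^^ n \<and> (u + z, y + z) \<in> ?R \<omega>)"
      by (simp only: Suc) (simp add: sset_shift[OF sset_strong_component \<omega>])
    also have "\<dots> \<longleftrightarrow> (\<exists>u. (x + z, u) \<in> ?R \<omega> ^^ n \<and> (u, y + z) \<in> ?R \<omega>)"
      by (rule ex_translate)
    also have "\<dots> \<longleftrightarrow> (x + z, y + z) \<in> ?R \<omega> ^^ Suc n" by auto
    finally show ?case .
  qed auto
  show ?thesis
    unfolding sevent_def hole_def
  proof (intro conjI allI ballI)
    fix x y
    have "Measurable.pred P (\<lambda>\<omega>. if x \<in> ?C \<omega> then y = x else (\<exists>n. (x, y) \<in> ?R \<omega> ^^ n))"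
      using R by measurable
    also have "(\<lambda>\<omega>. if x \<in> ?C \<omega> then y = x else (\<exists>n. (x, y) \<in> ?R \<omega> ^^ n))
        = (\<lambda>\<omega>. y \<in> (if x \<in> ?C \<omega> then {x} else {v. (x, v) \<in> (?R \<omega>)\<^sup>*}))"
      by (auto simp: fun_eq_iff rtrancl_power)
    finally show "Measurable.pred P (\<lambda>\<omega>. y \<in> (if x \<in> ?C \<omega> then {x} else {v. (x, v) \<in> (?R \<omega>)\<^sup>*}))" .
  next
    fix \<omega> z x y assume \<omega>: "\<omega> \<in> space P"
    show "y \<in> (if x \<in> ?C (shift z \<omega>) then {x} else {v. (x, v) \<in> (?R (shift z \<omega>))\<^sup>*})
        \<longleftrightarrow> y + z \<in> (if x + z \<in> ?C \<omega> then {x + z} else {v. (x + z, v) \<in> (?R \<omega>)\<^sup>*})"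
      using S[OF \<omega>] by (simp add: sset_shift[OF sset_strong_component \<omega>] rtrancl_power)
  qed
qed

lemma sevent_adjacent_holes: "sevent (\<lambda>\<omega> x y. y \<in> adjacent_holes \<alpha> \<omega> x)"
proof -
  note h = sevent_hole[of \<alpha>, unfolded sevent_def]
  show ?thesis
    unfolding sevent_def adjacent_holes_def
  proof (intro conjI allI ballI)
    fix x y
    have [measurable]: "Measurable.pred P (\<lambda>\<omega>. y \<in> hole \<alpha> \<omega> u)" for u using h by blast
    have "Measurable.pred P (\<lambda>\<omega>. \<exists>u. neighbor x u \<and> y \<in> hole \<alpha> \<omega> u)" by measurable
    then show "Measurable.pred P (\<lambda>\<omega>. y \<in> (\<Union>u\<in>{u. neighbor x u}. hole \<alpha> \<omega> u))" by simp
  next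
    fix \<omega> z x y assume \<omega>: "\<omega> \<in> space P"
    have "y \<in> (\<Union>u\<in>{u. neighbor x u}. hole \<alpha> (shift z \<omega>) u) \<longleftrightarrow> (\<exists>u. neighbor (x + z) (u + z) \<and> y + z \<in> hole \<alpha> \<omega> (u + z))"
      using h \<omega> by simp
    also have "\<dots> \<longleftrightarrow> (\<exists>u. neighbor (x + z) u \<and> y + z \<in> hole \<alpha> \<omega> u)" by (rule ex_translate)
    finally show "y \<in> (\<Union>u\<in>{u. neighbor x u}. hole \<alpha> (shift z \<omega>) u) \<longleftrightarrow> y + z \<in> (\<Union>u\<in>{u. neighbor (x + z) u}. hole \<alpha> \<omega> u)"
      by simp
  qed
qed

lemma skernel_indicator: "sevent R \<Longrightarrow> skernel (\<lambda>\<omega> x y. indicator {y. R \<omega> x y} y)"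
  unfolding skernel_def
proof (intro conjI allI ballI)
  fix x y assume "sevent R"
  then have [measurable]: "Measurable.pred P (\<lambda>\<omega>. R \<omega> x y)" by (simp add: sevent_def)
  have "(\<lambda>\<omega>. if R \<omega> x y then 1 else 0 :: ennreal) \<in> borel_measurable P" by measurable
  then show "(\<lambda>\<omega>. indicator {y. R \<omega> x y} y :: ennreal) \<in> borel_measurable P" by (simp add: indicator_def[abs_def] of_bool_def)
qed (auto simp: indicator_def sevent_def)

text \<open>The expected mass sent from 0 equals the expected mass received at 0: by stationarity,
  what 0 sends to y has the same mean as what -y sends to 0.\<close>

lemma mass_transport:
  assumes "skernel A"
  shows "(\<integral>\<^sup>+\<omega>. (\<integral>\<^sup>+y. A \<omega> 0 y \<partial>count_space UNIV) \<partial>P) = (\<integral>\<^sup>+\<omega>. (\<integral>\<^sup>+y. A \<omega> y 0 \<partial>count_space UNIV) \<partial>P)"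
proof -
  have swap: "(\<integral>\<^sup>+\<omega>. (\<integral>\<^sup>+y. B \<omega> y \<partial>count_space UNIV) \<partial>P) = (\<integral>\<^sup>+y. (\<integral>\<^sup>+\<omega>. B \<omega> y \<partial>P) \<partial>count_space UNIV)"
    if "\<And>y. (\<lambda>\<omega>. B \<omega> y) \<in> borel_measurable P" for B :: "'d environment \<Rightarrow> 'd site \<Rightarrow> ennreal"
    by (rule nn_integral_count_space_nn_integral[where I=UNIV and M=P and f="\<lambda>y \<omega>. B \<omega> y"]) (auto intro: that)
  have "(\<integral>\<^sup>+\<omega>. A \<omega> 0 y \<partial>P) = (\<integral>\<^sup>+\<omega>. A \<omega> (- y) 0 \<partial>P)" for y
  proof -
    have "(\<integral>\<^sup>+\<omega>. A (shift y \<omega>) (- y) 0 \<partial>P) = (\<integral>\<^sup>+\<omega>. A \<omega> (- y) 0 \<partial>P)"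
      by (rule nn_integral_shift[OF skernel_meas[OF assms]])
    moreover have "(\<integral>\<^sup>+\<omega>. A (shift y \<omega>) (- y) 0 \<partial>P) = (\<integral>\<^sup>+\<omega>. A \<omega> 0 y \<partial>P)"
      by (intro nn_integral_cong) (simp add: skernel_shift[OF assms])
    ultimately show ?thesis by simp
  qed
  then show ?thesis
    using nn_integral_count_space_uminus[of "\<lambda>y. \<integral>\<^sup>+\<omega>. A \<omega> y 0 \<partial>P"]
    by (simp add: swap skernel_meas[OF assms])
qed

end

section \<open>The maximal ergodic theorem\<close>

text \<open>A reservoir with input \<open>f\<close>, transport by \<open>A\<close> and outflow \<open>c\<close> per step; the truncated
  subtraction makes its positivity detect averages above \<open>c\<close>.\<close>

primrec reservoir :: "'s kernel \<Rightarrow> ('s \<Rightarrow> ennreal) \<Rightarrow> ennreal \<Rightarrow> nat \<Rightarrow> 's \<Rightarrow> ennreal" where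
  "reservoir A f c 0 = (\<lambda>x. 0)"
| "reservoir A f c (Suc n) = (\<lambda>x. (f x + kapp A (reservoir A f c n) x) - c)"

lemma reservoir_mono: "reservoir A f c n x \<le> reservoir A f c (Suc n) x"
proof (induction n arbitrary: x)
  case (Suc n)
  show ?case
    unfolding reservoir.simps(2)[of A f c "Suc n"]
    by (subst reservoir.simps(2)) (intro ennreal_minus_mono add_left_mono kapp_mono Suc order_refl)
qed simp

text \<open>Each step removes at most \<open>c\<close>, and the sub-Markov property lets the
  accumulated deficit pass through the kernel. An average above \<open>c\<close> therefore leaves
  the reservoir positive.\<close>

lemma ksums_le_reservoir:
  assumes "\<And>x. kapp A (\<lambda>_. 1) x \<le> 1" "c \<noteq> \<top>"
  shows "ksums A f n x \<le> reservoir A f c n x + of_nat n * c"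
proof (induction n arbitrary: x)
  case (Suc n)
  have "kapp A (ksums A f n) x \<le> kapp A (\<lambda>y. reservoir A f c n y + 1 * (of_nat n * c)) x"
    using Suc by (intro kapp_mono) auto
  also have "\<dots> = kapp A (reservoir A f c n) x + kapp A (\<lambda>_. 1) x * (of_nat n * c)"
    unfolding kapp_add kapp_multc ..
  also have "\<dots> \<le> kapp A (reservoir A f c n) x + 1 * (of_nat n * c)"
    by (intro add_left_mono mult_right_mono assms) simp
  finally have "ksums A f (Suc n) x \<le> (f x + kapp A (reservoir A f c n) x) + of_nat n * c"
    by (simp add: add.assoc add_left_mono)
  also have "f x + kapp A (reservoir A f c n) x \<le> reservoir A f c (Suc n) x + c"
  proof (cases "c \<le> f x + kapp A (reservoir A f c n) x")
    case True
    then show ?thesis by (simp add: diff_add_cancel_ennreal)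
  next
    case False
    then show ?thesis by (simp add: add_increasing)
  qed
  finally have "ksums A f (Suc n) x \<le> reservoir A f c (Suc n) x + c + of_nat n * c"
    by (simp only: add_right_mono)
  then show ?case by (simp only: of_nat_Suc distrib_right mult_1 add_ac)
qed simp

lemma ksums_add: "ksums A (\<lambda>x. f x + g x) n x = ksums A f n x + ksums A g n x"
proof (induction n arbitrary: x)
  case (Suc n)
  then have "ksums A (\<lambda>x. f x + g x) n = (\<lambda>x. ksums A f n x + ksums A g n x)" by (intro ext)
  then show ?case by (simp add: kapp_add ac_simps)
qed simp

lemma ksums_mono: "(\<And>x. f x \<le> g x) \<Longrightarrow> ksums A f n x \<le> ksums A g n x"
proof (induction n arbitrary: x)
  case (Suc n)
  then show ?case by (auto intro!: add_mono kapp_mono)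
qed simp

lemma ksums_const_le:
  assumes "\<And>x. kapp A (\<lambda>_. 1) x \<le> 1"
  shows "ksums A (\<lambda>_. c) n x \<le> of_nat n * c"
proof (induction n arbitrary: x)
  case (Suc n)
  have "kapp A (ksums A (\<lambda>_. c) n) x \<le> kapp A (\<lambda>_. 1 * (of_nat n * c)) x"
    using Suc by (intro kapp_mono) auto
  also have "\<dots> \<le> 1 * (of_nat n * c)"
    unfolding kapp_multc by (intro mult_right_mono assms) simp
  finally show ?case by (simp add: distrib_right add_left_mono)
qed simp

lemma ennreal_divide_of_nat_Suc: "x / of_nat (Suc n) \<le> y \<longleftrightarrow> x \<le> of_nat (Suc n) * (y :: ennreal)"
proof -
  have "of_nat (Suc n) * (x / of_nat (Suc n)) = x"
    by (metis ennreal_mult_divide_eq ennreal_times_divide mult.commute of_nat_neq_0 ennreal_of_nat_neq_top)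
  then show ?thesis
    by (metis divide_right_mono_ennreal mult_left_mono zero_le ennreal_mult_divide_eq mult.commute of_nat_neq_0 ennreal_of_nat_neq_top)
qed

text \<open>Truncation: the part of \<open>f\<close> up to level \<open>c\<close> contributes
  averages of at most \<open>c\<close>.\<close>

lemma kmaxavg_split:
  assumes "\<And>x. kapp A (\<lambda>_. 1) x \<le> 1" "\<And>x. f x \<le> c + h x"
  shows "kmaxavg A f x \<le> c + kmaxavg A h x"
  unfolding kmaxavg_def[of A f]
proof (rule SUP_least)
  fix n
  have "ksums A f (Suc n) x \<le> ksums A (\<lambda>x. c + h x) (Suc n) x"
    using assms(2) by (rule ksums_mono)
  also have "\<dots> \<le> of_nat (Suc n) * c + of_nat (Suc n) * kmaxavg A h x"
    unfolding ksums_add by (intro add_mono ksums_const_le assms(1) ksums_le_kmaxavg)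
  finally show "ksums A f (Suc n) x / of_nat (Suc n) \<le> c + kmaxavg A h x"
    unfolding ennreal_divide_of_nat_Suc distrib_left .
qed

lemma kmaxavg_gr_reservoir:
  assumes "\<And>x. kapp A (\<lambda>_. 1) x \<le> 1" "c \<noteq> \<top>" "c < kmaxavg A f x"
  shows "\<exists>n. 0 < reservoir A f c n x"
proof -
  obtain n where "c < ksums A f (Suc n) x / of_nat (Suc n)"
    using assms(3) unfolding kmaxavg_def less_SUP_iff by blast
  then have "\<not> ksums A f (Suc n) x \<le> of_nat (Suc n) * c"
    unfolding ennreal_divide_of_nat_Suc[symmetric] by simp
  then have "0 < reservoir A f c (Suc n) x"
    using ksums_le_reservoir[OF assms(1,2), of f "Suc n" x] by (metis add_0 gr_zeroI)
  then show ?thesis by blast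
qed

context stationary_env
begin

lemma reservoir_sfield: "skernel A \<Longrightarrow> sfield f \<Longrightarrow> sfield (\<lambda>\<omega>. reservoir (A \<omega>) (f \<omega>) c n)"
proof (induction n)
  case 0
  show ?case by (simp add: sfield_const)
next
  case (Suc n)
  show ?case
    unfolding reservoir.simps
    by (rule sfield_diff[OF sfield_add[OF Suc.prems(2) skernel_kapp[OF Suc.prems(1) Suc.IH[OF Suc.prems]]] sfield_const])
qed

text \<open>The measure w(0) dP is subinvariant for the environment seen from the chain: mass
  transport moves the kernel to the other side, where reversibility turns the column sum into a row
  sum.\<close>

lemma weighted_invariance:
  assumes A: "skernel A" and w: "sfield w" and f: "sfield f"
    and sym: "\<And>\<omega>. \<omega> \<in> space P \<Longrightarrow> ksym (w \<omega>) (A \<omega>)"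
    and one: "\<And>\<omega> x. \<omega> \<in> space P \<Longrightarrow> kapp (A \<omega>) (\<lambda>_. 1) x \<le> 1"
  shows "(\<integral>\<^sup>+\<omega>. w \<omega> 0 * kapp (A \<omega>) (f \<omega>) 0 \<partial>P) \<le> (\<integral>\<^sup>+\<omega>. w \<omega> 0 * f \<omega> 0 \<partial>P)"
proof -
  let ?B = "\<lambda>\<omega> x y. w \<omega> x * (A \<omega> x y * f \<omega> y)"
  have B: "skernel ?B"
    by (intro skernel_mult skernel_left skernel_right w f A)
  have "(\<integral>\<^sup>+\<omega>. w \<omega> 0 * kapp (A \<omega>) (f \<omega>) 0 \<partial>P) = (\<integral>\<^sup>+\<omega>. (\<integral>\<^sup>+y. ?B \<omega> 0 y \<partial>count_space UNIV) \<partial>P)"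
    by (simp add: kapp_def nn_integral_cmult)
  also have "\<dots> = (\<integral>\<^sup>+\<omega>. (\<integral>\<^sup>+y. ?B \<omega> y 0 \<partial>count_space UNIV) \<partial>P)"
    by (rule mass_transport[OF B])
  also have "\<dots> \<le> (\<integral>\<^sup>+\<omega>. w \<omega> 0 * f \<omega> 0 \<partial>P)"
  proof (intro nn_integral_mono)
    fix \<omega> assume \<omega>: "\<omega> \<in> space P"
    have "?B \<omega> y 0 = (w \<omega> 0 * f \<omega> 0) * (A \<omega> 0 y * 1)" for y
      using ksymD[OF sym[OF \<omega>], of y 0] by (metis (no_types, lifting) mult.assoc mult.commute mult_1)
    then have "(\<integral>\<^sup>+y. ?B \<omega> y 0 \<partial>count_space UNIV) = (w \<omega> 0 * f \<omega> 0) * kapp (A \<omega>) (\<lambda>_. 1) 0"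
      unfolding kapp_def by (subst nn_integral_cmult[symmetric]) auto
    also have "\<dots> \<le> (w \<omega> 0 * f \<omega> 0) * 1"
      by (intro mult_left_mono one \<omega>) simp
    finally show "(\<integral>\<^sup>+y. ?B \<omega> y 0 \<partial>count_space UNIV) \<le> w \<omega> 0 * f \<omega> 0" by simp
  qed
  finally show ?thesis .
qed

text \<open>Hopf's maximal inequality. In one step the weighted content of the reservoir gains at
  most the input and loses \<open>c\<close> wherever it stays positive; as the content increases in
  n, the loss is bounded by the input.\<close>

lemma maximal_inequality:
  assumes A: "skernel A" and w: "sfield w" and f: "sfield f"
    and sym: "\<And>\<omega>. \<omega> \<in> space P \<Longrightarrow> ksym (w \<omega>) (A \<omega>)"
    and one: "\<And>\<omega> x. \<omega> \<in> space P \<Longrightarrow> kapp (A \<omega>) (\<lambda>_. 1) x \<le> 1"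
    and fin: "(\<integral>\<^sup>+\<omega>. w \<omega> 0 * f \<omega> 0 \<partial>P) < \<top>" and c: "c \<noteq> \<top>"
  shows "c * (\<integral>\<^sup>+\<omega>. w \<omega> 0 * (if c < kmaxavg (A \<omega>) (f \<omega>) 0 then 1 else 0) \<partial>P) \<le> (\<integral>\<^sup>+\<omega>. w \<omega> 0 * f \<omega> 0 \<partial>P)"
proof -
  let ?V = "\<lambda>n \<omega>. reservoir (A \<omega>) (f \<omega>) c n"
  have V: "sfield (?V n)" for n by (rule reservoir_sfield[OF A f])
  note [measurable] = sfield_meas[OF V] sfield_meas[OF w] sfield_meas[OF f]
    sfield_meas[OF skernel_kapp[OF A V]] sfield_meas[OF sfield_kmaxavg[OF A f]]
  define I where "I n = (\<integral>\<^sup>+\<omega>. w \<omega> 0 * ?V n \<omega> 0 \<partial>P)" for n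
  let ?F = "\<integral>\<^sup>+\<omega>. w \<omega> 0 * f \<omega> 0 \<partial>P"
  have step: "I (Suc n) + c * (\<integral>\<^sup>+\<omega>. w \<omega> 0 * (if 0 < ?V (Suc n) \<omega> 0 then 1 else 0) \<partial>P) \<le> ?F + I n" for n
  proof -
    have "I (Suc n) + c * (\<integral>\<^sup>+\<omega>. w \<omega> 0 * (if 0 < ?V (Suc n) \<omega> 0 then 1 else 0) \<partial>P)
        = (\<integral>\<^sup>+\<omega>. w \<omega> 0 * ?V (Suc n) \<omega> 0 + c * (w \<omega> 0 * (if 0 < ?V (Suc n) \<omega> 0 then 1 else 0)) \<partial>P)"
      unfolding I_def by (subst nn_integral_add) (measurable, simp add: nn_integral_cmult del: reservoir.simps)
    also have "\<dots> \<le> (\<integral>\<^sup>+\<omega>. w \<omega> 0 * f \<omega> 0 + w \<omega> 0 * kapp (A \<omega>) (?V n \<omega>) 0 \<partial>P)"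
    proof (intro nn_integral_mono)
      fix \<omega>
      let ?y = "f \<omega> 0 + kapp (A \<omega>) (?V n \<omega>) 0"
      have *: "?V (Suc n) \<omega> 0 + c * (if 0 < ?V (Suc n) \<omega> 0 then 1 else 0) \<le> ?y"
      proof (cases "c \<le> ?y")
        case True
        then have "?V (Suc n) \<omega> 0 + c = ?y" by (simp add: diff_add_cancel_ennreal)
        then show ?thesis by (auto simp del: reservoir.simps intro: order_trans[OF _ eq_refl])
      next
        case False
        then have "?V (Suc n) \<omega> 0 = 0" by (auto intro!: diff_eq_0_ennreal simp: not_le less_imp_le intro: order_less_le_trans[OF _ top_greatest])
        then show ?thesis by (simp del: reservoir.simps)
      qed
      have "w \<omega> 0 * ?V (Suc n) \<omega> 0 + c * (w \<omega> 0 * (if 0 < ?V (Suc n) \<omega> 0 then 1 else 0))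
          = w \<omega> 0 * (?V (Suc n) \<omega> 0 + c * (if 0 < ?V (Suc n) \<omega> 0 then 1 else 0))"
        unfolding distrib_left by (simp only: mult.left_commute)
      also have "\<dots> \<le> w \<omega> 0 * ?y" using * by (rule mult_left_mono) simp
      finally show "w \<omega> 0 * ?V (Suc n) \<omega> 0 + c * (w \<omega> 0 * (if 0 < ?V (Suc n) \<omega> 0 then 1 else 0))
          \<le> w \<omega> 0 * f \<omega> 0 + w \<omega> 0 * kapp (A \<omega>) (?V n \<omega>) 0"
        unfolding distrib_left .
    qed
    also have "\<dots> = ?F + (\<integral>\<^sup>+\<omega>. w \<omega> 0 * kapp (A \<omega>) (?V n \<omega>) 0 \<partial>P)"
      by (rule nn_integral_add) measurable
    also have "\<dots> \<le> ?F + I n"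
      unfolding I_def by (intro add_left_mono weighted_invariance A w V sym one)
    finally show ?thesis .
  qed
  \<comment> \<open>Finiteness of the content is what permits cancelling it in
    \<open>ennreal\<close>.\<close>
  have Ifin: "I n < \<top>" for n
  proof (induction n)
    case (Suc n)
    have "I (Suc n) \<le> ?F + I n" by (rule order_trans[OF _ step]) (simp add: add_increasing2)
    also have "\<dots> < \<top>" using Suc fin by simp
    finally show ?case .
  qed (simp add: I_def)
  have Imono: "I n \<le> I (Suc n)" for n
    unfolding I_def by (intro nn_integral_mono mult_left_mono reservoir_mono) simp
  have pos: "c * (\<integral>\<^sup>+\<omega>. w \<omega> 0 * (if 0 < ?V (Suc n) \<omega> 0 then 1 else 0) \<partial>P) \<le> ?F" for n
  proof -
    have "I (Suc n) + c * (\<integral>\<^sup>+\<omega>. w \<omega> 0 * (if 0 < ?V (Suc n) \<omega> 0 then 1 else 0) \<partial>P) \<le> I (Suc n) + ?F"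
    proof -
      have "?F + I n \<le> I (Suc n) + ?F" unfolding add.commute[of ?F] by (rule add_right_mono[OF Imono])
      with step[of n] show ?thesis by (rule order_trans)
    qed
    then show ?thesis using Ifin[of "Suc n"] by (simp only: ennreal_add_left_cancel_le) auto
  qed
  have "(\<integral>\<^sup>+\<omega>. w \<omega> 0 * (if c < kmaxavg (A \<omega>) (f \<omega>) 0 then 1 else 0) \<partial>P)
      \<le> (\<integral>\<^sup>+\<omega>. (SUP n. w \<omega> 0 * (if 0 < ?V (Suc n) \<omega> 0 then 1 else 0)) \<partial>P)"
  proof (intro nn_integral_mono)
    fix \<omega> assume \<omega>: "\<omega> \<in> space P"
    show "w \<omega> 0 * (if c < kmaxavg (A \<omega>) (f \<omega>) 0 then 1 else 0) \<le> (SUP n. w \<omega> 0 * (if 0 < ?V (Suc n) \<omega> 0 then 1 else 0))"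
    proof (cases "c < kmaxavg (A \<omega>) (f \<omega>) 0")
      case True
      obtain n where "0 < ?V n \<omega> 0" using kmaxavg_gr_reservoir[OF one[OF \<omega>] c True] by blast
      then have "0 < ?V (Suc n) \<omega> 0" using reservoir_mono by (rule less_le_trans)
      then show ?thesis using True by (intro SUP_upper2[of n]) (auto simp del: reservoir.simps)
    qed simp
  qed
  also have "\<dots> = (SUP n. \<integral>\<^sup>+\<omega>. w \<omega> 0 * (if 0 < ?V (Suc n) \<omega> 0 then 1 else 0) \<partial>P)"
  proof (rule nn_integral_monotone_convergence_SUP)
    show "incseq (\<lambda>n \<omega>. w \<omega> 0 * (if 0 < ?V (Suc n) \<omega> 0 then 1 else 0))"
    proof (intro incseq_SucI le_funI mult_left_mono)
      fix n \<omega>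
      show "(if 0 < ?V (Suc n) \<omega> 0 then 1 else 0 :: ennreal) \<le> (if 0 < ?V (Suc (Suc n)) \<omega> 0 then 1 else 0)"
        using less_le_trans[OF _ reservoir_mono[of "A \<omega>" "f \<omega>" c "Suc n" 0]] by (auto simp del: reservoir.simps)
    qed simp
  qed measurable
  finally have "c * (\<integral>\<^sup>+\<omega>. w \<omega> 0 * (if c < kmaxavg (A \<omega>) (f \<omega>) 0 then 1 else 0) \<partial>P)
      \<le> c * (SUP n. \<integral>\<^sup>+\<omega>. w \<omega> 0 * (if 0 < ?V (Suc n) \<omega> 0 then 1 else 0) \<partial>P)"
    by (rule mult_left_mono) simp
  also have "\<dots> = (SUP n. c * (\<integral>\<^sup>+\<omega>. w \<omega> 0 * (if 0 < ?V (Suc n) \<omega> 0 then 1 else 0) \<partial>P))"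
    by (rule SUP_mult_left_ennreal)
  also have "\<dots> \<le> ?F" by (intro SUP_least pos)
  finally show ?thesis .
qed

text \<open>Apply the maximal inequality to f restricted to f > k, whose maximal average exceeds k
  whenever that of f exceeds 2k. Any power of decay results, because k^p <= f^p where f > k.\<close>

lemma kmaxavg_tail:
  assumes A: "skernel A" and w: "sfield w" and f: "sfield f"
    and sym: "\<And>\<omega>. \<omega> \<in> space P \<Longrightarrow> ksym (w \<omega>) (A \<omega>)"
    and one: "\<And>\<omega> x. \<omega> \<in> space P \<Longrightarrow> kapp (A \<omega>) (\<lambda>_. 1) x \<le> 1"
    and fin: "(\<integral>\<^sup>+\<omega>. w \<omega> 0 * f \<omega> 0 \<partial>P) < \<top>"
  shows "of_nat k ^ Suc p * (\<integral>\<^sup>+\<omega>. w \<omega> 0 * (if 2 * of_nat k < kmaxavg (A \<omega>) (f \<omega>) 0 then 1 else 0) \<partial>P)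
    \<le> (\<integral>\<^sup>+\<omega>. w \<omega> 0 * f \<omega> 0 ^ Suc p \<partial>P)"
proof -
  define h where "h \<omega> x = (if of_nat k < f \<omega> x then f \<omega> x else 0)" for \<omega> x
  note [measurable] = sfield_meas[OF f] sfield_meas[OF w]
  have h: "sfield h"
  proof (rule sfieldI)
    show "(\<lambda>\<omega>. h \<omega> x) \<in> borel_measurable P" for x unfolding h_def by measurable
  qed (simp add: h_def sfield_shift[OF f])
  note [measurable] = sfield_meas[OF sfield_kmaxavg[OF A f]] sfield_meas[OF sfield_kmaxavg[OF A h]] sfield_meas[OF h]
  have hf: "h \<omega> x \<le> f \<omega> x" "f \<omega> x \<le> of_nat k + h \<omega> x" for \<omega> x
    by (auto simp: h_def)
  have "(\<integral>\<^sup>+\<omega>. w \<omega> 0 * h \<omega> 0 \<partial>P) \<le> (\<integral>\<^sup>+\<omega>. w \<omega> 0 * f \<omega> 0 \<partial>P)"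
    by (intro nn_integral_mono mult_left_mono hf) simp
  then have finh: "(\<integral>\<^sup>+\<omega>. w \<omega> 0 * h \<omega> 0 \<partial>P) < \<top>" using fin by (rule le_less_trans)
  have "(\<integral>\<^sup>+\<omega>. w \<omega> 0 * (if 2 * of_nat k < kmaxavg (A \<omega>) (f \<omega>) 0 then 1 else 0) \<partial>P)
      \<le> (\<integral>\<^sup>+\<omega>. w \<omega> 0 * (if of_nat k < kmaxavg (A \<omega>) (h \<omega>) 0 then 1 else 0) \<partial>P)"
  proof (intro nn_integral_mono mult_left_mono)
    fix \<omega> assume \<omega>: "\<omega> \<in> space P"
    have "of_nat k < kmaxavg (A \<omega>) (h \<omega>) 0" if a: "2 * of_nat k < kmaxavg (A \<omega>) (f \<omega>) 0"
    proof (rule ccontr)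
      assume "\<not> of_nat k < kmaxavg (A \<omega>) (h \<omega>) 0"
      then have "of_nat k + kmaxavg (A \<omega>) (h \<omega>) 0 \<le> of_nat k + of_nat k" by (intro add_left_mono) simp
      then have "kmaxavg (A \<omega>) (f \<omega>) 0 \<le> of_nat k + of_nat k"
        using kmaxavg_split[where A="A \<omega>" and f="f \<omega>" and c="of_nat k" and h="h \<omega>" and x=0] one[OF \<omega>] hf(2)
        by (meson order_trans)
      then show False using a by (simp add: mult_2)
    qed
    then show "(if 2 * of_nat k < kmaxavg (A \<omega>) (f \<omega>) 0 then 1 else 0 :: ennreal)
        \<le> (if of_nat k < kmaxavg (A \<omega>) (h \<omega>) 0 then 1 else 0)" by auto
  qed simp
  then have "of_nat k ^ Suc p * (\<integral>\<^sup>+\<omega>. w \<omega> 0 * (if 2 * of_nat k < kmaxavg (A \<omega>) (f \<omega>) 0 then 1 else 0) \<partial>P)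
      \<le> of_nat k ^ p * (of_nat k * (\<integral>\<^sup>+\<omega>. w \<omega> 0 * (if of_nat k < kmaxavg (A \<omega>) (h \<omega>) 0 then 1 else 0) \<partial>P))"
    unfolding power_Suc2 mult.assoc by (intro mult_left_mono) auto
  also have "\<dots> \<le> of_nat k ^ p * (\<integral>\<^sup>+\<omega>. w \<omega> 0 * h \<omega> 0 \<partial>P)"
    by (intro mult_left_mono maximal_inequality[OF A w h sym one finh]) auto
  also have "\<dots> = (\<integral>\<^sup>+\<omega>. of_nat k ^ p * (w \<omega> 0 * h \<omega> 0) \<partial>P)"
    by (rule nn_integral_cmult[symmetric]) measurable
  also have "\<dots> \<le> (\<integral>\<^sup>+\<omega>. w \<omega> 0 * f \<omega> 0 ^ Suc p \<partial>P)"
  proof (intro nn_integral_mono)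
    fix \<omega>
    have "of_nat k ^ p * h \<omega> 0 \<le> f \<omega> 0 ^ p * f \<omega> 0"
    proof (cases "of_nat k < f \<omega> 0")
      case True
      then show ?thesis unfolding h_def by (auto intro!: mult_right_mono power_mono)
    qed (simp add: h_def)
    then have "w \<omega> 0 * (of_nat k ^ p * h \<omega> 0) \<le> w \<omega> 0 * (f \<omega> 0 ^ p * f \<omega> 0)" by (rule mult_left_mono) simp
    then show "of_nat k ^ p * (w \<omega> 0 * h \<omega> 0) \<le> w \<omega> 0 * f \<omega> 0 ^ Suc p"
      by (simp only: power_Suc2 mult.left_commute)
  qed
  finally show ?thesis .
qed

end

lemma suminf_inverse_squares_finite: "(\<Sum>k. ennreal (1 / real (Suc k) ^ 2)) < \<top>"
proof -
  have "summable (\<lambda>k. 1 / real (Suc k) ^ 2)"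
    using inverse_power_summable[of 2, where 'a=real] summable_Suc_iff[of "\<lambda>n. inverse (real n ^ 2)"]
    by (simp add: inverse_eq_divide)
  then show ?thesis by (subst suminf_ennreal_eq[OF _ summable_sums]) auto
qed

text \<open>The levels are those of the tail bound: if 2(k+1) < x <= 2(k+2), the term with index k
  alone dominates x^q. For infinite x all terms are at least 1 and the series diverges.\<close>

lemma ennreal_power_le_levels:
  "(x::ennreal) ^ q \<le> 2 ^ q + (\<Sum>k. of_nat (2 * (k + 2)) ^ q * (if 2 * of_nat (Suc k) < x then 1 else 0))"
proof (cases "x \<le> 2")
  case True
  then have "x ^ q \<le> 2 ^ q" by (intro power_mono) auto
  then show ?thesis by (simp add: add_increasing2)
next
  case gt2: False
  let ?t = "\<lambda>k. of_nat (2 * (k + 2)) ^ q * (if 2 * of_nat (Suc k) < x then 1 else 0 :: ennreal)"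
  show ?thesis
  proof (cases "x = \<top>")
    case True
    have "of_nat n \<le> (\<Sum>k. ?t k)" for n
    proof -
      have "of_nat n = (\<Sum>k<n. 1 :: ennreal)" by simp
      also have "\<dots> \<le> (\<Sum>k<n. ?t k)"
      proof (intro sum_mono)
        fix k
        have "(of_nat 1 :: ennreal) \<le> of_nat (2 * (k + 2))" by (rule of_nat_mono) simp
        then have "(1::ennreal) \<le> of_nat (2 * (k + 2))" unfolding of_nat_1 .
        then have "(1::ennreal) \<le> of_nat (2 * (k + 2)) ^ q" by (rule one_le_power)
        moreover have "2 * of_nat (Suc k) < x" using True by (simp only: ennreal_mult_less_top) (simp add: of_nat_less_top del: of_nat_Suc)
        ultimately show "1 \<le> ?t k" by simp
      qed
      also have "\<dots> \<le> (\<Sum>k. ?t k)" by (intro sum_le_suminf) auto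
      finally show ?thesis .
    qed
    then have "(SUP n. of_nat n :: ennreal) \<le> (\<Sum>k. ?t k)" by (intro SUP_least)
    then have "(\<Sum>k. ?t k) = \<top>" by (simp add: ennreal_SUP_of_nat_eq_top top_unique)
    then show ?thesis by simp
  next
    case False
    obtain m where m: "x \<le> of_nat m"
      using False ennreal_Ex_less_of_nat[of x] by (metis less_imp_le top.not_eq_extremum infinity_ennreal_def)
    define n where "n = (LEAST n. x \<le> of_nat (2 * n))"
    have "x \<le> of_nat (2 * m)" using m by (rule order_trans) (simp del: of_nat_mult)
    then have n: "x \<le> of_nat (2 * n)" unfolding n_def by (rule LeastI)
    have "n \<noteq> 0"
    proof
      assume "n = 0"
      with n gt2 show False by simp
    qed
    moreover have "n \<noteq> 1"
    proof
      assume "n = 1"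
      with n gt2 show False by simp
    qed
    ultimately obtain k where k: "n = k + 2" by (metis One_nat_def add_2_eq_Suc' not0_implies_Suc)
    have "\<not> x \<le> of_nat (2 * Suc k)" unfolding n_def using not_less_Least[of "Suc k" "\<lambda>n. x \<le> of_nat (2 * n)"] k n_def by simp
    then have lt: "2 * of_nat (Suc k) < x" by (simp only: not_le of_nat_mult of_nat_numeral)
    have "x ^ q \<le> of_nat (2 * (k + 2)) ^ q" using n k by (intro power_mono) auto
    also have "\<dots> = (\<Sum>k\<in>{k}. ?t k)" using lt by (simp del: of_nat_mult of_nat_add of_nat_Suc)
    also have "\<dots> \<le> (\<Sum>k. ?t k)" by (intro sum_le_suminf) auto
    finally show ?thesis by (simp add: add_increasing)
  qed
qed

context stationary_env
begin

text \<open>The tail bound with power q + 2 leaves a factor 1 / (k+1)^2 to sum over the levels; 4^q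
  absorbs the ratio of 2(k+2) to k + 1.\<close>

lemma kmaxavg_moment:
  assumes A: "skernel A" and w: "sfield w" and f: "sfield f"
    and sym: "\<And>\<omega>. \<omega> \<in> space P \<Longrightarrow> ksym (w \<omega>) (A \<omega>)"
    and one: "\<And>\<omega> x. \<omega> \<in> space P \<Longrightarrow> kapp (A \<omega>) (\<lambda>_. 1) x \<le> 1"
    and fin: "\<And>p. (\<integral>\<^sup>+\<omega>. w \<omega> 0 * f \<omega> 0 ^ p \<partial>P) < \<top>"
  shows "(\<integral>\<^sup>+\<omega>. w \<omega> 0 * kmaxavg (A \<omega>) (f \<omega>) 0 ^ q \<partial>P) < \<top>"
proof -
  let ?M = "\<lambda>\<omega>. kmaxavg (A \<omega>) (f \<omega>) 0"
  note [measurable] = sfield_meas[OF w] sfield_meas[OF sfield_kmaxavg[OF A f]]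
  let ?t = "\<lambda>k. \<integral>\<^sup>+\<omega>. w \<omega> 0 * (if 2 * of_nat (Suc k) < ?M \<omega> then 1 else 0) \<partial>P"
  let ?F = "\<integral>\<^sup>+\<omega>. w \<omega> 0 * f \<omega> 0 ^ Suc (Suc q) \<partial>P"
  have t: "of_nat (2 * (k + 2)) ^ q * ?t k \<le> 4 ^ q * ?F * ennreal (1 / real (Suc k) ^ 2)" for k
  proof -
    let ?K = "of_nat (Suc k) :: ennreal"
    have K: "?K ^ 2 * ennreal (1 / real (Suc k) ^ 2) = 1"
      by (simp add: ennreal_of_nat_eq_real_of_nat ennreal_power ennreal_mult[symmetric] del: of_nat_Suc)
    have "?K ^ Suc (Suc q) * ?t k \<le> ?F"
      using fin[of 1] by (intro kmaxavg_tail[OF A w f sym one]) auto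
    then have le: "?K ^ q * ?t k * ?K ^ 2 \<le> ?F"
      by (simp add: power2_eq_square ac_simps)
    have "?K ^ q * ?t k = ?K ^ q * ?t k * (?K ^ 2 * ennreal (1 / real (Suc k) ^ 2))"
      unfolding K by simp
    also have "\<dots> = (?K ^ q * ?t k * ?K ^ 2) * ennreal (1 / real (Suc k) ^ 2)"
      by (simp only: mult.assoc)
    also have "\<dots> \<le> ?F * ennreal (1 / real (Suc k) ^ 2)"
      using le by (rule mult_right_mono) simp
    finally have *: "?K ^ q * ?t k \<le> ?F * ennreal (1 / real (Suc k) ^ 2)" .
    have "(of_nat (2 * (k + 2)) :: ennreal) \<le> of_nat (4 * Suc k)" by (subst of_nat_le_iff) simp
    then have "(of_nat (2 * (k + 2)) :: ennreal) ^ q \<le> (4 * ?K) ^ q" by (intro power_mono) auto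
    then have "of_nat (2 * (k + 2)) ^ q * ?t k \<le> (4 * ?K) ^ q * ?t k" by (rule mult_right_mono) simp
    also have "\<dots> = 4 ^ q * (?K ^ q * ?t k)" by (simp only: power_mult_distrib mult.assoc)
    also have "\<dots> \<le> 4 ^ q * (?F * ennreal (1 / real (Suc k) ^ 2))" using * by (rule mult_left_mono) simp
    finally show ?thesis by (simp only: mult.assoc)
  qed
  have "(\<integral>\<^sup>+\<omega>. w \<omega> 0 * ?M \<omega> ^ q \<partial>P)
      \<le> (\<integral>\<^sup>+\<omega>. w \<omega> 0 * 2 ^ q + (\<Sum>k. of_nat (2 * (k + 2)) ^ q * (w \<omega> 0 * (if 2 * of_nat (Suc k) < ?M \<omega> then 1 else 0))) \<partial>P)"
  proof (intro nn_integral_mono)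
    fix \<omega>
    have "w \<omega> 0 * ?M \<omega> ^ q \<le> w \<omega> 0 * (2 ^ q + (\<Sum>k. of_nat (2 * (k + 2)) ^ q * (if 2 * of_nat (Suc k) < ?M \<omega> then 1 else 0)))"
      by (intro mult_left_mono ennreal_power_le_levels) simp
    also have "\<dots> = w \<omega> 0 * 2 ^ q + (\<Sum>k. of_nat (2 * (k + 2)) ^ q * (w \<omega> 0 * (if 2 * of_nat (Suc k) < ?M \<omega> then 1 else 0)))"
      unfolding distrib_left ennreal_suminf_cmult[symmetric] by (simp only: mult.left_commute)
    finally show "w \<omega> 0 * ?M \<omega> ^ q \<le> \<dots>" .
  qed
  also have "\<dots> = (\<integral>\<^sup>+\<omega>. w \<omega> 0 * 2 ^ q \<partial>P) + (\<Sum>k. of_nat (2 * (k + 2)) ^ q * ?t k)"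
    by (subst nn_integral_add, measurable) (simp add: nn_integral_suminf nn_integral_cmult del: of_nat_Suc of_nat_mult of_nat_add)
  also have "\<dots> \<le> (\<integral>\<^sup>+\<omega>. w \<omega> 0 * 2 ^ q \<partial>P) + (\<Sum>k. 4 ^ q * ?F * ennreal (1 / real (Suc k) ^ 2))"
    by (intro add_left_mono suminf_le t) auto
  also have "\<dots> = (\<integral>\<^sup>+\<omega>. w \<omega> 0 * f \<omega> 0 ^ 0 \<partial>P) * 2 ^ q + 4 ^ q * ?F * (\<Sum>k. ennreal (1 / real (Suc k) ^ 2))"
    by (simp add: nn_integral_multc ennreal_suminf_cmult)
  also have "\<dots> < \<top>"
    using fin[of 0] fin[of "Suc (Suc q)"] suminf_inverse_squares_finite
    by (simp only: ennreal_add_less_top ennreal_mult_less_top power_less_top_ennreal) (auto simp: ennreal_mult_less_top)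
  finally show ?thesis .
qed

end

section \<open>Distances and holes\<close>

definition l1 :: "'d::finite site \<Rightarrow> 'd site \<Rightarrow> nat" where
  "l1 x y = nat (\<Sum>i\<in>UNIV. \<bar>x $ i - y $ i\<bar>)"

lemma int_l1: "int (l1 x y) = (\<Sum>i\<in>UNIV. \<bar>x $ i - y $ i\<bar>)"
  unfolding l1_def by (simp add: sum_nonneg)

lemma neighbor_l1: "neighbor x y \<longleftrightarrow> l1 x y = 1"
  unfolding neighbor_def int_l1[symmetric] by simp

lemma l1_triangle: "l1 x z \<le> l1 x y + l1 y z"
proof -
  have "int (l1 x z) \<le> (\<Sum>i\<in>UNIV. \<bar>x $ i - y $ i\<bar> + \<bar>y $ i - z $ i\<bar>)"
    unfolding int_l1 by (intro sum_mono) auto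
  then show ?thesis by (simp add: sum.distrib int_l1[symmetric])
qed

lemma l1_ball:
  fixes R :: nat
  shows "finite {y :: 'd::finite site. l1 0 y \<le> R}" "card {y :: 'd site. l1 0 y \<le> R} \<le> (2 * R + 1) ^ CARD('d)"
proof -
  let ?S = "(UNIV :: 'd set) \<rightarrow>\<^sub>E {- int R..int R}"
  have sub: "vec_nth ` {y :: 'd site. l1 0 y \<le> R} \<subseteq> ?S"
  proof safe
    fix y :: "'d site" and i assume "l1 0 y \<le> R"
    then have "(\<Sum>i\<in>UNIV. \<bar>y $ i\<bar>) \<le> int R" using int_l1[of 0 y] by simp
    then have "\<bar>y $ i\<bar> \<le> int R" using member_le_sum[of i UNIV "\<lambda>i. \<bar>y $ i\<bar>"] by simp
    then show "y $ i \<in> {- int R..int R}" by auto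
  qed auto
  have fin: "finite ?S" by (intro finite_PiE) auto
  have inj: "inj_on vec_nth {y :: 'd site. l1 0 y \<le> R}" by (auto simp: inj_on_def vec_eq_iff)
  show "finite {y :: 'd site. l1 0 y \<le> R}"
    using finite_subset[OF sub fin] inj by (rule finite_imageD)
  have "card {y :: 'd site. l1 0 y \<le> R} = card (vec_nth ` {y :: 'd site. l1 0 y \<le> R})"
    by (simp add: card_image[OF inj])
  also have "\<dots> \<le> card ?S" using fin sub by (rule card_mono)
  also have "\<dots> = (2 * R + 1) ^ CARD('d)" by (simp add: card_PiE nat_add_distrib nat_mult_distrib)
  finally show "card {y :: 'd site. l1 0 y \<le> R} \<le> (2 * R + 1) ^ CARD('d)" .
qed

text \<open>The exponent: a ball of radius R has at most (2R+1)^d points, and two further powers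
  make the sum over R converge. The weight serves to replace a value at a random site by a sum over
  all sites.\<close>

definition decay :: "'d::finite site \<Rightarrow> ennreal" where
  "decay y = ennreal (1 / real (Suc (l1 0 y)) ^ (CARD('d) + 2))"

lemma decay_summable: "(\<integral>\<^sup>+y. decay (y :: 'd::finite site) \<partial>count_space UNIV) < \<top>"
proof -
  let ?d = "CARD('d)"
  have "(\<integral>\<^sup>+y. decay (y :: 'd site) \<partial>count_space UNIV)
      \<le> (\<integral>\<^sup>+y. (\<Sum>R. ennreal (1 / real (Suc R) ^ (?d + 2)) * indicator {y :: 'd site. l1 0 y \<le> R \<and> R \<le> l1 0 y} y) \<partial>count_space UNIV)"
  proof (intro nn_integral_mono)
    fix y :: "'d site"
    have "decay y = (\<Sum>R\<in>{l1 0 y}. ennreal (1 / real (Suc R) ^ (?d + 2)) * indicator {y :: 'd site. l1 0 y \<le> R \<and> R \<le> l1 0 y} y)"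
      by (simp add: decay_def)
    also have "\<dots> \<le> (\<Sum>R. ennreal (1 / real (Suc R) ^ (?d + 2)) * indicator {y :: 'd site. l1 0 y \<le> R \<and> R \<le> l1 0 y} y)"
      by (intro sum_le_suminf) auto
    finally show "decay y \<le> \<dots>" .
  qed
  also have "\<dots> = (\<Sum>R. ennreal (1 / real (Suc R) ^ (?d + 2)) * emeasure (count_space UNIV) {y :: 'd site. l1 0 y \<le> R \<and> R \<le> l1 0 y})"
    by (simp add: nn_integral_suminf nn_integral_cmult)
  also have "\<dots> \<le> (\<Sum>R. 2 ^ ?d * ennreal (1 / real (Suc R) ^ 2))"
  proof (intro suminf_le)
    fix R
    have "{y :: 'd site. l1 0 y \<le> R \<and> R \<le> l1 0 y} \<subseteq> {y. l1 0 y \<le> R}" by auto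
    then have "emeasure (count_space UNIV) {y :: 'd site. l1 0 y \<le> R \<and> R \<le> l1 0 y} \<le> emeasure (count_space UNIV) {y :: 'd site. l1 0 y \<le> R}"
      by (intro emeasure_mono) auto
    also have "\<dots> = ennreal (real (card {y :: 'd site. l1 0 y \<le> R}))"
      by (simp add: emeasure_count_space_finite l1_ball ennreal_of_nat_eq_real_of_nat)
    also have "\<dots> \<le> ennreal ((2 * real (Suc R)) ^ ?d)"
    proof (intro ennreal_leI)
      have "real (card {y :: 'd site. l1 0 y \<le> R}) \<le> real ((2 * R + 1) ^ ?d)"
        using l1_ball(2)[where 'd='d, of R] by (rule of_nat_mono)
      also have "\<dots> \<le> (2 * real (Suc R)) ^ ?d"
        unfolding of_nat_power by (intro power_mono) auto
      finally show "real (card {y :: 'd site. l1 0 y \<le> R}) \<le> (2 * real (Suc R)) ^ ?d" .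
    qed
    finally have "ennreal (1 / real (Suc R) ^ (?d + 2)) * emeasure (count_space UNIV) {y :: 'd site. l1 0 y \<le> R \<and> R \<le> l1 0 y}
        \<le> ennreal (1 / real (Suc R) ^ (?d + 2)) * ennreal ((2 * real (Suc R)) ^ ?d)"
      by (rule mult_left_mono) simp
    also have "\<dots> = ennreal (2 ^ ?d * (1 / real (Suc R) ^ 2))"
      by (subst ennreal_mult[symmetric]) (auto simp: power_add power_mult_distrib power2_eq_square simp del: of_nat_Suc)
    also have "\<dots> = 2 ^ ?d * ennreal (1 / real (Suc R) ^ 2)"
      by (subst ennreal_mult) (auto simp: ennreal_power[symmetric])
    finally show "ennreal (1 / real (Suc R) ^ (?d + 2)) * emeasure (count_space UNIV) {y :: 'd site. l1 0 y \<le> R \<and> R \<le> l1 0 y}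
        \<le> 2 ^ ?d * ennreal (1 / real (Suc R) ^ 2)" .
  qed auto
  also have "\<dots> = 2 ^ ?d * (\<Sum>R. ennreal (1 / real (Suc R) ^ 2))" by (rule ennreal_suminf_cmult)
  also have "\<dots> < \<top>"
    using suminf_inverse_squares_finite by (simp add: ennreal_mult_less_top power_less_top_ennreal)
  finally show ?thesis .
qed

definition weak_edges :: "real \<Rightarrow> 'd::finite environment \<Rightarrow> ('d site \<times> 'd site) set" where
  "weak_edges \<alpha> \<omega> = {(u, v). neighbor u v \<and> u \<notin> strong_component \<alpha> \<omega> \<and> v \<notin> strong_component \<alpha> \<omega>}"

lemma hole_weak: "u \<notin> strong_component \<alpha> \<omega> \<Longrightarrow> hole \<alpha> \<omega> u = {v. (u, v) \<in> (weak_edges \<alpha> \<omega>)\<^sup>*}"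
  by (simp add: hole_def weak_edges_def)

lemma sym_weak_edges: "sym (weak_edges \<alpha> \<omega>)"
  by (auto simp: weak_edges_def sym_def neighbor_sym)

lemma weak_path_outside:
  "(u, v) \<in> (weak_edges \<alpha> \<omega>)\<^sup>* \<Longrightarrow> u \<notin> strong_component \<alpha> \<omega> \<Longrightarrow> v \<notin> strong_component \<alpha> \<omega>"
  by (induction rule: rtrancl_induct) (auto simp: weak_edges_def)

text \<open>Raising the threshold shrinks the strong component and so enlarges or merges the holes.
  Moment bounds at a good \<beta> above \<alpha> thereby pass to \<alpha>.\<close>

lemma adjacent_holes_mono:
  assumes "\<alpha> \<le> \<beta>"
  shows "adjacent_holes \<alpha> \<omega> x \<subseteq> adjacent_holes \<beta> \<omega> x"
proof -
  note C = strong_component_mono[OF assms, of \<omega>]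
  have "weak_edges \<alpha> \<omega> \<subseteq> weak_edges \<beta> \<omega>" using C by (auto simp: weak_edges_def)
  then have W: "(weak_edges \<alpha> \<omega>)\<^sup>* \<subseteq> (weak_edges \<beta> \<omega>)\<^sup>*" by (rule rtrancl_mono)
  have "hole \<alpha> \<omega> y \<subseteq> hole \<beta> \<omega> y" for y
  proof (cases "y \<in> strong_component \<alpha> \<omega>")
    case True
    then have "hole \<alpha> \<omega> y = {y}" by (simp add: hole_def)
    moreover have "y \<in> hole \<beta> \<omega> y" by (auto simp: hole_def)
    ultimately show ?thesis by simp
  next
    case False
    then have "y \<notin> strong_component \<beta> \<omega>" using C by auto
    then show ?thesis using False W by (auto simp: hole_weak)
  qed
  then show ?thesis by (auto simp: adjacent_holes_def)
qed

text \<open>A path that avoids the component strictly in between is a single step, or stays in one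
  hole between its first and its last step.\<close>

lemma taboo_support:
  assumes "taboo (walk \<omega>) (strong_component \<alpha> \<omega>) t x z \<noteq> 0"
  shows "neighbor x z \<or> (\<exists>u v. neighbor x u \<and> u \<notin> strong_component \<alpha> \<omega> \<and> (u, v) \<in> (weak_edges \<alpha> \<omega>)\<^sup>* \<and> neighbor v z)"
  using assms
proof (induction t arbitrary: z)
  case 0
  then show ?case using walk_nonzero by auto
next
  case (Suc t)
  let ?C = "strong_component \<alpha> \<omega>"
  obtain y where y: "kresr (- ?C) (taboo (walk \<omega>) ?C t) x y \<noteq> 0" "walk \<omega> y z \<noteq> 0"
    using Suc.prems unfolding taboo_Suc_right by (rule kcomp_nonzeroE)
  then have y': "taboo (walk \<omega>) ?C t x y \<noteq> 0" "y \<notin> ?C" "neighbor y z"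
    using walk_nonzero by (auto simp: kresr_def indicator_def split: if_splits)
  from Suc.IH[OF y'(1)] show ?case
  proof
    assume "neighbor x y"
    then show ?thesis using y' by blast
  next
    assume "\<exists>u v. neighbor x u \<and> u \<notin> ?C \<and> (u, v) \<in> (weak_edges \<alpha> \<omega>)\<^sup>* \<and> neighbor v y"
    then obtain u v where uv: "neighbor x u" "u \<notin> ?C" "(u, v) \<in> (weak_edges \<alpha> \<omega>)\<^sup>*" "neighbor v y" by blast
    then have "(v, y) \<in> weak_edges \<alpha> \<omega>" using weak_path_outside[OF uv(3,2)] y' by (simp add: weak_edges_def)
    then have "(u, y) \<in> (weak_edges \<alpha> \<omega>)\<^sup>*" using uv(3) by (rule rtrancl_into_rtrancl[rotated])
    then show ?thesis using uv y' by blast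
  qed
qed

lemma taboo_adjacent_holes:
  assumes "taboo (walk \<omega>) (strong_component \<alpha> \<omega>) t x z \<noteq> 0" "z \<notin> strong_component \<alpha> \<omega>"
  shows "z \<in> adjacent_holes \<alpha> \<omega> x"
  using taboo_support[OF assms(1)]
proof
  assume "neighbor x z"
  moreover have "z \<in> hole \<alpha> \<omega> z" by (auto simp: hole_def)
  ultimately show ?thesis by (auto simp: adjacent_holes_def)
next
  assume "\<exists>u v. neighbor x u \<and> u \<notin> strong_component \<alpha> \<omega> \<and> (u, v) \<in> (weak_edges \<alpha> \<omega>)\<^sup>* \<and> neighbor v z"
  then obtain u v where uv: "neighbor x u" "u \<notin> strong_component \<alpha> \<omega>" "(u, v) \<in> (weak_edges \<alpha> \<omega>)\<^sup>*" "neighbor v z" by blast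
  then have "(v, z) \<in> weak_edges \<alpha> \<omega>" using weak_path_outside[OF uv(3,2)] assms by (simp add: weak_edges_def)
  then have "(u, z) \<in> (weak_edges \<alpha> \<omega>)\<^sup>*" using uv(3) by (rule rtrancl_into_rtrancl[rotated])
  then show ?thesis using uv by (auto simp: adjacent_holes_def hole_weak)
qed

definition hole_size :: "real \<Rightarrow> 'd::finite environment \<Rightarrow> 'd site \<Rightarrow> ennreal" where
  "hole_size \<alpha> \<omega> x = emeasure (count_space UNIV) (adjacent_holes \<alpha> \<omega> x)"

lemma hole_size_integral: "hole_size \<alpha> \<omega> x = (\<integral>\<^sup>+y. indicator (adjacent_holes \<alpha> \<omega> x) y \<partial>count_space UNIV)"
  by (simp add: hole_size_def)

lemma hole_size_mono: "\<alpha> \<le> \<beta> \<Longrightarrow> hole_size \<alpha> \<omega> x \<le> hole_size \<beta> \<omega> x"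
  unfolding hole_size_def by (intro emeasure_mono adjacent_holes_mono) auto

text \<open>A connected set containing a neighbor of \<open>x\<close> and a point at distance \<open>n\<close> from \<open>x\<close> meets all
  intermediate spheres.\<close>

lemma weak_path_l1:
  assumes "(u, v) \<in> (weak_edges \<alpha> \<omega>)\<^sup>*" "neighbor x u"
  shows "{1..l1 x v} \<subseteq> l1 x ` {v. (u, v) \<in> (weak_edges \<alpha> \<omega>)\<^sup>*}"
  using assms(1)
proof (induction rule: rtrancl_induct)
  case base
  have "l1 x u \<in> l1 x ` {v. (u, v) \<in> (weak_edges \<alpha> \<omega>)\<^sup>*}" by (intro imageI) simp
  moreover have e: "l1 x u = 1" using assms(2) by (simp add: neighbor_l1)
  ultimately show ?case unfolding e by (simp only: atLeastAtMost_singleton insert_subset empty_subsetI simp_thms)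
next
  case (step y z)
  have "l1 y z = 1" using step.hyps(2) by (auto simp: weak_edges_def neighbor_l1)
  then have "l1 x z \<le> Suc (l1 x y)" using l1_triangle[of x z y] by simp
  then have "{1..l1 x z} \<subseteq> {1..l1 x y} \<union> {l1 x z}" by auto
  moreover have "l1 x z \<in> l1 x ` {v. (u, v) \<in> (weak_edges \<alpha> \<omega>)\<^sup>*}"
    using rtrancl_into_rtrancl[OF step.hyps] by (intro imageI) simp
  ultimately show ?case using step.IH by blast
qed

text \<open>A hole traversed up to some distance from x contains a site at each smaller positive
  distance, so its size bounds that distance; the final step adds 1.\<close>

lemma taboo_l1_le:
  assumes "taboo (walk \<omega>) (strong_component \<alpha> \<omega>) t x z \<noteq> 0"
  shows "of_nat (l1 x z) \<le> hole_size \<alpha> \<omega> x + 1"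
  using taboo_support[OF assms]
proof
  assume "neighbor x z"
  then show ?thesis by (simp add: neighbor_l1 add_increasing)
next
  assume "\<exists>u v. neighbor x u \<and> u \<notin> strong_component \<alpha> \<omega> \<and> (u, v) \<in> (weak_edges \<alpha> \<omega>)\<^sup>* \<and> neighbor v z"
  then obtain u v where uv: "neighbor x u" "u \<notin> strong_component \<alpha> \<omega>" "(u, v) \<in> (weak_edges \<alpha> \<omega>)\<^sup>*" "neighbor v z" by blast
  have sub: "hole \<alpha> \<omega> u \<subseteq> adjacent_holes \<alpha> \<omega> x" using uv(1) by (auto simp: adjacent_holes_def)
  have "of_nat (l1 x v) \<le> hole_size \<alpha> \<omega> x"
  proof (cases "finite (adjacent_holes \<alpha> \<omega> x)")
    case True
    then have "finite (hole \<alpha> \<omega> u)" using sub by (rule finite_subset[rotated])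
    have "l1 x v = card {1..l1 x v}" by simp
    also have "\<dots> \<le> card (l1 x ` hole \<alpha> \<omega> u)"
      using weak_path_l1[OF uv(3,1)] \<open>finite (hole \<alpha> \<omega> u)\<close> by (intro card_mono) (auto simp: hole_weak[OF uv(2)])
    also have "\<dots> \<le> card (hole \<alpha> \<omega> u)" using \<open>finite (hole \<alpha> \<omega> u)\<close> by (rule card_image_le)
    also have "\<dots> \<le> card (adjacent_holes \<alpha> \<omega> x)" using True sub by (rule card_mono)
    finally have "(of_nat (l1 x v) :: ennreal) \<le> of_nat (card (adjacent_holes \<alpha> \<omega> x))" by (rule of_nat_mono)
    then show ?thesis using True by (simp add: hole_size_def)
  qed (simp add: hole_size_def)
  moreover have "l1 x z \<le> l1 x v + 1" using l1_triangle[of x z v] uv(4) by (simp add: neighbor_l1)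
  then have "(of_nat (l1 x z) :: ennreal) \<le> of_nat (l1 x v + 1)" by (rule of_nat_mono)
  then have "(of_nat (l1 x z) :: ennreal) \<le> of_nat (l1 x v) + 1" by (simp only: of_nat_add of_nat_1)
  ultimately show ?thesis by (meson add_right_mono order_trans)
qed

lemma lattice_connected: "(x, y) \<in> {(u, v :: 'd::finite site). neighbor u v}\<^sup>*"
proof (induction "l1 x y" arbitrary: x)
  case 0
  then have "(\<Sum>i\<in>UNIV. \<bar>x $ i - y $ i\<bar>) = 0" using int_l1[of x y] by simp
  then have "x = y" by (simp add: sum_nonneg_eq_0_iff vec_eq_iff)
  then show ?case by simp
next
  case (Suc n)
  have "\<exists>i. x $ i \<noteq> y $ i"
  proof (rule ccontr)
    assume "\<nexists>i. x $ i \<noteq> y $ i"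
    then have "int (l1 x y) = 0" unfolding int_l1 by simp
    then show False using Suc.hyps(2) by simp
  qed
  then obtain i where i: "x $ i \<noteq> y $ i" by blast
  let ?s = "sgn (y $ i - x $ i)"
  define z where "z = x + axis i ?s"
  have z: "z $ j = (if j = i then x $ i + ?s else x $ j)" for j by (simp add: z_def axis_def)
  have "(\<Sum>j\<in>UNIV. \<bar>x $ j - z $ j\<bar>) = (\<Sum>j\<in>UNIV. if j = i then 1 else 0)"
    using i by (intro sum.cong) (auto simp: z sgn_if)
  then have "neighbor x z" by (simp add: neighbor_def)
  have "(\<Sum>j\<in>UNIV. \<bar>x $ j - y $ j\<bar>) = (\<Sum>j\<in>UNIV. \<bar>z $ j - y $ j\<bar> + (if j = i then 1 else 0))"
    using i by (intro sum.cong) (auto simp: z sgn_if)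
  then have "int (l1 x y) = int (l1 z y) + 1" by (simp add: int_l1 sum.distrib)
  then have "n = l1 z y" using Suc.hyps(2) by simp
  then have "(z, y) \<in> {(u, v). neighbor u v}\<^sup>*" by (rule Suc.hyps(1))
  then show ?case using \<open>neighbor x z\<close> by (simp add: converse_rtrancl_into_rtrancl)
qed

text \<open>A lattice path from y to the component can leave the hole of y only into the component,
  and the vertex entered there is adjacent to the hole.\<close>

lemma hole_boundary:
  assumes "y \<notin> strong_component \<alpha> \<omega>" "strong_component \<alpha> \<omega> \<noteq> {}"
  shows "\<exists>x\<in>strong_component \<alpha> \<omega>. hole \<alpha> \<omega> y \<subseteq> adjacent_holes \<alpha> \<omega> x"
proof -
  let ?C = "strong_component \<alpha> \<omega>" and ?W = "(weak_edges \<alpha> \<omega>)\<^sup>*"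
  obtain c where "c \<in> ?C" using assms(2) by blast
  have "(y, z) \<in> ?W \<or> (\<exists>x v. x \<in> ?C \<and> (y, v) \<in> ?W \<and> neighbor v x)" for z
    using lattice_connected[of y z]
  proof (induction rule: rtrancl_induct)
    case (step u z)
    show ?case
    proof (cases "(y, u) \<in> ?W \<and> z \<notin> ?C")
      case True
      then have "(u, z) \<in> weak_edges \<alpha> \<omega>"
        using weak_path_outside[of y u] assms(1) step.hyps(2) by (auto simp: weak_edges_def)
      then show ?thesis using True by (meson rtrancl_into_rtrancl)
    qed (use step in auto)
  qed simp
  then obtain x v where xv: "x \<in> ?C" "(y, v) \<in> ?W" "neighbor v x"
    using \<open>c \<in> ?C\<close> weak_path_outside[of y c] assms(1) by blast
  have "v \<notin> ?C" using weak_path_outside[OF xv(2) assms(1)] .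
  have "(v, y) \<in> ?W" using xv(2) sym_rtrancl[OF sym_weak_edges] by (meson symD)
  then have "hole \<alpha> \<omega> y \<subseteq> hole \<alpha> \<omega> v"
    using assms(1) \<open>v \<notin> ?C\<close> by (auto simp: hole_weak intro: rtrancl_trans)
  moreover have "hole \<alpha> \<omega> v \<subseteq> adjacent_holes \<alpha> \<omega> x"
    using xv(3) unfolding adjacent_holes_def neighbor_sym[of v x] by blast
  ultimately show ?thesis using xv(1) by blast
qed

lemma card_neighbors: "card {y. neighbor (x :: 'd::finite site) y} = card {y. neighbor (0 :: 'd site) y}"
proof -
  have "bij_betw (\<lambda>y. y + x) {y. neighbor (0 :: 'd site) y} {y. neighbor x y}"
  proof (rule bij_betw_byWitness[where f'="\<lambda>y. y - x"])
    show "(\<lambda>y. y + x) ` {y. neighbor 0 y} \<subseteq> {y. neighbor x y}"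
      using neighbor_shift[of 0 x] by auto
    show "(\<lambda>y. y - x) ` {y. neighbor x y} \<subseteq> {y. neighbor 0 y}"
      using neighbor_shift[of 0 x "_ - x"] by auto
  qed auto
  from bij_betw_same_card[OF this] show ?thesis by simp
qed

text \<open>Every neighbor of x outside the component lies in the hole of x itself, so at most the
  neighbors are added; their number is absorbed because the hole is nonempty.\<close>

lemma hole_size_outside:
  fixes \<omega> :: "'d::finite environment"
  assumes "x \<notin> strong_component \<alpha> \<omega>"
  shows "hole_size \<alpha> \<omega> x \<le> of_nat (card {y. neighbor (0 :: 'd site) y} + 1) * emeasure (count_space UNIV) (hole \<alpha> \<omega> x)"
proof -
  let ?N = "{y. neighbor x y}"
  have "adjacent_holes \<alpha> \<omega> x \<subseteq> ?N \<union> hole \<alpha> \<omega> x"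
  proof
    fix z assume "z \<in> adjacent_holes \<alpha> \<omega> x"
    then obtain y where y: "neighbor x y" "z \<in> hole \<alpha> \<omega> y" by (auto simp: adjacent_holes_def)
    show "z \<in> ?N \<union> hole \<alpha> \<omega> x"
    proof (cases "y \<in> strong_component \<alpha> \<omega>")
      case True
      then show ?thesis using y by (simp add: hole_def)
    next
      case False
      then have "(x, y) \<in> weak_edges \<alpha> \<omega>" using assms y(1) by (simp add: weak_edges_def)
      then show ?thesis using y(2) assms False by (auto simp: hole_weak intro: converse_rtrancl_into_rtrancl)
    qed
  qed
  then have "hole_size \<alpha> \<omega> x \<le> emeasure (count_space UNIV) (?N \<union> hole \<alpha> \<omega> x)"
    unfolding hole_size_def by (intro emeasure_mono) auto
  also have "\<dots> \<le> emeasure (count_space UNIV) ?N + emeasure (count_space UNIV) (hole \<alpha> \<omega> x)"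
    by (rule emeasure_subadditive) auto
  also have "emeasure (count_space UNIV) ?N = of_nat (card {y. neighbor (0 :: 'd site) y}) * 1"
    using finite_neighbors[of x] by (simp add: card_neighbors[of x])
  also have "\<dots> \<le> of_nat (card {y. neighbor (0 :: 'd site) y}) * emeasure (count_space UNIV) (hole \<alpha> \<omega> x)"
  proof (rule mult_left_mono)
    have "{x} \<subseteq> hole \<alpha> \<omega> x" by (auto simp: hole_def)
    then have "emeasure (count_space UNIV) {x} \<le> emeasure (count_space UNIV) (hole \<alpha> \<omega> x)"
      by (intro emeasure_mono) auto
    then show "1 \<le> emeasure (count_space UNIV) (hole \<alpha> \<omega> x)" by simp
  qed simp
  finally have "hole_size \<alpha> \<omega> x \<le> of_nat (card {y. neighbor (0 :: 'd site) y}) * emeasure (count_space UNIV) (hole \<alpha> \<omega> x)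
      + emeasure (count_space UNIV) (hole \<alpha> \<omega> x)"
    by (simp only: add_right_mono)
  then show ?thesis by (simp only: of_nat_add of_nat_1 distrib_right mult_1_left)
qed

lemma less_top_of_divide: "a / b < \<top> \<Longrightarrow> b < \<infinity> \<Longrightarrow> a < (\<top> :: ennreal)"
  by (cases "a = \<top>") (auto simp: ennreal_top_divide top.not_eq_extremum split: if_splits)

context stationary_env
begin

lemma sfield_hole_size: "sfield (hole_size \<alpha>)"
proof -
  have "skernel (\<lambda>\<omega> x y. indicator {y. y \<in> adjacent_holes \<alpha> \<omega> x} y)"
    by (rule skernel_indicator[OF sevent_adjacent_holes])
  from skernel_kapp[OF this sfield_const[of 1]]
  have "sfield (\<lambda>\<omega>. kapp (\<lambda>x y. indicator {y. y \<in> adjacent_holes \<alpha> \<omega> x} y) (\<lambda>_. 1))" .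
  also have "(\<lambda>\<omega>. kapp (\<lambda>x y. indicator {y. y \<in> adjacent_holes \<alpha> \<omega> x} y) (\<lambda>_. 1)) = hole_size \<alpha>"
    by (intro ext) (simp add: kapp_def hole_size_integral)
  finally show ?thesis .
qed

lemma component_event_sets: "component_event P \<alpha> \<in> sets P"
  unfolding component_event_def using sset_meas[OF sset_strong_component, of 0 \<alpha>] by (simp add: pred_def)

text \<open>Ergodicity, beyond stationarity, enters here: the existence of a component vertex is a
  shift-invariant event of positive probability.\<close>

lemma strong_component_nonempty:
  assumes "measure P (component_event P \<alpha>) \<noteq> 0"
  shows "AE \<omega> in P. strong_component \<alpha> \<omega> \<noteq> {}"
proof -
  let ?A = "{\<omega> \<in> space P. \<exists>x. x \<in> strong_component \<alpha> \<omega>}"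
  note [measurable] = sset_meas[OF sset_strong_component]
  have A: "?A \<in> sets P" by measurable
  have "shift z -` ?A \<inter> space P = ?A" for z
  proof -
    have "(\<exists>x. x \<in> strong_component \<alpha> (shift z \<omega>)) \<longleftrightarrow> (\<exists>x. x \<in> strong_component \<alpha> \<omega>)" if "\<omega> \<in> space P" for \<omega>
      unfolding sset_shift[OF sset_strong_component that] by (rule ex_translate)
    then show ?thesis using shift_space by auto
  qed
  then have "measure P ?A = 0 \<or> measure P ?A = 1"
    using ergodic_P A unfolding jointly_ergodic_def by blast
  moreover have "measure P (component_event P \<alpha>) \<le> measure P ?A"
    using A by (intro finite_measure_mono) (auto simp: component_event_def)
  moreover have "0 < measure P (component_event P \<alpha>)" using assms by (simp add: zero_less_measure_iff)
  ultimately have "measure P ?A = 1" by linarith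
  then have "AE \<omega> in P. \<omega> \<in> ?A" by (simp add: prob_eq_1[OF A])
  then show ?thesis by (rule AE_mp) auto
qed

text \<open>Removes the conditioning, which costs a factor P(0 in the component). On infinite sets
  \<open>hole_size\<close> is infinite while \<open>card\<close> is 0, so the almost sure finiteness
  in \<open>holes_in_Lp\<close> is used.\<close>

lemma hole_size_moment_inside:
  assumes "\<And>p. p \<ge> 1 \<Longrightarrow> holes_in_Lp P \<alpha> p" and pos: "measure P (component_event P \<alpha>) \<noteq> 0"
  shows "(\<integral>\<^sup>+\<omega>. indicator (strong_component \<alpha> \<omega>) 0 * hole_size \<alpha> \<omega> 0 ^ Suc p \<partial>P) < \<top>"
proof -
  let ?E = "component_event P \<alpha>"
  let ?f = "\<lambda>\<omega>. real (card (adjacent_holes \<alpha> \<omega> 0)) powr real (Suc p)"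
  have E: "?E \<in> sets P" "emeasure P ?E \<noteq> 0" "emeasure P ?E < \<infinity>"
    using component_event_sets pos by (auto simp: emeasure_eq_measure)
  have L: "AE \<omega> in cond_law P \<alpha>. finite (adjacent_holes \<alpha> \<omega> 0)" "integrable (cond_law P \<alpha>) ?f"
    using assms(1)[of "real (Suc p)"] by (auto simp: holes_in_Lp_def)
  have f: "?f \<in> borel_measurable P"
    using borel_measurable_integrable[OF L(2)] by (simp add: cond_law_def measurable_cong_sets[OF sets_uniform_measure refl])
  have fin: "AE \<omega> in P. \<omega> \<in> ?E \<longrightarrow> finite (adjacent_holes \<alpha> \<omega> 0)"
    using L(1) unfolding cond_law_def by (simp only: AE_uniform_measure[OF E(2,3)])
  have "(\<integral>\<^sup>+\<omega>. ennreal (?f \<omega>) \<partial>cond_law P \<alpha>) < \<infinity>"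
    using L(2) unfolding integrable_iff_bounded by simp
  then have "(\<integral>\<^sup>+\<omega>. ennreal (?f \<omega>) * indicator ?E \<omega> \<partial>P) / emeasure P ?E < \<top>"
    unfolding cond_law_def using f E(1) by (simp add: nn_integral_uniform_measure)
  then have "(\<integral>\<^sup>+\<omega>. ennreal (?f \<omega>) * indicator ?E \<omega> \<partial>P) < \<top>"
    using E(3) by (rule less_top_of_divide)
  moreover have "(\<integral>\<^sup>+\<omega>. indicator (strong_component \<alpha> \<omega>) 0 * hole_size \<alpha> \<omega> 0 ^ Suc p \<partial>P)
      = (\<integral>\<^sup>+\<omega>. ennreal (?f \<omega>) * indicator ?E \<omega> \<partial>P)"
  proof (rule nn_integral_cong_AE)
    show "AE \<omega> in P. indicator (strong_component \<alpha> \<omega>) 0 * hole_size \<alpha> \<omega> 0 ^ Suc p = ennreal (?f \<omega>) * indicator ?E \<omega>"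
      using fin AE_space
    proof eventually_elim
      fix \<omega> assume \<omega>: "\<omega> \<in> ?E \<longrightarrow> finite (adjacent_holes \<alpha> \<omega> 0)" "\<omega> \<in> space P"
      show "indicator (strong_component \<alpha> \<omega>) 0 * hole_size \<alpha> \<omega> 0 ^ Suc p = ennreal (?f \<omega>) * indicator ?E \<omega>"
      proof (cases "0 \<in> strong_component \<alpha> \<omega>")
        case True
        then have E: "\<omega> \<in> ?E" using \<omega>(2) by (simp add: component_event_def)
        let ?c = "card (adjacent_holes \<alpha> \<omega> 0)"
        have "?f \<omega> = real ?c ^ Suc p"
          by (cases "?c = 0") (simp_all add: powr_realpow del: of_nat_Suc)
        then show ?thesis
          using True E \<omega>(1) by (simp add: hole_size_def ennreal_of_nat_eq_real_of_nat ennreal_power del: power_Suc)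
      next
        case False
        then have "\<omega> \<notin> ?E" by (simp add: component_event_def)
        then show ?thesis using False by simp
      qed
    qed
  qed
  ultimately show ?thesis by simp
qed

end

section \<open>Excursions of the walk from the strong component\<close>

lemma conductance_le:
  fixes \<omega> :: "'d::finite environment"
  assumes "\<omega> \<in> space env_space"
  shows "conductance \<omega> x \<le> of_nat (card {y. neighbor (0 :: 'd site) y})"
proof -
  have "total_conductance \<omega> x \<le> (\<Sum>z | neighbor x z. 1)"
    unfolding total_conductance_def using env_pos(2)[OF assms] by (intro sum_mono) auto
  then have "total_conductance \<omega> x \<le> real (card {y. neighbor (0 :: 'd site) y})"
    by (simp add: card_neighbors[of x])
  then show ?thesis by (simp add: conductance_def ennreal_of_nat_eq_real_of_nat ennreal_leI)
qed

text \<open>A component vertex has an incident edge of conductance at least \<alpha>. With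
  \<open>conductance_le\<close>, the reversible weight is thus comparable to 1 on the
  component.\<close>

lemma conductance_ge:
  fixes \<omega> :: "'d::finite environment"
  assumes \<omega>: "\<omega> \<in> space env_space" and x: "x \<in> strong_component \<alpha> \<omega>"
  shows "ennreal \<alpha> \<le> conductance \<omega> x"
proof -
  obtain ps where ps: "length ps = Suc 1" "ps ! 0 = x" "strong_path \<alpha> \<omega> ps"
    using x unfolding strong_component_paths by blast
  then have y: "neighbor x (ps ! 1)" "\<alpha> \<le> \<omega> {x, ps ! 1}" by (auto simp: strong_path_def)
  have "\<omega> {x, ps ! 1} \<le> total_conductance \<omega> x"
    unfolding total_conductance_def using y env_pos(1)[OF \<omega>] finite_neighbors[of x]
    by (intro member_le_sum[where f="\<lambda>z. \<omega> {x, z}"]) (auto intro: less_imp_le)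
  then show ?thesis using y(2) by (simp add: conductance_def ennreal_leI)
qed

definition exc :: "real \<Rightarrow> 'd::finite environment \<Rightarrow> nat \<Rightarrow> 'd site kernel" where
  "exc \<alpha> \<omega> = excursion (walk \<omega>) (strong_component \<alpha> \<omega>)"

lemma exc_outside: "x \<notin> strong_component \<alpha> \<omega> \<or> y \<notin> strong_component \<alpha> \<omega> \<Longrightarrow> exc \<alpha> \<omega> t x y = 0"
  unfolding exc_def by (rule excursion_outside)

lemma kmoment_outside: "x \<notin> strong_component \<alpha> \<omega> \<or> y \<notin> strong_component \<alpha> \<omega> \<Longrightarrow> kmoment p (exc \<alpha> \<omega>) x y = 0"
  by (simp add: kmoment_def exc_outside)

lemma ktotal_outside: "x \<notin> strong_component \<alpha> \<omega> \<or> y \<notin> strong_component \<alpha> \<omega> \<Longrightarrow> ktotal (exc \<alpha> \<omega>) x y = 0"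
  by (simp add: ktotal_def exc_outside)

lemma ktotal_one: "\<omega> \<in> space env_space \<Longrightarrow> kapp (ktotal (exc \<alpha> \<omega>)) (\<lambda>_. 1) x \<le> 1"
  unfolding exc_def by (rule ktotal_excursion_le_1)

lemma exc_sym: "\<omega> \<in> space env_space \<Longrightarrow> ksym (conductance \<omega>) (exc \<alpha> \<omega> t)"
  unfolding exc_def by (rule reversible_chain.excursion_sym[OF reversible_chain_walk])

lemma ktotal_sym: "\<omega> \<in> space env_space \<Longrightarrow> ksym (conductance \<omega>) (ktotal (exc \<alpha> \<omega>))"
  unfolding ksym_def ktotal_def ennreal_suminf_cmult[symmetric] by (simp add: ksymD[OF exc_sym])

lemma kmoment_sym:
  assumes "\<omega> \<in> space env_space"
  shows "ksym (conductance \<omega>) (kmoment p (exc \<alpha> \<omega>))"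
  unfolding ksym_def kmoment_def ennreal_suminf_cmult[symmetric]
proof (intro allI suminf_cong)
  fix x y t
  have "conductance \<omega> x * exc \<alpha> \<omega> t x y = conductance \<omega> y * exc \<alpha> \<omega> t y x"
    by (rule ksymD[OF exc_sym[OF assms]])
  then show "conductance \<omega> x * (of_nat t ^ p * exc \<alpha> \<omega> t x y) = conductance \<omega> y * (of_nat t ^ p * exc \<alpha> \<omega> t y x)"
    by (metis mult.left_commute)
qed

lemma exc_l1_le:
  assumes "exc \<alpha> \<omega> t x y \<noteq> 0"
  shows "of_nat (l1 x y) \<le> hole_size \<alpha> \<omega> x + 1"
proof -
  obtain s where "t = Suc s" using assms by (cases t) (auto simp: exc_def)
  then have "taboo (walk \<omega>) (strong_component \<alpha> \<omega>) s x y \<noteq> 0" using assms by (auto simp: exc_def)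
  then show ?thesis by (rule taboo_l1_le)
qed

lemma kapp_kmoment:
  assumes x: "x \<in> strong_component \<alpha> \<omega>"
  shows "kapp (kmoment p (exc \<alpha> \<omega>)) (\<lambda>_. 1) x
    \<le> (\<Sum>t. of_nat (Suc t) ^ p * hitting (walk \<omega>) (strong_component \<alpha> \<omega>) t x)"
proof -
  let ?C = "strong_component \<alpha> \<omega>"
  have "kapp (kmoment p (exc \<alpha> \<omega>)) (\<lambda>_. 1) x = (\<Sum>t. kapp (\<lambda>x y. of_nat t ^ p * exc \<alpha> \<omega> t x y) (\<lambda>_. 1) x)"
    unfolding kmoment_def by (rule kapp_suminf_left)
  also have "\<dots> = (\<Sum>t. of_nat t ^ p * kapp (exc \<alpha> \<omega> t) (\<lambda>_. 1) x)"
    by (simp add: kapp_def nn_integral_cmult)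
  also have "\<dots> = (\<Sum>t. of_nat (Suc t) ^ p * kapp (exc \<alpha> \<omega> (Suc t)) (\<lambda>_. 1) x) + of_nat 0 ^ p * kapp (exc \<alpha> \<omega> 0) (\<lambda>_. 1) x"
    by (subst suminf_offset[where i=1]) (auto simp: add.commute)
  also have "kapp (exc \<alpha> \<omega> 0) (\<lambda>_. 1) x = 0" by (simp add: exc_def kapp_def)
  also have "(\<lambda>t. kapp (exc \<alpha> \<omega> (Suc t)) (\<lambda>_. 1) x) = (\<lambda>t. hitting (walk \<omega>) ?C t x)"
    using x by (auto simp: exc_def kapp_def hitting_def)
  then have "(\<Sum>t. of_nat (Suc t) ^ p * kapp (exc \<alpha> \<omega> (Suc t)) (\<lambda>_. 1) x) = (\<Sum>t. of_nat (Suc t) ^ p * hitting (walk \<omega>) ?C t x)"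
    by metis
  finally show ?thesis by simp
qed

text \<open>By reversibility, the expected time spent at a hole site z, weighted by the conductance
  of x, is at most the conductance of z. The bound therefore depends on the size of the holes and
  not on how small the conductances inside them are.\<close>

lemma mean_excursion_le:
  fixes \<omega> :: "'d::finite environment"
  assumes \<omega>: "\<omega> \<in> space env_space" and x: "x \<in> strong_component \<alpha> \<omega>" and \<alpha>: "0 < \<alpha>"
  shows "kapp (kmoment 1 (exc \<alpha> \<omega>)) (\<lambda>_. 1) x
    \<le> 1 + ennreal (1 / \<alpha>) * (of_nat (card {y. neighbor (0 :: 'd site) y}) * hole_size \<alpha> \<omega> x)"
proof -
  let ?C = "strong_component \<alpha> \<omega>" and ?N = "of_nat (card {y. neighbor (0 :: 'd site) y}) :: ennreal"
  interpret reversible_chain "walk \<omega>" "conductance \<omega>" ?C by (rule reversible_chain_walk[OF \<omega>])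
  let ?S = "\<Sum>t. survival (walk \<omega>) ?C t x"
  have "ennreal \<alpha> * ?S \<le> conductance \<omega> x * ?S"
    by (intro mult_right_mono conductance_ge \<omega> x) simp
  also have "\<dots> \<le> (\<integral>\<^sup>+z. conductance \<omega> z * indicator {z. z \<notin> ?C \<and> (\<exists>t. taboo (walk \<omega>) ?C t x z \<noteq> 0)} z \<partial>count_space UNIV)"
    by (rule weighted_survival_le[OF x])
  also have "\<dots> \<le> (\<integral>\<^sup>+z. ?N * indicator (adjacent_holes \<alpha> \<omega> x) z \<partial>count_space UNIV)"
    using taboo_adjacent_holes by (intro nn_integral_mono mult_mono conductance_le \<omega>) (auto simp: indicator_def)
  also have "\<dots> = ?N * hole_size \<alpha> \<omega> x" by (simp add: nn_integral_cmult hole_size_def)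
  finally have *: "ennreal \<alpha> * ?S \<le> ?N * hole_size \<alpha> \<omega> x" .
  have "?S = ennreal (1 / \<alpha>) * (ennreal \<alpha> * ?S)"
    using \<alpha> by (simp add: mult.assoc[symmetric] ennreal_mult[symmetric])
  also have "\<dots> \<le> ennreal (1 / \<alpha>) * (?N * hole_size \<alpha> \<omega> x)" using * by (rule mult_left_mono) simp
  finally have S: "?S \<le> ennreal (1 / \<alpha>) * (?N * hole_size \<alpha> \<omega> x)" .
  have "kapp (kmoment 1 (exc \<alpha> \<omega>)) (\<lambda>_. 1) x \<le> (\<Sum>t. of_nat (Suc t) ^ 1 * hitting (walk \<omega>) ?C t x)"
    by (rule kapp_kmoment[OF x])
  also have "\<dots> \<le> 1 + ?S" unfolding power_one_right by (rule suminf_of_nat_hitting_le)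
  also have "\<dots> \<le> 1 + ennreal (1 / \<alpha>) * (?N * hole_size \<alpha> \<omega> x)" using S by (rule add_left_mono)
  finally show ?thesis .
qed

lemma kapp_less_1:
  assumes "kapp p (\<lambda>_. 1) x = 1" "\<And>z. h z \<le> 1" "p x v \<noteq> 0" "h v < 1"
  shows "kapp p h x < 1"
proof -
  let ?k = "\<lambda>z. if z = v then 1 - h v else 0"
  have "p x v * (1 - h v) \<le> kapp p ?k x"
    using kcomp_term_le[of p x v "\<lambda>z _. ?k z" v] by (simp add: kcomp_def)
  moreover have "0 < p x v * (1 - h v)"
    using assms(3) diff_gr0_ennreal[OF assms(4)] by (simp add: ennreal_zero_less_mult_iff zero_less_iff_neq_zero)
  ultimately have pos: "kapp p ?k x \<noteq> 0" by auto
  have "kapp p h x + kapp p ?k x = kapp p (\<lambda>z. h z + ?k z) x" by (rule kapp_add[symmetric])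
  also have "\<dots> \<le> kapp p (\<lambda>_. 1) x"
  proof (intro kapp_mono order_refl)
    fix z show "h z + ?k z \<le> 1"
      using assms(2)[of z] by (auto simp: add_diff_inverse_ennreal)
  qed
  finally have le: "kapp p h x + kapp p ?k x \<le> 1" by (simp only: assms(1))
  show ?thesis
  proof (rule ccontr)
    assume "\<not> kapp p h x < 1"
    then have "1 + kapp p ?k x \<le> kapp p h x + kapp p ?k x" by (intro add_right_mono) simp
    then have "1 + kapp p ?k x \<le> 1 + 0" using le by (simp only: add_0_right order_trans)
    then show False using pos by (simp only: ennreal_add_left_cancel_le) simp
  qed
qed

text \<open>Retracing the path from \<open>v\<close> back to \<open>x\<close> has positive
  probability and ends in \<open>C\<close>.\<close>

lemma survival_lt_1:
  fixes \<omega> :: "'d::finite environment"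
  assumes \<omega>: "\<omega> \<in> space env_space" and x: "x \<in> C" and u: "neighbor x u"
    and path: "(u, v) \<in> {(u, v). neighbor u v \<and> u \<notin> C \<and> v \<notin> C}\<^sup>*"
  shows "\<exists>t. survival (walk \<omega>) C t v < 1"
  using path
proof (induction rule: rtrancl_induct)
  case base
  have "kapp (walk \<omega>) (indicator (- C)) u < 1"
    using walk_pos[OF \<omega>, of u x] u x
    by (intro kapp_less_1[where v=x] walk_one[OF \<omega>]) (auto simp: neighbor_sym indicator_def)
  then show ?case by (intro exI[of _ 0]) (simp add: survival_def)
next
  case (step v v')
  interpret reversible_chain "walk \<omega>" "conductance \<omega>" C by (rule reversible_chain_walk[OF \<omega>])
  obtain t where t: "survival (walk \<omega>) C t v < 1" using step.IH by blast
  have "kapp (walk \<omega>) (\<lambda>z. indicator (- C) z * survival (walk \<omega>) C t z) v' < 1"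
  proof (intro kapp_less_1[where v=v] walk_one[OF \<omega>])
    show "indicator (- C) z * survival (walk \<omega>) C t z \<le> 1" for z
      using survival_le_1[of t z] by (auto simp: indicator_def)
    show "walk \<omega> v' v \<noteq> 0" using step.hyps(2) by (intro walk_pos[OF \<omega>]) (simp add: neighbor_sym)
    show "indicator (- C) v * survival (walk \<omega>) C t v < 1" using t by (auto simp: indicator_def)
  qed
  then show ?case by (intro exI[of _ "Suc t"]) (simp only: survival_Suc)
qed

text \<open>Finitely many hole sites that can be left only into the component give a geometric tail;
  no uniformity in \<omega> is claimed.\<close>

lemma kmoment_finite:
  fixes \<omega> :: "'d::finite environment"
  assumes \<omega>: "\<omega> \<in> space env_space" and x: "x \<in> strong_component \<alpha> \<omega>"
    and fin: "finite (adjacent_holes \<alpha> \<omega> x)"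
  shows "kapp (kmoment p (exc \<alpha> \<omega>)) (\<lambda>_. 1) x < \<top>"
proof -
  let ?C = "strong_component \<alpha> \<omega>"
  interpret reversible_chain "walk \<omega>" "conductance \<omega>" ?C by (rule reversible_chain_walk[OF \<omega>])
  let ?H = "adjacent_holes \<alpha> \<omega> x - ?C"
  have H: "\<exists>u. neighbor x u \<and> u \<notin> ?C \<and> (u, z) \<in> (weak_edges \<alpha> \<omega>)\<^sup>*" if z: "z \<in> ?H" for z
  proof -
    obtain u where u: "neighbor x u" "z \<in> hole \<alpha> \<omega> u" using z by (auto simp: adjacent_holes_def)
    then have "u \<notin> ?C" using z by (auto simp: hole_def split: if_splits)
    then show ?thesis using u by (auto simp: hole_weak)
  qed
  have "(\<Sum>t. of_nat (Suc t) ^ p * hitting (walk \<omega>) ?C t x) < \<top>"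
  proof (rule survival_moment_finite[where H="?H"])
    show "finite ?H" using fin by simp
    show "?H \<inter> ?C = {}" by auto
    fix z assume z: "z \<in> ?H"
    then obtain u where u: "neighbor x u" "u \<notin> ?C" "(u, z) \<in> (weak_edges \<alpha> \<omega>)\<^sup>*" using H by blast
    show "\<exists>t. survival (walk \<omega>) ?C t z < 1"
      using survival_lt_1[OF \<omega> x u(1)] u(3) by (simp add: weak_edges_def)
    fix z' assume z': "walk \<omega> z z' \<noteq> 0" "z' \<notin> ?C"
    then have "(z, z') \<in> weak_edges \<alpha> \<omega>" using z walk_nonzero by (auto simp: weak_edges_def)
    then have "z' \<in> hole \<alpha> \<omega> u" using u by (auto simp: hole_weak)
    then show "z' \<in> ?H" using u(1) z'(2) by (auto simp: adjacent_holes_def)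
  next
    fix z assume "walk \<omega> x z \<noteq> 0" "z \<notin> ?C"
    then show "z \<in> ?H" using walk_nonzero[of \<omega> x z] by (auto simp: adjacent_holes_def hole_def)
  qed
  then show ?thesis using kapp_kmoment[OF x] by (rule le_less_trans[rotated])
qed

lemma ktotal_le_1: "\<omega> \<in> space env_space \<Longrightarrow> ktotal (exc \<alpha> \<omega>) x y \<le> 1"
  using kernel_le_total ktotal_one by (rule order_trans)

lemma ktotal_nonzero_support:
  assumes "ktotal (exc \<alpha> \<omega>) x y \<noteq> 0"
  shows "of_nat (l1 x y) \<le> hole_size \<alpha> \<omega> x + 1" "y \<in> strong_component \<alpha> \<omega>"
proof -
  have "\<exists>t. exc \<alpha> \<omega> t x y \<noteq> 0"
  proof (rule ccontr)
    assume "\<nexists>t. exc \<alpha> \<omega> t x y \<noteq> 0"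
    then show False using assms by (simp add: ktotal_def)
  qed
  then obtain t where "exc \<alpha> \<omega> t x y \<noteq> 0" ..
  then show "of_nat (l1 x y) \<le> hole_size \<alpha> \<omega> x + 1" by (rule exc_l1_le)
  show "y \<in> strong_component \<alpha> \<omega>" using assms ktotal_outside by blast
qed

lemma l1_shift: "l1 x y = l1 0 (y - x)"
  unfolding l1_def by (simp add: abs_minus_commute)

lemma finite_l1_ball: "finite {y :: 'd::finite site. l1 x y \<le> R}"
proof -
  have "{y. l1 x y \<le> R} = (\<lambda>y. y + x) ` {y :: 'd site. l1 0 y \<le> R}"
  proof (intro set_eqI iffI)
    fix y assume "y \<in> {y. l1 x y \<le> R}"
    then show "y \<in> (\<lambda>y. y + x) ` {y. l1 0 y \<le> R}"
      using l1_shift[of x y] by (intro image_eqI[of _ _ "y - x"]) auto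
  next
    fix y assume "y \<in> (\<lambda>y. y + x) ` {y. l1 0 y \<le> R}"
    then show "y \<in> {y. l1 x y \<le> R}" using l1_shift[of x] by auto
  qed
  then show ?thesis by (simp only: finite_imageI l1_ball(1))
qed

text \<open>The length of a coarse step is bounded by the size of the adjacent holes, so only
  finitely many sites are reached.\<close>

lemma kapp_ktotal_finite:
  fixes \<omega> :: "'d::finite environment"
  assumes \<omega>: "\<omega> \<in> space env_space" and fin: "hole_size \<alpha> \<omega> x < \<top>"
    and f: "\<And>y. y \<in> strong_component \<alpha> \<omega> \<Longrightarrow> f y < \<top>"
  shows "kapp (ktotal (exc \<alpha> \<omega>)) f x < \<top>"
proof -
  obtain R where R: "hole_size \<alpha> \<omega> x + 1 < of_nat R"
    using ennreal_Ex_less_of_nat[of "hole_size \<alpha> \<omega> x + 1"] fin by auto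
  let ?F = "{y. l1 x y \<le> R \<and> y \<in> strong_component \<alpha> \<omega>}"
  have F: "finite ?F" by (rule finite_subset[OF _ finite_l1_ball[of x R]]) auto
  have "kapp (ktotal (exc \<alpha> \<omega>)) f x = (\<Sum>y\<in>?F. ktotal (exc \<alpha> \<omega>) x y * f y)"
    unfolding kapp_def
  proof (rule nn_integral_count_space'[OF F])
    fix y assume "y \<notin> ?F"
    have "ktotal (exc \<alpha> \<omega>) x y = 0"
    proof (rule ccontr)
      assume a: "ktotal (exc \<alpha> \<omega>) x y \<noteq> 0"
      have "(of_nat (l1 x y) :: ennreal) < of_nat R"
        using ktotal_nonzero_support(1)[OF a] R by (rule le_less_trans)
      then have "l1 x y \<le> R" by (metis linorder_not_le of_nat_mono less_imp_le)
      then show False using \<open>y \<notin> ?F\<close> ktotal_nonzero_support(2)[OF a] by simp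
    qed
    then show "ktotal (exc \<alpha> \<omega>) x y * f y = 0" by simp
  qed auto
  also have "\<dots> < \<top>"
  proof -
    have "ktotal (exc \<alpha> \<omega>) x y * f y < \<top>" if "y \<in> ?F" for y
      using ktotal_le_1[OF \<omega>, of \<alpha> x y] f[of y] that
      by (auto simp: ennreal_mult_less_top intro: le_less_trans[OF _ ennreal_one_less_top])
    then show ?thesis by (simp only: ennreal_sum_less_top[OF F] Ball_def) blast
  qed
  finally show ?thesis .
qed

lemma kword_moment_finite:
  fixes \<omega> :: "'d::finite environment"
  assumes \<omega>: "\<omega> \<in> space env_space" and x: "x \<in> strong_component \<alpha> \<omega>"
    and fin: "\<And>x. hole_size \<alpha> \<omega> x < \<top>"
  shows "kapp (kword (ktotal (exc \<alpha> \<omega>)) (kmoment p (exc \<alpha> \<omega>)) l 1) (\<lambda>_. 1) x < \<top>"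
  using x
proof (induction l arbitrary: x)
  case 0
  then show ?case by (simp add: kapp_def)
next
  case (Suc l)
  let ?P = "ktotal (exc \<alpha> \<omega>)" and ?Q = "kmoment p (exc \<alpha> \<omega>)"
  have "kapp (kword ?P ?Q (Suc l) 1) (\<lambda>_. 1) x
      = kapp ?P (kapp (kword ?P ?Q l 1) (\<lambda>_. 1)) x + kapp ?Q (kapp (kword ?P ?Q l 0) (\<lambda>_. 1)) x"
    by (simp add: kapp_add_left kapp_kcomp)
  also have "kapp ?Q (kapp (kword ?P ?Q l 0) (\<lambda>_. 1)) x \<le> kapp ?Q (\<lambda>_. 1) x"
    using kword_total_le[where P="?P" and Q="?Q" and q=0 and l=l and m=l] ktotal_one[OF \<omega>]
    by (intro kapp_mono) auto
  finally have "kapp (kword ?P ?Q (Suc l) 1) (\<lambda>_. 1) x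
      \<le> kapp ?P (kapp (kword ?P ?Q l 1) (\<lambda>_. 1)) x + kapp ?Q (\<lambda>_. 1) x"
    by (simp only: add_left_mono)
  also have "\<dots> < \<top>"
  proof -
    have "finite (adjacent_holes \<alpha> \<omega> x)"
      using fin[of x] by (cases "finite (adjacent_holes \<alpha> \<omega> x)") (auto simp: hole_size_def)
    then show ?thesis
      using kapp_ktotal_finite[OF \<omega> fin Suc.IH] kmoment_finite[OF \<omega> Suc.prems] by simp
  qed
  finally show ?case .
qed

lemma ennreal_mult_le_squares: "a * b \<le> a\<^sup>2 + (b\<^sup>2 :: ennreal)"
proof (cases "a \<le> b")
  case True
  then have "a * b \<le> b\<^sup>2" unfolding power2_eq_square by (rule mult_right_mono) simp
  then show ?thesis by (simp add: add_increasing)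
next
  case False
  then have "a * b \<le> a\<^sup>2" unfolding power2_eq_square by (intro mult_left_mono) auto
  then show ?thesis by (simp add: add_increasing2)
qed

lemma ennreal_top_power: "0 < n \<Longrightarrow> (\<top> :: ennreal) ^ n = \<top>"
  by (induction n) (auto simp: ennreal_mult_top ennreal_top_mult power_0_left split: nat.splits)

lemma ennreal_one_plus_power_le: "(1 + h) ^ p \<le> 2 ^ p * (1 + h ^ p :: ennreal)"
proof -
  have "1 + h \<le> 2 * max 1 h"
    unfolding mult_2 by (intro add_mono) auto
  then have "(1 + h) ^ p \<le> (2 * max 1 h) ^ p" by (rule power_mono) simp
  also have "\<dots> = 2 ^ p * max 1 h ^ p" by (rule power_mult_distrib)
  also have "\<dots> \<le> 2 ^ p * (1 + h ^ p)"
    by (intro mult_left_mono) (auto simp: max_def add_increasing add_increasing2)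
  finally show ?thesis .
qed

section \<open>Stationary fields with all moments on the strong component\<close>

context stationary_env
begin

lemma sset_Compl: "sset B \<Longrightarrow> sset (\<lambda>\<omega>. - B \<omega>)"
  unfolding sset_def by (auto intro: pred_intros_logic(2))

lemma skernel_taboo: "skernel (\<lambda>\<omega>. taboo (walk \<omega>) (strong_component \<alpha> \<omega>) t)"
proof (induction t)
  case 0
  show ?case by (simp add: skernel_walk)
next
  case (Suc t)
  have "skernel (\<lambda>\<omega>. kresl (- strong_component \<alpha> \<omega>) (taboo (walk \<omega>) (strong_component \<alpha> \<omega>) t))"
    unfolding kresl_def[abs_def]
    by (intro skernel_mult[OF skernel_left Suc] sfield_indicator sset_Compl sset_strong_component)
  then show ?case by (simp add: skernel_kcomp[OF skernel_walk])
qed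

lemma skernel_exc: "skernel (\<lambda>\<omega>. exc \<alpha> \<omega> t)"
proof (cases t)
  case 0
  then show ?thesis by (simp add: exc_def skernel_zero)
next
  case (Suc s)
  have ind: "sfield (\<lambda>\<omega>. indicator (strong_component \<alpha> \<omega>))"
    by (rule sfield_indicator[OF sset_strong_component])
  show ?thesis
    unfolding exc_def Suc excursion.simps
    by (intro skernel_mult skernel_left[OF ind] skernel_right[OF ind] skernel_taboo)
qed

lemma skernel_kmoment: "skernel (\<lambda>\<omega>. kmoment p (exc \<alpha> \<omega>))"
  unfolding kmoment_def[abs_def] by (intro skernel_suminf skernel_const_mult skernel_exc)

lemma skernel_ktotal: "skernel (\<lambda>\<omega>. ktotal (exc \<alpha> \<omega>))"
  unfolding ktotal_def[abs_def] by (intro skernel_suminf skernel_exc)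

text \<open>If 0 lies outside the component, its hole is charged to an adjacent component vertex x.
  Each x is charged only by sites of its own adjacent holes, so mass transport turns the charges
  into one more power of \<open>hole_size\<close> at a component vertex.\<close>

lemma hole_size_moment:
  assumes Lp: "\<And>p. p \<ge> 1 \<Longrightarrow> holes_in_Lp P \<beta> p" and pos: "measure P (component_event P \<beta>) \<noteq> 0"
  shows "(\<integral>\<^sup>+\<omega>. hole_size \<beta> \<omega> 0 ^ p \<partial>P) < \<top>"
proof (cases p)
  case 0
  then show ?thesis by (simp add: emeasure_space_1)
next
  case (Suc q)
  let ?C = "strong_component \<beta>" and ?h = "hole_size \<beta>"
  let ?N = "of_nat (card {y. neighbor (0 :: 'd site) y} + 1) :: ennreal"
  let ?A = "\<lambda>\<omega> x y. indicator (?C \<omega>) x * (indicator {y. y \<in> adjacent_holes \<beta> \<omega> x} y * ?h \<omega> x ^ p)"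
  have ind: "sfield (\<lambda>\<omega>. indicator (?C \<omega>))"
    by (rule sfield_indicator[OF sset_strong_component])
  have hp: "sfield (\<lambda>\<omega> x. ?h \<omega> x ^ p)" by (rule sfield_power[OF sfield_hole_size])
  have A: "skernel ?A"
    by (intro skernel_mult[OF skernel_left[OF ind]] skernel_mult skernel_left[OF hp] skernel_indicator sevent_adjacent_holes)
  have mA: "(\<lambda>\<omega>. \<integral>\<^sup>+x. ?A \<omega> x 0 \<partial>count_space UNIV) \<in> borel_measurable P"
    by (rule borel_measurable_count_space_integral) (rule skernel_meas[OF A])
  have "(\<integral>\<^sup>+\<omega>. ?h \<omega> 0 ^ p \<partial>P)
      \<le> (\<integral>\<^sup>+\<omega>. indicator (?C \<omega>) 0 * ?h \<omega> 0 ^ p + ?N ^ p * (\<integral>\<^sup>+x. ?A \<omega> x 0 \<partial>count_space UNIV) \<partial>P)"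
  proof (rule nn_integral_mono_AE)
    show "AE \<omega> in P. ?h \<omega> 0 ^ p \<le> indicator (?C \<omega>) 0 * ?h \<omega> 0 ^ p + ?N ^ p * (\<integral>\<^sup>+x. ?A \<omega> x 0 \<partial>count_space UNIV)"
      using strong_component_nonempty[OF pos]
    proof eventually_elim
      fix \<omega> :: "'d environment" assume ne: "?C \<omega> \<noteq> {}"
      show "?h \<omega> 0 ^ p \<le> indicator (?C \<omega>) 0 * ?h \<omega> 0 ^ p + ?N ^ p * (\<integral>\<^sup>+x. ?A \<omega> x 0 \<partial>count_space UNIV)"
      proof (cases "0 \<in> ?C \<omega>")
        case True
        then show ?thesis by (simp add: add_increasing2)
      next
        case False
        obtain x where x: "x \<in> ?C \<omega>" "hole \<beta> \<omega> 0 \<subseteq> adjacent_holes \<beta> \<omega> x"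
          using hole_boundary[OF False ne] by blast
        have "0 \<in> hole \<beta> \<omega> 0" by (auto simp: hole_def)
        then have 0: "0 \<in> adjacent_holes \<beta> \<omega> x" using x by auto
        have "?h \<omega> 0 \<le> ?N * emeasure (count_space UNIV) (hole \<beta> \<omega> 0)" by (rule hole_size_outside[OF False])
        also have "\<dots> \<le> ?N * ?h \<omega> x"
          unfolding hole_size_def using x(2) by (intro mult_left_mono emeasure_mono) auto
        finally have "?h \<omega> 0 ^ p \<le> (?N * ?h \<omega> x) ^ p" by (rule power_mono) simp
        also have "\<dots> = ?N ^ p * (?A \<omega> x 0 * 1)" using x(1) 0 by (simp add: power_mult_distrib)
        also have "\<dots> \<le> ?N ^ p * (\<integral>\<^sup>+x. ?A \<omega> x 0 \<partial>count_space UNIV)"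
        proof (rule mult_left_mono)
          show "?A \<omega> x 0 * 1 \<le> (\<integral>\<^sup>+x. ?A \<omega> x 0 \<partial>count_space UNIV)"
            using kernel_le_total[of "\<lambda>_ x. ?A \<omega> x 0" undefined x] by (simp add: kapp_def)
        qed simp
        finally show ?thesis by (simp add: add_increasing)
      qed
    qed
  qed
  also have "\<dots> = (\<integral>\<^sup>+\<omega>. indicator (?C \<omega>) 0 * ?h \<omega> 0 ^ p \<partial>P) + ?N ^ p * (\<integral>\<^sup>+\<omega>. (\<integral>\<^sup>+x. ?A \<omega> x 0 \<partial>count_space UNIV) \<partial>P)"
    unfolding nn_integral_cmult[OF mA, symmetric]
    by (rule nn_integral_add[OF sfield_meas[OF sfield_mult[OF ind hp]] borel_measurable_times_ennreal[OF borel_measurable_const mA]])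
  also have "(\<integral>\<^sup>+\<omega>. (\<integral>\<^sup>+x. ?A \<omega> x 0 \<partial>count_space UNIV) \<partial>P) = (\<integral>\<^sup>+\<omega>. (\<integral>\<^sup>+y. ?A \<omega> 0 y \<partial>count_space UNIV) \<partial>P)"
    by (rule mass_transport[OF A, symmetric])
  also have "\<dots> = (\<integral>\<^sup>+\<omega>. indicator (?C \<omega>) 0 * ?h \<omega> 0 ^ Suc p \<partial>P)"
    by (simp add: nn_integral_cmult nn_integral_multc hole_size_def)
  also have "(\<integral>\<^sup>+\<omega>. indicator (?C \<omega>) 0 * ?h \<omega> 0 ^ p \<partial>P) + ?N ^ p * (\<integral>\<^sup>+\<omega>. indicator (?C \<omega>) 0 * ?h \<omega> 0 ^ Suc p \<partial>P) < \<top>"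
    using hole_size_moment_inside[OF Lp pos, of q] hole_size_moment_inside[OF Lp pos, of p]
    unfolding Suc by (simp only: ennreal_add_less_top ennreal_mult_less_top power_less_top_ennreal of_nat_less_top simp_thms)
  finally show ?thesis .
qed

text \<open>The indicator restricts the requirement to component vertices, outside of which the
  excursion kernels vanish.\<close>

definition moments :: "real \<Rightarrow> ('d environment \<Rightarrow> 'd site \<Rightarrow> ennreal) \<Rightarrow> bool" where
  "moments \<alpha> f \<longleftrightarrow> sfield f \<and> (\<forall>p. (\<integral>\<^sup>+\<omega>. indicator (strong_component \<alpha> \<omega>) 0 * f \<omega> 0 ^ p \<partial>P) < \<top>)"

lemma moments_one: "moments \<alpha> (\<lambda>\<omega> x. 1)"
proof -
  have "(\<integral>\<^sup>+\<omega>. indicator (strong_component \<alpha> \<omega>) 0 * 1 ^ p \<partial>P) \<le> (\<integral>\<^sup>+\<omega>. 1 \<partial>P)" for p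
    by (intro nn_integral_mono) (auto simp: indicator_def)
  also have "\<dots> < \<top>" by (simp add: emeasure_space_1)
  finally show ?thesis by (simp add: moments_def sfield_const)
qed

text \<open>The maximal theorem asks for a weight that makes P reversible. The conductance cut off
  outside the component is one, and on the component it lies between \<alpha> and the number of
  neighbors, so it can be exchanged with the indicator.\<close>

lemma moments_kmaxavg:
  assumes \<alpha>: "0 < \<alpha>" and f: "moments \<alpha> f"
  shows "moments \<alpha> (\<lambda>\<omega>. kmaxavg (ktotal (exc \<alpha> \<omega>)) (f \<omega>))"
proof -
  let ?C = "strong_component \<alpha>" and ?N = "of_nat (card {y. neighbor (0 :: 'd site) y}) :: ennreal"
  let ?P = "\<lambda>\<omega>. ktotal (exc \<alpha> \<omega>)"
  define w where "w \<omega> x = indicator (?C \<omega>) x * conductance \<omega> x" for \<omega> :: "'d environment" and x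
  have ind: "sfield (\<lambda>\<omega>. indicator (?C \<omega>))"
    by (rule sfield_indicator[OF sset_strong_component])
  have w: "sfield w" unfolding w_def[abs_def] by (rule sfield_mult[OF ind sfield_conductance])
  have f': "sfield f" "\<And>p. (\<integral>\<^sup>+\<omega>. indicator (?C \<omega>) 0 * f \<omega> 0 ^ p \<partial>P) < \<top>"
    using f by (auto simp: moments_def)
  have M: "sfield (\<lambda>\<omega>. kmaxavg (?P \<omega>) (f \<omega>))" by (rule sfield_kmaxavg[OF skernel_ktotal f'(1)])
  note [measurable] = sfield_meas[OF ind] sfield_meas[OF f'(1)] sfield_meas[OF M]
  have sym: "ksym (w \<omega>) (?P \<omega>)" if "\<omega> \<in> space P" for \<omega>
    unfolding ksym_def
  proof (intro allI)
    fix x y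
    show "w \<omega> x * ?P \<omega> x y = w \<omega> y * ?P \<omega> y x"
    proof (cases "x \<in> ?C \<omega> \<and> y \<in> ?C \<omega>")
      case True
      then show ?thesis using ksymD[OF ktotal_sym[of \<omega> \<alpha>], of x y] that by (simp add: w_def space_P)
    next
      case False
      then have "?P \<omega> x y = 0" "?P \<omega> y x = 0" by (intro ktotal_outside; blast)+
      then show ?thesis by simp
    qed
  qed
  have "(\<integral>\<^sup>+\<omega>. w \<omega> 0 * kmaxavg (?P \<omega>) (f \<omega>) 0 ^ q \<partial>P) < \<top>" for q
  proof (rule kmaxavg_moment[OF skernel_ktotal w f'(1) sym])
    show "kapp (?P \<omega>) (\<lambda>_. 1) x \<le> 1" if "\<omega> \<in> space P" for \<omega> x
      using that by (simp add: space_P ktotal_one)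
    fix p
    have "(\<integral>\<^sup>+\<omega>. w \<omega> 0 * f \<omega> 0 ^ p \<partial>P) \<le> (\<integral>\<^sup>+\<omega>. ?N * (indicator (?C \<omega>) 0 * f \<omega> 0 ^ p) \<partial>P)"
    proof (intro nn_integral_mono)
      fix \<omega> :: "'d environment" assume "\<omega> \<in> space P"
      then have "conductance \<omega> 0 \<le> ?N" by (intro conductance_le) (simp add: space_P)
      then have "conductance \<omega> 0 * (indicator (?C \<omega>) 0 * f \<omega> 0 ^ p) \<le> ?N * (indicator (?C \<omega>) 0 * f \<omega> 0 ^ p)"
        by (rule mult_right_mono) simp
      then show "w \<omega> 0 * f \<omega> 0 ^ p \<le> ?N * (indicator (?C \<omega>) 0 * f \<omega> 0 ^ p)"
        by (simp add: w_def ac_simps)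
    qed
    also have "\<dots> = ?N * (\<integral>\<^sup>+\<omega>. indicator (?C \<omega>) 0 * f \<omega> 0 ^ p \<partial>P)" by (rule nn_integral_cmult) measurable
    also have "\<dots> < \<top>" using f'(2) by (simp add: ennreal_mult_less_top of_nat_less_top)
    finally show "(\<integral>\<^sup>+\<omega>. w \<omega> 0 * f \<omega> 0 ^ p \<partial>P) < \<top>" .
  qed
  moreover have "ennreal \<alpha> * (\<integral>\<^sup>+\<omega>. indicator (?C \<omega>) 0 * kmaxavg (?P \<omega>) (f \<omega>) 0 ^ q \<partial>P)
      \<le> (\<integral>\<^sup>+\<omega>. w \<omega> 0 * kmaxavg (?P \<omega>) (f \<omega>) 0 ^ q \<partial>P)" for q
    unfolding nn_integral_cmult[symmetric, OF borel_measurable_times_ennreal[OF sfield_meas[OF ind] sfield_meas[OF sfield_power[OF M]]]]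
  proof (intro nn_integral_mono)
    fix \<omega> :: "'d environment" assume \<omega>: "\<omega> \<in> space P"
    show "ennreal \<alpha> * (indicator (?C \<omega>) 0 * kmaxavg (?P \<omega>) (f \<omega>) 0 ^ q) \<le> w \<omega> 0 * kmaxavg (?P \<omega>) (f \<omega>) 0 ^ q"
      using conductance_ge[of \<omega> 0 \<alpha>] \<omega> by (auto simp: w_def space_P indicator_def intro: mult_right_mono)
  qed
  ultimately have fin: "ennreal \<alpha> * (\<integral>\<^sup>+\<omega>. indicator (?C \<omega>) 0 * kmaxavg (?P \<omega>) (f \<omega>) 0 ^ q \<partial>P) < \<top>" for q
    by (meson le_less_trans)
  have "(\<integral>\<^sup>+\<omega>. indicator (?C \<omega>) 0 * kmaxavg (?P \<omega>) (f \<omega>) 0 ^ q \<partial>P) < \<top>" for q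
    using fin[of q] \<alpha> by (auto simp: ennreal_mult_less_top)
  then show ?thesis using M by (simp add: moments_def)
qed

text \<open>Q f(0) is at most the mean excursion time times f at the best reachable site y. This y
  depends on \<omega>, but its distance is bounded by G; \<open>decay\<close> times a power of G
  pays for replacing it by a sum over all sites, and \<open>ennreal_mult_le_squares\<close>
  separates f from G, so that stationarity applies to f and the hole moments to G.\<close>

lemma moments_kmoment:
  assumes \<alpha>: "0 < \<alpha>" "\<alpha> \<le> \<beta>" and h: "\<And>p. (\<integral>\<^sup>+\<omega>. hole_size \<beta> \<omega> 0 ^ p \<partial>P) < \<top>" and f: "moments \<alpha> f"
  shows "moments \<alpha> (\<lambda>\<omega>. kapp (kmoment 1 (exc \<alpha> \<omega>)) (f \<omega>))"
proof -
  let ?C = "strong_component \<alpha>" and ?N = "of_nat (card {y. neighbor (0 :: 'd site) y}) :: ennreal"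
  let ?Q = "\<lambda>\<omega>. kmoment 1 (exc \<alpha> \<omega>)"
  let ?k = "CARD('d) + 2"
  have ind: "sfield (\<lambda>\<omega>. indicator (?C \<omega>))"
    by (rule sfield_indicator[OF sset_strong_component])
  have f': "sfield f" "\<And>p. (\<integral>\<^sup>+\<omega>. indicator (?C \<omega>) 0 * f \<omega> 0 ^ p \<partial>P) < \<top>"
    using f by (auto simp: moments_def)
  \<comment> \<open>With this constant G dominates both the mean excursion time and one plus the
    length of a coarse step.\<close>
  define \<kappa> where "\<kappa> = 2 + ennreal (1 / \<alpha>) * ?N"
  define G where "G \<omega> = \<kappa> * (1 + hole_size \<beta> \<omega> 0)" for \<omega> :: "'d environment"
  have \<kappa>: "\<kappa> < \<top>" by (simp add: \<kappa>_def ennreal_mult_less_top of_nat_less_top)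
  have [measurable]: "(\<lambda>\<omega>. hole_size \<beta> \<omega> 0) \<in> borel_measurable P" by (rule sfield_meas[OF sfield_hole_size])
  have G_meas [measurable]: "G \<in> borel_measurable P" unfolding G_def[abs_def] by measurable
  note [measurable] = sfield_meas[OF ind] sfield_meas[OF f'(1)]
  have Gp: "(\<integral>\<^sup>+\<omega>. G \<omega> ^ p \<partial>P) < \<top>" for p
  proof -
    have "(\<integral>\<^sup>+\<omega>. G \<omega> ^ p \<partial>P) \<le> (\<integral>\<^sup>+\<omega>. \<kappa> ^ p * 2 ^ p * (1 + hole_size \<beta> \<omega> 0 ^ p) \<partial>P)"
      unfolding G_def power_mult_distrib mult.assoc
      by (intro nn_integral_mono mult_left_mono ennreal_one_plus_power_le) simp
    also have "\<dots> = \<kappa> ^ p * 2 ^ p * (1 + (\<integral>\<^sup>+\<omega>. hole_size \<beta> \<omega> 0 ^ p \<partial>P))"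
      by (simp add: nn_integral_cmult nn_integral_add emeasure_space_1)
    also have "\<dots> < \<top>" using \<kappa> h[of p] by (simp add: ennreal_mult_less_top power_less_top_ennreal)
    finally show ?thesis .
  qed
  have Q: "sfield (\<lambda>\<omega>. kapp (?Q \<omega>) (f \<omega>))" by (rule skernel_kapp[OF skernel_kmoment f'(1)])
  define F where "F p \<omega> = (\<integral>\<^sup>+y. decay y * (indicator (?C \<omega>) y * f \<omega> y ^ (2 * p)) \<partial>count_space UNIV)
      + (\<integral>\<^sup>+y. decay (y :: 'd site) \<partial>count_space UNIV) * G \<omega> ^ (2 * (p + ?k))" for p \<omega>
  have pointwise: "indicator (?C \<omega>) 0 * kapp (?Q \<omega>) (f \<omega>) 0 ^ p \<le> F p \<omega>" if \<omega>: "\<omega> \<in> space P" and p: "0 < p" for \<omega> p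
  proof (cases "0 \<in> ?C \<omega>")
    case True
    have \<omega>': "\<omega> \<in> space env_space" using \<omega> by (simp add: space_P)
    have hm: "hole_size \<alpha> \<omega> 0 \<le> hole_size \<beta> \<omega> 0" by (rule hole_size_mono[OF \<alpha>(2)])
    have W: "kapp (?Q \<omega>) (\<lambda>_. 1) 0 \<le> G \<omega>"
    proof -
      have "kapp (?Q \<omega>) (\<lambda>_. 1) 0 \<le> 1 + ennreal (1 / \<alpha>) * (?N * hole_size \<alpha> \<omega> 0)"
        by (rule mean_excursion_le[OF \<omega>' True \<alpha>(1)])
      also have "\<dots> \<le> \<kappa> * 1 + \<kappa> * hole_size \<beta> \<omega> 0"
        unfolding mult.assoc[symmetric]
        by (intro add_mono mult_mono hm) (auto simp: \<kappa>_def add_increasing2 add_increasing one_le_numeral)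
      finally show ?thesis by (simp add: G_def distrib_left)
    qed
    have D: "of_nat (Suc (l1 0 y)) \<le> G \<omega>" if "?Q \<omega> 0 y \<noteq> 0" for y
    proof -
      have "\<exists>t. exc \<alpha> \<omega> t 0 y \<noteq> 0"
      proof (rule ccontr)
        assume "\<nexists>t. exc \<alpha> \<omega> t 0 y \<noteq> 0"
        then show False using that by (simp add: kmoment_def)
      qed
      then obtain t where "exc \<alpha> \<omega> t 0 y \<noteq> 0" ..
      then have "of_nat (l1 0 y) \<le> hole_size \<beta> \<omega> 0 + 1"
        using exc_l1_le hm by (meson add_right_mono order_trans)
      then have "of_nat (Suc (l1 0 y)) \<le> 1 + (hole_size \<beta> \<omega> 0 + 1)" unfolding of_nat_Suc by (rule add_left_mono)
      also have "\<dots> = 2 * 1 + 1 * hole_size \<beta> \<omega> 0" by (simp add: add.commute add.left_commute)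
      also have "\<dots> \<le> \<kappa> * 1 + \<kappa> * hole_size \<beta> \<omega> 0"
        by (intro add_mono mult_right_mono) (auto simp: \<kappa>_def intro: add_increasing2)
      finally show ?thesis by (simp add: G_def distrib_left)
    qed
    show ?thesis
    proof (cases "G \<omega> = \<top>")
      \<comment> \<open>An infinite G makes the bound F infinite, as it enters with a positive power
        and a positive factor.\<close>
      case G: True
      have "decay (0 :: 'd site) \<noteq> 0" by (simp add: decay_def del: of_nat_Suc)
      moreover have "decay (0 :: 'd site) \<le> (\<integral>\<^sup>+y. decay (y :: 'd site) \<partial>count_space UNIV)"
        using kernel_le_total[of "\<lambda>_ y. decay y" undefined "0 :: 'd site"] by (simp add: kapp_def)
      ultimately have "(\<integral>\<^sup>+y. decay (y :: 'd site) \<partial>count_space UNIV) \<noteq> 0" by (metis le_zero_eq)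
      then have "F p \<omega> = \<top>" unfolding F_def G by (simp add: ennreal_mult_top ennreal_top_power)
      then show ?thesis by simp
    next
      case G: False
      let ?Y = "{y. ?Q \<omega> 0 y \<noteq> 0}"
      obtain R where R: "G \<omega> < of_nat R" using G ennreal_Ex_less_of_nat[of "G \<omega>"] by (auto simp: top.not_eq_extremum)
      have "?Y \<subseteq> {y. l1 0 y \<le> R}"
      proof
        fix y assume "y \<in> ?Y"
        then have "of_nat (Suc (l1 0 y)) \<le> G \<omega>" using D by blast
        then have "(of_nat (Suc (l1 0 y)) :: ennreal) < of_nat R" using R by (rule le_less_trans)
        then have "Suc (l1 0 y) \<le> R" by (metis linorder_not_le of_nat_mono less_imp_le)
        then show "y \<in> {y. l1 0 y \<le> R}" by simp
      qed
      then have finY: "finite ?Y" using finite_l1_ball finite_subset by blast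
      show ?thesis
      proof (cases "?Y = {}")
        case True
        then have "kapp (?Q \<omega>) (f \<omega>) 0 = 0" by (simp add: kapp_def)
        then show ?thesis using p by (simp add: zero_power)
      next
        case False
        define m where "m = Max (f \<omega> ` ?Y)"
        have "m \<in> f \<omega> ` ?Y" unfolding m_def using finY False by (intro Max_in) auto
        then obtain y where y: "y \<in> ?Y" "m = f \<omega> y" by blast
        have ymax: "f \<omega> z \<le> f \<omega> y" if "?Q \<omega> 0 z \<noteq> 0" for z
          unfolding y(2)[symmetric] m_def using that finY by (intro Max_ge) auto
        have yC: "y \<in> ?C \<omega>" using y(1) kmoment_outside by blast
        have "kapp (?Q \<omega>) (f \<omega>) 0 \<le> kapp (?Q \<omega>) (\<lambda>_. 1 * f \<omega> y) 0"
          using ymax by (intro kapp_mono_right) simp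
        also have "\<dots> \<le> G \<omega> * f \<omega> y" unfolding kapp_multc by (rule mult_right_mono[OF W]) simp
        finally have "kapp (?Q \<omega>) (f \<omega>) 0 ^ p \<le> (G \<omega> * f \<omega> y) ^ p" by (rule power_mono) simp
        also have "\<dots> = 1 * (G \<omega> ^ p * f \<omega> y ^ p)" by (simp add: power_mult_distrib)
        also have "\<dots> \<le> (decay y * G \<omega> ^ ?k) * (G \<omega> ^ p * f \<omega> y ^ p)"
        proof (rule mult_right_mono)
          have "1 = decay y * of_nat (Suc (l1 0 y)) ^ ?k"
            by (simp add: decay_def ennreal_of_nat_eq_real_of_nat ennreal_power ennreal_mult[symmetric] del: of_nat_Suc power_Suc)
          also have "\<dots> \<le> decay y * G \<omega> ^ ?k"
            using D y(1) by (intro mult_left_mono power_mono) auto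
          finally show "1 \<le> decay y * G \<omega> ^ ?k" .
        qed simp
        also have "\<dots> = decay y * (f \<omega> y ^ p * G \<omega> ^ (p + ?k))" by (simp only: power_add mult_ac)
        also have "\<dots> \<le> decay y * ((f \<omega> y ^ p)\<^sup>2 + (G \<omega> ^ (p + ?k))\<^sup>2)"
          by (rule mult_left_mono[OF ennreal_mult_le_squares]) simp
        also have "\<dots> = decay y * (indicator (?C \<omega>) y * f \<omega> y ^ (2 * p)) + decay y * G \<omega> ^ (2 * (p + ?k))"
        proof -
          have sq: "(a ^ n)\<^sup>2 = a ^ (2 * n)" for a :: ennreal and n
            unfolding power_mult[symmetric] by (simp only: mult.commute)
          show ?thesis using yC unfolding sq distrib_left by simp
        qed
        also have "\<dots> \<le> F p \<omega>"
          unfolding F_def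
        proof (intro add_mono mult_right_mono)
          show "decay y * (indicator (?C \<omega>) y * f \<omega> y ^ (2 * p)) \<le> (\<integral>\<^sup>+y. decay y * (indicator (?C \<omega>) y * f \<omega> y ^ (2 * p)) \<partial>count_space UNIV)"
            using kernel_le_total[of "\<lambda>_ y. decay y * (indicator (?C \<omega>) y * f \<omega> y ^ (2 * p))" undefined y] by (simp add: kapp_def)
          show "decay y \<le> (\<integral>\<^sup>+y. decay (y :: 'd site) \<partial>count_space UNIV)"
            using kernel_le_total[of "\<lambda>_ y. decay y" undefined y] by (simp add: kapp_def)
        qed simp
        finally show ?thesis using True by simp
      qed
    qed
  qed simp
  have F: "(\<integral>\<^sup>+\<omega>. F p \<omega> \<partial>P) < \<top>" for p
  proof -
    let ?g = "\<lambda>\<omega> y. indicator (?C \<omega>) y * f \<omega> y ^ (2 * p)"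
    have g: "sfield ?g" by (intro sfield_mult ind sfield_power f'(1))
    note [measurable] = sfield_meas[OF g]
    have Gm: "(\<lambda>\<omega>. G \<omega> ^ (2 * (p + ?k))) \<in> borel_measurable P" by measurable
    have mg: "(\<lambda>\<omega>. \<integral>\<^sup>+y. decay y * ?g \<omega> y \<partial>count_space UNIV) \<in> borel_measurable P"
      by (intro borel_measurable_count_space_integral borel_measurable_times_ennreal borel_measurable_const sfield_meas[OF g])
    have st: "(\<integral>\<^sup>+\<omega>. ?g \<omega> y \<partial>P) = (\<integral>\<^sup>+\<omega>. ?g \<omega> 0 \<partial>P)" for y
    proof -
      have "(\<integral>\<^sup>+\<omega>. ?g (shift y \<omega>) 0 \<partial>P) = (\<integral>\<^sup>+\<omega>. ?g \<omega> 0 \<partial>P)"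
        by (rule nn_integral_shift[OF sfield_meas[OF g]])
      moreover have "(\<integral>\<^sup>+\<omega>. ?g (shift y \<omega>) 0 \<partial>P) = (\<integral>\<^sup>+\<omega>. ?g \<omega> y \<partial>P)"
        by (intro nn_integral_cong) (simp only: sfield_shift[OF g] add_0)
      ultimately show ?thesis by simp
    qed
    have "(\<integral>\<^sup>+\<omega>. F p \<omega> \<partial>P) = (\<integral>\<^sup>+\<omega>. (\<integral>\<^sup>+y. decay y * ?g \<omega> y \<partial>count_space UNIV) \<partial>P)
        + (\<integral>\<^sup>+y. decay (y :: 'd site) \<partial>count_space UNIV) * (\<integral>\<^sup>+\<omega>. G \<omega> ^ (2 * (p + ?k)) \<partial>P)"
      unfolding F_def nn_integral_cmult[OF Gm, symmetric]
      by (rule nn_integral_add[OF mg borel_measurable_times_ennreal[OF borel_measurable_const Gm]])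
    also have "(\<integral>\<^sup>+\<omega>. (\<integral>\<^sup>+y. decay y * ?g \<omega> y \<partial>count_space UNIV) \<partial>P)
        = (\<integral>\<^sup>+y. (\<integral>\<^sup>+\<omega>. decay y * ?g \<omega> y \<partial>P) \<partial>count_space UNIV)"
      by (rule nn_integral_count_space_nn_integral[where I=UNIV and M=P and f="\<lambda>y \<omega>. decay y * ?g \<omega> y",
            OF countableI_type borel_measurable_times_ennreal[OF borel_measurable_const sfield_meas[OF g]]])
    also have "\<dots> = (\<integral>\<^sup>+y. decay (y :: 'd site) \<partial>count_space UNIV) * (\<integral>\<^sup>+\<omega>. ?g \<omega> 0 \<partial>P)"
    proof -
      have "(\<integral>\<^sup>+\<omega>. decay y * ?g \<omega> y \<partial>P) = decay y * (\<integral>\<^sup>+\<omega>. ?g \<omega> 0 \<partial>P)" for y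
        unfolding nn_integral_cmult[OF sfield_meas[OF g]] st[of y] ..
      then have "(\<integral>\<^sup>+y. (\<integral>\<^sup>+\<omega>. decay y * ?g \<omega> y \<partial>P) \<partial>count_space UNIV)
          = (\<integral>\<^sup>+y. decay (y :: 'd site) * (\<integral>\<^sup>+\<omega>. ?g \<omega> 0 \<partial>P) \<partial>count_space UNIV)" by (simp only:)
      also have "\<dots> = (\<integral>\<^sup>+y. decay (y :: 'd site) \<partial>count_space UNIV) * (\<integral>\<^sup>+\<omega>. ?g \<omega> 0 \<partial>P)"
        by (rule nn_integral_multc) simp
      finally show ?thesis .
    qed
    finally show ?thesis
      using decay_summable[where 'd='d] f'(2)[of "2 * p"] Gp[of "2 * (p + ?k)"]
      by (simp only: ennreal_add_less_top ennreal_mult_less_top simp_thms)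
  qed
  have "(\<integral>\<^sup>+\<omega>. indicator (?C \<omega>) 0 * kapp (?Q \<omega>) (f \<omega>) 0 ^ p \<partial>P) < \<top>" for p
  proof (cases "p = 0")
    case True
    then show ?thesis using f'(2)[of 0] by simp
  next
    case False
    then have "(\<integral>\<^sup>+\<omega>. indicator (?C \<omega>) 0 * kapp (?Q \<omega>) (f \<omega>) 0 ^ p \<partial>P) \<le> (\<integral>\<^sup>+\<omega>. F p \<omega> \<partial>P)"
      by (intro nn_integral_mono pointwise) auto
    then show ?thesis using F by (rule le_less_trans)
  qed
  then show ?thesis using Q by (simp add: moments_def)
qed

lemma moments_kiter:
  assumes "0 < \<alpha>" "\<alpha> \<le> \<beta>" "\<And>p. (\<integral>\<^sup>+\<omega>. hole_size \<beta> \<omega> 0 ^ p \<partial>P) < \<top>"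
  shows "moments \<alpha> (\<lambda>\<omega>. kiter (ktotal (exc \<alpha> \<omega>)) (kmoment 1 (exc \<alpha> \<omega>)) q)"
proof (induction q)
  case 0
  show ?case by (simp add: moments_one)
next
  case (Suc q)
  show ?case
    unfolding kiter.simps by (intro moments_kmaxavg moments_kmoment[OF assms] Suc assms(1))
qed

lemma moments_AE_finite:
  assumes "moments \<alpha> f"
  shows "AE \<omega> in P. 0 \<in> strong_component \<alpha> \<omega> \<longrightarrow> f \<omega> 0 < \<top>"
proof -
  have ind: "sfield (\<lambda>\<omega>. indicator (strong_component \<alpha> \<omega>))"
    by (rule sfield_indicator[OF sset_strong_component])
  have f: "sfield f" using assms by (simp add: moments_def)
  have "(\<integral>\<^sup>+\<omega>. indicator (strong_component \<alpha> \<omega>) 0 * f \<omega> 0 ^ 1 \<partial>P) < \<top>"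
    using assms unfolding moments_def by blast
  then have "AE \<omega> in P. indicator (strong_component \<alpha> \<omega>) 0 * f \<omega> 0 ^ 1 \<noteq> \<infinity>"
    by (intro nn_integral_PInf_AE sfield_meas[OF sfield_mult[OF ind sfield_power[OF f]]]) auto
  then show ?thesis by eventually_elim (auto simp: top.not_eq_extremum)
qed

lemma hole_size_AE_finite:
  assumes "(\<integral>\<^sup>+\<omega>. hole_size \<beta> \<omega> 0 ^ 1 \<partial>P) < \<top>"
  shows "AE \<omega> in P. \<forall>x. hole_size \<beta> \<omega> x < \<top>"
  unfolding AE_all_countable
proof
  fix x
  have "(\<integral>\<^sup>+\<omega>. hole_size \<beta> (shift x \<omega>) 0 \<partial>P) = (\<integral>\<^sup>+\<omega>. hole_size \<beta> \<omega> 0 \<partial>P)"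
    by (rule nn_integral_shift[OF sfield_meas[OF sfield_hole_size]])
  moreover have "(\<integral>\<^sup>+\<omega>. hole_size \<beta> (shift x \<omega>) 0 \<partial>P) = (\<integral>\<^sup>+\<omega>. hole_size \<beta> \<omega> x \<partial>P)"
    by (intro nn_integral_cong) (simp only: sfield_shift[OF sfield_hole_size] add_0)
  ultimately have "(\<integral>\<^sup>+\<omega>. hole_size \<beta> \<omega> x \<partial>P) < \<top>" using assms by simp
  then have "AE \<omega> in P. hole_size \<beta> \<omega> x \<noteq> \<infinity>"
    by (intro nn_integral_PInf_AE sfield_meas[OF sfield_hole_size]) auto
  then show "AE \<omega> in P. hole_size \<beta> \<omega> x < \<top>" by eventually_elim (auto simp: top.not_eq_extremum)
qed

end

section \<open>From the heat-kernel estimate to bounds on words\<close>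

lemma ktotal_nonzero_of_kmoment:
  assumes "kmoment p (exc \<alpha> \<omega>) x y \<noteq> 0"
  shows "ktotal (exc \<alpha> \<omega>) x y \<noteq> 0"
proof
  assume "ktotal (exc \<alpha> \<omega>) x y = 0"
  then have "exc \<alpha> \<omega> t x y = 0" for t
    using sum_le_suminf[of "\<lambda>t. exc \<alpha> \<omega> t x y" "{t}"] by (simp add: ktotal_def)
  then show False using assms by (simp add: kmoment_def)
qed

lemma kcomp_nonzero: "(A x z :: ennreal) \<noteq> 0 \<Longrightarrow> B z y \<noteq> 0 \<Longrightarrow> (A \<odot> B) x y \<noteq> 0"
  using kcomp_term_le[of A x z B y] by auto

text \<open>Replacing letters Q by P preserves positivity, so a site reached by a word of length l
  is within coarse distance l.\<close>

lemma kword_nonzero_0: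
  assumes PQ: "\<And>x y. Q x y \<noteq> 0 \<Longrightarrow> P x y \<noteq> 0" and "kword P Q l q x y \<noteq> 0"
  shows "kword P Q l 0 x y \<noteq> 0"
  using assms(2)
proof (induction l arbitrary: q x)
  case 0
  then show ?case by (cases q) auto
next
  case (Suc l)
  have "(\<exists>p. (P \<odot> kword P Q l p) x y \<noteq> 0) \<or> (\<exists>p. (Q \<odot> kword P Q l p) x y \<noteq> 0)"
    using Suc.prems by (cases q) auto
  then obtain p z where z: "P x z \<noteq> 0" "kword P Q l p z y \<noteq> 0"
    using PQ by (meson kcomp_nonzeroE)
  have "(P \<odot> kword P Q l 0) x y \<noteq> 0"
    using z(1) Suc.IH[OF z(2)] by (rule kcomp_nonzero)
  then show ?case by simp
qed

lemma kword_source: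
  assumes "\<And>x y. P x y \<noteq> 0 \<Longrightarrow> x \<in> C" "\<And>x y. Q x y \<noteq> 0 \<Longrightarrow> x \<in> C" "y \<in> C" "kword P Q l q x y \<noteq> 0"
  shows "x \<in> C"
proof (cases l)
  case 0
  then show ?thesis using assms(3,4) by (cases q) (auto simp: kone_def split: if_splits)
next
  case (Suc k)
  have "(\<exists>p. (P \<odot> kword P Q k p) x y \<noteq> 0) \<or> (\<exists>p. (Q \<odot> kword P Q k p) x y \<noteq> 0)"
    using assms(4) unfolding Suc by (cases q) auto
  then show ?thesis using assms(1,2) by (meson kcomp_nonzeroE)
qed

text \<open>Combines \<open>kword_diag_le\<close> with the heat-kernel bound on a free block of
  length L. Such a block begins after at most q others, hence at coarse distance at most q L <=
  \<rho> L from 0.\<close>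

lemma kword_bound:
  fixes \<omega> :: "'d::finite environment" and \<alpha> \<rho> D :: real and q :: nat
  defines "P \<equiv> ktotal (exc \<alpha> \<omega>)" and "Q \<equiv> kmoment 1 (exc \<alpha> \<omega>)"
    and "N \<equiv> real (card {y. neighbor (0 :: 'd site) y})"
  assumes \<omega>: "\<omega> \<in> space env_space" and 0: "0 \<in> strong_component \<alpha> \<omega>" and \<alpha>: "0 < \<alpha>"
    and hk: "\<And>n x y. 1 \<le> n \<Longrightarrow> x \<in> strong_component \<alpha> \<omega> \<Longrightarrow> y \<in> strong_component \<alpha> \<omega> \<Longrightarrow>
      ereal_of_enat (coarse_dist \<alpha> \<omega> 0 x) \<le> ereal (\<rho> * real n) \<Longrightarrow>
      coarse_heat_kernel \<alpha> \<omega> n x y \<le> D / real n powr (real d / 2)"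
    and q: "1 \<le> q" "real q \<le> \<rho>" and l: "1 \<le> l"
  shows "kword P Q l q 0 0 \<le>
    (of_nat (Suc q) * ennreal (\<bar>D\<bar> * (2 * real (Suc q)) powr (real d / 2)) * ennreal (N / \<alpha>)
        * (\<Sum>a\<le>q. kiter P Q a 0 * kiter P Q (q - a) 0)
      + ennreal (real q powr (real d / 2)) * kiter P Q q 0)
    * ennreal (real l powr (real q - real d / 2))"
    (is "_ \<le> (?A + ?B) * _")
proof -
  let ?C = "strong_component \<alpha> \<omega>" and ?w = "conductance \<omega>"
  have P1: "kapp P (\<lambda>_. 1) x \<le> 1" for x unfolding P_def by (rule ktotal_one[OF \<omega>])
  have lq: "of_nat l ^ q = ennreal (real l powr real q)"
    using l by (simp add: ennreal_of_nat_eq_real_of_nat ennreal_power powr_realpow)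
  have lpow: "ennreal (real l powr real q) * ennreal (real l powr (- (real d / 2))) = ennreal (real l powr (real q - real d / 2))"
    by (simp add: ennreal_mult[symmetric] powr_add[symmetric])
  show ?thesis
  proof (cases "l \<le> q")
    \<comment> \<open>For l <= q the blocks would be empty. The trivial bound is brought to the
      common form by the factor q^(d/2) l^(-d/2) >= 1.\<close>
    case True
    have "kword P Q l q 0 0 \<le> kapp (kword P Q l q) (\<lambda>_. 1) 0" by (rule kernel_le_total)
    also have "\<dots> \<le> of_nat l ^ q * kiter P Q q 0" by (rule kword_total_le[OF P1 order_refl])
    also have "\<dots> = 1 * (ennreal (real l powr real q) * kiter P Q q 0)" by (simp add: lq)
    also have "\<dots> \<le> ennreal (real q powr (real d / 2) * real l powr (- (real d / 2))) * (ennreal (real l powr real q) * kiter P Q q 0)"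
    proof (rule mult_right_mono)
      have "real l powr (real d / 2) \<le> real q powr (real d / 2)" using True by (intro powr_mono2) auto
      then have "1 \<le> real q powr (real d / 2) * real l powr (- (real d / 2))"
        using l by (simp add: powr_minus field_simps)
      then show "1 \<le> ennreal (real q powr (real d / 2) * real l powr (- (real d / 2)))"
        by (simp add: ennreal_leI[of 1, simplified])
    qed simp
    also have "\<dots> = ?B * (ennreal (real l powr real q) * ennreal (real l powr (- (real d / 2))))"
      by (simp add: ennreal_mult ac_simps)
    also have "\<dots> \<le> (?A + ?B) * ennreal (real l powr (real q - real d / 2))"
      unfolding lpow by (intro mult_right_mono) (auto simp: add_increasing)
    finally show ?thesis .
  next
    case False
    define L where "L = l div Suc q"
    have L: "Suc q * L \<le> l" unfolding L_def by (rule times_div_less_eq_dividend)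
    have L1: "1 \<le> L" using False by (simp add: L_def Suc_le_eq div_greater_zero_iff)
    \<comment> \<open>As L >= 1, rounding l down to a multiple of q + 1 loses at most a factor
      2.\<close>
    have l2: "l \<le> 2 * Suc q * L"
    proof -
      have "l = Suc q * L + l mod Suc q" unfolding L_def by (rule mult_div_mod_eq[symmetric])
      also have "l mod Suc q \<le> Suc q * L" using L1 mod_less_divisor[of "Suc q" l] by (metis less_imp_le le_trans mult_le_mono2 nat_mult_1_right zero_less_Suc)
      finally show ?thesis by simp
    qed
    have PQ: "Q x y \<noteq> 0 \<Longrightarrow> P x y \<noteq> 0" for x y
      unfolding P_def Q_def by (rule ktotal_nonzero_of_kmoment)
    have src: "P x y \<noteq> 0 \<Longrightarrow> x \<in> ?C" "Q x y \<noteq> 0 \<Longrightarrow> x \<in> ?C" for x y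
      unfolding P_def Q_def using ktotal_outside kmoment_outside by blast+
    have symPQ: "ksym ?w P" "ksym ?w Q"
      unfolding P_def Q_def by (intro ktotal_sym kmoment_sym \<omega>)+
    have in_C: "y \<in> ?C" if "kword P Q k b y 0 \<noteq> 0" for k b y
      using src 0 that by (rule kword_source)
    have w: "?w 0 \<noteq> 0" "?w y \<noteq> \<top>" "?w y \<noteq> 0" for y
      using total_conductance_pos[OF \<omega>] by (auto simp: conductance_def ennreal_eq_0_iff not_le)
    have in_C': "x \<in> ?C" if "kword P Q k b 0 x \<noteq> 0" for k b x
    proof (rule in_C)
      have "?w 0 * kword P Q k b 0 x \<noteq> 0" using w(1) that by simp
      then have "?w x * kword P Q k b x 0 \<noteq> 0" unfolding ksymD[OF kword_sym[OF symPQ], of 0] .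
      then show "kword P Q k b x 0 \<noteq> 0" by auto
    qed
    \<comment> \<open>The absolute value keeps e nonnegative whatever the sign of D; the factor 2 (q
      + 1) comes from L >= l / (2 (q + 1)).\<close>
    define e where "e = \<bar>D\<bar> * (2 * real (Suc q)) powr (real d / 2) * real l powr (- (real d / 2))"
    have e: "D / real L powr (real d / 2) \<le> e"
    proof -
      have "real l \<le> real (2 * Suc q * L)" using l2 by (rule of_nat_mono)
      then have "real l \<le> 2 * real (Suc q) * real L" by (simp only: of_nat_mult of_nat_numeral)
      then have "real l powr (real d / 2) \<le> (2 * real (Suc q) * real L) powr (real d / 2)"
        by (intro powr_mono2) (auto simp del: of_nat_Suc)
      also have "\<dots> = (2 * real (Suc q)) powr (real d / 2) * real L powr (real d / 2)"
        by (rule powr_mult)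
      finally have "1 / real L powr (real d / 2) \<le> (2 * real (Suc q)) powr (real d / 2) * real l powr (- (real d / 2))"
        using L1 l by (simp add: powr_minus field_simps del: of_nat_Suc)
      then have "\<bar>D\<bar> * (1 / real L powr (real d / 2)) \<le> e"
        unfolding e_def mult.assoc by (rule mult_left_mono) simp
      moreover have "D / real L powr (real d / 2) \<le> \<bar>D\<bar> / real L powr (real d / 2)"
        by (intro divide_right_mono) auto
      ultimately show ?thesis by simp
    qed
    have "kword P Q l q 0 0 \<le> of_nat (Suc q) * of_nat l ^ q * ennreal e * ennreal (N / \<alpha>) * (\<Sum>a\<le>q. kiter P Q a 0 * kiter P Q (q - a) 0)"
    proof (rule kword_diag_le[OF P1 symPQ _ L])
      fix k b y assume "kword P Q k b y 0 \<noteq> 0"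
      then have "ennreal \<alpha> \<le> ?w y" by (intro conductance_ge \<omega> in_C)
      have "?w 0 \<le> ennreal N"
        using conductance_le[OF \<omega>, of 0] by (simp add: N_def ennreal_of_nat_eq_real_of_nat)
      also have "ennreal N = ennreal (N / \<alpha>) * ennreal \<alpha>"
        using \<alpha> by (simp add: ennreal_mult[symmetric] N_def)
      also have "\<dots> \<le> ennreal (N / \<alpha>) * ?w y" using \<open>ennreal \<alpha> \<le> ?w y\<close> by (rule mult_left_mono) simp
      finally show "?w 0 \<le> ennreal (N / \<alpha>) * ?w y \<and> ?w y \<noteq> 0 \<and> ?w y \<noteq> \<top>" using w by simp
    next
      fix j a b k x y
      assume j: "j \<le> q" and x: "kword P Q (j * L) a 0 x \<noteq> 0" and y: "kword P Q k b y 0 \<noteq> 0"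
      have xC: "x \<in> ?C" and yC: "y \<in> ?C" using in_C'[OF x] in_C[OF y] by auto
      have chk: "ennreal (coarse_heat_kernel \<alpha> \<omega> n u v) = kword P Q n 0 u v" if "u \<in> ?C" "v \<in> ?C" for n u v
        unfolding P_def exc_def by (rule coarse_heat_kernel_kword[OF \<omega> refl that])
      have "kword P Q (j * L) 0 0 x \<noteq> 0" using PQ x by (rule kword_nonzero_0)
      then have "0 < coarse_heat_kernel \<alpha> \<omega> (j * L) 0 x"
        unfolding chk[OF 0 xC, symmetric] by (simp add: ennreal_eq_0_iff not_le)
      then have "coarse_dist \<alpha> \<omega> 0 x \<le> enat (j * L)"
        unfolding coarse_dist_def by (intro Inf_lower) blast
      then have "ereal_of_enat (coarse_dist \<alpha> \<omega> 0 x) \<le> ereal_of_enat (enat (j * L))"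
        by (simp only: ereal_of_enat_le_iff)
      also have "\<dots> = ereal (real j * real L)" by simp
      also have "\<dots> \<le> ereal (\<rho> * real L)"
        using j q(2) by (simp only: ereal_less_eq) (intro mult_right_mono, auto)
      finally have "coarse_heat_kernel \<alpha> \<omega> L x y \<le> e"
        using hk[OF L1 xC yC] e by linarith
      then show "kword P Q L 0 x y \<le> ennreal e"
        unfolding chk[OF xC yC, symmetric] by (rule ennreal_leI)
    qed
    also have "\<dots> = ?A * (ennreal (real l powr real q) * ennreal (real l powr (- (real d / 2))))"
      unfolding e_def lq by (subst ennreal_mult) (auto simp: ac_simps simp del: of_nat_Suc)
    also have "\<dots> \<le> (?A + ?B) * ennreal (real l powr (real q - real d / 2))"
      unfolding lpow by (intro mult_right_mono) (auto simp: add_increasing2)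
    finally show ?thesis .
  qed
qed

lemma alpha1_positive_measure:
  assumes "0 < \<beta>" "\<beta> < alpha1 P"
  shows "measure P (component_event P \<beta>) \<noteq> 0"
proof
  assume "measure P (component_event P \<beta>) = 0"
  then have "alpha1 P \<le> \<beta>"
    unfolding alpha1_def using assms(1) by (intro cInf_lower bdd_belowI[of _ 0]) auto
  then show False using assms(2) by simp
qed

theorem theorem2p3:
  fixes P :: "('d::finite) environment measure"
    and \<alpha>0 \<alpha> :: real
    and r :: nat
    and lam :: "nat \<Rightarrow> 'd environment \<Rightarrow> real"
  assumes dim: "CARD('d) \<ge> 4"
    and law: "prob_space P" "sets P = sets env_space"
    and A1: "jointly_ergodic P"
    and A2: "AE \<omega> in P. (\<Union>\<alpha>\<in>{0<..}. strong_component \<alpha> \<omega>) = UNIV"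
    and A3: "good_alphas P \<noteq> {}"
    and A4: "0 < \<alpha>0" "\<alpha>0 \<le> alpha2 P" "heat_kernel_bound P \<alpha>0"
    and r_def: "r = nat \<lfloor>real CARD('d) / 2 - 1\<rfloor>"
    and lam_def: "\<And>n \<omega>. lam n \<omega> = real n powr (real CARD('d) / 2) * heat_kernel \<omega> (2 * n) 0 0"
    and \<alpha>: "0 < \<alpha>" "\<alpha> < \<alpha>0"
  shows "\<exists>C :: 'd environment \<Rightarrow> real. C \<in> borel_measurable P \<and>
    (AE \<omega> in cond_law P \<alpha>. \<forall>n\<ge>1. \<forall>\<theta>::real. 1 \<le> \<theta> \<and> \<theta> \<le> real n / 2 \<longrightarrow>
      (\<exists>m::nat. real n - \<theta> \<le> real m \<and> m \<le> n \<and>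
        \<P>(X in walk_law \<omega> 0. trapping_event (strong_component \<alpha> \<omega>) r \<theta> m X \<bar> X (2 * m) = 0)
          \<ge> 1 - C \<omega> / lam n \<omega> *
              (if CARD('d) = 4 then real n / \<theta> * ln (real n / \<theta>)
               else (real n / \<theta>) powr (real CARD('d) / 2 - 1))))"
proof -
  interpret stationary_env P by (rule stationary_env.intro[OF law A1])
  let ?d = "CARD('d)" and ?C = "strong_component \<alpha>"
  \<comment> \<open>\<alpha> lies below the supremum of the good thresholds; a good \<beta> above it
    controls the holes at \<alpha> by monotonicity.\<close>
  obtain \<beta> where \<beta>: "\<beta> \<in> good_alphas P" "\<alpha> < \<beta>"
    using less_cSupD[OF A3, of \<alpha>] \<alpha>(2) A4(2) by (auto simp: alpha2_def)
  then have \<beta>': "0 < \<beta>" "\<beta> < alpha1 P" and Lp: "\<And>p. p \<ge> 1 \<Longrightarrow> holes_in_Lp P \<beta> p"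
    by (auto simp: good_alphas_def)
  have pos: "measure P (component_event P \<beta>) \<noteq> 0" by (rule alpha1_positive_measure[OF \<beta>'])
  have hole: "(\<integral>\<^sup>+\<omega>. hole_size \<beta> \<omega> 0 ^ p \<partial>P) < \<top>" for p by (rule hole_size_moment[OF Lp pos])
  let ?E = "component_event P \<alpha>"
  have E: "emeasure P ?E \<noteq> 0" "emeasure P ?E < \<infinity>"
  proof -
    have "component_event P \<beta> \<subseteq> ?E"
      using strong_component_mono[of \<alpha> \<beta>] \<beta>(2) by (auto simp: component_event_def)
    then have "emeasure P (component_event P \<beta>) \<le> emeasure P ?E"
      by (intro emeasure_mono component_event_sets)
    moreover have "emeasure P (component_event P \<beta>) \<noteq> 0" using pos by (simp add: emeasure_eq_measure)
    ultimately show "emeasure P ?E \<noteq> 0" by auto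
    show "emeasure P ?E < \<infinity>" by (simp add: emeasure_eq_measure)
  qed
  have AE_cond: "AE \<omega> in cond_law P \<alpha>. R \<omega>" if "AE \<omega> in P. 0 \<in> ?C \<omega> \<longrightarrow> R \<omega>" for R
    unfolding cond_law_def AE_uniform_measure[OF E]
    using that by eventually_elim (auto simp: component_event_def)
  \<comment> \<open>Words carry at most r + 1 letters Q, so a free block starts after at most r + 1
    blocks.\<close>
  define \<rho> where "\<rho> = real (Suc r)"
  obtain D :: "'d environment \<Rightarrow> real" where D: "D \<in> borel_measurable P"
    and hk: "AE \<omega> in cond_law P \<alpha>. \<forall>n\<ge>1. \<forall>x\<in>?C \<omega>.
       ereal_of_enat (coarse_dist \<alpha> \<omega> 0 x) \<le> ereal (\<rho> * real n) \<longrightarrow>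
       (\<forall>y\<in>?C \<omega>. coarse_heat_kernel \<alpha> \<omega> n x y \<le> D \<omega> / real n powr (real ?d / 2))"
  proof -
    have "0 < \<rho>" by (simp add: \<rho>_def)
    then show ?thesis using A4(3) \<alpha> that unfolding heat_kernel_bound_def by meson
  qed
  obtain c where c: "0 \<le> c" and sums: "\<And>n \<theta>. 1 \<le> \<theta> \<Longrightarrow> \<theta> \<le> real n / 2 \<Longrightarrow>
      (\<Sum>l | \<theta> < real l \<and> l \<le> 2 * n. real l powr (1 - real ?d / 2)) / real n
      + fact (Suc r) / (real n * \<theta> ^ r) * (\<Sum>l | 1 \<le> l \<and> real l \<le> \<theta>. real l powr (real (Suc r) - real ?d / 2))
      + real r * (real r / real n) ^ Suc r
      \<le> c * (\<theta> * real n powr (- (real ?d / 2)) * trap_error ?d (real n) \<theta>)"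
    using trap_sums_le[OF dim r_def] by blast
  let ?P = "\<lambda>\<omega>. ktotal (exc \<alpha> \<omega>)" and ?Q = "\<lambda>\<omega>. kmoment 1 (exc \<alpha> \<omega>)" and ?R = "\<lambda>\<omega>. kmoment (Suc r) (exc \<alpha> \<omega>)"
  define h where "h q \<omega> = kiter (?P \<omega>) (?Q \<omega>) q 0" for q and \<omega> :: "'d environment"
  define B1 where "B1 q \<omega> = of_nat (Suc q) * ennreal (\<bar>D \<omega>\<bar> * (2 * real (Suc q)) powr (real ?d / 2))
      * ennreal (real (card {y. neighbor (0 :: 'd site) y}) / \<alpha>) * (\<Sum>a\<le>q. h a \<omega> * h (q - a) \<omega>)
      + ennreal (real q powr (real ?d / 2)) * h q \<omega>" for q and \<omega> :: "'d environment"
  \<comment> \<open>One constant for all three kinds of words. The last sum is treated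
    qualitatively: it is finite almost surely.\<close>
  define B where "B \<omega> = B1 1 \<omega> + B1 (Suc r) \<omega> + (\<Sum>l<r. kword (?P \<omega>) (?R \<omega>) l 1 0 0)" for \<omega> :: "'d environment"
  have h_meas [measurable]: "h q \<in> borel_measurable P" for q
    unfolding h_def[abs_def] by (rule sfield_meas[OF sfield_kiter[OF skernel_ktotal skernel_kmoment]])
  have [measurable]: "(\<lambda>\<omega>. kword (?P \<omega>) (?R \<omega>) l 1 0 0) \<in> borel_measurable P" for l
    by (rule skernel_meas[OF skernel_kword[OF skernel_ktotal skernel_kmoment]])
  note [measurable] = D
  \<comment> \<open>\<open>enn2real\<close> sends infinity to 0, which does no harm because B is
    finite almost surely.\<close>
  have B_meas: "(\<lambda>\<omega>. c * enn2real (B \<omega>)) \<in> borel_measurable P"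
    unfolding B_def[abs_def] B1_def[abs_def] by measurable
  have "AE \<omega> in P. \<forall>q. 0 \<in> ?C \<omega> \<longrightarrow> h q \<omega> < \<top>"
    unfolding AE_all_countable
    using moments_AE_finite[OF moments_kiter[OF \<alpha>(1) less_imp_le[OF \<beta>(2)] hole]] by (simp add: h_def)
  then have h_fin: "AE \<omega> in cond_law P \<alpha>. \<forall>q. h q \<omega> < \<top>"
    by (intro AE_cond) (auto elim: eventually_mono)
  have hole_fin: "AE \<omega> in cond_law P \<alpha>. \<forall>x. hole_size \<beta> \<omega> x < \<top>"
    using hole_size_AE_finite[OF hole] by (intro AE_cond) (auto elim: eventually_mono)
  have inE: "AE \<omega> in cond_law P \<alpha>. \<omega> \<in> space P \<and> 0 \<in> ?C \<omega>"
    by (intro AE_cond) (use AE_space in eventually_elim, auto)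
  have main: "AE \<omega> in cond_law P \<alpha>. \<forall>n\<ge>1. \<forall>\<theta>::real. 1 \<le> \<theta> \<and> \<theta> \<le> real n / 2 \<longrightarrow>
      (\<exists>m::nat. real n - \<theta> \<le> real m \<and> m \<le> n \<and>
        \<P>(X in walk_law \<omega> 0. trapping_event (?C \<omega>) r \<theta> m X \<bar> X (2 * m) = 0)
          \<ge> 1 - c * enn2real (B \<omega>) / (real n powr (real ?d / 2) * heat_kernel \<omega> (2 * n) 0 0) * trap_error ?d (real n) \<theta>)"
    using hk h_fin hole_fin inE
  proof eventually_elim
    fix \<omega> :: "'d environment"
    assume hk\<omega>: "\<forall>n\<ge>1. \<forall>x\<in>?C \<omega>. ereal_of_enat (coarse_dist \<alpha> \<omega> 0 x) \<le> ereal (\<rho> * real n) \<longrightarrow>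
         (\<forall>y\<in>?C \<omega>. coarse_heat_kernel \<alpha> \<omega> n x y \<le> D \<omega> / real n powr (real ?d / 2))"
      and h\<omega>: "\<forall>q. h q \<omega> < \<top>" and hole\<omega>: "\<forall>x. hole_size \<beta> \<omega> x < \<top>" and E\<omega>: "\<omega> \<in> space P \<and> 0 \<in> ?C \<omega>"
    have \<omega>: "\<omega> \<in> space env_space" and 0: "0 \<in> ?C \<omega>" using E\<omega> by (auto simp: space_P)
    have hole\<alpha>: "hole_size \<alpha> \<omega> x < \<top>" for x
      using hole_size_mono[OF less_imp_le[OF \<beta>(2)], of \<omega> x] hole\<omega> by (meson le_less_trans)
    have K: "excursion (walk \<omega>) (?C \<omega>) = exc \<alpha> \<omega>" by (simp add: exc_def)
    have D3: "kword (?P \<omega>) (?R \<omega>) l 1 0 0 < \<top>" for l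
      using kernel_le_total kword_moment_finite[OF \<omega> 0 hole\<alpha>] by (rule le_less_trans)
    have B1_fin: "B1 q \<omega> < \<top>" for q
      unfolding B1_def using h\<omega> by (simp add: ennreal_mult_less_top of_nat_less_top del: of_nat_Suc)
    have "B \<omega> < \<top>" unfolding B_def using B1_fin D3 by simp
    then have B_eq: "ennreal (enn2real (B \<omega>)) = B \<omega>" by (simp add: ennreal_enn2real_if top.not_eq_extremum)
    have le: "kword (?P \<omega>) (?Q \<omega>) l q 0 0 \<le> ennreal (enn2real (B \<omega>) * real l powr (real q - real ?d / 2))"
      if "1 \<le> l" and q: "q = 1 \<or> q = Suc r" for l q
    proof -
      have "kword (?P \<omega>) (?Q \<omega>) l q 0 0 \<le> B1 q \<omega> * ennreal (real l powr (real q - real ?d / 2))"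
        unfolding B1_def h_def
        using q that(1) hk\<omega> by (intro kword_bound[OF \<omega> 0 \<alpha>(1), where \<rho>=\<rho>]) (auto simp: \<rho>_def)
      also have "\<dots> \<le> B \<omega> * ennreal (real l powr (real q - real ?d / 2))"
        using q unfolding B_def by (intro mult_right_mono) (auto simp: add_increasing add_increasing2 add.assoc)
      also have "\<dots> = ennreal (enn2real (B \<omega>) * real l powr (real q - real ?d / 2))"
        by (subst ennreal_mult) (auto simp: B_eq)
      finally show ?thesis .
    qed
    show "\<forall>n\<ge>1. \<forall>\<theta>::real. 1 \<le> \<theta> \<and> \<theta> \<le> real n / 2 \<longrightarrow>
      (\<exists>m::nat. real n - \<theta> \<le> real m \<and> m \<le> n \<and>
        \<P>(X in walk_law \<omega> 0. trapping_event (?C \<omega>) r \<theta> m X \<bar> X (2 * m) = 0)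
          \<ge> 1 - c * enn2real (B \<omega>) / (real n powr (real ?d / 2) * heat_kernel \<omega> (2 * n) 0 0) * trap_error ?d (real n) \<theta>)"
    proof (intro allI impI)
      fix n :: nat and \<theta> :: real assume "1 \<le> n" and \<theta>: "1 \<le> \<theta> \<and> \<theta> \<le> real n / 2"
      show "\<exists>m::nat. real n - \<theta> \<le> real m \<and> m \<le> n \<and>
        \<P>(X in walk_law \<omega> 0. trapping_event (?C \<omega>) r \<theta> m X \<bar> X (2 * m) = 0)
          \<ge> 1 - c * enn2real (B \<omega>) / (real n powr (real ?d / 2) * heat_kernel \<omega> (2 * n) 0 0) * trap_error ?d (real n) \<theta>"
      proof (rule trapping_quenched[OF \<omega> 0], unfold K)
        show "kword (?P \<omega>) (?Q \<omega>) l 1 0 0 \<le> ennreal (enn2real (B \<omega>) * real l powr (1 - real ?d / 2))" if "1 \<le> l" for l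
          using le[OF that, of 1] by simp
        show "kword (?P \<omega>) (?Q \<omega>) l (Suc r) 0 0 \<le> ennreal (enn2real (B \<omega>) * real l powr (real (Suc r) - real ?d / 2))" if "1 \<le> l" for l
          using le[OF that, of "Suc r"] by simp
        show "kword (?P \<omega>) (?R \<omega>) l 1 0 0 \<le> ennreal (enn2real (B \<omega>))" if "l < r" for l
        proof -
          have "kword (?P \<omega>) (?R \<omega>) l 1 0 0 \<le> (\<Sum>l<r. kword (?P \<omega>) (?R \<omega>) l 1 0 0)"
            using that by (intro member_le_sum[where f="\<lambda>l. kword (?P \<omega>) (?R \<omega>) l 1 0 0"]) auto
          then show ?thesis unfolding B_eq unfolding B_def by (rule add_increasing[rotated]) simp
        qed
      qed (use \<theta> c sums in auto)
    qed
  qed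
  show ?thesis
  proof (intro exI conjI)
    show "(\<lambda>\<omega>. c * enn2real (B \<omega>)) \<in> borel_measurable P" by (rule B_meas)
    show "AE \<omega> in cond_law P \<alpha>. \<forall>n\<ge>1. \<forall>\<theta>::real. 1 \<le> \<theta> \<and> \<theta> \<le> real n / 2 \<longrightarrow>
      (\<exists>m::nat. real n - \<theta> \<le> real m \<and> m \<le> n \<and>
        \<P>(X in walk_law \<omega> 0. trapping_event (strong_component \<alpha> \<omega>) r \<theta> m X \<bar> X (2 * m) = 0)
          \<ge> 1 - c * enn2real (B \<omega>) / lam n \<omega> *
              (if CARD('d) = 4 then real n / \<theta> * ln (real n / \<theta>)
               else (real n / \<theta>) powr (real CARD('d) / 2 - 1)))"
      using main unfolding lam_def trap_error_def .
  qed
qed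

end
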